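(* Let $M$ be a compact, connected, $n$-dimensional Riemannian manifold with Riemannian distance $d$, and let $(p_i)_{i\ge1}$ be a sequence in $M$ such that the empirical measures $\mu^N=\frac1N\sum_{i=1}^N\delta_{p_i}$ satisfy $W_1(\mu^N,\bar V)\to0$ as $N\to\infty$. Let $k:[0,\infty)\to[0,\infty)$ be Lipschitz and compactly supported. Put $$\epsilon(N)=\Big(\sup_{m\ge N}W_1(\mu^m,\bar V)\Big)^{\frac1{4+n}},\qquad W^{N}_{ij}=k\big(d(p_i,p_j)/\epsilon(N)\big),\qquad a(N)=\epsilon(N)^{-2-n}N^{-1}.$$ Then there is a constant $C>0$, namely $$C=\frac{\pi^{n/2}}{V(M)\,n\,\Gamma(n/2)}\int_0^\infty k(r)\,r^{n+1}\,dr,$$ such that for every smooth $f:M\to\mathbb{R}$, $$\lim_{N\to\infty}\ \sup_{1\le i\le N}\Big|a(N)\sum_{j=1}^N W^{N}_{ij}\,(f(p_j)-f(p_i))-C\Delta_Mf(p_i)\Big|=0.$$ In particular, the grids $G^N=\{p_1,\dots,p_N\}$ with weights $W^N$ are uniformly approximating grids, i.e. for every smooth $f$, $$\lim_{N\to\infty}\frac1N\sum_{i=1}^N\Big|a(N)\sum_{j=1}^N W^{N}_{ij}\,(f(p_j)-f(p_i))-C\Delta_Mf(p_i)\Big|=0.$$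
   Context: $\Delta_M$ is the Laplace-Beltrami operator on $M$; $V(M)$ is the total Riemannian volume of $M$, and $\bar V$ is the Riemannian volume measure normalized to be a probability measure. $\Gamma$ is the Gamma function. $W_1$ denotes the Kantorovich distance: $W_1(\mu,\nu)=\sup_f\{\int f\,d\mu-\int f\,d\nu\}$, the supremum being over functions $f:M\to\mathbb{R}$ that are Lipschitz with respect to $d$ with Lipschitz constant at most $1$.
   Formalization: The claim C>0 is asserted only when k is not identically zero on [0,∞) (for k=0 the formula gives C=0); both limits are proved for every admissible k, and the dimension n is at least 1. *)

theory Defs
  imports "HOL-Analysis.Analysis"
begin

section \<open>Smooth maps between open subsets of normed spaces\<close>

primrec Ck_on :: "nat \<Rightarrow> ('e::real_normed_vector \<Rightarrow> 'f::real_normed_vector) \<Rightarrow> 'e set \<Rightarrow> bool" where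
  "Ck_on 0 = (\<lambda>f S. continuous_on S f)"
| "Ck_on (Suc k) = (\<lambda>f S. f differentiable_on S \<and>
      (\<forall>v. Ck_on k (\<lambda>x. frechet_derivative f (at x) v) S))"

text \<open>Only used for open \<open>S\<close>.\<close>

definition smooth_on :: "('e::real_normed_vector \<Rightarrow> 'f::real_normed_vector) \<Rightarrow> 'e set \<Rightarrow> bool" where
  "smooth_on f S \<longleftrightarrow> (\<forall>k. Ck_on k f S)"


section \<open>Riemannian manifolds without boundary\<close>

text \<open>
  A chart is a pair \<open>(U, \<phi>)\<close>; the values of \<open>\<phi>\<close> outside \<open>U\<close> are irrelevant.
  The manifold is a subset of a Hausdorff space with the subspace topology, and its dimension
  is \<open>CARD('n)\<close>, hence at least 1.
\<close>

type_synonym ('a, 'n) chart = "'a set \<times> ('a \<Rightarrow> real ^ 'n)"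

abbreviation chart_dom :: "('a, 'n) chart \<Rightarrow> 'a set" where
  "chart_dom c \<equiv> fst c"

abbreviation chart_map :: "('a, 'n) chart \<Rightarrow> 'a \<Rightarrow> real ^ 'n" where
  "chart_map c \<equiv> snd c"

definition chart_inv :: "('a, 'n) chart \<Rightarrow> real ^ 'n \<Rightarrow> 'a" where
  "chart_inv c = inv_into (chart_dom c) (chart_map c)"

definition chart_img :: "('a, 'n) chart \<Rightarrow> (real ^ 'n) set" where
  "chart_img c = chart_map c ` chart_dom c"

definition is_chart :: "'a::topological_space set \<Rightarrow> ('a, 'n::finite) chart \<Rightarrow> bool" where
  "is_chart M c \<longleftrightarrow> openin (top_of_set M) (chart_dom c) \<and> open (chart_img c) \<and>
     homeomorphism (chart_dom c) (chart_img c) (chart_map c) (chart_inv c)"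

definition transition :: "('a, 'n) chart \<Rightarrow> ('a, 'n) chart \<Rightarrow> real ^ 'n \<Rightarrow> real ^ 'n" where
  "transition c c' = chart_map c' \<circ> chart_inv c"

text \<open>
  The metric tensor is given by its local expressions: \<open>g c x\<close> is the inner product, read in the
  chart \<open>c\<close>, on the tangent space at the point with coordinates \<open>x\<close>. The law
  \<open>metric_change\<close> says that these expressions define one tensor field on \<open>M\<close>.
\<close>

locale riemannian_manifold =
  fixes M :: "'a::t2_space set"
    and \<A> :: "('a, 'n::finite) chart set"
    and g :: "('a, 'n) chart \<Rightarrow> real ^ 'n \<Rightarrow> real ^ 'n \<Rightarrow> real ^ 'n \<Rightarrow> real"
  assumes charts: "c \<in> \<A> \<Longrightarrow> is_chart M c"
    and cover: "(\<Union>c\<in>\<A>. chart_dom c) = M"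
    and compatible: "\<lbrakk>c \<in> \<A>; c' \<in> \<A>\<rbrakk> \<Longrightarrow>
      smooth_on (transition c c') (chart_map c ` (chart_dom c \<inter> chart_dom c'))"
    and metric_bilinear: "\<lbrakk>c \<in> \<A>; x \<in> chart_img c\<rbrakk> \<Longrightarrow> bilinear (g c x)"
    and metric_sym: "\<lbrakk>c \<in> \<A>; x \<in> chart_img c\<rbrakk> \<Longrightarrow> g c x u v = g c x v u"
    and metric_pos: "\<lbrakk>c \<in> \<A>; x \<in> chart_img c; v \<noteq> 0\<rbrakk> \<Longrightarrow> g c x v v > 0"
    and metric_smooth: "c \<in> \<A> \<Longrightarrow> smooth_on (\<lambda>x. g c x u v) (chart_img c)"
    and metric_change: "\<lbrakk>c \<in> \<A>; c' \<in> \<A>; x \<in> chart_map c ` (chart_dom c \<inter> chart_dom c')\<rbrakk> \<Longrightarrow>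
      g c x u v = g c' (transition c c' x)
        (frechet_derivative (transition c c') (at x) u)
        (frechet_derivative (transition c c') (at x) v)"

definition smooth_function :: "('a, 'n::finite) chart set \<Rightarrow> ('a \<Rightarrow> real) \<Rightarrow> bool" where
  "smooth_function \<A> f \<longleftrightarrow> (\<forall>c\<in>\<A>. smooth_on (f \<circ> chart_inv c) (chart_img c))"

text \<open>
  Speed and the Laplace-Beltrami operator below do not depend on the chart around the point;
  an arbitrary one is chosen.
\<close>

definition chart_at :: "('a, 'n) chart set \<Rightarrow> 'a \<Rightarrow> ('a, 'n) chart" where
  "chart_at \<A> q = (SOME c. c \<in> \<A> \<and> q \<in> chart_dom c)"


subsection \<open>Riemannian distance\<close>

definition C1_curve_on :: "('a, 'n::finite) chart set \<Rightarrow> real \<Rightarrow> real \<Rightarrow> (real \<Rightarrow> 'a) \<Rightarrow> bool" where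
  "C1_curve_on \<A> a b \<gamma> \<longleftrightarrow> (\<forall>c\<in>\<A>. \<exists>D.
     continuous_on {t \<in> {a..b}. \<gamma> t \<in> chart_dom c} D \<and>
     (\<forall>t\<in>{a..b}. \<gamma> t \<in> chart_dom c \<longrightarrow>
        ((chart_map c \<circ> \<gamma>) has_vector_derivative D t) (at t within {a..b})))"

text \<open>
  The library's notion of piecewise C1 does not require one-sided limits of the derivative at
  the break points, so its curves may have non-integrable speed. Here the curve is C1 on each
  closed interval between consecutive break points.
\<close>

definition piecewise_C1_curve ::
    "'a::topological_space set \<Rightarrow> ('a, 'n::finite) chart set \<Rightarrow> (real \<Rightarrow> 'a) \<Rightarrow> bool" where
  "piecewise_C1_curve M \<A> \<gamma> \<longleftrightarrow> continuous_on {0..1} \<gamma> \<and> \<gamma> ` {0..1} \<subseteq> M \<and>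
     (\<exists>S. finite S \<and> {0, 1} \<subseteq> S \<and> S \<subseteq> {0..1} \<and>
        (\<forall>a\<in>S. \<forall>b\<in>S. a < b \<and> {a<..<b} \<inter> S = {} \<longrightarrow> C1_curve_on \<A> a b \<gamma>))"

definition speed :: "('a, 'n::finite) chart set
    \<Rightarrow> (('a, 'n) chart \<Rightarrow> real ^ 'n \<Rightarrow> real ^ 'n \<Rightarrow> real ^ 'n \<Rightarrow> real)
    \<Rightarrow> (real \<Rightarrow> 'a) \<Rightarrow> real \<Rightarrow> real" where
  "speed \<A> g \<gamma> t =
    (let c = chart_at \<A> (\<gamma> t); v = vector_derivative (chart_map c \<circ> \<gamma>) (at t)
     in sqrt (g c (chart_map c (\<gamma> t)) v v))"

definition riem_dist :: "'a::topological_space set \<Rightarrow> ('a, 'n::finite) chart set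
    \<Rightarrow> (('a, 'n) chart \<Rightarrow> real ^ 'n \<Rightarrow> real ^ 'n \<Rightarrow> real ^ 'n \<Rightarrow> real)
    \<Rightarrow> 'a \<Rightarrow> 'a \<Rightarrow> real" where
  "riem_dist M \<A> g x y =
    (INF \<gamma>\<in>{\<gamma>. piecewise_C1_curve M \<A> \<gamma> \<and> \<gamma> 0 = x \<and> \<gamma> 1 = y}. integral {0..1} (speed \<A> g \<gamma>))"


subsection \<open>Riemannian volume and the Laplace-Beltrami operator\<close>

definition gram :: "(('a, 'n::finite) chart \<Rightarrow> real ^ 'n \<Rightarrow> real ^ 'n \<Rightarrow> real ^ 'n \<Rightarrow> real)
    \<Rightarrow> ('a, 'n) chart \<Rightarrow> real ^ 'n \<Rightarrow> real ^ 'n ^ 'n" where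
  "gram g c x = (\<chi> i j. g c x (axis i 1) (axis j 1))"

text \<open>The Borel measure on \<open>M\<close> with density \<open>\<surd>(det g)\<close> in every chart.\<close>

definition riem_volume :: "'a::topological_space set \<Rightarrow> ('a, 'n::finite) chart set
    \<Rightarrow> (('a, 'n) chart \<Rightarrow> real ^ 'n \<Rightarrow> real ^ 'n \<Rightarrow> real ^ 'n \<Rightarrow> real) \<Rightarrow> 'a measure" where
  "riem_volume M \<A> g = (THE V. sets V = sets (restrict_space borel M) \<and>
     (\<forall>c\<in>\<A>. \<forall>B\<in>sets V. B \<subseteq> chart_dom c \<longrightarrow>
        emeasure V B = (\<integral>\<^sup>+x\<in>chart_map c ` B. ennreal (sqrt (det (gram g c x))) \<partial>lborel)))"

definition partial_deriv :: "'n::finite \<Rightarrow> (real ^ 'n \<Rightarrow> real) \<Rightarrow> real ^ 'n \<Rightarrow> real" where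
  "partial_deriv i h x = frechet_derivative h (at x) (axis i 1)"

text \<open>The sign convention is \<open>div grad\<close>, so that the operator is non-positive.\<close>

definition laplace_beltrami :: "('a, 'n::finite) chart set
    \<Rightarrow> (('a, 'n) chart \<Rightarrow> real ^ 'n \<Rightarrow> real ^ 'n \<Rightarrow> real ^ 'n \<Rightarrow> real)
    \<Rightarrow> ('a \<Rightarrow> real) \<Rightarrow> 'a \<Rightarrow> real" where
  "laplace_beltrami \<A> g f q =
    (let c = chart_at \<A> q; x = chart_map c q; \<rho> = (\<lambda>y. sqrt (det (gram g c y)))
     in 1 / \<rho> x * (\<Sum>i\<in>UNIV. partial_deriv i (\<lambda>y. \<Sum>j\<in>UNIV.
          \<rho> y * matrix_inv (gram g c y) $ i $ j * partial_deriv j (f \<circ> chart_inv c) y) x))"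


section \<open>Kantorovich distance and empirical measures\<close>

definition kantorovich :: "'a set \<Rightarrow> ('a \<Rightarrow> 'a \<Rightarrow> real) \<Rightarrow> 'a measure \<Rightarrow> 'a measure \<Rightarrow> real" where
  "kantorovich M d \<mu> \<nu> =
    (SUP f\<in>{f. \<forall>x\<in>M. \<forall>y\<in>M. \<bar>f x - f y\<bar> \<le> d x y}. (\<integral>x. f x \<partial>\<mu>) - (\<integral>x. f x \<partial>\<nu>))"

text \<open>
  The measure \<open>1/N \<Sum>\<^sub>i \<delta>\<^bsub>p i\<^esub>\<close>, as the image of the uniform distribution on \<open>{1..N}\<close>;
  a point occurring several times is counted with multiplicity.
\<close>

definition empirical_measure ::
    "'a::topological_space set \<Rightarrow> (nat \<Rightarrow> 'a) \<Rightarrow> nat \<Rightarrow> 'a measure" where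
  "empirical_measure M p N = distr (uniform_count_measure {1..N}) (restrict_space borel M) p"

definition W1_to_volume :: "'a::topological_space set \<Rightarrow> ('a, 'n::finite) chart set
    \<Rightarrow> (('a, 'n) chart \<Rightarrow> real ^ 'n \<Rightarrow> real ^ 'n \<Rightarrow> real ^ 'n \<Rightarrow> real)
    \<Rightarrow> (nat \<Rightarrow> 'a) \<Rightarrow> nat \<Rightarrow> real" where
  "W1_to_volume M \<A> g p N =
    kantorovich M (riem_dist M \<A> g) (empirical_measure M p N) (uniform_measure (riem_volume M \<A> g) M)"


section \<open>Graph Laplacians on the grids\<close>

definition bandwidth :: "'a::topological_space set \<Rightarrow> ('a, 'n::finite) chart set
    \<Rightarrow> (('a, 'n) chart \<Rightarrow> real ^ 'n \<Rightarrow> real ^ 'n \<Rightarrow> real ^ 'n \<Rightarrow> real)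
    \<Rightarrow> (nat \<Rightarrow> 'a) \<Rightarrow> nat \<Rightarrow> real" where
  "bandwidth M \<A> g p N =
    (SUP m\<in>{N..}. W1_to_volume M \<A> g p m) powr (1 / (4 + real CARD('n)))"

definition weight :: "'a::topological_space set \<Rightarrow> ('a, 'n::finite) chart set
    \<Rightarrow> (('a, 'n) chart \<Rightarrow> real ^ 'n \<Rightarrow> real ^ 'n \<Rightarrow> real ^ 'n \<Rightarrow> real)
    \<Rightarrow> (nat \<Rightarrow> 'a) \<Rightarrow> (real \<Rightarrow> real) \<Rightarrow> nat \<Rightarrow> nat \<Rightarrow> nat \<Rightarrow> real" where
  "weight M \<A> g p k N i j = k (riem_dist M \<A> g (p i) (p j) / bandwidth M \<A> g p N)"

definition rescaling :: "'a::topological_space set \<Rightarrow> ('a, 'n::finite) chart set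
    \<Rightarrow> (('a, 'n) chart \<Rightarrow> real ^ 'n \<Rightarrow> real ^ 'n \<Rightarrow> real ^ 'n \<Rightarrow> real)
    \<Rightarrow> (nat \<Rightarrow> 'a) \<Rightarrow> nat \<Rightarrow> real" where
  "rescaling M \<A> g p N = bandwidth M \<A> g p N powr (- 2 - real CARD('n)) / real N"

definition limit_constant :: "'a::topological_space set \<Rightarrow> ('a, 'n::finite) chart set
    \<Rightarrow> (('a, 'n) chart \<Rightarrow> real ^ 'n \<Rightarrow> real ^ 'n \<Rightarrow> real ^ 'n \<Rightarrow> real)
    \<Rightarrow> (real \<Rightarrow> real) \<Rightarrow> real" where
  "limit_constant M \<A> g k =
    pi powr (real CARD('n) / 2)
      / (measure (riem_volume M \<A> g) M * real CARD('n) * Gamma (real CARD('n) / 2))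
    * integral {0..} (\<lambda>r. k r * r ^ (CARD('n) + 1))"

end

theory Submission
  imports Defs
begin

text \<open>
In coordinates around a point \<open>z\<close>, the map \<open>Phi z\<close> sends \<open>y\<close> to \<open>(y - z) + B (y - z, y - z) / 2\<close>, where
\<open>B\<close> is the Christoffel form at \<open>z\<close>. It replaces the inverse of the exponential map: it carries the
metric to the constant metric at \<open>z\<close> up to second order, hence the distance from \<open>z\<close> is the norm
of \<open>Phi z\<close> up to third order. The upper bound comes from an explicit curve, the lower one from the
linear functions of \<open>Phi z\<close>, which are almost 1-Lipschitz. Substituting \<open>u = Phi z y\<close> in
\<open>\<integral> k (d / \<epsilon>) (f - f z) dV\<close> leaves, up to order \<open>n + 3\<close> in \<open>\<epsilon>\<close>, the integral of a radial kernel
against the second Taylor polynomial of \<open>f\<close> in \<open>u\<close>. The linear part cancels, and the quadratic part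
gives the trace of the Hessian of \<open>f\<close>, which is the Laplacian. The error is uniform in \<open>z\<close> by compactness.

The functions \<open>k (d (x, -) / \<epsilon>) (f - f x)\<close> are Lipschitz uniformly in \<open>x\<close> and \<open>\<epsilon>\<close>, because \<open>f - f x\<close> is of
order \<open>\<epsilon>\<close> on the support of the kernel. So the empirical average differs from the integral by a
multiple of \<open>W1 \<le> \<epsilon> (N) ^ (n + 4)\<close>, and the normalization \<open>\<epsilon> (N) ^ (- n - 2)\<close> leaves an error \<open>O (\<epsilon> (N))\<close>.
\<close>

text \<open>Geodesics and the exponential map never appear, because an error of third order in the
  distance is good enough. Divided by \<epsilon> it changes the kernel by O(\<epsilon>^2); the
  factor f - f z contributes \<epsilon> and the volume of the support \<epsilon>^n, which gives the
  order n + 3. A quadratic correction of the coordinates achieves it since the Christoffel form is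
  exactly what makes the first derivatives of the metric and of its pullback agree. The limit
  constant is half the second moment of the kernel in one coordinate direction, divided by V(M): the
  half is that of Taylor's formula, and the unit ball volume in the moment produces the power of pi
  and the Gamma function. Three points that usually go without saying need proofs. The volume is a
  definite description, so existence and uniqueness have to be shown. The Laplacian uses an
  arbitrarily chosen chart at each point; independence of the chart is read off from the asymptotics
  of one kernel integral. The bandwidth is a divisor, hence W1 must be strictly positive for every
  N.\<close>

section \<open>Change of variables over a finite index type\<close>

text \<open>The library's change of variables theorem needs a well-ordered index type, so the
  finite index type is copied and ordered by an enumeration.\<close>

typedef 'n wo = "UNIV :: 'n set" by simp

instance wo :: (finite) finite
proof
  have "(UNIV :: 'a wo set) = Abs_wo ` UNIV"
    by (metis Abs_wo_cases UNIV_eq_I image_eqI UNIV_I)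
  then show "finite (UNIV :: 'a wo set)" by (metis finite_imageI finite_class.finite_UNIV)
qed

definition wo_rank :: "'n::finite wo \<Rightarrow> nat" where
  "wo_rank x = (SOME f :: 'n \<Rightarrow> nat. inj f) (Rep_wo x)"

lemma inj_wo_rank: "inj wo_rank"
proof -
  have "\<exists>f :: 'a \<Rightarrow> nat. inj f"
    using finite_imp_inj_to_nat_seg[OF finite_class.finite_UNIV] by blast
  then have "inj (SOME f :: 'a \<Rightarrow> nat. inj f)" by (rule someI_ex)
  then show ?thesis unfolding inj_def wo_rank_def using Rep_wo_inject by blast
qed

instantiation wo :: (finite) wellorder
begin
definition "x \<le> y \<longleftrightarrow> wo_rank x \<le> wo_rank y"
definition "x < y \<longleftrightarrow> wo_rank x < wo_rank y"
instance
proof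
  fix P :: "'a wo \<Rightarrow> bool" and a
  assume *: "\<And>x. (\<And>y. y < x \<Longrightarrow> P y) \<Longrightarrow> P x"
  show "P a"
    by (induction a rule: measure_induct_rule[of wo_rank]) (use * in \<open>simp add: less_wo_def\<close>)
qed (use inj_wo_rank in \<open>auto simp: less_eq_wo_def less_wo_def inj_def\<close>)
end

lemma bij_Rep_wo: "bij Rep_wo"
  by (metis Rep_wo_inject Abs_wo_inverse UNIV_I bijI injI surjI)

text \<open>Conjugation with \<open>r\<close> is a bijection between the permutations of the two
  index types that keeps signs, so it matches the two Leibniz sums term by term.\<close>

lemma det_reindex:
  fixes A :: "'a::comm_ring_1 ^ 'n ^ 'n" and r :: "'m::finite \<Rightarrow> 'n::finite"
  assumes r: "bij r"
  shows "det (\<chi> i j. A $ r i $ r j) = det A"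
proof -
  let ?F = "map_permutation UNIV r"
  have F: "?F p = r \<circ> p \<circ> inv r" for p
    using r by (simp add: map_permutation_def restrict_id_def fun_eq_iff bij_is_surj)
  have bij: "bij_betw ?F {p. p permutes UNIV} {p. p permutes UNIV}"
  proof -
    have "?F = (\<lambda>\<pi> x. if x \<in> UNIV then r (\<pi> (inv_into UNIV r x)) else x)"
      using F by (simp add: fun_eq_iff)
    then show ?thesis using bij_betw_permutations[OF r] by simp
  qed
  have "det A = (\<Sum>p | p permutes UNIV. of_int (sign (?F p)) * (\<Prod>i\<in>UNIV. A $ i $ ?F p i))"
    unfolding det_def by (rule sum.reindex_bij_betw[OF bij, symmetric])
  also have "\<dots> = (\<Sum>p | p permutes UNIV. of_int (sign p) * (\<Prod>i\<in>UNIV. A $ r i $ r (p i)))"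
  proof (rule sum.cong[OF refl])
    fix p :: "'m \<Rightarrow> 'm" assume "p \<in> {p. p permutes UNIV}"
    then have "sign (?F p) = sign p"
      using r by (simp add: sign_map_permutation bij_is_inj)
    moreover have "(\<Prod>i\<in>UNIV. A $ i $ ?F p i) = (\<Prod>i\<in>UNIV. A $ r i $ ?F p (r i))"
      by (rule prod.reindex_bij_betw[OF r, symmetric])
    moreover have "?F p (r i) = r (p i)" for i
      using r by (simp add: F bij_is_inj)
    ultimately show "of_int (sign (?F p)) * (\<Prod>i\<in>UNIV. A $ i $ ?F p i) =
        of_int (sign p) * (\<Prod>i\<in>UNIV. A $ r i $ r (p i))" by simp
  qed
  finally show ?thesis by (simp add: det_def)
qed

definition to_wo :: "real ^ 'n::finite \<Rightarrow> real ^ 'n wo" where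
  "to_wo x = (\<chi> i. x $ Rep_wo i)"

definition of_wo :: "real ^ 'n::finite wo \<Rightarrow> real ^ 'n" where
  "of_wo y = (\<chi> i. y $ Abs_wo i)"

lemma to_of_wo [simp]: "to_wo (of_wo y) = y" "of_wo (to_wo x) = x"
  by (auto simp: to_wo_def of_wo_def vec_eq_iff Rep_wo_inverse Abs_wo_inverse)

lemma linear_to_wo: "linear to_wo" and linear_of_wo: "linear of_wo"
  by (auto simp: linear_iff to_wo_def of_wo_def vec_eq_iff)

lemma continuous_to_wo: "continuous_on S to_wo" and continuous_of_wo: "continuous_on T of_wo"
  using linear_to_wo linear_of_wo by (auto intro: linear_continuous_on linear_conv_bounded_linear[THEN iffD1])

lemma measurable_to_wo [measurable]: "to_wo \<in> borel_measurable borel"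
  and measurable_of_wo [measurable]: "of_wo \<in> borel_measurable borel"
  by (auto intro: borel_measurable_continuous_onI continuous_to_wo continuous_of_wo)

lemma prod_Basis_cart: "(\<Prod>b\<in>Basis. f b) = (\<Prod>i\<in>UNIV. f (axis i (1::real)))"
  for f :: "real ^ 'n::finite \<Rightarrow> 'b::comm_monoid_mult"
proof -
  have "Basis = range (\<lambda>i. axis i (1::real) :: real ^ 'n)" by (auto simp: Basis_vec_def)
  moreover have "inj (\<lambda>i. axis i (1::real) :: real ^ 'n)" by (auto simp: inj_def axis_eq_axis)
  ultimately show ?thesis by (metis (no_types, lifting) prod.reindex_cong)
qed

text \<open>Lebesgue measure is determined by its values on boxes, and renaming coordinates maps a
  box to a box with the same side lengths in another order.\<close>

lemma distr_to_wo: "distr lborel borel to_wo = (lborel :: (real ^ 'n::finite wo) measure)"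
proof (rule lborel_eqI[symmetric])
  fix l u :: "real ^ 'n wo" assume le: "\<And>b. b \<in> Basis \<Longrightarrow> l \<bullet> b \<le> u \<bullet> b"
  have le': "l $ i \<le> u $ i" for i
    using le[of "axis i 1"] by (simp add: inner_axis axis_in_Basis_iff)
  have "to_wo -` box l u = box (of_wo l) (of_wo u)"
    unfolding set_eq_iff by (simp add: mem_box_cart to_wo_def of_wo_def)
      (metis Rep_wo_inverse Abs_wo_inverse UNIV_I)
  then have "emeasure (distr lborel borel to_wo) (box l u) = emeasure lborel (box (of_wo l) (of_wo u))"
    by (simp add: emeasure_distr)
  also have "\<dots> = ennreal (\<Prod>b\<in>Basis. (of_wo u - of_wo l) \<bullet> b)"
  proof (rule emeasure_lborel_box)
    fix b :: "real ^ 'n" assume "b \<in> Basis"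
    then obtain i where "b = axis i 1" by (auto simp: Basis_vec_def)
    then show "of_wo l \<bullet> b \<le> of_wo u \<bullet> b" using le' by (simp add: inner_axis of_wo_def)
  qed
  also have "(\<Prod>b\<in>Basis. (of_wo u - of_wo l) \<bullet> b) = (\<Prod>i\<in>UNIV. u $ Abs_wo i - l $ Abs_wo i)"
    by (simp add: prod_Basis_cart inner_axis of_wo_def)
  also have "\<dots> = (\<Prod>i\<in>UNIV. u $ Abs_wo (Rep_wo i) - l $ Abs_wo (Rep_wo i))"
    by (rule prod.reindex_bij_betw[OF bij_Rep_wo, symmetric])
  also have "\<dots> = (\<Prod>b\<in>Basis. (u - l) \<bullet> b)"
    by (simp add: prod_Basis_cart inner_axis Rep_wo_inverse)
  finally show "emeasure (distr lborel borel to_wo) (box l u) = ennreal (\<Prod>b\<in>Basis. (u - l) \<bullet> b)" .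
qed simp

lemma nn_integral_to_wo:
  assumes [measurable]: "h \<in> borel_measurable borel"
  shows "(\<integral>\<^sup>+y. h (of_wo y) \<partial>lborel) = (\<integral>\<^sup>+x. h x \<partial>(lborel :: (real ^ 'n::finite) measure))"
  by (subst distr_to_wo[symmetric]) (simp add: nn_integral_distr)

lemma matrix_wo:
  assumes "linear f"
  shows "matrix (to_wo \<circ> f \<circ> of_wo) = (\<chi> i j. matrix f $ Rep_wo i $ Rep_wo j)"
proof -
  have "Abs_wo i = j \<longleftrightarrow> i = Rep_wo j" for i and j :: "'a wo"
    by (metis Rep_wo_inverse Abs_wo_inverse UNIV_I)
  then have "of_wo (axis j 1) = axis (Rep_wo j) (1::real)" for j :: "'a wo"
    by (auto simp: of_wo_def axis_def vec_eq_iff)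
  then show ?thesis by (simp add: matrix_def to_wo_def)
qed

text \<open>If the Jacobian is integrable, the Henstock-Kurzweil version of the formula applies; if
  not, the image has infinite measure and the right side is infinite as well. For Borel sets
  \<open>lborel\<close> and \<open>lebesgue\<close> may be exchanged.\<close>

lemma emeasure_differentiable_image_wo:
  fixes f :: "real ^ 'n::{finite,wellorder} \<Rightarrow> real ^ 'n::_"
  assumes S: "S \<in> sets borel" and fS: "f ` S \<in> sets borel"
    and der: "\<And>x. x \<in> S \<Longrightarrow> (f has_derivative f' x) (at x within S)" and inj: "inj_on f S"
    and meas: "(\<lambda>x. indicator S x * \<bar>det (matrix (f' x))\<bar>) \<in> borel_measurable borel"
  shows "emeasure lborel (f ` S) = (\<integral>\<^sup>+x. ennreal (indicator S x * \<bar>det (matrix (f' x))\<bar>) \<partial>lborel)"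
proof -
  let ?J = "\<lambda>x. indicator S x * \<bar>det (matrix (f' x))\<bar>"
  have S': "S \<in> sets lebesgue" using S by simp
  have fS': "f ` S \<in> sets lebesgue" using fS by simp
  have J: "?J \<in> borel_measurable lebesgue" using meas by (simp add: measurable_completion)
  have nn: "(\<integral>\<^sup>+x. ennreal (?J x) \<partial>lebesgue) = (\<integral>\<^sup>+x. ennreal (?J x) \<partial>lborel)"
    using meas by (simp add: nn_integral_completion)
  have restr: "(\<lambda>x. \<bar>det (matrix (f' x))\<bar>) integrable_on S \<longleftrightarrow> ?J integrable_on UNIV"
    "integral S (\<lambda>x. \<bar>det (matrix (f' x))\<bar>) = integral UNIV ?J"
  proof -
    have eq: "?J = (\<lambda>x. if x \<in> S then \<bar>det (matrix (f' x))\<bar> else 0)" by (auto simp: indicator_def)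
    show "(\<lambda>x. \<bar>det (matrix (f' x))\<bar>) integrable_on S \<longleftrightarrow> ?J integrable_on UNIV"
      unfolding eq by (simp add: integrable_restrict_UNIV)
    show "integral S (\<lambda>x. \<bar>det (matrix (f' x))\<bar>) = integral UNIV ?J"
      unfolding eq by (simp add: integral_restrict_UNIV)
  qed
  have img: "f ` S \<in> lmeasurable \<longleftrightarrow> ?J integrable_on UNIV"
    using measurable_differentiable_image_eq[OF S' der inj] restr by simp
  show ?thesis
  proof (cases "?J integrable_on UNIV")
    case True
    then have hi: "(?J has_integral integral UNIV ?J) UNIV" by (rule integrable_integral)
    then have "(\<integral>\<^sup>+x. ennreal (?J x) \<partial>lebesgue) = ennreal (integral UNIV ?J)"
      using has_integral_iff_nn_integral_lebesgue[of ?J "integral UNIV ?J"] by simp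
    moreover have "measure lebesgue (f ` S) = integral UNIV ?J"
      using measure_differentiable_image_eq[OF S' der inj] restr True by simp
    moreover have "f ` S \<in> lmeasurable" using img True by simp
    then have "emeasure lebesgue (f ` S) = ennreal (measure lebesgue (f ` S))"
      by (rule emeasure_eq_ennreal_measure[OF fmeasurableD2])
    moreover have "emeasure lebesgue (f ` S) = emeasure lborel (f ` S)" using fS by simp
    ultimately show ?thesis using nn \<open>measure lebesgue (f ` S) = integral UNIV ?J\<close>
      \<open>(\<integral>\<^sup>+x. ennreal (?J x) \<partial>lebesgue) = ennreal (integral UNIV ?J)\<close> by (simp only:)
  next
    case False
    then have "f ` S \<notin> lmeasurable" using img by simp
    then have 1: "emeasure lborel (f ` S) = \<infinity>"
      using fS fS' by (auto simp: fmeasurable_def less_top[symmetric])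
    have "(\<integral>\<^sup>+x. ennreal (?J x) \<partial>lebesgue) = \<infinity>"
    proof (cases "\<integral>\<^sup>+x. ennreal (?J x) \<partial>lebesgue" rule: ennreal_cases)
      case (real r)
      then have "(?J has_integral r) UNIV"
        using J has_integral_iff_nn_integral_lebesgue[of ?J r] by simp
      then show ?thesis using False by blast
    qed simp
    then show ?thesis using 1 nn by simp
  qed
qed

text \<open>Conjugating \<open>f\<close> with the renaming of coordinates changes neither Lebesgue
  measure (\<open>distr_to_wo\<close>) nor the Jacobian determinant
  (\<open>det_reindex\<close>).\<close>

lemma emeasure_differentiable_image:
  fixes f :: "real ^ 'n::finite \<Rightarrow> real ^ 'n"
  assumes S: "S \<in> sets borel" and fS: "f ` S \<in> sets borel"
    and der: "\<And>x. x \<in> S \<Longrightarrow> (f has_derivative f' x) (at x within S)" and inj: "inj_on f S"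
    and meas: "(\<lambda>x. indicator S x * \<bar>det (matrix (f' x))\<bar>) \<in> borel_measurable borel"
  shows "emeasure lborel (f ` S) = (\<integral>\<^sup>+x. ennreal (indicator S x * \<bar>det (matrix (f' x))\<bar>) \<partial>lborel)"
proof -
  define F where "F = to_wo \<circ> f \<circ> of_wo"
  define F' where "F' y = to_wo \<circ> f' (of_wo y) \<circ> of_wo" for y
  define T where "T = to_wo ` S"
  have T: "T = of_wo -` S" unfolding T_def by (force simp: image_iff)
  have FT: "F ` T = of_wo -` (f ` S)"
  proof -
    have "F ` T = to_wo ` f ` S" by (simp add: T_def F_def image_image)
    also have "to_wo ` A = of_wo -` A" for A :: "(real ^ 'n) set"
      by (auto intro!: image_eqI[of _ _ "of_wo _"])
    finally show ?thesis .
  qed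
  have det: "det (matrix (F' y)) = det (matrix (f' (of_wo y)))" if "y \<in> T" for y
  proof -
    have "linear (f' (of_wo y))" using der[of "of_wo y"] that T by (auto intro: has_derivative_linear)
    then show ?thesis unfolding F'_def by (simp add: matrix_wo det_reindex[OF bij_Rep_wo])
  qed
  have blf: "bounded_linear to_wo" "bounded_linear of_wo"
    using linear_to_wo linear_of_wo linear_conv_bounded_linear by blast+
  have J: "(\<lambda>y. indicator T y * \<bar>det (matrix (F' y))\<bar>) =
      (\<lambda>y. indicator S (of_wo y) * \<bar>det (matrix (f' (of_wo y)))\<bar>)"
    using det by (auto simp: fun_eq_iff T indicator_def)
  have "emeasure lborel (F ` T) = (\<integral>\<^sup>+y. ennreal (indicator T y * \<bar>det (matrix (F' y))\<bar>) \<partial>lborel)"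
  proof (rule emeasure_differentiable_image_wo)
    show "T \<in> sets borel" using measurable_sets[OF measurable_of_wo S] by (simp add: T)
    show "F ` T \<in> sets borel" using measurable_sets[OF measurable_of_wo fS] by (simp add: FT)
    show "inj_on F T"
      unfolding inj_on_def F_def T_def using inj by (auto simp: inj_on_def) (metis to_of_wo(2))+
    show "(F has_derivative F' y) (at y within T)" if "y \<in> T" for y
    proof -
      have "(of_wo has_derivative of_wo) (at y within T)"
        using blf(2) by (rule bounded_linear_imp_has_derivative)
      moreover have "(f has_derivative f' (of_wo y)) (at (of_wo y) within of_wo ` T)"
        using der[of "of_wo y"] that by (auto simp: T_def image_image)
      ultimately have "(f \<circ> of_wo has_derivative f' (of_wo y) \<circ> of_wo) (at y within T)"
        by (rule diff_chain_within)
      from bounded_linear.has_derivative[OF blf(1) this] show ?thesis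
        by (simp add: F_def F'_def o_def)
    qed
    show "(\<lambda>y. indicator T y * \<bar>det (matrix (F' y))\<bar>) \<in> borel_measurable borel"
      unfolding J using measurable_compose[OF measurable_of_wo meas] by simp
  qed
  also have "\<dots> = (\<integral>\<^sup>+x. ennreal (indicator S x * \<bar>det (matrix (f' x))\<bar>) \<partial>lborel)"
  proof -
    have "(\<lambda>x. ennreal (indicator S x * \<bar>det (matrix (f' x))\<bar>)) \<in> borel_measurable borel"
      using meas by simp
    from nn_integral_to_wo[OF this] show ?thesis
      by (subst fun_cong[OF J])
  qed
  also have "emeasure lborel (F ` T) = emeasure lborel (f ` S)"
  proof -
    have "emeasure lborel (F ` T) = emeasure (distr lborel borel to_wo) (F ` T)"
      by (simp add: distr_to_wo)
    also have "\<dots> = emeasure lborel (to_wo -` (F ` T))"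
      using measurable_sets[OF measurable_of_wo fS] by (simp add: emeasure_distr FT)
    also have "to_wo -` (F ` T) = f ` S" by (auto simp: FT)
    finally show ?thesis .
  qed
  finally show ?thesis .
qed

text \<open>By the image formula for sets, the pushforward under \<open>f\<close> of the measure on
  \<open>U\<close> whose density is the Jacobian is Lebesgue measure on the image; integrating
  \<open>h\<close> against these equal measures gives the claim.\<close>

theorem nn_integral_change_of_variables:
  fixes f :: "real ^ 'n::finite \<Rightarrow> real ^ 'n"
  assumes U: "open U" and der: "\<And>x. x \<in> U \<Longrightarrow> (f has_derivative f' x) (at x)" and inj: "inj_on f U"
    and cont: "continuous_on U (\<lambda>x. det (matrix (f' x)))"
    and h [measurable]: "h \<in> borel_measurable borel"
  shows "(\<integral>\<^sup>+y\<in>f ` U. h y \<partial>lborel) = (\<integral>\<^sup>+x\<in>U. ennreal \<bar>det (matrix (f' x))\<bar> * h (f x) \<partial>lborel)"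
proof -
  let ?J = "\<lambda>x. ennreal (indicator U x * \<bar>det (matrix (f' x))\<bar>)"
  \<comment> \<open>Cutting \<open>f\<close> off to 0 outside \<open>U\<close> makes it Borel on the
    whole space; the density \<open>?J\<close> vanishes there, so these values carry no
    mass.\<close>
  let ?f = "\<lambda>x. indicator U x *\<^sub>R f x"
  have cf: "continuous_on U f"
    using der has_derivative_at_withinI has_derivative_continuous_on by blast
  have Ub [measurable]: "U \<in> sets borel" using U by simp
  have fm [measurable]: "?f \<in> borel_measurable borel"
    using cf U by (intro borel_measurable_continuous_on_indicator) auto
  have "(\<lambda>x. indicator U x *\<^sub>R \<bar>det (matrix (f' x))\<bar>) \<in> borel_measurable borel"
    using cont U by (intro borel_measurable_continuous_on_indicator continuous_intros) auto
  then have Jm0 [measurable]: "(\<lambda>x. indicator U x * \<bar>det (matrix (f' x))\<bar>) \<in> borel_measurable borel"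
    by simp
  have Jm [measurable]: "?J \<in> borel_measurable borel" by measurable
  have fU [measurable]: "f ` U \<in> sets borel"
    using invariance_of_domain[OF cf U inj] by simp
  define Q where "Q = distr (density lborel ?J) borel ?f"
  define R where "R = density lborel (indicator (f ` U)) "
  have "R = Q"
  proof (rule measure_eqI)
    show "sets R = sets Q" by (simp add: Q_def R_def)
    fix A assume "A \<in> sets R"
    then have A [measurable]: "A \<in> sets borel" by (simp add: R_def)
    \<comment> \<open>The part of \<open>U\<close> that is mapped into \<open>A\<close>; the image
      formula for sets is applied to it.\<close>
    define S where "S = U \<inter> ?f -` A"
    have Sb [measurable]: "S \<in> sets borel" unfolding S_def by (auto intro: measurable_sets_borel)
    have SU: "S \<subseteq> U" by (auto simp: S_def)
    have fS: "f ` S = A \<inter> f ` U" by (force simp: S_def)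
    have "emeasure R A = emeasure lborel (f ` S)"
      unfolding R_def fS by (subst emeasure_density) (auto simp flip: indicator_inter_arith simp: Int_commute nn_integral_indicator)
    also have "\<dots> = (\<integral>\<^sup>+x. ennreal (indicator S x * \<bar>det (matrix (f' x))\<bar>) \<partial>lborel)"
    proof (rule emeasure_differentiable_image)
      show "f ` S \<in> sets borel" by (simp add: fS)
      show "inj_on f S" using inj SU inj_on_subset by blast
      show "(f has_derivative f' x) (at x within S)" if "x \<in> S" for x
        using der that SU has_derivative_at_withinI by blast
      have "(\<lambda>x. indicator S x * \<bar>det (matrix (f' x))\<bar>) = (\<lambda>x. indicator S x * (indicator U x * \<bar>det (matrix (f' x))\<bar>))"
        using SU by (auto simp: fun_eq_iff indicator_def)
      then show "(\<lambda>x. indicator S x * \<bar>det (matrix (f' x))\<bar>) \<in> borel_measurable borel"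
        using Jm0 by simp
    qed simp
    also have "\<dots> = (\<integral>\<^sup>+x. ?J x * indicator (?f -` A) x \<partial>lborel)"
      by (intro nn_integral_cong) (auto simp: S_def indicator_def)
    also have "\<dots> = emeasure Q A"
      unfolding Q_def using A measurable_sets_borel[OF fm A]
      by (subst emeasure_distr, simp, simp, subst emeasure_density) auto
    finally show "emeasure R A = emeasure Q A" .
  qed
  have "(\<integral>\<^sup>+y\<in>f ` U. h y \<partial>lborel) = (\<integral>\<^sup>+y. h y \<partial>R)"
    unfolding R_def by (subst nn_integral_density) (auto simp: mult.commute)
  also have "\<dots> = (\<integral>\<^sup>+y. h y \<partial>Q)" by (simp add: \<open>R = Q\<close>)
  also have "\<dots> = (\<integral>\<^sup>+x. ?J x * h (?f x) \<partial>lborel)"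
    unfolding Q_def by (subst nn_integral_distr, simp, simp, subst nn_integral_density) auto
  also have "\<dots> = (\<integral>\<^sup>+x\<in>U. ennreal \<bar>det (matrix (f' x))\<bar> * h (f x) \<partial>lborel)"
    by (intro nn_integral_cong) (auto simp: indicator_def)
  finally show ?thesis .
qed

section \<open>Smooth functions and directional derivatives\<close>

definition dird :: "'a::real_normed_vector \<Rightarrow> ('a \<Rightarrow> 'b::real_normed_vector) \<Rightarrow> 'a \<Rightarrow> 'b" where
  "dird v f x = frechet_derivative f (at x) v"

lemma smooth_on_continuous: "smooth_on f S \<Longrightarrow> continuous_on S f"
  unfolding smooth_on_def by (metis Ck_on.simps(1))

lemma smooth_on_differentiable: "smooth_on f S \<Longrightarrow> f differentiable_on S"
  unfolding smooth_on_def by (metis Ck_on.simps(2))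

lemma smooth_on_dird: "smooth_on f S \<Longrightarrow> smooth_on (dird v f) S"
  unfolding smooth_on_def dird_def by (metis Ck_on.simps(2))

lemma smooth_on_has_derivative:
  assumes "smooth_on f S" "open S" "x \<in> S"
  shows "(f has_derivative (\<lambda>v. dird v f x)) (at x)"
proof -
  have "f differentiable (at x)"
    using smooth_on_differentiable[OF assms(1)] assms(2,3)
    by (metis at_within_open differentiable_on_def)
  then show ?thesis by (simp add: dird_def frechet_derivative_works[symmetric])
qed

lemma dird_eqI: "(f has_derivative f') (at x) \<Longrightarrow> dird v f x = f' v"
  unfolding dird_def by (metis frechet_derivative_at)

lemma frechet_derivative_cong_open:
  assumes "open S" "x \<in> S" "\<And>y. y \<in> S \<Longrightarrow> f y = h y"
  shows "frechet_derivative f (at x) = frechet_derivative h (at x)"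
proof -
  have "(f has_derivative D) (at x) \<longleftrightarrow> (h has_derivative D) (at x)" for D
    using has_derivative_transform_within_open[OF _ assms(1,2)] assms(3) by metis
  then show ?thesis by (simp add: frechet_derivative_def)
qed

lemma dird_cong:
  assumes "open S" "x \<in> S" "\<And>y. y \<in> S \<Longrightarrow> f y = h y"
  shows "dird v f x = dird v h x"
  unfolding dird_def using frechet_derivative_cong_open[OF assms] by simp

lemma dird_expand:
  fixes f :: "real ^ 'n::finite \<Rightarrow> 'b::real_normed_vector"
  assumes "smooth_on f S" "open S" "x \<in> S"
  shows "dird v f x = (\<Sum>i\<in>UNIV. v $ i *\<^sub>R dird (axis i 1) f x)"
proof -
  have lin: "linear (\<lambda>v. dird v f x)"
    using smooth_on_has_derivative[OF assms] by (rule has_derivative_linear)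
  have "dird v f x = dird (\<Sum>i\<in>UNIV. v $ i *\<^sub>R axis i 1) f x"
    by (simp add: basis_expansion scalar_mult_eq_scaleR[symmetric])
  then show ?thesis by (simp add: linear_sum[OF lin] linear_cmul[OF lin])
qed

lemma partial_deriv_dird: "partial_deriv i h x = dird (axis i 1) h x"
  by (simp add: partial_deriv_def dird_def)

lemma smooth_on_dird_funpow: "smooth_on f S \<Longrightarrow> smooth_on ((dird v ^^ m) f) S"
  by (induction m) (auto intro: smooth_on_dird)

lemma dird_funpow_cong:
  assumes "open S" "\<And>y. y \<in> S \<Longrightarrow> f y = h y"
  shows "x \<in> S \<Longrightarrow> (dird v ^^ m) f x = (dird v ^^ m) h x"
proof (induction m arbitrary: x)
  case (Suc m)
  then show ?case using dird_cong[OF assms(1), of x "(dird v ^^ m) f" "(dird v ^^ m) h"] by simp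
qed (use assms in simp)

lemma dird_funpow_sum:
  fixes h :: "'i \<Rightarrow> 'a::real_normed_vector \<Rightarrow> 'b::real_normed_vector"
  assumes "open S" "finite I" "\<And>i. i \<in> I \<Longrightarrow> smooth_on (h i) S"
  shows "x \<in> S \<Longrightarrow> (dird v ^^ m) (\<lambda>x. \<Sum>i\<in>I. a i *\<^sub>R h i x) x = (\<Sum>i\<in>I. a i *\<^sub>R (dird v ^^ m) (h i) x)"
proof (induction m arbitrary: x)
  case (Suc m)
  have "(dird v ^^ Suc m) (\<lambda>x. \<Sum>i\<in>I. a i *\<^sub>R h i x) x =
     dird v (\<lambda>x. \<Sum>i\<in>I. a i *\<^sub>R (dird v ^^ m) (h i) x) x"
    using dird_cong[OF assms(1) Suc.prems Suc.IH] by simp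
  also have "\<dots> = (\<Sum>i\<in>I. a i *\<^sub>R dird v ((dird v ^^ m) (h i)) x)"
    by (rule dird_eqI, rule has_derivative_sum, rule has_derivative_scaleR_right,
        rule smooth_on_has_derivative[OF smooth_on_dird_funpow assms(1) Suc.prems], rule assms(3))
  finally show ?case by simp
qed simp

text \<open>The derivative along \<open>v\<close> is a combination of coordinate derivatives whose
  coefficients are bounded by the norm of \<open>v\<close>, and the induction hypothesis applies to
  each of these. Iterated derivatives in one direction are what a Taylor expansion along a segment
  uses.\<close>

lemma dird_funpow_bound:
  fixes h :: "real ^ 'n::finite \<Rightarrow> 'b::real_normed_vector"
  assumes S: "open S" and K: "compact K" "K \<subseteq> S" and h: "smooth_on h S"
  shows "\<exists>C\<ge>0. \<forall>x\<in>K. \<forall>v. norm ((dird v ^^ m) h x) \<le> C * norm v ^ m"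
  using h
proof (induction m arbitrary: h)
  case 0
  have "compact (h ` K)" using compact_continuous_image K smooth_on_continuous[OF 0]
    by (metis continuous_on_subset)
  then obtain C where "\<And>x. x \<in> K \<Longrightarrow> norm (h x) \<le> C"
    using compact_imp_bounded bounded_iff by (metis imageI)
  then have "\<forall>x\<in>K. \<forall>v. norm ((dird v ^^ 0) h x) \<le> max C 0 * norm v ^ 0"
    by (auto simp: le_max_iff_disj)
  then show ?case by (meson max.cobounded2)
next
  case (Suc m)
  have "\<exists>C\<ge>0. \<forall>x\<in>K. \<forall>v. norm ((dird v ^^ m) (dird (axis i 1) h) x) \<le> C * norm v ^ m" for i
    using Suc.IH[OF smooth_on_dird[OF Suc.prems]] .
  then obtain C where C: "\<And>i. C i \<ge> 0"
    "\<And>i x v. x \<in> K \<Longrightarrow> norm ((dird v ^^ m) (dird (axis i 1) h) x) \<le> C i * norm v ^ m"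
    by metis
  have "norm ((dird v ^^ Suc m) h x) \<le> (\<Sum>i\<in>UNIV. C i) * norm v ^ Suc m" if x: "x \<in> K" for x v
  proof -
    have xS: "x \<in> S" using x K by auto
    have "(dird v ^^ Suc m) h x = (dird v ^^ m) (dird v h) x"
      by (simp add: funpow_swap1)
    also have "\<dots> = (dird v ^^ m) (\<lambda>x. \<Sum>i\<in>UNIV. v $ i *\<^sub>R dird (axis i 1) h x) x"
      by (rule dird_funpow_cong[OF S _ xS]) (rule dird_expand[OF Suc.prems S])
    also have "\<dots> = (\<Sum>i\<in>UNIV. v $ i *\<^sub>R (dird v ^^ m) (dird (axis i 1) h) x)"
      using dird_funpow_sum[OF S finite_class.finite_UNIV, of "\<lambda>i. dird (axis i 1) h" x m v "\<lambda>i. v $ i"]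
        smooth_on_dird[OF Suc.prems] xS by simp
    also have "norm \<dots> \<le> (\<Sum>i\<in>UNIV. norm v * (C i * norm v ^ m))"
      by (intro sum_norm_le) (simp, intro mult_mono C(2) x component_le_norm_cart, auto)
    also have "\<dots> = (\<Sum>i\<in>UNIV. C i) * norm v ^ Suc m"
      by (simp add: sum_distrib_right sum_distrib_left mult_ac)
    finally show ?thesis .
  qed
  then show ?case using C(1) by (meson sum_nonneg)
qed

text \<open>Maclaurin's formula on the segment from \<open>z\<close> to \<open>y\<close>, which
  convexity keeps inside \<open>K\<close>; compactness makes the remainder uniform in both
  points.\<close>

lemma taylor_bound:
  fixes h :: "real ^ 'n::finite \<Rightarrow> real"
  assumes S: "open S" and K: "compact K" "convex K" "K \<subseteq> S" and h: "smooth_on h S"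
  shows "\<exists>C\<ge>0. \<forall>z\<in>K. \<forall>y\<in>K.
    \<bar>h y - (\<Sum>j<m. (dird (y - z) ^^ j) h z / fact j)\<bar> \<le> C * norm (y - z) ^ m"
proof -
  obtain C where C: "C \<ge> 0" "\<And>x v. x \<in> K \<Longrightarrow> \<bar>(dird v ^^ m) h x\<bar> \<le> C * norm v ^ m"
    using dird_funpow_bound[OF S K(1,3) h, of m] by auto
  have "\<bar>h y - (\<Sum>j<m. (dird (y - z) ^^ j) h z / fact j)\<bar> \<le> C * norm (y - z) ^ m"
    if zy: "z \<in> K" "y \<in> K" for z y
  proof (cases "m = 0")
    case True
    then show ?thesis using C(2)[OF zy(2), of 0] by simp
  next
    case False
    define v where "v = y - z"
    define diff where "diff j t = (dird v ^^ j) h (z + t *\<^sub>R v)" for j t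
    have inK: "z + t *\<^sub>R v \<in> K" if "0 \<le> t" "t \<le> 1" for t
    proof -
      have "z + t *\<^sub>R v = (1 - t) *\<^sub>R z + t *\<^sub>R y" by (simp add: v_def algebra_simps)
      then show ?thesis using convexD[OF K(2) zy, of "1 - t" t] that by simp
    qed
    have D: "DERIV (diff j) t :> diff (Suc j) t" if "0 \<le> t" "t \<le> 1" for j t
    proof -
      have "((dird v ^^ j) h has_derivative (\<lambda>w. dird w ((dird v ^^ j) h) (z + t *\<^sub>R v))) (at (z + t *\<^sub>R v))"
        by (rule smooth_on_has_derivative[OF smooth_on_dird_funpow[OF h] S]) (use inK[OF that] K in auto)
      moreover have "((\<lambda>t. z + t *\<^sub>R v) has_derivative (\<lambda>s. s *\<^sub>R v)) (at t)"
        by (auto intro!: derivative_eq_intros)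
      ultimately have "((\<lambda>t. (dird v ^^ j) h (z + t *\<^sub>R v)) has_derivative
          (\<lambda>s. dird (s *\<^sub>R v) ((dird v ^^ j) h) (z + t *\<^sub>R v))) (at t)"
        by (rule has_derivative_compose[rotated])
      moreover have "dird (s *\<^sub>R v) ((dird v ^^ j) h) (z + t *\<^sub>R v) = s * dird v ((dird v ^^ j) h) (z + t *\<^sub>R v)" for s
        using linear_cmul[OF has_derivative_linear[OF smooth_on_has_derivative[OF smooth_on_dird_funpow[OF h] S]]]
          inK[OF that] K by (metis real_scaleR_def subsetD)
      ultimately show ?thesis by (simp add: diff_def[abs_def] has_field_derivative_def mult.commute[of _ "dird _ _ _"] mult_commute_abs)
    qed
    obtain t where t: "0 < t" "t < 1" "diff 0 1 = (\<Sum>j<m. diff j 0 / fact j * 1 ^ j) + diff m t / fact m * 1 ^ m"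
      using Maclaurin[of 1 m diff "diff 0"] False D by auto
    have "\<bar>diff m t / fact m\<bar> \<le> \<bar>diff m t\<bar>"
      by (simp add: field_simps abs_mult) (metis abs_ge_zero fact_ge_1 mult.commute mult_left_mono mult.right_neutral)
    also have "\<dots> \<le> C * norm v ^ m" unfolding diff_def using C(2) inK t by simp
    finally have "\<bar>diff 0 1 - (\<Sum>j<m. diff j 0 / fact j)\<bar> \<le> C * norm v ^ m" using t(3) by simp
    then show ?thesis by (simp add: diff_def v_def)
  qed
  then show ?thesis using C(1) by blast
qed

lemma lipschitz_bound:
  fixes h :: "real ^ 'n::finite \<Rightarrow> real"
  assumes "open S" "compact K" "convex K" "K \<subseteq> S" "smooth_on h S"
  shows "\<exists>C\<ge>0. \<forall>z\<in>K. \<forall>y\<in>K. \<bar>h y - h z\<bar> \<le> C * norm (y - z)"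
  using taylor_bound[OF assms, of 1] by simp

lemma taylor2_bound:
  fixes h :: "real ^ 'n::finite \<Rightarrow> real"
  assumes "open S" "compact K" "convex K" "K \<subseteq> S" "smooth_on h S"
  shows "\<exists>C\<ge>0. \<forall>z\<in>K. \<forall>y\<in>K. \<bar>h y - h z - dird (y - z) h z\<bar> \<le> C * (norm (y - z))\<^sup>2"
  using taylor_bound[OF assms, of 2] by (simp add: numeral_2_eq_2 algebra_simps)

lemma taylor3_bound:
  fixes h :: "real ^ 'n::finite \<Rightarrow> real"
  assumes "open S" "compact K" "convex K" "K \<subseteq> S" "smooth_on h S"
  shows "\<exists>C\<ge>0. \<forall>z\<in>K. \<forall>y\<in>K.
    \<bar>h y - h z - dird (y - z) h z - dird (y - z) (dird (y - z) h) z / 2\<bar> \<le> C * norm (y - z) ^ 3"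
proof -
  have "(\<Sum>j<3. F j) = F 0 + F 1 + F 2" for F :: "nat \<Rightarrow> real"
    by (simp add: numeral_3_eq_3 numeral_2_eq_2)
  then have eq: "h y - (\<Sum>j<3. (dird v ^^ j) h z / fact j) = h y - h z - dird v h z - dird v (dird v h) z / 2" for y v z
    by (simp add: numeral_2_eq_2)
  show ?thesis using taylor_bound[OF assms, of 3] unfolding eq .
qed

lemma dird2_expand:
  fixes h :: "real ^ 'n::finite \<Rightarrow> real"
  assumes "smooth_on h S" "open S" "x \<in> S"
  shows "dird v (dird v h) x = (\<Sum>i\<in>UNIV. \<Sum>j\<in>UNIV. v $ i * v $ j * partial_deriv i (partial_deriv j h) x)"
proof -
  have "dird v (dird v h) x = (\<Sum>i\<in>UNIV. v $ i * dird (axis i 1) (dird v h) x)"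
    using dird_expand[OF smooth_on_dird[OF assms(1)] assms(2,3), of v v] unfolding real_scaleR_def .
  also have "dird (axis i 1) (dird v h) x = (\<Sum>j\<in>UNIV. v $ j * dird (axis i 1) (dird (axis j 1) h) x)" for i
  proof -
    have "dird (axis i 1) (dird v h) x = dird (axis i 1) (\<lambda>x. \<Sum>j\<in>UNIV. v $ j *\<^sub>R dird (axis j 1) h x) x"
      by (rule dird_cong[OF assms(2,3)]) (rule dird_expand[OF assms(1,2)])
    then show ?thesis
      using dird_funpow_sum[OF assms(2) finite_class.finite_UNIV, of "\<lambda>j. dird (axis j 1) h" x 1 "axis i 1" "\<lambda>j. v $ j"]
        smooth_on_dird[OF assms(1)] assms(3) by simp
  qed
  then have "(\<Sum>i\<in>UNIV. v $ i * dird (axis i 1) (dird v h) x) =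
      (\<Sum>i\<in>UNIV. v $ i * (\<Sum>j\<in>UNIV. v $ j * dird (axis i 1) (dird (axis j 1) h) x))" by presburger
  finally show ?thesis by (simp add: partial_deriv_dird[abs_def] sum_distrib_left mult.assoc)
qed

text \<open>Lets second-order error bounds serve as proofs of differentiability; the derivatives of
  the density and of the inverse metric are obtained in this way.\<close>

lemma has_derivative_of_quadratic_bound:
  fixes f :: "'a::euclidean_space \<Rightarrow> 'b::real_normed_vector"
  assumes L: "linear L" and r: "0 < r"
    and b: "\<And>y. norm (y - z) < r \<Longrightarrow> norm (f y - f z - L (y - z)) \<le> C * (norm (y - z))\<^sup>2"
  shows "(f has_derivative L) (at z)"
  unfolding has_derivative_at_alt
proof (intro conjI allI impI)
  show "bounded_linear L" using L by (simp add: linear_conv_bounded_linear)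
  fix e :: real assume e: "0 < e"
  define d where "d = min r (e / (\<bar>C\<bar> + 1))"
  have "norm (f y - f z - L (y - z)) \<le> e * norm (y - z)" if y: "norm (y - z) < d" for y
  proof -
    have "norm (f y - f z - L (y - z)) \<le> (\<bar>C\<bar> + 1) * norm (y - z) * norm (y - z)"
    proof -
      have "C * (norm (y - z) * norm (y - z)) \<le> (\<bar>C\<bar> + 1) * (norm (y - z) * norm (y - z))"
        by (rule mult_right_mono) auto
      then show ?thesis using b[of y] y by (simp add: d_def power2_eq_square mult.assoc)
    qed
    also have "(\<bar>C\<bar> + 1) * norm (y - z) \<le> e" using y by (simp add: d_def field_simps)
    finally show ?thesis by (simp add: mult_right_mono)
  qed
  moreover have "0 < d" using e r by (simp add: d_def)
  ultimately show "\<exists>d>0. \<forall>y. norm (y - z) < d \<longrightarrow> norm (f y - f z - L (y - z)) \<le> e * norm (y - z)" by blast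
qed

lemma bilinear_expand:
  fixes b :: "real ^ 'n::finite \<Rightarrow> real ^ 'm::finite \<Rightarrow> 'c::real_vector"
  assumes "bilinear b"
  shows "b v w = (\<Sum>i\<in>UNIV. \<Sum>j\<in>UNIV. (v $ i * w $ j) *\<^sub>R b (axis i 1) (axis j 1))"
proof -
  have l1: "linear (b x)" and l2: "linear (\<lambda>x. b x y)" for x y using assms by (auto simp: bilinear_def)
  have exv: "v = (\<Sum>i\<in>UNIV. v $ i *\<^sub>R axis i 1)" and exw: "w = (\<Sum>i\<in>UNIV. w $ i *\<^sub>R axis i 1)"
    by (simp_all add: basis_expansion scalar_mult_eq_scaleR[symmetric])
  have "b v w = (\<Sum>i\<in>UNIV. v $ i *\<^sub>R b (axis i 1) w)"
    by (subst exv) (simp add: linear_sum[OF l2] linear_cmul[OF l2])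
  also have "b (axis i 1) w = (\<Sum>j\<in>UNIV. w $ j *\<^sub>R b (axis i 1) (axis j 1))" for i
    by (subst exw) (simp add: linear_sum[OF l1] linear_cmul[OF l1])
  then have "(\<Sum>i\<in>UNIV. v $ i *\<^sub>R b (axis i 1) w) =
      (\<Sum>i\<in>UNIV. v $ i *\<^sub>R (\<Sum>j\<in>UNIV. w $ j *\<^sub>R b (axis i 1) (axis j 1)))" by presburger
  finally show ?thesis by (simp add: scaleR_sum_right)
qed

section \<open>Bilinear forms, frames and determinants\<close>

lemma matrix_inv_unique:
  fixes A :: "real ^ 'n::finite ^ 'n"
  assumes "A ** X = mat 1"
  shows "matrix_inv A = X"
proof -
  have XA: "X ** A = mat 1" using assms matrix_left_right_inverse by blast
  have "\<exists>A'. A ** A' = mat 1 \<and> A' ** A = mat 1" using assms XA by blast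
  then have "A ** matrix_inv A = mat 1 \<and> matrix_inv A ** A = mat 1"
    unfolding matrix_inv_def by (rule someI_ex)
  then show ?thesis using XA by (metis matrix_mul_assoc matrix_mul_lid matrix_mul_rid)
qed

definition form_matrix :: "(real ^ 'n::finite \<Rightarrow> real ^ 'n \<Rightarrow> real) \<Rightarrow> real ^ 'n ^ 'n" where
  "form_matrix b = (\<chi> i j. b (axis i 1) (axis j 1))"

lemma gram_form_matrix: "gram g c x = form_matrix (g c x)"
  by (simp add: gram_def form_matrix_def)

lemma form_matrix_inner:
  assumes "bilinear b"
  shows "b v w = v \<bullet> (form_matrix b *v w)"
  by (subst bilinear_expand[OF assms])
    (simp add: inner_vec_def matrix_vector_mult_def form_matrix_def sum_distrib_left mult_ac)

text \<open>Gram-Schmidt; the last condition keeps the induction going.\<close>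

lemma orthonormal_family_exists:
  fixes b :: "real ^ 'n::finite \<Rightarrow> real ^ 'n \<Rightarrow> real"
  assumes bil: "bilinear b" and sym: "\<And>u v. b u v = b v u" and pos: "\<And>v. v \<noteq> 0 \<Longrightarrow> b v v > 0"
    and "finite I"
  shows "\<exists>e. (\<forall>i\<in>I. \<forall>j\<in>I. b (e i) (e j) = (if i = j then 1 else 0)) \<and> (\<forall>i\<in>I. \<forall>k. k \<notin> I \<longrightarrow> e i $ k = 0)"
  using \<open>finite I\<close>
proof induction
  case (insert k I)
  then obtain e where e: "\<And>i j. i \<in> I \<Longrightarrow> j \<in> I \<Longrightarrow> b (e i) (e j) = (if i = j then 1 else 0)"
    and e0: "\<And>i k. i \<in> I \<Longrightarrow> k \<notin> I \<Longrightarrow> e i $ k = 0" by blast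
  have l1: "linear (b x)" and l2: "linear (\<lambda>x. b x y)" for x y using bil by (auto simp: bilinear_def)
  define v where "v = axis k 1 - (\<Sum>i\<in>I. b (axis k 1) (e i) *\<^sub>R e i)"
  \<comment> \<open>The earlier members have no component along \<open>axis k 1\<close>, so the
    residual keeps the coefficient 1 there and cannot vanish.\<close>
  have vk: "v $ k = 1" using insert e0 by (simp add: v_def axis_def)
  have v0: "v $ m = 0" if "m \<notin> insert k I" for m using that e0 by (simp add: v_def axis_def)
  have "v \<noteq> 0" using vk by auto
  then have bv: "b v v > 0" by (rule pos)
  have orth: "b v (e j) = 0" if "j \<in> I" for j
  proof -
    have "b v (e j) = b (axis k 1) (e j) - (\<Sum>i\<in>I. b (axis k 1) (e i) * b (e i) (e j))"
      by (simp add: v_def linear_diff[OF l2] linear_sum[OF l2] linear_cmul[OF l2])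
    also have "(\<Sum>i\<in>I. b (axis k 1) (e i) * b (e i) (e j)) = (\<Sum>i\<in>I. if i = j then b (axis k 1) (e i) else 0)"
      by (rule sum.cong) (use e that in auto)
    finally show ?thesis using that insert.hyps by simp
  qed
  define w where "w = (1 / sqrt (b v v)) *\<^sub>R v"
  have bw: "b w x = b v x / sqrt (b v v)" "b x w = b x v / sqrt (b v v)" for x
    by (simp_all add: w_def linear_cmul[OF l1] linear_cmul[OF l2])
  have ww: "b w w = 1" using bv by (simp add: bw)
  define e' where "e' = e(k := w)"
  have we: "b w (e j) = 0" "b (e j) w = 0" if "j \<in> I" for j
    using orth[OF that] sym by (auto simp: bw)
  have "b (e' i) (e' j) = (if i = j then 1 else 0)" if "i \<in> insert k I" "j \<in> insert k I" for i j
    using that e ww we insert.hyps(2) by (auto simp: e'_def)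
  moreover have "e' i $ m = 0" if "i \<in> insert k I" "m \<notin> insert k I" for i m
    using that e0 v0 by (auto simp: e'_def w_def)
  ultimately show ?case by blast
qed simp

text \<open>The columns of \<open>T\<close> form a \<open>b\<close>-orthonormal basis.\<close>

definition is_frame :: "(real ^ 'n::finite \<Rightarrow> real ^ 'n \<Rightarrow> real) \<Rightarrow> real ^ 'n ^ 'n \<Rightarrow> bool" where
  "is_frame b T \<longleftrightarrow> (\<forall>s t. b (T *v s) (T *v t) = s \<bullet> t)"

lemma frame_exists:
  fixes b :: "real ^ 'n::finite \<Rightarrow> real ^ 'n \<Rightarrow> real"
  assumes bil: "bilinear b" and sym: "\<And>u v. b u v = b v u" and pos: "\<And>v. v \<noteq> 0 \<Longrightarrow> b v v > 0"
  shows "\<exists>T. is_frame b T"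
proof -
  have "\<exists>e. (\<forall>i\<in>(UNIV :: 'n set). \<forall>j\<in>UNIV. b (e i) (e j) = (if i = j then 1 else 0)) \<and>
      (\<forall>i\<in>UNIV. \<forall>k. k \<notin> UNIV \<longrightarrow> e i $ k = 0)"
    by (rule orthonormal_family_exists[OF assms finite_class.finite_UNIV])
  then obtain e :: "'n \<Rightarrow> real ^ 'n" where e: "\<And>i j. b (e i) (e j) = (if i = j then 1 else 0)"
    by blast
  define T :: "real ^ 'n ^ 'n" where "T = (\<chi> i j. e j $ i)"
  have T: "T *v s = (\<Sum>j\<in>UNIV. s $ j *\<^sub>R e j)" for s
    by (simp add: T_def matrix_vector_mult_def vec_eq_iff mult.commute)
  have l1: "linear (b x)" and l2: "linear (\<lambda>x. b x y)" for x y using bil by (auto simp: bilinear_def)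
  have "b (T *v s) (T *v t) = s \<bullet> t" for s t
  proof -
    have "b (T *v s) (T *v t) = (\<Sum>i\<in>UNIV. \<Sum>j\<in>UNIV. s $ i * (t $ j * (if i = j then 1 else 0)))"
    proof -
      have "b (T *v s) x = (\<Sum>i\<in>UNIV. s $ i * b (e i) x)" for x
        unfolding T by (simp add: linear_sum[OF l2] linear_cmul[OF l2])
      moreover have "b (e i) (T *v t) = (\<Sum>j\<in>UNIV. t $ j * (if i = j then 1 else 0))" for i
        unfolding T by (simp add: linear_sum[OF l1] linear_cmul[OF l1] e)
      ultimately show ?thesis by (simp only: sum_distrib_left)
    qed
    also have "\<dots> = s \<bullet> t" by (simp add: inner_vec_def if_distrib cong: if_cong)
    finally show ?thesis .
  qed
  then show ?thesis unfolding is_frame_def by blast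
qed

lemma frame_matrix:
  assumes bil: "bilinear b" and T: "is_frame b T"
  shows "transpose T ** form_matrix b ** T = mat 1"
proof -
  have "s \<bullet> ((transpose T ** form_matrix b ** T) *v t) = s \<bullet> t" for s t
  proof -
    have "s \<bullet> ((transpose T ** form_matrix b ** T) *v t) = (T *v s) \<bullet> (form_matrix b *v (T *v t))"
      by (metis dot_lmul_matrix matrix_vector_mul_assoc transpose_matrix_vector transpose_transpose)
    then show ?thesis using T form_matrix_inner[OF bil] unfolding is_frame_def by metis
  qed
  then have "(transpose T ** form_matrix b ** T) *v t = t" for t
    by (metis vector_eq_ldot)
  then show ?thesis by (metis matrix_eq matrix_vector_mul_lid)
qed

text \<open>In T^t G T = 1 the left factor can be moved to the right, since one-sided inverses of
  square matrices are two-sided; this gives G T T^t = 1.\<close>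

lemma frame_inverse:
  assumes bil: "bilinear b" and T: "is_frame b T"
  shows "form_matrix b ** (T ** transpose T) = mat 1" "matrix_inv (form_matrix b) = T ** transpose T"
proof -
  have "transpose T ** (form_matrix b ** T) = mat 1"
    using frame_matrix[OF assms] by (simp add: matrix_mul_assoc)
  then have "(form_matrix b ** T) ** transpose T = mat 1"
    using matrix_left_right_inverse by blast
  then show "form_matrix b ** (T ** transpose T) = mat 1" by (simp add: matrix_mul_assoc)
  then show "matrix_inv (form_matrix b) = T ** transpose T" by (rule matrix_inv_unique)
qed

text \<open>Determinants in T^t G T = 1. The second equation is the reason why the Jacobian of a
  substitution by a frame cancels the Riemannian density.\<close>

lemma frame_det:
  assumes bil: "bilinear b" and T: "is_frame b T"
  shows "det (form_matrix b) > 0" "sqrt (det (form_matrix b)) * \<bar>det T\<bar> = 1"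
proof -
  have eq: "det (form_matrix b) * (det T)\<^sup>2 = 1"
    using arg_cong[OF frame_matrix[OF assms], of det] by (simp add: det_mul power2_eq_square mult_ac)
  then have "det T \<noteq> 0" by auto
  then have d2: "(det T)\<^sup>2 > 0" by simp
  show "det (form_matrix b) > 0"
  proof (rule ccontr)
    assume "\<not> det (form_matrix b) > 0"
    then have "det (form_matrix b) * (det T)\<^sup>2 \<le> 0" using d2 by (simp add: mult_nonpos_nonneg)
    then show False using eq by simp
  qed
  have "sqrt (det (form_matrix b) * (det T)\<^sup>2) = sqrt (det (form_matrix b)) * \<bar>det T\<bar>"
    by (simp add: real_sqrt_mult)
  then show "sqrt (det (form_matrix b)) * \<bar>det T\<bar> = 1" using eq by simp
qed

text \<open>The trace of a quadratic form relative to \<open>b\<close>, once in an orthonormal basis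
  and once as a contraction with the inverse Gram matrix; they agree because that inverse is T
  T^t.\<close>

lemma frame_sum_square:
  assumes bil: "bilinear b" and T: "is_frame b T"
    and q: "\<And>v. q v = (\<Sum>i\<in>UNIV. \<Sum>j\<in>UNIV. v $ i * v $ j * Q i j)"
  shows "(\<Sum>k\<in>UNIV. q (T *v axis k 1)) = (\<Sum>i\<in>UNIV. \<Sum>j\<in>UNIV. matrix_inv (form_matrix b) $ i $ j * Q i j)"
proof -
  have T1: "(T *v axis k 1) $ i = T $ i $ k" for i k
    by (simp add: matrix_vector_mult_def axis_def if_distrib cong: if_cong)
  have "(\<Sum>k\<in>UNIV. q (T *v axis k 1)) = (\<Sum>k\<in>UNIV. \<Sum>i\<in>UNIV. \<Sum>j\<in>UNIV. T $ i $ k * T $ j $ k * Q i j)"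
    by (simp add: q T1)
  also have "\<dots> = (\<Sum>i\<in>UNIV. \<Sum>k\<in>UNIV. \<Sum>j\<in>UNIV. T $ i $ k * T $ j $ k * Q i j)"
    by (rule sum.swap)
  also have "\<dots> = (\<Sum>i\<in>UNIV. \<Sum>j\<in>UNIV. \<Sum>k\<in>UNIV. T $ i $ k * T $ j $ k * Q i j)"
    by (intro sum.cong refl sum.swap)
  also have "\<dots> = (\<Sum>i\<in>UNIV. \<Sum>j\<in>UNIV. matrix_inv (form_matrix b) $ i $ j * Q i j)"
    by (simp add: frame_inverse(2)[OF bil T] matrix_matrix_mult_def transpose_def sum_distrib_right)
  finally show ?thesis .
qed

text \<open>Each Leibniz product has bounded factors and is therefore Lipschitz in them, with a
  constant that depends on the bound and the dimension alone.\<close>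

lemma det_diff_bound:
  fixes M :: real
  assumes "M \<ge> 0"
  shows "\<exists>C\<ge>0. \<forall>A B :: real ^ 'n::finite ^ 'n. \<forall>e. (\<forall>i j. \<bar>A $ i $ j\<bar> \<le> M \<and> \<bar>B $ i $ j\<bar> \<le> M \<and> \<bar>A $ i $ j - B $ i $ j\<bar> \<le> e) \<longrightarrow>
    \<bar>det A - det B\<bar> \<le> C * e"
proof -
  \<comment> \<open>The estimate for differences of products wants factors of size at most 1, so
    entries are divided by \<open>L\<close>; adding 1 keeps \<open>L\<close> positive when
    \<open>M\<close> is 0.\<close>
  define L where "L = M + 1"
  define P where "P = {p. p permutes (UNIV :: 'n set)}"
  have L: "L > 0" using assms by (simp add: L_def)
  define C where "C = (\<Sum>p\<in>P. L ^ CARD('n) * (CARD('n) / L))"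
  have prod: "\<bar>(\<Prod>i\<in>UNIV. A $ i $ p i) - (\<Prod>i\<in>UNIV. B $ i $ p i)\<bar> \<le> L ^ CARD('n) * (CARD('n) / L) * e"
    if *: "\<forall>i j. \<bar>A $ i $ j\<bar> \<le> M \<and> \<bar>B $ i $ j\<bar> \<le> M \<and> \<bar>A $ i $ j - B $ i $ j\<bar> \<le> e" for A B :: "real ^ 'n ^ 'n" and e p
  proof -
    have sc: "(\<Prod>i\<in>UNIV. A $ i $ p i) = L ^ CARD('n) * (\<Prod>i\<in>UNIV. A $ i $ p i / L)" for A :: "real ^ 'n ^ 'n"
      using L by (simp add: prod_dividef)
    have "\<bar>(\<Prod>i\<in>UNIV. A $ i $ p i / L) - (\<Prod>i\<in>UNIV. B $ i $ p i / L)\<bar> \<le> (\<Sum>i\<in>UNIV. \<bar>A $ i $ p i / L - B $ i $ p i / L\<bar>)"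
    proof -
      have "\<bar>A $ i $ p i / L\<bar> \<le> 1 \<and> \<bar>B $ i $ p i / L\<bar> \<le> 1" for i
      proof -
        have "\<bar>A $ i $ p i\<bar> \<le> L" "\<bar>B $ i $ p i\<bar> \<le> L"
          using *[rule_format, of i "p i"] by (simp_all add: L_def)
        then show ?thesis using L by simp
      qed
      then show ?thesis using norm_prod_diff[of UNIV "\<lambda>i. A $ i $ p i / L" "\<lambda>i. B $ i $ p i / L"] by simp
    qed
    also have "\<dots> \<le> (\<Sum>i\<in>(UNIV :: 'n set). e / L)"
    proof (rule sum_mono)
      fix i :: 'n
      have "\<bar>A $ i $ p i / L - B $ i $ p i / L\<bar> = \<bar>A $ i $ p i - B $ i $ p i\<bar> / L"
        using L by (simp add: diff_divide_distrib[symmetric])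
      also have "\<dots> \<le> e / L" using * L by (simp add: divide_right_mono)
      finally show "\<bar>A $ i $ p i / L - B $ i $ p i / L\<bar> \<le> e / L" .
    qed
    also have "\<dots> = CARD('n) / L * e" by simp
    finally have "L ^ CARD('n) * \<bar>(\<Prod>i\<in>UNIV. A $ i $ p i / L) - (\<Prod>i\<in>UNIV. B $ i $ p i / L)\<bar> \<le> L ^ CARD('n) * (CARD('n) / L * e)"
      using L by (intro mult_left_mono) auto
    then show ?thesis
      unfolding sc[of A] sc[of B] right_diff_distrib[symmetric] abs_mult using L by (simp add: mult.assoc)
  qed
  have "\<bar>det A - det B\<bar> \<le> C * e"
    if *: "\<forall>i j. \<bar>A $ i $ j\<bar> \<le> M \<and> \<bar>B $ i $ j\<bar> \<le> M \<and> \<bar>A $ i $ j - B $ i $ j\<bar> \<le> e" for A B :: "real ^ 'n ^ 'n" and e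
  proof -
    have "det A - det B = (\<Sum>p\<in>P. of_int (sign p) * ((\<Prod>i\<in>UNIV. A $ i $ p i) - (\<Prod>i\<in>UNIV. B $ i $ p i)))"
      unfolding det_def P_def by (simp add: sum_subtractf right_diff_distrib)
    also have "\<bar>\<dots>\<bar> \<le> (\<Sum>p\<in>P. L ^ CARD('n) * (CARD('n) / L) * e)"
    proof (rule order_trans[OF sum_abs], rule sum_mono)
      fix p assume "p \<in> P"
      have "\<bar>real_of_int (sign p)\<bar> = 1" by (simp add: sign_def)
      then show "\<bar>of_int (sign p) * ((\<Prod>i\<in>UNIV. A $ i $ p i) - (\<Prod>i\<in>UNIV. B $ i $ p i))\<bar> \<le> L ^ CARD('n) * (CARD('n) / L) * e"
        using prod[OF *, of p] by (simp only: abs_mult mult_1)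
    qed
    also have "\<dots> = C * e" by (simp only: C_def sum_distrib_right)
    finally show ?thesis .
  qed
  moreover have "C \<ge> 0" using L by (simp add: C_def sum_nonneg)
  ultimately show ?thesis by blast
qed

lemma continuous_on_det:
  fixes A :: "'a::topological_space \<Rightarrow> real ^ 'n::finite ^ 'n"
  assumes "\<And>i j. continuous_on S (\<lambda>x. A x $ i $ j)"
  shows "continuous_on S (\<lambda>x. det (A x))"
  unfolding det_def by (intro continuous_intros assms)

text \<open>A permutation other than the identity moves at least two indices, so its Leibniz term
  still contains a zero entry of the unit matrix after one factor has been differentiated. Only the
  diagonal term survives.\<close>

lemma has_derivative_det_identity:
  "(det has_derivative trace) (at (mat 1 :: real ^ 'n::finite ^ 'n))"
proof -
  define P where "P = {p. p permutes (UNIV :: 'n set)}"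
  let ?I = "mat 1 :: real ^ 'n ^ 'n"
  have lin: "((\<lambda>A :: real ^ 'n ^ 'n. A $ i $ j) has_derivative (\<lambda>A. A $ i $ j)) (at ?I)" for i j
    by (intro bounded_linear_imp_has_derivative bounded_linear_compose[OF bounded_linear_vec_nth bounded_linear_vec_nth])
  have "((\<lambda>A. \<Sum>p\<in>P. of_int (sign p) * (\<Prod>i\<in>UNIV. A $ i $ p i)) has_derivative
     (\<lambda>H. \<Sum>p\<in>P. of_int (sign p) * (\<Sum>i\<in>UNIV. H $ i $ p i * (\<Prod>j\<in>UNIV - {i}. ?I $ j $ p j)))) (at ?I)"
    by (intro has_derivative_sum has_derivative_mult_right has_derivative_prod lin)
  moreover have "(\<Sum>p\<in>P. of_int (sign p) * (\<Sum>i\<in>UNIV. H $ i $ p i * (\<Prod>j\<in>UNIV - {i}. ?I $ j $ p j))) = trace H" for H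
  proof -
    have fin: "finite P" "id \<in> P" by (simp_all add: P_def finite_permutations permutes_id)
    have z: "(\<Prod>j\<in>UNIV - {i}. ?I $ j $ p j) = 0" if p: "p \<in> P - {id}" for p i
    proof -
      have "\<exists>j. j \<noteq> i \<and> p j \<noteq> j"
      proof (rule ccontr)
        assume "\<not> ?thesis"
        then have *: "\<And>j. j \<noteq> i \<Longrightarrow> p j = j" by auto
        have "inj p" using p by (auto simp: P_def permutes_inj)
        then have "p i = i" using * by (metis injD)
        then have "p = id" using * by (metis eq_id_iff)
        then show False using p by simp
      qed
      then obtain j where "j \<in> UNIV - {i}" "?I $ j $ p j = 0" by (auto simp: mat_def)
      then show ?thesis by (intro prod_zero) auto
    qed
    have "(\<Sum>p\<in>P. of_int (sign p) * (\<Sum>i\<in>UNIV. H $ i $ p i * (\<Prod>j\<in>UNIV - {i}. ?I $ j $ p j)))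
       = (\<Sum>p\<in>{id}. of_int (sign p) * (\<Sum>i\<in>UNIV. H $ i $ p i * (\<Prod>j\<in>UNIV - {i}. ?I $ j $ p j)))"
      by (rule sum.mono_neutral_right) (use fin in \<open>auto simp: z simp del: prod_zero_iff\<close>)
    also have "\<dots> = trace H" by (simp add: trace_def mat_def sign_id)
    finally show ?thesis .
  qed
  ultimately show ?thesis unfolding det_def[abs_def] P_def by (simp add: fun_eq_iff)
qed

section \<open>Normal coordinates up to third order\<close>

text \<open>A Riemannian metric on an open coordinate domain. Every chart of the manifold is an
  instance, which keeps the tensor calculus free of charts and of points of
  \<open>M\<close>.\<close>

locale local_metric =
  fixes S :: "(real ^ 'n::finite) set" and g :: "real ^ 'n \<Rightarrow> real ^ 'n \<Rightarrow> real ^ 'n \<Rightarrow> real"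
  assumes open_S: "open S"
    and bilin: "x \<in> S \<Longrightarrow> bilinear (g x)"
    and sym: "x \<in> S \<Longrightarrow> g x u v = g x v u"
    and pos: "x \<in> S \<Longrightarrow> v \<noteq> 0 \<Longrightarrow> g x v v > 0"
    and smooth: "smooth_on (\<lambda>x. g x u v) S"
begin

definition dg :: "real ^ 'n \<Rightarrow> real ^ 'n \<Rightarrow> real ^ 'n \<Rightarrow> real ^ 'n \<Rightarrow> real" where
  "dg u x v w = dird u (\<lambda>y. g y v w) x"

text \<open>The Christoffel symbols of the second kind.\<close>

definition chr :: "real ^ 'n \<Rightarrow> real ^ 'n \<Rightarrow> real ^ 'n \<Rightarrow> real ^ 'n" where
  "chr z u v = matrix_inv (form_matrix (g z)) *v
     (\<chi> l. (dg u z v (axis l 1) + dg v z u (axis l 1) - dg (axis l 1) z u v) / 2)"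

abbreviation ent :: "'n \<Rightarrow> 'n \<Rightarrow> real ^ 'n \<Rightarrow> real" where
  "ent i j \<equiv> \<lambda>x. g x (axis i 1) (axis j 1)"

lemma g_lin:
  assumes "x \<in> S"
  shows "linear (g x v)" "linear (\<lambda>v. g x v w)"
  using bilin[OF assms] by (auto simp: bilinear_def)

lemma g_arith:
  assumes "x \<in> S"
  shows "g x (u + v) w = g x u w + g x v w" "g x w (u + v) = g x w u + g x w v"
    "g x (u - v) w = g x u w - g x v w" "g x w (u - v) = g x w u - g x w v"
    "g x (c *\<^sub>R v) w = c * g x v w" "g x w (c *\<^sub>R v) = c * g x w v" "g x 0 w = 0" "g x w 0 = 0"
    "g x (- v) w = - g x v w" "g x w (- v) = - g x w v"
  using linear_add[OF g_lin(1)[OF assms]] linear_add[OF g_lin(2)[OF assms]]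
    linear_diff[OF g_lin(1)[OF assms]] linear_diff[OF g_lin(2)[OF assms]]
    linear_cmul[OF g_lin(1)[OF assms]] linear_cmul[OF g_lin(2)[OF assms]]
    linear_0[OF g_lin(1)[OF assms]] linear_0[OF g_lin(2)[OF assms]]
    linear_neg[OF g_lin(1)[OF assms]] linear_neg[OF g_lin(2)[OF assms]]
  by simp_all

lemma g_expand: "x \<in> S \<Longrightarrow> g x v w = (\<Sum>i\<in>UNIV. \<Sum>j\<in>UNIV. v $ i * w $ j * ent i j x)"
  using bilinear_expand[OF bilin] by simp

lemma g_matrix: "x \<in> S \<Longrightarrow> g x v w = v \<bullet> (form_matrix (g x) *v w)"
  by (rule form_matrix_inner[OF bilin])

lemma frame_ex: "x \<in> S \<Longrightarrow> \<exists>T. is_frame (g x) T"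
  by (rule frame_exists[OF bilin sym pos])

lemma det_pos: "x \<in> S \<Longrightarrow> det (form_matrix (g x)) > 0"
  using frame_ex frame_det(1)[OF bilin] by blast

lemma matrix_inv_right:
  assumes "x \<in> S"
  shows "form_matrix (g x) ** matrix_inv (form_matrix (g x)) = mat 1"
  using frame_ex[OF assms] frame_inverse[OF bilin[OF assms]] by metis

lemma g_inv:
  assumes "x \<in> S"
  shows "g x v (matrix_inv (form_matrix (g x)) *v w) = v \<bullet> w"
  using matrix_inv_right[OF assms] by (simp add: g_matrix[OF assms] matrix_vector_mul_assoc)

lemma g_eqI:
  assumes "x \<in> S" "\<And>w. g x u w = g x v w"
  shows "u = v"
proof (rule ccontr)
  assume "u \<noteq> v"
  then have "g x (u - v) (u - v) > 0" using pos[OF assms(1)] by simp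
  then show False using assms by (simp add: g_arith)
qed

lemma g_nonneg: "x \<in> S \<Longrightarrow> g x v v \<ge> 0"
  using pos[of x v] by (cases "v = 0") (auto simp: g_arith)

lemma g_sqrt_power2 [simp]: "x \<in> S \<Longrightarrow> (sqrt (g x v v))\<^sup>2 = g x v v"
  using g_nonneg by simp

text \<open>A frame turns \<open>g x\<close> into the Euclidean inner product.\<close>

lemma g_cauchy_schwarz:
  assumes "x \<in> S"
  shows "\<bar>g x v w\<bar> \<le> sqrt (g x v v) * sqrt (g x w w)"
proof -
  obtain T where T: "is_frame (g x) T" using frame_ex[OF assms] by blast
  have "T ** transpose T ** form_matrix (g x) = mat 1"
    using frame_inverse(1)[OF bilin[OF assms] T] matrix_left_right_inverse by blast
  then have *: "T *v (transpose T *v (form_matrix (g x) *v u)) = u" for u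
    by (metis matrix_vector_mul_assoc matrix_vector_mul_lid matrix_mul_assoc)
  then obtain s t where st: "v = T *v s" "w = T *v t" by metis
  have "g x v w = s \<bullet> t" "g x v v = s \<bullet> s" "g x w w = t \<bullet> t" using T by (simp_all add: st is_frame_def)
  then show ?thesis using Cauchy_Schwarz_ineq2[of s t] by (simp add: norm_eq_sqrt_inner)
qed

lemma dg_expand:
  assumes "x \<in> S"
  shows "dg u x v w = (\<Sum>i\<in>UNIV. \<Sum>j\<in>UNIV. v $ i * w $ j * dird u (ent i j) x)"
proof -
  have "dg u x v w = dird u (\<lambda>y. \<Sum>i\<in>UNIV. \<Sum>j\<in>UNIV. v $ i * w $ j * ent i j y) x"
    unfolding dg_def by (rule dird_cong[OF open_S assms]) (rule g_expand)
  also have "\<dots> = (\<Sum>i\<in>UNIV. \<Sum>j\<in>UNIV. v $ i * w $ j * dird u (ent i j) x)"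
    by (rule dird_eqI)
      (intro has_derivative_sum has_derivative_mult_right smooth_on_has_derivative[OF smooth open_S assms])
  finally show ?thesis .
qed

lemma dg_linear:
  assumes "x \<in> S"
  shows "linear (\<lambda>u. dg u x v w)" "linear (\<lambda>v. dg u x v w)" "linear (\<lambda>w. dg u x v w)"
proof -
  show "linear (\<lambda>u. dg u x v w)"
    unfolding dg_def using smooth_on_has_derivative[OF smooth open_S assms] by (rule has_derivative_linear)
  show "linear (\<lambda>v. dg u x v w)" "linear (\<lambda>w. dg u x v w)"
    by (rule linearI; simp add: dg_expand[OF assms] distrib_right distrib_left sum.distrib sum_distrib_left mult_ac)+
qed

lemma dg_sym: "x \<in> S \<Longrightarrow> dg u x v w = dg u x w v"
  unfolding dg_def by (rule dird_cong[OF open_S]) (auto simp: sym)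

text \<open>Lowering the index cancels the inverse Gram matrix in \<open>chr\<close>; what remains
  is the Koszul formula in coordinates.\<close>

lemma g_chr:
  assumes "z \<in> S"
  shows "g z w (chr z u v) = (dg u z v w + dg v z u w - dg w z u v) / 2"
proof -
  have ex: "w = (\<Sum>i\<in>UNIV. w $ i *\<^sub>R axis i 1)"
    by (simp add: basis_expansion scalar_mult_eq_scaleR[symmetric])
  have *: "L w = (\<Sum>l\<in>UNIV. w $ l * L (axis l 1))" if "linear L" for L :: "real ^ 'n \<Rightarrow> real"
    by (subst ex) (simp add: linear_sum[OF that] linear_cmul[OF that])
  have "g z w (chr z u v) = (\<Sum>l\<in>UNIV. w $ l * ((dg u z v (axis l 1) + dg v z u (axis l 1) - dg (axis l 1) z u v) / 2))"
    unfolding chr_def g_inv[OF assms] by (simp add: inner_vec_def)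
  also have "\<dots> = ((\<Sum>l\<in>UNIV. w $ l * dg u z v (axis l 1)) + (\<Sum>l\<in>UNIV. w $ l * dg v z u (axis l 1))
      - (\<Sum>l\<in>UNIV. w $ l * dg (axis l 1) z u v)) / 2"
  proof -
    have "w $ l * ((a + b - c) / 2) = (w $ l * a + w $ l * b - w $ l * c) / 2" for l a b c
      by (simp add: algebra_simps)
    then show ?thesis by (simp only: sum_divide_distrib[symmetric] sum.distrib sum_subtractf)
  qed
  also have "\<dots> = (dg u z v w + dg v z u w - dg w z u v) / 2"
    using *[OF dg_linear(3)[OF assms, of u v]] *[OF dg_linear(3)[OF assms, of v u]] *[OF dg_linear(1)[OF assms, of u v]]
    by simp
  finally show ?thesis .
qed

lemma g_chr':
  "z \<in> S \<Longrightarrow> g z (chr z u v) w = (dg u z v w + dg v z u w - dg w z u v) / 2"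
  using g_chr sym by simp

text \<open>Metric compatibility of the Levi-Civita connection: in the sum of the two Koszul
  expressions the derivatives along \<open>v\<close> and \<open>w\<close> cancel.\<close>

lemma dg_chr:
  assumes "z \<in> S"
  shows "dg u z v w = g z (chr z u v) w + g z v (chr z u w)"
proof -
  have "g z (chr z u v) w + g z v (chr z u w) = (dg u z v w + dg u z w v) / 2"
    unfolding g_chr'[OF assms] g_chr[OF assms] by (simp add: add_divide_distrib diff_divide_distrib)
  then show ?thesis using dg_sym[OF assms, of u w v] by simp
qed

lemma chr_sym:
  assumes "z \<in> S" shows "chr z u v = chr z v u"
proof (rule g_eqI[OF assms])
  fix w
  have "g z w (chr z u v) = g z w (chr z v u)"
    unfolding g_chr[OF assms] using dg_sym[OF assms, of w u v] by simp
  then show "g z (chr z u v) w = g z (chr z v u) w" using sym[OF assms] by metis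
qed

lemma chr_linear:
  assumes "z \<in> S"
  shows "linear (chr z u)" "linear (\<lambda>u. chr z u v)"
proof -
  show *: "linear (chr z u)" for u
  proof (rule linearI)
    fix v w c
    show "chr z u (v + w) = chr z u v + chr z u w"
      by (rule g_eqI[OF assms])
        (simp add: g_arith[OF assms] g_chr'[OF assms] linear_add[OF dg_linear(1)[OF assms]]
          linear_add[OF dg_linear(2)[OF assms]] linear_add[OF dg_linear(3)[OF assms]] field_simps)
    show "chr z u (c *\<^sub>R v) = c *\<^sub>R chr z u v"
      by (rule g_eqI[OF assms])
        (simp add: g_arith[OF assms] g_chr'[OF assms] linear_cmul[OF dg_linear(1)[OF assms]]
          linear_cmul[OF dg_linear(2)[OF assms]] linear_cmul[OF dg_linear(3)[OF assms]] field_simps)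
  qed
  have "(\<lambda>u. chr z u v) = chr z v" using chr_sym[OF assms] by auto
  then show "linear (\<lambda>u. chr z u v)" using * by simp
qed

text \<open>The derivative of \<open>Phi z\<close> at \<open>z + v\<close>; the two halves that
  arise from the quadratic term merge by symmetry of \<open>chr z\<close>.\<close>

definition dPhi :: "real ^ 'n \<Rightarrow> real ^ 'n \<Rightarrow> real ^ 'n \<Rightarrow> real ^ 'n" where
  "dPhi z v w = w + chr z v w"

text \<open>Normal coordinates at \<open>z\<close> up to third order.\<close>

definition Phi :: "real ^ 'n \<Rightarrow> real ^ 'n \<Rightarrow> real ^ 'n" where
  "Phi z y = (y - z) + (1/2) *\<^sub>R chr z (y - z) (y - z)"

lemma chr_bilinear: "z \<in> S \<Longrightarrow> bounded_bilinear (chr z)"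
  using chr_linear unfolding bilinear_conv_bounded_bilinear[symmetric] bilinear_def by blast

lemma Phi_has_derivative:
  assumes "z \<in> S"
  shows "(Phi z has_derivative dPhi z (y - z)) (at y within X)"
proof -
  have "((\<lambda>y. chr z (y - z) (y - z)) has_derivative (\<lambda>w. chr z (y - z) w + chr z w (y - z))) (at y within X)"
    by (rule bounded_bilinear.FDERIV[OF chr_bilinear[OF assms]]) (auto intro!: derivative_eq_intros)
  then have "((\<lambda>y. (y - z) + (1/2) *\<^sub>R chr z (y - z) (y - z)) has_derivative
      (\<lambda>w. w + (1/2) *\<^sub>R (chr z (y - z) w + chr z w (y - z)))) (at y within X)"
    by (auto intro!: derivative_eq_intros)
  moreover have "w + (1/2) *\<^sub>R (chr z (y - z) w + chr z w (y - z)) = dPhi z (y - z) w" for w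
  proof -
    have "chr z w (y - z) = chr z (y - z) w" using chr_sym[OF assms] .
    then show ?thesis by (simp add: dPhi_def scaleR_2[symmetric])
  qed
  ultimately show ?thesis by (simp add: Phi_def[abs_def])
qed

text \<open>Smoothness of the metric is assumed for fixed vector arguments; joint continuity follows
  by expanding in the entries of the Gram matrix.\<close>

lemma g_continuous:
  assumes "continuous_on X f" "continuous_on X v" "continuous_on X w" "f ` X \<subseteq> S"
  shows "continuous_on X (\<lambda>x. g (f x) (v x) (w x))"
proof -
  have "continuous_on X (\<lambda>x. ent i j (f x))" for i j
    using continuous_on_compose2[OF smooth_on_continuous[OF smooth] assms(1,4)] .
  then have "continuous_on X (\<lambda>x. \<Sum>i\<in>UNIV. \<Sum>j\<in>UNIV. v x $ i * w x $ j * ent i j (f x))"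
    by (intro continuous_intros assms)
  moreover have "(\<Sum>i\<in>UNIV. \<Sum>j\<in>UNIV. v x $ i * w x $ j * ent i j (f x)) = g (f x) (v x) (w x)" if "x \<in> X" for x
  proof -
    have "f x \<in> S" using that assms(4) by blast
    then show ?thesis by (rule g_expand[symmetric])
  qed
  ultimately show ?thesis by (rule continuous_on_eq)
qed

lemma sum2_bound:
  fixes F :: "'n \<Rightarrow> 'n \<Rightarrow> real" and v w :: "real ^ 'n"
  assumes "\<And>i j. \<bar>F i j\<bar> \<le> C i j * t"
  shows "\<bar>\<Sum>i\<in>UNIV. \<Sum>j\<in>UNIV. v $ i * w $ j * F i j\<bar> \<le> (\<Sum>i\<in>UNIV. \<Sum>j\<in>UNIV. C i j) * t * norm v * norm w"
proof -
  have "\<bar>v $ i * w $ j * F i j\<bar> \<le> norm v * norm w * (C i j * t)" for i j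
    unfolding abs_mult using component_le_norm_cart[of v i] component_le_norm_cart[of w j] assms[of i j]
    by (intro mult_mono) auto
  then have "\<bar>\<Sum>i\<in>UNIV. \<Sum>j\<in>UNIV. v $ i * w $ j * F i j\<bar> \<le> (\<Sum>i\<in>UNIV. \<Sum>j\<in>UNIV. norm v * norm w * (C i j * t))"
    by (intro order_trans[OF sum_abs] sum_mono)
  also have "\<dots> = (\<Sum>i\<in>UNIV. \<Sum>j\<in>UNIV. C i j) * t * norm v * norm w"
    unfolding sum_distrib_right by (intro sum.cong refl) simp
  finally show ?thesis .
qed

end

lemma inner_congruence:
  fixes A B :: "real ^ 'n::finite ^ 'n"
  shows "x \<bullet> ((transpose A ** B ** A) *v y) = (A *v x) \<bullet> (B *v (A *v y))"
  by (metis dot_lmul_matrix matrix_vector_mul_assoc transpose_matrix_vector transpose_transpose)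

section \<open>Bounds for the metric, the Christoffel form and the density, uniform on compact
  sets\<close>

context local_metric begin

definition vol_dens :: "real ^ 'n \<Rightarrow> real" where
  "vol_dens y = sqrt (det (form_matrix (g y)))"

text \<open>A positive continuous function on the compact product of \<open>K\<close> with the unit
  sphere has a positive minimum, and homogeneity carries it to all vectors.\<close>

lemma g_lower_bound:
  assumes K: "compact K" "K \<subseteq> S"
  shows "\<exists>a>0. \<forall>z\<in>K. \<forall>w. a * norm w \<le> sqrt (g z w w)"
proof (cases "K = {}")
  case False
  have cont: "continuous_on (K \<times> sphere 0 1) (\<lambda>p. g (fst p) (snd p) (snd p))"
    using K(2) by (intro g_continuous continuous_intros) auto
  have "compact (K \<times> sphere (0 :: real ^ 'n) 1)" using K(1) by (intro compact_Times compact_sphere)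
  moreover have "K \<times> sphere (0 :: real ^ 'n) 1 \<noteq> {}" using False by (simp add: sphere_eq_empty)
  ultimately obtain p where p: "p \<in> K \<times> sphere 0 1"
    and min: "\<And>q. q \<in> K \<times> sphere 0 1 \<Longrightarrow> g (fst p) (snd p) (snd p) \<le> g (fst q) (snd q) (snd q)"
    using continuous_attains_inf[OF _ _ cont] by blast
  define a where "a = g (fst p) (snd p) (snd p)"
  have "snd p \<noteq> 0" "fst p \<in> S" using p K(2) by (auto simp: mem_Times_iff)
  then have a: "a > 0" unfolding a_def by (rule pos[rotated])
  have "sqrt a * norm w \<le> sqrt (g z w w)" if z: "z \<in> K" for z w
  proof (cases "w = 0")
    case False
    have zS: "z \<in> S" using z K(2) by auto
    let ?u = "(1 / norm w) *\<^sub>R w"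
    have "a \<le> g z ?u ?u" using min[of "(z, ?u)"] False z unfolding a_def by simp
    also have "\<dots> = g z w w / (norm w)\<^sup>2" by (simp add: g_arith[OF zS] power2_eq_square)
    finally have "a * (norm w)\<^sup>2 \<le> g z w w" using False by (simp add: field_simps)
    then have "sqrt (a * (norm w)\<^sup>2) \<le> sqrt (g z w w)" by simp
    then show ?thesis by (simp add: real_sqrt_mult)
  qed (use z K(2) g_arith in \<open>auto simp: subset_iff\<close>)
  then show ?thesis using a by (intro exI[of _ "sqrt a"]) auto
qed (auto intro: exI[of _ 1])

lemma g_upper_bound:
  assumes K: "compact K" "K \<subseteq> S"
  shows "\<exists>C\<ge>0. \<forall>z\<in>K. \<forall>v w. \<bar>g z v w\<bar> \<le> C * norm v * norm w"
proof -
  have "\<forall>i j. \<exists>C\<ge>0. \<forall>x\<in>K. \<bar>ent i j x\<bar> \<le> C * 1"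
  proof (intro allI)
    fix i j :: 'n
    show "\<exists>C\<ge>0. \<forall>x\<in>K. \<bar>ent i j x\<bar> \<le> C * 1"
      using dird_funpow_bound[OF open_S K smooth[of "axis i 1" "axis j 1"], of 0] by auto
  qed
  then obtain C where C: "\<And>i j. C i j \<ge> 0" "\<And>i j x. x \<in> K \<Longrightarrow> \<bar>ent i j x\<bar> \<le> C i j * 1" by metis
  have "\<bar>g z v w\<bar> \<le> (\<Sum>i\<in>UNIV. \<Sum>j\<in>UNIV. C i j) * norm v * norm w" if "z \<in> K" for z v w
  proof -
    have "z \<in> S" using that K by auto
    from g_expand[OF this, of v w] sum2_bound[OF C(2)[OF that], of v w] show ?thesis by simp
  qed
  moreover have "0 \<le> (\<Sum>i\<in>UNIV. \<Sum>j\<in>UNIV. C i j)" using C(1) by (simp add: sum_nonneg)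
  ultimately show ?thesis by blast
qed

lemma dg_bound:
  assumes K: "compact K" "K \<subseteq> S"
  shows "\<exists>C\<ge>0. \<forall>z\<in>K. \<forall>u v w. \<bar>dg u z v w\<bar> \<le> C * norm u * norm v * norm w"
proof -
  have "\<forall>i j. \<exists>C\<ge>0. \<forall>x\<in>K. \<forall>u. \<bar>dird u (ent i j) x\<bar> \<le> C * norm u"
  proof (intro allI)
    fix i j :: 'n
    show "\<exists>C\<ge>0. \<forall>x\<in>K. \<forall>u. \<bar>dird u (ent i j) x\<bar> \<le> C * norm u"
      using dird_funpow_bound[OF open_S K smooth[of "axis i 1" "axis j 1"], of 1] by simp
  qed
  then obtain C where C: "\<And>i j. C i j \<ge> 0" "\<And>i j x u. x \<in> K \<Longrightarrow> \<bar>dird u (ent i j) x\<bar> \<le> C i j * norm u" by metis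
  have "\<bar>dg u z v w\<bar> \<le> (\<Sum>i\<in>UNIV. \<Sum>j\<in>UNIV. C i j) * norm u * norm v * norm w" if "z \<in> K" for u z v w
  proof -
    have "z \<in> S" using that K by auto
    from dg_expand[OF this] sum2_bound[OF C(2)[OF that], of v w u] show ?thesis by simp
  qed
  moreover have "0 \<le> (\<Sum>i\<in>UNIV. \<Sum>j\<in>UNIV. C i j)" using C(1) by (simp add: sum_nonneg)
  ultimately show ?thesis by blast
qed

lemma g_taylor:
  assumes K: "compact K" "convex K" "K \<subseteq> S"
  shows "\<exists>C\<ge>0. \<forall>z\<in>K. \<forall>y\<in>K. \<forall>v w. \<bar>g y v w - g z v w - dg (y - z) z v w\<bar> \<le> C * (norm (y - z))\<^sup>2 * norm v * norm w"
proof -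
  have "\<forall>i j. \<exists>C\<ge>0. \<forall>z\<in>K. \<forall>y\<in>K. \<bar>ent i j y - ent i j z - dird (y - z) (ent i j) z\<bar> \<le> C * (norm (y - z))\<^sup>2"
    using taylor2_bound[OF open_S K smooth] by blast
  then obtain C where C: "\<And>i j. C i j \<ge> 0"
    "\<And>i j z y. z \<in> K \<Longrightarrow> y \<in> K \<Longrightarrow> \<bar>ent i j y - ent i j z - dird (y - z) (ent i j) z\<bar> \<le> C i j * (norm (y - z))\<^sup>2" by metis
  have "\<bar>g y v w - g z v w - dg (y - z) z v w\<bar> \<le> (\<Sum>i\<in>UNIV. \<Sum>j\<in>UNIV. C i j) * (norm (y - z))\<^sup>2 * norm v * norm w"
    if zy: "z \<in> K" "y \<in> K" for z y v w
  proof -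
    have S: "z \<in> S" "y \<in> S" using zy K by auto
    have "g y v w - g z v w - dg (y - z) z v w =
      (\<Sum>i\<in>UNIV. \<Sum>j\<in>UNIV. v $ i * w $ j * (ent i j y - ent i j z - dird (y - z) (ent i j) z))"
      unfolding g_expand[OF S(1), of v w] g_expand[OF S(2), of v w] dg_expand[OF S(1)]
      by (simp only: right_diff_distrib sum_subtractf)
    then show ?thesis using sum2_bound[OF C(2)[OF zy], of v w] by simp
  qed
  moreover have "0 \<le> (\<Sum>i\<in>UNIV. \<Sum>j\<in>UNIV. C i j)" using C(1) by (simp add: sum_nonneg)
  ultimately show ?thesis by blast
qed

text \<open>\<open>chr z u v\<close> is tested against itself: the Koszul formula bounds its squared
  length by derivatives of the metric times its norm, and the lower bound for the metric allows one
  factor of the norm to be divided out.\<close>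

lemma chr_bound:
  assumes K: "compact K" "K \<subseteq> S"
  shows "\<exists>C\<ge>0. \<forall>z\<in>K. \<forall>u v. norm (chr z u v) \<le> C * norm u * norm v"
proof -
  obtain a where a: "a > 0" "\<And>z w. z \<in> K \<Longrightarrow> a * norm w \<le> sqrt (g z w w)" using g_lower_bound[OF K] by blast
  obtain C where C: "C \<ge> 0" "\<And>z u v w. z \<in> K \<Longrightarrow> \<bar>dg u z v w\<bar> \<le> C * norm u * norm v * norm w"
    using dg_bound[OF K] by blast
  have "norm (chr z u v) \<le> 2 * C / a\<^sup>2 * norm u * norm v" if z: "z \<in> K" for z u v
  proof -
    have zS: "z \<in> S" using z K by auto
    let ?b = "chr z u v"
    have "(a * norm ?b)\<^sup>2 \<le> (sqrt (g z ?b ?b))\<^sup>2" using a z by (intro power_mono) auto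
    also have "\<dots> = (dg u z v ?b + dg v z u ?b - dg ?b z u v) / 2"
      unfolding g_sqrt_power2[OF zS] by (rule g_chr[OF zS])
    also have "\<dots> \<le> 2 * (C * norm u * norm v * norm ?b)"
    proof -
      have "0 \<le> C * norm u * norm v * norm ?b" using C(1) by simp
      moreover have "\<bar>dg u z v ?b\<bar> \<le> C * norm u * norm v * norm ?b" using C(2)[OF z] .
      moreover have "\<bar>dg v z u ?b\<bar> \<le> C * norm u * norm v * norm ?b" using C(2)[OF z, of v u ?b] by (simp add: mult_ac)
      moreover have "\<bar>dg ?b z u v\<bar> \<le> C * norm u * norm v * norm ?b" using C(2)[OF z, of ?b u v] by (simp add: mult_ac)
      ultimately show ?thesis by argo
    qed
    finally have *: "a\<^sup>2 * norm ?b * norm ?b \<le> (2 * C * norm u * norm v) * norm ?b"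
      by (simp add: power2_eq_square mult_ac)
    show ?thesis
    proof (cases "norm ?b = 0")
      case True
      then show ?thesis using C(1) a(1) by (simp only: True) simp
    next
      case False
      then have "a\<^sup>2 * norm ?b \<le> 2 * C * norm u * norm v" using * by (simp only: mult_le_cancel_right) auto
      then show ?thesis using a(1) by (simp add: field_simps)
    qed
  qed
  moreover have "0 \<le> 2 * C / a\<^sup>2" using C(1) by simp
  ultimately show ?thesis by blast
qed

lemma pullback_expand:
  assumes "z \<in> S"
  shows "g z (dPhi z v w) (dPhi z v w') = g z w w' + dg v z w w' + g z (chr z v w) (chr z v w')"
  unfolding dPhi_def dg_chr[OF assms] by (simp add: g_arith[OF assms])

text \<open>By metric compatibility the pullback of \<open>g z\<close> has the same value and the
  same first-order term at \<open>z\<close> as \<open>g\<close> itself. The second-order Taylor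
  remainder and the product of two Christoffel terms are all that is left.\<close>

lemma pullback_bound:
  assumes K: "compact K" "convex K" "K \<subseteq> S"
  shows "\<exists>C\<ge>0. \<forall>z\<in>K. \<forall>y\<in>K. \<forall>w w'.
    \<bar>g y w w' - g z (dPhi z (y - z) w) (dPhi z (y - z) w')\<bar> \<le> C * (norm (y - z))\<^sup>2 * norm w * norm w'"
proof -
  obtain A where A: "A \<ge> 0" "\<And>z v w. z \<in> K \<Longrightarrow> \<bar>g z v w\<bar> \<le> A * norm v * norm w" using g_upper_bound[OF K(1,3)] by blast
  obtain B where B: "B \<ge> 0" "\<And>z u v. z \<in> K \<Longrightarrow> norm (chr z u v) \<le> B * norm u * norm v" using chr_bound[OF K(1,3)] by blast
  obtain D where D: "D \<ge> 0" "\<And>z y v w. z \<in> K \<Longrightarrow> y \<in> K \<Longrightarrow>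
     \<bar>g y v w - g z v w - dg (y - z) z v w\<bar> \<le> D * (norm (y - z))\<^sup>2 * norm v * norm w" using g_taylor[OF K] by blast
  have "\<bar>g y w w' - g z (dPhi z (y - z) w) (dPhi z (y - z) w')\<bar> \<le> (D + A * B * B) * (norm (y - z))\<^sup>2 * norm w * norm w'"
    if zy: "z \<in> K" "y \<in> K" for z y w w'
  proof -
    have zS: "z \<in> S" using zy K by auto
    let ?v = "y - z"
    have "\<bar>g z (chr z ?v w) (chr z ?v w')\<bar> \<le> A * norm (chr z ?v w) * norm (chr z ?v w')" using A(2)[OF zy(1)] .
    also have "\<dots> \<le> A * (B * norm ?v * norm w) * (B * norm ?v * norm w')"
      using A(1) B zy by (intro mult_mono) auto
    finally have "\<bar>g z (chr z ?v w) (chr z ?v w')\<bar> \<le> A * B * B * (norm ?v)\<^sup>2 * norm w * norm w'"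
      by (simp add: power2_eq_square mult_ac)
    moreover have "\<bar>g y w w' - g z w w' - dg ?v z w w'\<bar> \<le> D * (norm ?v)\<^sup>2 * norm w * norm w'" using D(2)[OF zy] .
    ultimately show ?thesis unfolding pullback_expand[OF zS] by (simp add: algebra_simps abs_le_iff)
  qed
  moreover have "0 \<le> D + A * B * B" using A(1) B(1) D(1) by simp
  ultimately show ?thesis by blast
qed

lemma det_pullback:
  assumes "z \<in> S" "linear L"
  shows "det (form_matrix (\<lambda>w w'. g z (L w) (L w'))) = det (form_matrix (g z)) * (det (matrix L))\<^sup>2"
proof -
  have "form_matrix (\<lambda>w w'. g z (L w) (L w')) = transpose (matrix L) ** form_matrix (g z) ** matrix L"
  proof -
    have "form_matrix (\<lambda>w w'. g z (L w) (L w')) $ i $ j = (transpose (matrix L) ** form_matrix (g z) ** matrix L) $ i $ j" for i j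
    proof -
      have "form_matrix (\<lambda>w w'. g z (L w) (L w')) $ i $ j = (matrix L *v axis i 1) \<bullet> (form_matrix (g z) *v (matrix L *v axis j 1))"
      proof -
        have "form_matrix (\<lambda>w w'. g z (L w) (L w')) $ i $ j = g z (L (axis i 1)) (L (axis j 1))"
          by (simp add: form_matrix_def)
        then show ?thesis using assms(2) g_matrix[OF assms(1), of "L (axis i 1)" "L (axis j 1)"] by (simp add: matrix_works)
      qed
      also have "\<dots> = axis i 1 \<bullet> ((transpose (matrix L) ** form_matrix (g z) ** matrix L) *v axis j 1)"
        by (rule inner_congruence[symmetric])
      finally show ?thesis by (simp add: inner_axis' matrix_vector_mult_basis column_def)
    qed
    then show ?thesis by (simp add: vec_eq_iff)
  qed
  then show ?thesis by (simp add: det_mul power2_eq_square mult_ac)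
qed

lemma vol_dens_pos: "z \<in> S \<Longrightarrow> vol_dens z > 0"
  using det_pos by (simp add: vol_dens_def)

lemma vol_dens_continuous: "continuous_on S vol_dens"
  unfolding vol_dens_def using smooth_on_continuous[OF smooth]
  by (intro continuous_on_real_sqrt continuous_on_det) (simp add: form_matrix_def)

lemma vol_dens_bounds:
  assumes K: "compact K" "K \<subseteq> S"
  shows "\<exists>m>0. \<exists>C\<ge>0. \<forall>z\<in>K. m \<le> vol_dens z \<and> vol_dens z \<le> C"
proof (cases "K = {}")
  case False
  have c: "continuous_on K vol_dens" using vol_dens_continuous K(2) continuous_on_subset by blast
  obtain x where x: "x \<in> K" "\<And>z. z \<in> K \<Longrightarrow> vol_dens x \<le> vol_dens z"
    using continuous_attains_inf[OF K(1) False c] by blast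
  obtain y where y: "y \<in> K" "\<And>z. z \<in> K \<Longrightarrow> vol_dens z \<le> vol_dens y"
    using continuous_attains_sup[OF K(1) False c] by blast
  have "vol_dens x > 0" "vol_dens y \<ge> 0" using x(1) y(1) K(2) vol_dens_pos by (auto simp: less_imp_le subset_iff)
  then show ?thesis using x(2) y(2) by blast
qed (auto intro: exI[of _ 1])

lemma dPhi_linear: "z \<in> S \<Longrightarrow> linear (dPhi z v)"
  unfolding dPhi_def[abs_def] by (intro linear_compose_add linear_ident chr_linear)

text \<open>The determinants of the two Gram matrices are compared first. The square roots follow by
  dividing the difference of squares by the sum, which is at least the minimum \<open>m\<close> of
  the density.\<close>

lemma vol_dens_bound:
  assumes K: "compact K" "convex K" "K \<subseteq> S"
  shows "\<exists>C\<ge>0. \<forall>z\<in>K. \<forall>y\<in>K. \<bar>vol_dens y - vol_dens z * \<bar>det (matrix (dPhi z (y - z)))\<bar>\<bar> \<le> C * (norm (y - z))\<^sup>2"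
proof -
  obtain A where A: "A \<ge> 0" "\<And>z v w. z \<in> K \<Longrightarrow> \<bar>g z v w\<bar> \<le> A * norm v * norm w" using g_upper_bound[OF K(1,3)] by blast
  obtain P where P: "P \<ge> 0" "\<And>z y w w'. z \<in> K \<Longrightarrow> y \<in> K \<Longrightarrow>
    \<bar>g y w w' - g z (dPhi z (y - z) w) (dPhi z (y - z) w')\<bar> \<le> P * (norm (y - z))\<^sup>2 * norm w * norm w'"
    using pullback_bound[OF K] by blast
  obtain d where d: "\<And>z y. z \<in> K \<Longrightarrow> y \<in> K \<Longrightarrow> norm (y - z) \<le> d"
    using compact_imp_bounded[OF K(1)] bounded_two_points by (metis dist_norm)
  obtain m where m: "m > 0" "\<And>z. z \<in> K \<Longrightarrow> m \<le> vol_dens z" using vol_dens_bounds[OF K(1,3)] by blast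
  \<comment> \<open>A common bound for the entries of both Gram matrices: \<open>A\<close> for the
    metric, and for the pullback in addition the comparison error on a set of diameter at most
    \<open>d\<close>.\<close>
  define M where "M = A + P * d\<^sup>2"
  have M: "M \<ge> 0" using A(1) P(1) by (simp add: M_def)
  obtain E where E: "E \<ge> 0" "\<And>A B :: real ^ 'n ^ 'n. \<And>e.
     (\<And>i j. \<bar>A $ i $ j\<bar> \<le> M \<and> \<bar>B $ i $ j\<bar> \<le> M \<and> \<bar>A $ i $ j - B $ i $ j\<bar> \<le> e) \<Longrightarrow> \<bar>det A - det B\<bar> \<le> E * e"
    using det_diff_bound[OF M] by blast
  have "\<bar>vol_dens y - vol_dens z * \<bar>det (matrix (dPhi z (y - z)))\<bar>\<bar> \<le> E * P / m * (norm (y - z))\<^sup>2"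
    if zy: "z \<in> K" "y \<in> K" for z y
  proof -
    have S: "z \<in> S" "y \<in> S" using zy K by auto
    let ?L = "dPhi z (y - z)" and ?a = "vol_dens y" and ?b = "vol_dens z * \<bar>det (matrix (dPhi z (y - z)))\<bar>"
    have a2: "?a\<^sup>2 = det (form_matrix (g y))" using det_pos[OF S(2)] by (simp add: vol_dens_def)
    have b2: "?b\<^sup>2 = det (form_matrix (\<lambda>w w'. g z (?L w) (?L w')))"
      using det_pos[OF S(1)] by (simp add: det_pullback[OF S(1) dPhi_linear[OF S(1)]] vol_dens_def power_mult_distrib)
    have "\<bar>det (form_matrix (g y)) - det (form_matrix (\<lambda>w w'. g z (?L w) (?L w')))\<bar> \<le> E * (P * (norm (y - z))\<^sup>2)"
    proof (rule E(2))
      fix i j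
      have 1: "\<bar>g y (axis i 1) (axis j 1)\<bar> \<le> A" using A(2)[OF zy(2), of "axis i 1" "axis j 1"] by simp
      have 2: "\<bar>g y (axis i 1) (axis j 1) - g z (?L (axis i 1)) (?L (axis j 1))\<bar> \<le> P * (norm (y - z))\<^sup>2"
        using P(2)[OF zy, of "axis i 1" "axis j 1"] by simp
      have 3: "P * (norm (y - z))\<^sup>2 \<le> P * d\<^sup>2" using P(1) d[OF zy] by (intro mult_left_mono power_mono) auto
      have 4: "0 \<le> P * d\<^sup>2" using P(1) by simp
      show "\<bar>form_matrix (g y) $ i $ j\<bar> \<le> M \<and> \<bar>form_matrix (\<lambda>w w'. g z (?L w) (?L w')) $ i $ j\<bar> \<le> M \<and>
        \<bar>form_matrix (g y) $ i $ j - form_matrix (\<lambda>w w'. g z (?L w) (?L w')) $ i $ j\<bar> \<le> P * (norm (y - z))\<^sup>2"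
        unfolding form_matrix_def M_def using 1 2 3 4 by simp
    qed
    then have 1: "\<bar>?a\<^sup>2 - ?b\<^sup>2\<bar> \<le> E * P * (norm (y - z))\<^sup>2" unfolding a2 b2 by simp
    have b0: "?b \<ge> 0" using vol_dens_pos[OF S(1)] by simp
    have am: "m \<le> ?a" using m(2) zy by simp
    have "\<bar>?a - ?b\<bar> * m \<le> \<bar>?a - ?b\<bar> * (?a + ?b)" using am b0 by (intro mult_left_mono) auto
    also have "\<dots> = \<bar>(?a - ?b) * (?a + ?b)\<bar>" using am b0 m(1) by (simp only: abs_mult)
    also have "\<dots> = \<bar>?a\<^sup>2 - ?b\<^sup>2\<bar>" by (simp only: power2_eq_square square_diff_square_factored mult.commute)
    finally show ?thesis using 1 m(1) by (simp add: field_simps)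
  qed
  moreover have "0 \<le> E * P / m" using E(1) P(1) m(1) by simp
  ultimately show ?thesis by blast
qed

text \<open>The Riemannian Hessian of \<open>f\<close> at \<open>z\<close>, evaluated on the pair
  (w, w), in coordinates.\<close>

definition hess :: "(real ^ 'n \<Rightarrow> real) \<Rightarrow> real ^ 'n \<Rightarrow> real ^ 'n \<Rightarrow> real" where
  "hess f z w = dird w (dird w f) z - dird (chr z w w) f z"

end

section \<open>The Laplace-Beltrami operator as the trace of the Hessian\<close>

context local_metric begin

lemma matrix_of_linear_add:
  assumes "z \<in> S"
  shows "matrix (dPhi z v) = mat 1 + matrix (chr z v)"
  by (auto simp: matrix_def dPhi_def mat_def axis_def vec_eq_iff)

lemma matrix_chr_linear:
  assumes "z \<in> S"
  shows "linear (\<lambda>v. matrix (chr z v))"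
  using linear_add[OF chr_linear(2)[OF assms]] linear_cmul[OF chr_linear(2)[OF assms]]
  by (intro linearI) (auto simp: matrix_def vec_eq_iff)

text \<open>By \<open>vol_dens_bound\<close> the density agrees to second order with its value at
  \<open>z\<close> times the Jacobian of \<open>Phi z\<close>, so both have the same derivative at
  \<open>z\<close>. For the Jacobian this is a trace, because \<open>dPhi z 0\<close> is the
  identity.\<close>

lemma vol_dens_has_derivative:
  assumes z: "z \<in> S"
  shows "(vol_dens has_derivative (\<lambda>v. vol_dens z * trace (matrix (chr z v)))) (at z)"
proof -
  obtain r where r: "r > 0" "cball z r \<subseteq> S" using open_S z open_contains_cball by blast
  obtain C where C: "C \<ge> 0" "\<And>x y. x \<in> cball z r \<Longrightarrow> y \<in> cball z r \<Longrightarrow>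
      \<bar>vol_dens y - vol_dens x * \<bar>det (matrix (dPhi x (y - x)))\<bar>\<bar> \<le> C * (norm (y - x))\<^sup>2"
    using vol_dens_bound[OF compact_cball convex_cball r(2)] by blast
  let ?D = "\<lambda>y. det (matrix (dPhi z (y - z)))"
  have chr0: "chr z 0 = (\<lambda>w. 0)" using linear_0[OF chr_linear(2)[OF z]] by auto
  have "matrix (chr z 0) = 0" unfolding chr0 by (simp add: matrix_def vec_eq_iff)
  then have m0: "matrix (dPhi z (z - z)) = mat 1" using matrix_of_linear_add[OF z, of 0] by simp
  have D0: "?D z = 1" unfolding m0 by simp
  have "((\<lambda>y. vol_dens y - vol_dens z * \<bar>?D y\<bar>) has_derivative (\<lambda>v. 0)) (at z)"
  proof (rule has_derivative_of_quadratic_bound[of _ r _ _ C])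
    fix y assume "norm (y - z) < r"
    then have "y \<in> cball z r" by (simp add: dist_norm norm_minus_commute)
    then show "norm (vol_dens y - vol_dens z * \<bar>?D y\<bar> - (vol_dens z - vol_dens z * \<bar>?D z\<bar>) - 0) \<le> C * (norm (y - z))\<^sup>2"
      using C(2)[of z y] r(1) D0 by simp
  qed (use r in \<open>auto intro: linearI\<close>)
  moreover have dD: "(?D has_derivative (\<lambda>v. trace (matrix (chr z v)))) (at z)"
  proof -
    have "((\<lambda>y. matrix (chr z (y - z))) has_derivative (\<lambda>v. matrix (chr z v))) (at z)"
    proof -
      have bl: "bounded_linear (\<lambda>v. matrix (chr z v))"
        using matrix_chr_linear[OF z] linear_conv_bounded_linear by blast
      have "((\<lambda>y. y - z) has_derivative (\<lambda>v. v)) (at z)" by (auto intro!: derivative_eq_intros)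
      from bounded_linear.has_derivative[OF bl this] show ?thesis .
    qed
    then have m: "((\<lambda>y. matrix (dPhi z (y - z))) has_derivative (\<lambda>v. matrix (chr z v))) (at z)"
      unfolding matrix_of_linear_add[OF z] by (auto intro!: derivative_eq_intros)
    have "(det has_derivative trace) (at (matrix (dPhi z (z - z))))"
      unfolding m0 by (rule has_derivative_det_identity)
    from has_derivative_compose[OF m this] show ?thesis .
  qed
  have "((\<lambda>y. \<bar>?D y\<bar>) has_derivative (\<lambda>v. trace (matrix (chr z v)))) (at z)"
  proof -
    have "(abs has_derivative (\<lambda>h. h)) (at (?D z))"
      unfolding D0 by (rule has_derivative_transform_within_open[of "\<lambda>x. x" _ _ _ "{0<..}"]) auto
    from has_derivative_compose[OF dD this] show ?thesis .
  qed
  then have "((\<lambda>y. vol_dens z * \<bar>?D y\<bar>) has_derivative (\<lambda>v. vol_dens z * trace (matrix (chr z v)))) (at z)"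
    by (rule has_derivative_mult_right)
  ultimately have "((\<lambda>y. (vol_dens y - vol_dens z * \<bar>?D y\<bar>) + vol_dens z * \<bar>?D y\<bar>) has_derivative
     (\<lambda>v. 0 + vol_dens z * trace (matrix (chr z v)))) (at z)"
    by (rule has_derivative_add)
  then show ?thesis by simp
qed

abbreviation ginv :: "real ^ 'n \<Rightarrow> real ^ 'n ^ 'n" where
  "ginv y \<equiv> matrix_inv (form_matrix (g y))"

text \<open>Metric compatibility predicts the derivative of the inverse metric. The prediction is
  verified by estimating the error through its pairing with the metric, which avoids differentiating
  a matrix inverse.\<close>

lemma ginv_vec_has_derivative:
  assumes z: "z \<in> S"
  shows "((\<lambda>y. ginv y *v w) has_derivative
    (\<lambda>v. - chr z v (ginv z *v w) - ginv z *v (\<chi> l. w \<bullet> chr z v (axis l 1)))) (at z)"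
proof -
  obtain r where r: "r > 0" "cball z r \<subseteq> S" using open_S z open_contains_cball by blast
  let ?K = "cball z r"
  obtain a where a: "a > 0" "\<And>y w. y \<in> ?K \<Longrightarrow> a * norm w \<le> sqrt (g y w w)" using g_lower_bound[OF compact_cball r(2)] by blast
  obtain D where D: "D \<ge> 0" "\<And>x y v w. x \<in> ?K \<Longrightarrow> y \<in> ?K \<Longrightarrow>
     \<bar>g y v w - g x v w - dg (y - x) x v w\<bar> \<le> D * (norm (y - x))\<^sup>2 * norm v * norm w"
    using g_taylor[OF compact_cball convex_cball r(2)] by blast
  obtain E where E: "E \<ge> 0" "\<And>x u v w. x \<in> ?K \<Longrightarrow> \<bar>dg u x v w\<bar> \<le> E * norm u * norm v * norm w"
    using dg_bound[OF compact_cball r(2)] by blast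
  \<comment> \<open>A Lipschitz constant of the metric near \<open>z\<close>: \<open>D * r\<close>
    comes from the Taylor remainder on a ball of radius \<open>r\<close>, and \<open>E\<close> from
    the first derivative.\<close>
  define L1 where "L1 = D * r + E"
  have L1: "L1 \<ge> 0" using D(1) E(1) r(1) by (simp add: L1_def)
  have zK: "z \<in> ?K" using r by simp
  have lip: "\<bar>g y v w - g z v w\<bar> \<le> L1 * norm (y - z) * norm v * norm w" if y: "y \<in> ?K" for y v w
  proof -
    have "norm (y - z) \<le> r" using y by (simp add: dist_norm norm_minus_commute)
    then have "D * (norm (y - z))\<^sup>2 * norm v * norm w \<le> D * (r * norm (y - z)) * norm v * norm w"
      using D(1) by (intro mult_right_mono mult_left_mono) (auto simp: power2_eq_square mult_right_mono)
    then show ?thesis using D(2)[OF zK y, of v w] E(2)[OF zK, of "y - z" v w] by (simp add: L1_def algebra_simps)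
  qed
  define b where "b = ginv z *v w"
  \<comment> \<open>Both vectors are known by their pairing with \<open>g z\<close>:
    \<open>b\<close> represents the inner product with \<open>w\<close>, and \<open>c v\<close>
    represents the functional that takes x to the inner product of \<open>w\<close> with
    \<open>chr z v x\<close>.\<close>
  define c where "c v = ginv z *v (\<chi> l. w \<bullet> chr z v (axis l 1))" for v
  have gb: "g z b x = w \<bullet> x" for x using g_inv[OF z, of x w] sym[OF z] by (simp add: b_def inner_commute)
  have gc: "g z (c v) x = w \<bullet> chr z v x" for v x
  proof -
    have lin: "linear (\<lambda>x. w \<bullet> chr z v x)"
      by (rule linear_compose[OF chr_linear(1)[OF z], of "(\<bullet>) w", unfolded o_def]) (rule bounded_linear.linear[OF bounded_linear_inner_right])
    have ex: "x = (\<Sum>i\<in>UNIV. x $ i *\<^sub>R axis i 1)"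
      by (simp add: basis_expansion scalar_mult_eq_scaleR[symmetric])
    have "g z (c v) x = x \<bullet> (\<chi> l. w \<bullet> chr z v (axis l 1))" using g_inv[OF z] sym[OF z] by (simp add: c_def)
    also have "\<dots> = (\<Sum>i\<in>UNIV. x $ i * (w \<bullet> chr z v (axis i 1)))" by (simp add: inner_vec_def)
    also have "\<dots> = w \<bullet> chr z v (\<Sum>i\<in>UNIV. x $ i *\<^sub>R axis i 1)"
      by (simp only: linear_sum[OF lin] linear_cmul[OF lin] real_scaleR_def)
    also have "\<dots> = w \<bullet> chr z v x" using arg_cong[OF ex[symmetric], of "\<lambda>x. w \<bullet> chr z v x"] .
    finally show ?thesis .
  qed
  have clin: "linear c"
  proof (rule linearI)
    fix u v and s :: real
    show "c (u + v) = c u + c v"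
      by (rule g_eqI[OF z]) (simp add: gc g_arith[OF z] linear_add[OF chr_linear(2)[OF z]] inner_add_right)
    show "c (s *\<^sub>R v) = s *\<^sub>R c v"
      by (rule g_eqI[OF z]) (simp add: gc g_arith[OF z] linear_cmul[OF chr_linear(2)[OF z]])
  qed
  define C where "C = (D + L1 * L1 / a\<^sup>2) * norm b / a\<^sup>2"
  have main: "norm (ginv y *v w - b - (- chr z (y - z) b - c (y - z))) \<le> C * (norm (y - z))\<^sup>2" if y: "y \<in> ?K" for y
  proof -
    have yS: "y \<in> S" using y r by auto
    let ?v = "y - z"
    \<comment> \<open>The increment, accessible through its pairing \<open>ge\<close> under
      \<open>g y\<close>. Tested against itself it gives a first-order bound, which is then used in
      the second-order bound for \<open>R\<close>.\<close>
    define e where "e = ginv y *v w - b"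
    have ge: "g y e x = g z b x - g y b x" for x
    proof -
      have "g y (ginv y *v w) x = w \<bullet> x" using g_inv[OF yS, of x w] sym[OF yS] by (simp add: inner_commute)
      then show ?thesis unfolding e_def by (simp add: g_arith[OF yS] gb)
    qed
    have e_b: "norm e \<le> L1 * norm ?v * norm b / a\<^sup>2"
    proof -
      have "(a * norm e)\<^sup>2 \<le> (sqrt (g y e e))\<^sup>2" using a y by (intro power_mono) auto
      also have "\<dots> = g z b e - g y b e" unfolding g_sqrt_power2[OF yS] by (rule ge)
      also have "\<dots> \<le> L1 * norm ?v * norm b * norm e" using lip[OF y, of b e] by simp
      finally have *: "(a\<^sup>2 * norm e) * norm e \<le> (L1 * norm ?v * norm b) * norm e" by (simp add: power2_eq_square mult_ac)
      have "a\<^sup>2 * norm e \<le> L1 * norm ?v * norm b"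
      proof (cases "norm e = 0")
        case True then show ?thesis using L1 by (simp only: True) simp
      next
        case False then show ?thesis using * by (simp only: mult_le_cancel_right) auto
      qed
      then show ?thesis using a(1) by (simp add: field_simps)
    qed
    \<comment> \<open>What is left of the increment after the predicted derivative. Its pairing
      under \<open>g z\<close> consists of a Taylor remainder and of a product of two first-order
      quantities.\<close>
    define R where "R = e + chr z ?v b + c ?v"
    have gR: "g z R x = - (g y b x - g z b x - dg ?v z b x) - (g y e x - g z e x)" for x
    proof -
      have "g z R x = g z e x + dg ?v z b x"
        unfolding R_def dg_chr[OF z] by (simp add: g_arith[OF z] gc gb)
      then show ?thesis using ge[of x] by simp
    qed
    have R_b: "norm R \<le> C * (norm ?v)\<^sup>2"
    proof -
      have "(a * norm R)\<^sup>2 \<le> (sqrt (g z R R))\<^sup>2" using a zK by (intro power_mono) auto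
      also have "\<dots> = g z R R" using g_sqrt_power2[OF z] by simp
      also have "\<dots> \<le> D * (norm ?v)\<^sup>2 * norm b * norm R + L1 * norm ?v * norm e * norm R"
        unfolding gR[of R] using D(2)[OF zK y, of b R] lip[OF y, of e R] by linarith
      also have "\<dots> \<le> D * (norm ?v)\<^sup>2 * norm b * norm R + L1 * norm ?v * (L1 * norm ?v * norm b / a\<^sup>2) * norm R"
        using e_b L1 by (intro add_left_mono mult_right_mono mult_left_mono) auto
      also have "\<dots> = ((D + L1 * L1 / a\<^sup>2) * norm b * (norm ?v)\<^sup>2) * norm R"
        by (simp add: power2_eq_square algebra_simps)
      finally have *: "(a\<^sup>2 * norm R) * norm R \<le> ((D + L1 * L1 / a\<^sup>2) * norm b * (norm ?v)\<^sup>2) * norm R"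
        by (simp add: power2_eq_square mult_ac)
      have "a\<^sup>2 * norm R \<le> (D + L1 * L1 / a\<^sup>2) * norm b * (norm ?v)\<^sup>2"
      proof (cases "norm R = 0")
        case True then show ?thesis using L1 D(1) by (simp only: True) simp
      next
        case False then show ?thesis using * by (simp only: mult_le_cancel_right) auto
      qed
      then have "norm R \<le> (D + L1 * L1 / a\<^sup>2) * norm b * (norm ?v)\<^sup>2 / a\<^sup>2" using a(1) by (simp add: pos_le_divide_eq mult.commute)
      then show ?thesis by (simp add: C_def)
    qed
    have "ginv y *v w - b - (- chr z ?v b - c ?v) = R" by (simp add: R_def e_def)
    then show ?thesis using R_b by simp
  qed
  show ?thesis unfolding b_def[symmetric] c_def[symmetric]
  proof (rule has_derivative_of_quadratic_bound[OF _ r(1), of _ _ _ C])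
    have "linear (\<lambda>v. (- 1) *\<^sub>R chr z v b + (- 1) *\<^sub>R c v)"
      by (intro linear_compose_add linear_compose_scale_right chr_linear z clin)
    then show "linear (\<lambda>v. - chr z v b - c v)" by simp
    fix y assume "norm (y - z) < r"
    then have "y \<in> ?K" by (simp add: dist_norm norm_minus_commute)
    from main[OF this] show "norm (ginv y *v w - ginv z *v w - (- chr z (y - z) b - c (y - z))) \<le> C * (norm (y - z))\<^sup>2"
      by (simp add: b_def)
  qed
qed

text \<open>The Christoffel symbol with upper index \<open>m\<close> and lower indices
  \<open>i\<close> and \<open>l\<close>.\<close>

definition Gam :: "real ^ 'n \<Rightarrow> 'n \<Rightarrow> 'n \<Rightarrow> 'n \<Rightarrow> real" where
  "Gam z m i l = chr z (axis i 1) (axis l 1) $ m"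

lemma ginv_has_derivative:
  assumes z: "z \<in> S"
  shows "\<exists>D. ((\<lambda>y. ginv y $ i $ j) has_derivative D) (at z) \<and>
    (\<forall>m. D (axis m 1) = - (\<Sum>l\<in>UNIV. Gam z i m l * ginv z $ l $ j) - (\<Sum>l\<in>UNIV. ginv z $ i $ l * Gam z j m l))"
proof (intro exI conjI allI)
  let ?D = "\<lambda>v. (- chr z v (ginv z *v axis j 1) - ginv z *v (\<chi> l. axis j 1 \<bullet> chr z v (axis l 1))) $ i"
  have eq: "(A *v axis j 1) $ i = A $ i $ j" for A :: "real ^ 'n ^ 'n" and i
    by (simp add: matrix_vector_mult_basis column_def)
  show "((\<lambda>y. ginv y $ i $ j) has_derivative ?D) (at z)"
    using bounded_linear.has_derivative[OF bounded_linear_vec_nth[of i] ginv_vec_has_derivative[OF z, of "axis j 1"]]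
    by (simp only: eq)
  fix m
  have "chr z (axis m 1) (ginv z *v axis j 1) $ i = (\<Sum>l\<in>UNIV. Gam z i m l * ginv z $ l $ j)"
  proof -
    have ex: "w = (\<Sum>i\<in>UNIV. w $ i *\<^sub>R axis i 1)" for w :: "real ^ 'n"
      by (simp add: basis_expansion scalar_mult_eq_scaleR[symmetric])
    show ?thesis
      by (subst ex[of "ginv z *v axis j 1"])
        (simp add: linear_sum[OF chr_linear(1)[OF z]] linear_cmul[OF chr_linear(1)[OF z]] eq Gam_def mult.commute)
  qed
  moreover have "(ginv z *v (\<chi> l. axis j 1 \<bullet> chr z (axis m 1) (axis l 1))) $ i = (\<Sum>l\<in>UNIV. ginv z $ i $ l * Gam z j m l)"
    by (simp add: matrix_vector_mult_def inner_axis' Gam_def)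
  ultimately show "?D (axis m 1) = - (\<Sum>l\<in>UNIV. Gam z i m l * ginv z $ l $ j) - (\<Sum>l\<in>UNIV. ginv z $ i $ l * Gam z j m l)"
    by simp
qed

text \<open>In the product rule, the derivative of the density contributes contracted Christoffel
  symbols that cancel one of the two terms in the derivative of the inverse metric. The other term
  is the Christoffel part of the Hessian, and \<open>frame_sum_square\<close> turns the contraction
  into a trace over the frame.\<close>

lemma divergence_form:
  assumes z: "z \<in> S" and f: "smooth_on f S" and T: "is_frame (g z) T"
  shows "1 / vol_dens z * (\<Sum>i\<in>UNIV. partial_deriv i (\<lambda>y. \<Sum>j\<in>UNIV.
          vol_dens y * ginv y $ i $ j * partial_deriv j f y) z) = (\<Sum>k\<in>UNIV. hess f z (T *v axis k 1))"
proof -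
  define r where "r = vol_dens z"
  have r: "r > 0" using vol_dens_pos[OF z] by (simp add: r_def)
  define G where "G i j = ginv z $ i $ j" for i j
  define p where "p j = partial_deriv j f z" for j
  define h where "h i j = partial_deriv i (partial_deriv j f) z" for i j
  define D where "D i j = (SOME D. ((\<lambda>y. ginv y $ i $ j) has_derivative D) (at z) \<and>
    (\<forall>m. D (axis m 1) = - (\<Sum>l\<in>UNIV. Gam z i m l * ginv z $ l $ j) - (\<Sum>l\<in>UNIV. ginv z $ i $ l * Gam z j m l)))" for i j
  note DD = someI_ex[OF ginv_has_derivative[OF z], folded D_def]
  have D: "((\<lambda>y. ginv y $ i $ j) has_derivative D i j) (at z)" for i j using DD by blast
  have Dm: "D i j (axis m 1) = - (\<Sum>l\<in>UNIV. Gam z i m l * G l j) - (\<Sum>l\<in>UNIV. G i l * Gam z j m l)" for i j m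
    using DD unfolding G_def by blast
  have pd: "smooth_on (partial_deriv j f) S" for j
    using smooth_on_dird[OF f] by (simp add: partial_deriv_dird[abs_def])
  have Gam_sym: "Gam z m i l = Gam z m l i" for m i l unfolding Gam_def using chr_sym[OF z] by metis
  have tr: "trace (matrix (chr z (axis i 1))) = (\<Sum>m\<in>UNIV. Gam z m i m)" for i
    by (simp add: trace_def matrix_def Gam_def)
  have "partial_deriv i (\<lambda>y. \<Sum>j\<in>UNIV. vol_dens y * ginv y $ i $ j * partial_deriv j f y) z =
      (\<Sum>j\<in>UNIV. (r * D i j (axis i 1) + r * (\<Sum>m\<in>UNIV. Gam z m i m) * G i j) * p j + r * G i j * h i j)" (is "?lhs i = ?rhs i") for i
  proof -
    have "((\<lambda>y. \<Sum>j\<in>UNIV. vol_dens y * ginv y $ i $ j * partial_deriv j f y) has_derivative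
      (\<lambda>v. \<Sum>j\<in>UNIV. (vol_dens z * ginv z $ i $ j) * dird v (partial_deriv j f) z +
         (vol_dens z * D i j v + vol_dens z * trace (matrix (chr z v)) * ginv z $ i $ j) * partial_deriv j f z)) (at z)"
      by (intro has_derivative_sum has_derivative_mult D vol_dens_has_derivative z smooth_on_has_derivative[OF pd open_S z])
    from dird_eqI[OF this, of "axis i 1"] show ?thesis
      unfolding partial_deriv_dird[of i] by (simp add: tr r_def G_def p_def h_def partial_deriv_dird[of i] add.commute)
  qed
  then have "(\<Sum>i\<in>UNIV. ?lhs i) = (\<Sum>i\<in>UNIV. ?rhs i)" by presburger
  also have "\<dots> = r * ((\<Sum>i\<in>UNIV. \<Sum>j\<in>UNIV. G i j * h i j) + (\<Sum>i\<in>UNIV. \<Sum>j\<in>UNIV. \<Sum>m\<in>UNIV. Gam z m i m * G i j * p j)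
      - (\<Sum>i\<in>UNIV. \<Sum>j\<in>UNIV. \<Sum>l\<in>UNIV. Gam z i i l * G l j * p j) - (\<Sum>i\<in>UNIV. \<Sum>j\<in>UNIV. \<Sum>l\<in>UNIV. G i l * Gam z j i l * p j))"
    unfolding Dm
    by (simp add: sum_distrib_left sum_distrib_right sum.distrib sum_subtractf sum_negf algebra_simps)
  \<comment> \<open>The cancellation: after renaming of indices it is the symmetry of the lower
    Christoffel indices.\<close>
  also have "(\<Sum>i\<in>UNIV. \<Sum>j\<in>UNIV. \<Sum>m\<in>UNIV. Gam z m i m * G i j * p j) = (\<Sum>i\<in>UNIV. \<Sum>j\<in>UNIV. \<Sum>l\<in>UNIV. Gam z i i l * G l j * p j)"
  proof -
    have "(\<Sum>i\<in>UNIV. \<Sum>j\<in>UNIV. \<Sum>m\<in>UNIV. Gam z m i m * G i j * p j) = (\<Sum>j\<in>UNIV. \<Sum>i\<in>UNIV. \<Sum>m\<in>UNIV. Gam z m i m * G i j * p j)"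
      by (rule sum.swap)
    also have "\<dots> = (\<Sum>j\<in>UNIV. \<Sum>m\<in>UNIV. \<Sum>i\<in>UNIV. Gam z m i m * G i j * p j)"
      by (intro sum.cong refl sum.swap)
    also have "\<dots> = (\<Sum>m\<in>UNIV. \<Sum>j\<in>UNIV. \<Sum>i\<in>UNIV. Gam z m i m * G i j * p j)" by (rule sum.swap)
    finally show ?thesis using Gam_sym by presburger
  qed
  finally have main: "1 / r * (\<Sum>i\<in>UNIV. ?lhs i) =
     (\<Sum>i\<in>UNIV. \<Sum>j\<in>UNIV. G i j * h i j) - (\<Sum>i\<in>UNIV. \<Sum>j\<in>UNIV. \<Sum>l\<in>UNIV. G i l * Gam z j i l * p j)"
    using r by simp
  \<comment> \<open>Components of the covariant Hessian, as \<open>hq\<close> confirms.\<close>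
  define Q where "Q i j = h i j - (\<Sum>m\<in>UNIV. Gam z m i j * p m)" for i j
  have hq: "hess f z w = (\<Sum>i\<in>UNIV. \<Sum>j\<in>UNIV. w $ i * w $ j * Q i j)" for w
  proof -
    have bil: "bilinear (chr z)" using chr_linear[OF z] by (auto simp: bilinear_def)
    have "dird (chr z w w) f z = (\<Sum>m\<in>UNIV. chr z w w $ m * p m)"
      using dird_expand[OF f open_S z, of "chr z w w"] unfolding real_scaleR_def p_def partial_deriv_dird .
    also have "\<dots> = (\<Sum>m\<in>UNIV. (\<Sum>i\<in>UNIV. \<Sum>j\<in>UNIV. w $ i * w $ j * Gam z m i j) * p m)"
      by (subst bilinear_expand[OF bil, of w w]) (simp add: Gam_def)
    also have "\<dots> = (\<Sum>m\<in>UNIV. \<Sum>i\<in>UNIV. \<Sum>j\<in>UNIV. w $ i * w $ j * (Gam z m i j * p m))"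
      by (simp add: sum_distrib_right mult.assoc)
    also have "\<dots> = (\<Sum>i\<in>UNIV. \<Sum>m\<in>UNIV. \<Sum>j\<in>UNIV. w $ i * w $ j * (Gam z m i j * p m))" by (rule sum.swap)
    also have "\<dots> = (\<Sum>i\<in>UNIV. \<Sum>j\<in>UNIV. \<Sum>m\<in>UNIV. w $ i * w $ j * (Gam z m i j * p m))"
      by (intro sum.cong refl sum.swap)
    finally show ?thesis unfolding hess_def dird2_expand[OF f open_S z] Q_def
      by (simp add: h_def right_diff_distrib sum_subtractf sum_distrib_left)
  qed
  have "(\<Sum>k\<in>UNIV. hess f z (T *v axis k 1)) = (\<Sum>i\<in>UNIV. \<Sum>j\<in>UNIV. G i j * Q i j)"
    unfolding G_def by (rule frame_sum_square[OF bilin[OF z] T hq])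
  also have "\<dots> = (\<Sum>i\<in>UNIV. \<Sum>j\<in>UNIV. G i j * h i j) - (\<Sum>i\<in>UNIV. \<Sum>l\<in>UNIV. \<Sum>j\<in>UNIV. G i l * Gam z j i l * p j)"
    by (simp add: Q_def right_diff_distrib sum_subtractf sum_distrib_left mult.assoc)
  also have "(\<Sum>i\<in>UNIV. \<Sum>l\<in>UNIV. \<Sum>j\<in>UNIV. G i l * Gam z j i l * p j) = (\<Sum>i\<in>UNIV. \<Sum>j\<in>UNIV. \<Sum>l\<in>UNIV. G i l * Gam z j i l * p j)"
    by (intro sum.cong refl sum.swap)
  finally show ?thesis using main unfolding r_def by simp
qed

end

section \<open>Curves and the Riemannian distance\<close>

context riemannian_manifold begin

lemma chart_facts:
  assumes "c \<in> \<A>"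
  shows "openin (top_of_set M) (chart_dom c)" "open (chart_img c)"
    "homeomorphism (chart_dom c) (chart_img c) (chart_map c) (chart_inv c)" "chart_dom c \<subseteq> M"
  using charts[OF assms] openin_imp_subset by (auto simp: is_chart_def)

lemma chart_inv_map [simp]: "c \<in> \<A> \<Longrightarrow> q \<in> chart_dom c \<Longrightarrow> chart_inv c (chart_map c q) = q"
  using chart_facts(3) by (auto simp: homeomorphism_def)

lemma chart_map_inv [simp]: "c \<in> \<A> \<Longrightarrow> x \<in> chart_img c \<Longrightarrow> chart_map c (chart_inv c x) = x"
  using chart_facts(3) by (auto simp: homeomorphism_def)

lemma chart_inv_in [simp]: "c \<in> \<A> \<Longrightarrow> x \<in> chart_img c \<Longrightarrow> chart_inv c x \<in> chart_dom c"
  using homeomorphism_image2[OF chart_facts(3)] by blast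

lemma chart_map_in [simp]: "q \<in> chart_dom c \<Longrightarrow> chart_map c q \<in> chart_img c"
  by (auto simp: chart_img_def)

lemma chart_inv_M: "c \<in> \<A> \<Longrightarrow> x \<in> chart_img c \<Longrightarrow> chart_inv c x \<in> M"
  using chart_facts(4) chart_inv_in by blast

lemma chart_inv_continuous: "c \<in> \<A> \<Longrightarrow> continuous_on (chart_img c) (chart_inv c)"
  and chart_map_continuous: "c \<in> \<A> \<Longrightarrow> continuous_on (chart_dom c) (chart_map c)"
  using chart_facts(3) by (auto simp: homeomorphism_def)

lemma local_metric_chart: "c \<in> \<A> \<Longrightarrow> local_metric (chart_img c) (g c)"
  by unfold_locales (auto simp: chart_facts metric_bilinear metric_sym metric_pos metric_smooth)

lemma chart_at: "q \<in> M \<Longrightarrow> chart_at \<A> q \<in> \<A> \<and> q \<in> chart_dom (chart_at \<A> q)"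
  unfolding chart_at_def by (rule someI_ex) (use cover in blast)

lemma openin_chart_inv_image:
  assumes "c \<in> \<A>" "open X" "X \<subseteq> chart_img c"
  shows "openin (top_of_set M) (chart_inv c ` X)"
proof -
  have "openin (top_of_set (chart_img c)) X" using assms by (metis open_openin_trans chart_facts(2))
  then have "openin (top_of_set (chart_dom c)) (chart_inv c ` X)"
    using homeomorphism_imp_open_map[OF homeomorphism_sym[THEN iffD1, OF chart_facts(3)[OF assms(1)]]] by blast
  then show ?thesis using chart_facts(1)[OF assms(1)] openin_trans by blast
qed

lemma open_chart_map_image:
  assumes "c \<in> \<A>" "openin (top_of_set M) X" "X \<subseteq> chart_dom c"
  shows "open (chart_map c ` X)"
proof -
  have "openin (top_of_set (chart_dom c)) X"
    using assms by (metis chart_facts(4) openin_subset_trans)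
  then have "openin (top_of_set (chart_img c)) (chart_map c ` X)"
    using homeomorphism_imp_open_map[OF chart_facts(3)[OF assms(1)]] by blast
  then show ?thesis using chart_facts(2)[OF assms(1)] openin_open_trans by blast
qed

definition overlap :: "('a, 'n) chart \<Rightarrow> ('a, 'n) chart \<Rightarrow> (real ^ 'n) set" where
  "overlap c c' = chart_map c ` (chart_dom c \<inter> chart_dom c')"

lemma open_overlap: "c \<in> \<A> \<Longrightarrow> c' \<in> \<A> \<Longrightarrow> open (overlap c c')"
  unfolding overlap_def by (rule open_chart_map_image) (auto intro: openin_Int chart_facts)

lemma transition_smooth: "c \<in> \<A> \<Longrightarrow> c' \<in> \<A> \<Longrightarrow> smooth_on (transition c c') (overlap c c')"
  unfolding overlap_def by (rule compatible)

lemma transition_has_derivative: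
  "c \<in> \<A> \<Longrightarrow> c' \<in> \<A> \<Longrightarrow> x \<in> overlap c c' \<Longrightarrow>
    (transition c c' has_derivative (\<lambda>v. dird v (transition c c') x)) (at x)"
  by (rule smooth_on_has_derivative[OF transition_smooth open_overlap])

lemma g_change:
  "c \<in> \<A> \<Longrightarrow> c' \<in> \<A> \<Longrightarrow> x \<in> overlap c c' \<Longrightarrow>
    g c x u v = g c' (transition c c' x) (dird u (transition c c') x) (dird v (transition c c') x)"
  unfolding dird_def overlap_def by (rule metric_change)

lemma transition_apply: "c \<in> \<A> \<Longrightarrow> q \<in> chart_dom c \<Longrightarrow> transition c c' (chart_map c q) = chart_map c' q"
  by (simp add: transition_def)

lemma open_curve_preimage:
  assumes \<gamma>: "continuous_on {0..1::real} \<gamma>" "\<gamma> ` {0..1} \<subseteq> M" and X: "openin (top_of_set M) X"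
  shows "openin (top_of_set {0..1}) {t\<in>{0..1}. \<gamma> t \<in> X}" "open {t\<in>{0<..<1}. \<gamma> t \<in> X}"
proof -
  have eq: "{t\<in>{0..1}. \<gamma> t \<in> X} = {0..1} \<inter> \<gamma> -` X" "{t\<in>{0<..<1}. \<gamma> t \<in> X} = {0<..<1} \<inter> \<gamma> -` X" by auto
  show "openin (top_of_set {0..1}) {t\<in>{0..1}. \<gamma> t \<in> X}" unfolding eq
    using continuous_openin_preimage[OF \<gamma>(1) _ X] \<gamma>(2) by blast
  have "openin (top_of_set {0<..<1}) ({0<..<1} \<inter> \<gamma> -` X)"
    by (rule continuous_openin_preimage[OF continuous_on_subset[OF \<gamma>(1)] _ X]) (use \<gamma>(2) in auto)
  then show "open {t\<in>{0<..<1}. \<gamma> t \<in> X}" unfolding eq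
    using openin_open_trans open_greaterThanLessThan by blast
qed

text \<open>The chain rule for the transition map and the transformation law of the metric together:
  any chart around the point may replace the one chosen in \<open>speed\<close>.\<close>

lemma speed_chart:
  assumes c: "c \<in> \<A>" and \<gamma>: "continuous_on {0..1} \<gamma>" "\<gamma> ` {0..1} \<subseteq> M" and t: "t \<in> {0<..<1}" "\<gamma> t \<in> chart_dom c"
    and D: "((chart_map c \<circ> \<gamma>) has_vector_derivative D) (at t)"
  shows "speed \<A> g \<gamma> t = sqrt (g c (chart_map c (\<gamma> t)) D D)"
proof -
  define c' where "c' = chart_at \<A> (\<gamma> t)"
  have "\<gamma> t \<in> M" using t \<gamma>(2) by auto
  then have c': "c' \<in> \<A>" "\<gamma> t \<in> chart_dom c'" using chart_at by (auto simp: c'_def)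
  let ?x = "chart_map c (\<gamma> t)" and ?T = "transition c c'"
  have x: "?x \<in> overlap c c'" using t c' by (auto simp: overlap_def)
  have "((chart_map c \<circ> \<gamma>) has_derivative (\<lambda>h. h *\<^sub>R D)) (at t)" using D by (simp add: has_vector_derivative_def)
  moreover have "(?T has_derivative (\<lambda>v. dird v ?T ?x)) (at ((chart_map c \<circ> \<gamma>) t))"
    using transition_has_derivative[OF c c'(1) x] by simp
  ultimately have 1: "((\<lambda>s. ?T ((chart_map c \<circ> \<gamma>) s)) has_derivative (\<lambda>h. dird (h *\<^sub>R D) ?T ?x)) (at t)"
    by (rule has_derivative_compose)
  have "dird (h *\<^sub>R D) ?T ?x = h *\<^sub>R dird D ?T ?x" for h
    using linear_cmul[OF has_derivative_linear[OF transition_has_derivative[OF c c'(1) x]]] .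
  then have 2: "((\<lambda>s. ?T ((chart_map c \<circ> \<gamma>) s)) has_vector_derivative dird D ?T ?x) (at t)"
    using 1 by (simp add: has_vector_derivative_def)
  have "openin (top_of_set M) (chart_dom c)" using chart_facts(1)[OF c] .
  from open_curve_preimage(2)[OF \<gamma> this] have op: "open {s\<in>{0<..<1}. \<gamma> s \<in> chart_dom c}" .
  have "((chart_map c' \<circ> \<gamma>) has_vector_derivative dird D ?T ?x) (at t)"
    by (rule has_vector_derivative_transform_within_open[OF 2 op]) (use t c in \<open>auto simp: transition_apply\<close>)
  then have "vector_derivative (chart_map c' \<circ> \<gamma>) (at t) = dird D ?T ?x" by (rule vector_derivative_at)
  then show ?thesis unfolding speed_def Let_def c'_def[symmetric]
    using g_change[OF c c'(1) x, of D D] transition_apply[OF c t(2), of c'] by simp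
qed

lemma speed_nonneg: "\<gamma> t \<in> M \<Longrightarrow> speed \<A> g \<gamma> t \<ge> 0"
  unfolding speed_def Let_def
  using chart_at[of "\<gamma> t"] local_metric.g_nonneg[OF local_metric_chart] by simp

lemma C1_curve_speed:
  assumes C1: "C1_curve_on \<A> a b \<gamma>" and ab: "0 \<le> a" "b \<le> 1"
    and \<gamma>: "continuous_on {0..1} \<gamma>" "\<gamma> ` {0..1} \<subseteq> M" and c: "c \<in> \<A>"
  shows "\<exists>D. continuous_on {t \<in> {a..b}. \<gamma> t \<in> chart_dom c} D \<and> (\<forall>t\<in>{a<..<b}. \<gamma> t \<in> chart_dom c \<longrightarrow>
    ((chart_map c \<circ> \<gamma>) has_vector_derivative D t) (at t) \<and> speed \<A> g \<gamma> t = sqrt (g c (chart_map c (\<gamma> t)) (D t) (D t)))"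
proof -
  obtain D where D: "continuous_on {t \<in> {a..b}. \<gamma> t \<in> chart_dom c} D"
    "\<And>t. t\<in>{a..b} \<Longrightarrow> \<gamma> t \<in> chart_dom c \<Longrightarrow> ((chart_map c \<circ> \<gamma>) has_vector_derivative D t) (at t within {a..b})"
    using C1 c unfolding C1_curve_on_def by blast
  have der: "((chart_map c \<circ> \<gamma>) has_vector_derivative D t) (at t)" if t: "t \<in> {a<..<b}" "\<gamma> t \<in> chart_dom c" for t
  proof -
    have "at t within {a..b} = at t" using t by (intro at_within_interior) auto
    then show ?thesis using D(2)[of t] t by auto
  qed
  have "speed \<A> g \<gamma> t = sqrt (g c (chart_map c (\<gamma> t)) (D t) (D t))"
    if t: "t \<in> {a<..<b}" "\<gamma> t \<in> chart_dom c" for t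
    by (rule speed_chart[OF c \<gamma> _ t(2) der[OF t]]) (use t ab in auto)
  then show ?thesis using D(1) der by blast
qed

text \<open>The last break point up to \<open>u\<close> and the first one from \<open>v\<close> on
  are consecutive, because none lies strictly between \<open>u\<close> and \<open>v\<close>.\<close>

lemma piecewise_C1_piece:
  assumes S: "finite S" "{0, 1} \<subseteq> S" "S \<subseteq> {0..1}"
    "\<forall>a\<in>S. \<forall>b\<in>S. a < b \<and> {a<..<b} \<inter> S = {} \<longrightarrow> C1_curve_on \<A> a b \<gamma>"
    and uv: "0 \<le> u" "u < v" "v \<le> (1::real)" "{u<..<v} \<inter> S = {}"
  shows "\<exists>a b. 0 \<le> a \<and> a \<le> u \<and> v \<le> b \<and> b \<le> 1 \<and> C1_curve_on \<A> a b \<gamma>"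
proof -
  define a where "a = Max {s\<in>S. s \<le> u}"
  define b where "b = Min {s\<in>S. v \<le> s}"
  have "a \<in> {s\<in>S. s \<le> u}" unfolding a_def using S uv by (intro Max_in) auto
  moreover have "b \<in> {s\<in>S. v \<le> s}" unfolding b_def using S uv by (intro Min_in) auto
  moreover have "{a<..<b} \<inter> S = {}"
  proof -
    have "False" if s: "a < s" "s < b" "s \<in> S" for s
    proof -
      have "\<not> s \<le> u"
      proof
        assume "s \<le> u"
        then have "s \<le> a" unfolding a_def using s S(1) by (intro Max_ge) auto
        then show False using s by simp
      qed
      moreover have "\<not> v \<le> s"
      proof
        assume "v \<le> s"
        then have "b \<le> s" unfolding b_def using s S(1) by (intro Min_le) auto
        then show False using s by simp
      qed
      ultimately have "s \<in> {u<..<v} \<inter> S" using s(3) by simp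
      then show False using uv(4) by simp
    qed
    then show ?thesis by auto
  qed
  ultimately show ?thesis using S uv by (intro exI[of _ a] exI[of _ b]) auto
qed

lemma piecewise_C1_derivative:
  assumes "piecewise_C1_curve M \<A> \<gamma>"
  shows "\<exists>S. finite S \<and> (\<forall>c\<in>\<A>. \<forall>t\<in>{0<..<1} - S. \<gamma> t \<in> chart_dom c \<longrightarrow>
    (\<exists>D. ((chart_map c \<circ> \<gamma>) has_vector_derivative D) (at t) \<and> speed \<A> g \<gamma> t = sqrt (g c (chart_map c (\<gamma> t)) D D)))"
proof -
  obtain S where S: "finite S" "{0, 1} \<subseteq> S" "S \<subseteq> {0..1}"
    "\<forall>a\<in>S. \<forall>b\<in>S. a < b \<and> {a<..<b} \<inter> S = {} \<longrightarrow> C1_curve_on \<A> a b \<gamma>"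
    and \<gamma>: "continuous_on {0..1} \<gamma>" "\<gamma> ` {0..1} \<subseteq> M"
    using assms unfolding piecewise_C1_curve_def by blast
  have "\<exists>D. ((chart_map c \<circ> \<gamma>) has_vector_derivative D) (at t) \<and> speed \<A> g \<gamma> t = sqrt (g c (chart_map c (\<gamma> t)) D D)"
    if c: "c \<in> \<A>" and t: "t \<in> {0<..<1} - S" "\<gamma> t \<in> chart_dom c" for c t
  proof -
    obtain d where d: "d > 0" "\<And>s. s \<in> S \<Longrightarrow> s \<noteq> t \<Longrightarrow> d \<le> dist t s"
      using finite_set_avoid[OF S(1), of t] by auto
    define u where "u = max 0 (t - d)"
    define v where "v = min 1 (t + d)"
    have uv: "0 \<le> u" "u < t" "t < v" "v \<le> 1" using t d(1) by (auto simp: u_def v_def)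
    have "{u<..<v} \<inter> S = {}"
    proof -
      have "False" if "u < s" "s < v" "s \<in> S" for s
      proof -
        have "s \<noteq> t" using that t by auto
        then have "d \<le> \<bar>t - s\<bar>" using d(2)[OF that(3)] by (simp add: dist_real_def)
        moreover have "t - d < s" "s < t + d" using that by (auto simp: u_def v_def)
        ultimately show False by linarith
      qed
      then show ?thesis by auto
    qed
    then obtain a b where ab: "0 \<le> a" "a \<le> u" "v \<le> b" "b \<le> 1" "C1_curve_on \<A> a b \<gamma>"
      using piecewise_C1_piece[OF S, of u v] uv by auto
    show ?thesis using C1_curve_speed[OF ab(5,1,4) \<gamma> c] t uv ab by (meson greaterThanLessThan_iff less_le_trans le_less_trans)
  qed
  then show ?thesis using S(1) by blast
qed

text \<open>Near each parameter value the curve stays in one chart and meets at most one break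
  point. Splitting there leaves intervals on which the speed agrees with a continuous function
  except at the end points.\<close>

lemma speed_integrable:
  assumes "piecewise_C1_curve M \<A> \<gamma>"
  shows "speed \<A> g \<gamma> integrable_on {0..1}"
proof -
  obtain S where S: "finite S" "{0, 1} \<subseteq> S" "S \<subseteq> {0..1}"
    "\<forall>a\<in>S. \<forall>b\<in>S. a < b \<and> {a<..<b} \<inter> S = {} \<longrightarrow> C1_curve_on \<A> a b \<gamma>"
    and \<gamma>: "continuous_on {0..1} \<gamma>" "\<gamma> ` {0..1} \<subseteq> M"
    using assms unfolding piecewise_C1_curve_def by blast
  have piece: "speed \<A> g \<gamma> integrable_on {u..v}"
    if uv: "0 \<le> u" "u \<le> v" "v \<le> 1" "{u<..<v} \<inter> S = {}" and c: "c \<in> \<A>" "\<gamma> ` {u..v} \<subseteq> chart_dom c" for u v c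
  proof (cases "u = v")
    case False
    then obtain a b where ab: "0 \<le> a" "a \<le> u" "v \<le> b" "b \<le> 1" "C1_curve_on \<A> a b \<gamma>"
      using piecewise_C1_piece[OF S, of u v] uv by auto
    obtain D where D: "continuous_on {t \<in> {a..b}. \<gamma> t \<in> chart_dom c} D"
      "\<And>t. t\<in>{a<..<b} \<Longrightarrow> \<gamma> t \<in> chart_dom c \<Longrightarrow> speed \<A> g \<gamma> t = sqrt (g c (chart_map c (\<gamma> t)) (D t) (D t))"
      using C1_curve_speed[OF ab(5,1,4) \<gamma> c(1)] by blast
    interpret local_metric "chart_img c" "g c" using local_metric_chart[OF c(1)] .
    have "continuous_on {u..v} (\<lambda>t. sqrt (g c (chart_map c (\<gamma> t)) (D t) (D t)))"
    proof (intro continuous_on_real_sqrt g_continuous)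
      show "continuous_on {u..v} (\<lambda>t. chart_map c (\<gamma> t))"
        by (rule continuous_on_compose2[OF chart_map_continuous[OF c(1)]])
          (use c \<gamma> uv in \<open>auto intro: continuous_on_subset\<close>)
      show "continuous_on {u..v} D" "continuous_on {u..v} D"
        by (rule continuous_on_subset[OF D(1)]; use c ab uv in auto)+
      show "(\<lambda>t. chart_map c (\<gamma> t)) ` {u..v} \<subseteq> chart_img c" using c by auto
    qed
    then have "(\<lambda>t. sqrt (g c (chart_map c (\<gamma> t)) (D t) (D t))) integrable_on {u..v}"
      by (rule integrable_continuous_real)
    then show ?thesis
      by (rule integrable_spike[OF _ negligible_finite[of "{u, v}"]]) (use D(2) ab c in \<open>auto simp: image_subset_iff\<close>)
  qed (use integrable_on_refl[of "speed \<A> g \<gamma>" v] in simp)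
  have "speed \<A> g \<gamma> integrable_on cbox 0 1"
  proof (rule integrable_on_little_subintervals)
    show "\<forall>x\<in>cbox 0 1. \<exists>d>0. \<forall>u v. x \<in> cbox u v \<and> cbox u v \<subseteq> ball x d \<and> cbox u v \<subseteq> cbox 0 1 \<longrightarrow>
      speed \<A> g \<gamma> integrable_on cbox u v"
    proof
      fix x :: real assume x: "x \<in> cbox 0 1"
      then have "\<gamma> x \<in> M" using \<gamma>(2) by auto
      then obtain c where c: "c \<in> \<A>" "\<gamma> x \<in> chart_dom c" using cover by blast
      have "openin (top_of_set {0..1}) {t\<in>{0..1}. \<gamma> t \<in> chart_dom c}"
        by (rule open_curve_preimage(1)[OF \<gamma> chart_facts(1)[OF c(1)]])
      moreover have "x \<in> {t\<in>{0..1}. \<gamma> t \<in> chart_dom c}" using x c by auto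
      ultimately obtain e where e: "e > 0" "ball x e \<inter> {0..1} \<subseteq> {t\<in>{0..1}. \<gamma> t \<in> chart_dom c}"
        by (meson openin_contains_ball)
      obtain d where d: "d > 0" "\<And>s. s \<in> S \<Longrightarrow> s \<noteq> x \<Longrightarrow> d \<le> dist x s"
        using finite_set_avoid[OF S(1), of x] by auto
      have "speed \<A> g \<gamma> integrable_on cbox u v"
        if uv: "x \<in> cbox u v" "cbox u v \<subseteq> ball x (min d e)" "cbox u v \<subseteq> cbox 0 1" for u v
      proof -
        have le: "u \<le> x" "x \<le> v" using uv by auto
        have inU: "\<gamma> ` {u..v} \<subseteq> chart_dom c" using uv(2,3) e by (auto simp: image_subset_iff subset_iff)
        have nS: "s \<notin> S" if "s \<in> {u..v}" "s \<noteq> x" for s using uv(2) that d(2)[of s] by (auto simp: subset_iff)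
        have 01: "0 \<le> u" "v \<le> 1" using uv le by (auto simp: subset_iff)
        \<comment> \<open>\<open>x\<close> is the only possible break point in the interval, so
          neither half has one in its interior.\<close>
        have "speed \<A> g \<gamma> integrable_on {u..x}" "speed \<A> g \<gamma> integrable_on {x..v}"
          by (rule piece[OF _ _ _ _ c(1)]; use le inU nS 01 in force)+
        then show ?thesis using Henstock_Kurzweil_Integration.integrable_combine[OF le] by simp
      qed
      then show "\<exists>d>0. \<forall>u v. x \<in> cbox u v \<and> cbox u v \<subseteq> ball x d \<and> cbox u v \<subseteq> cbox 0 1 \<longrightarrow>
        speed \<A> g \<gamma> integrable_on cbox u v"
        using d(1) e(1) by (intro exI[of _ "min d e"]) auto
    qed
  qed
  then show ?thesis by simp
qed

abbreviation curves :: "'a \<Rightarrow> 'a \<Rightarrow> (real \<Rightarrow> 'a) set" where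
  "curves x y \<equiv> {\<gamma>. piecewise_C1_curve M \<A> \<gamma> \<and> \<gamma> 0 = x \<and> \<gamma> 1 = y}"

abbreviation len :: "(real \<Rightarrow> 'a) \<Rightarrow> real" where
  "len \<gamma> \<equiv> integral {0..1} (speed \<A> g \<gamma>)"

abbreviation rd :: "'a \<Rightarrow> 'a \<Rightarrow> real" where
  "rd \<equiv> riem_dist M \<A> g"

lemma len_nonneg: "piecewise_C1_curve M \<A> \<gamma> \<Longrightarrow> len \<gamma> \<ge> 0"
  by (rule integral_nonneg[OF speed_integrable]) (auto intro!: speed_nonneg simp: piecewise_C1_curve_def image_subset_iff)

lemma rd_le_len: "\<gamma> \<in> curves x y \<Longrightarrow> rd x y \<le> len \<gamma>"
  unfolding riem_dist_def by (rule cINF_lower) (auto intro!: bdd_belowI[of _ 0] len_nonneg)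

lemma rd_greatest: "curves x y \<noteq> {} \<Longrightarrow> (\<And>\<gamma>. \<gamma> \<in> curves x y \<Longrightarrow> m \<le> len \<gamma>) \<Longrightarrow> m \<le> rd x y"
  unfolding riem_dist_def by (rule cINF_greatest)

lemma rd_less_curve: "curves x y \<noteq> {} \<Longrightarrow> rd x y < m \<Longrightarrow> \<exists>\<gamma>\<in>curves x y. len \<gamma> < m"
  using rd_greatest[of x y m] by force

text \<open>A C1 curve in coordinates is admissible for every other chart too, with its derivative
  transported by the transition map.\<close>

lemma chart_curve:
  assumes c: "c \<in> \<A>" and w: "\<And>t. t \<in> {0..1} \<Longrightarrow> (w has_vector_derivative w' t) (at t)"
    and w': "continuous_on {0..1} w'" and img: "w ` {0..1} \<subseteq> chart_img c"
  shows "chart_inv c \<circ> w \<in> curves (chart_inv c (w 0)) (chart_inv c (w 1))"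
    "len (chart_inv c \<circ> w) = integral {0..1} (\<lambda>t. sqrt (g c (w t) (w' t) (w' t)))"
proof -
  let ?\<gamma> = "chart_inv c \<circ> w"
  have cw: "continuous_on {0..1} w"
    using w by (meson continuous_at_imp_continuous_on has_vector_derivative_continuous)
  have \<gamma>: "continuous_on {0..1} ?\<gamma>" "?\<gamma> ` {0..1} \<subseteq> M"
  proof -
    show "continuous_on {0..1} ?\<gamma>" unfolding o_def
      by (rule continuous_on_compose2[OF chart_inv_continuous[OF c] cw img])
    show "?\<gamma> ` {0..1} \<subseteq> M" using img chart_inv_M[OF c] by (auto simp: image_subset_iff)
  qed
  have "C1_curve_on \<A> 0 1 ?\<gamma>"
    unfolding C1_curve_on_def
  proof
    fix c' assume c': "c' \<in> \<A>"
    let ?T = "transition c c'" and ?X = "{t \<in> {0..1}. ?\<gamma> t \<in> chart_dom c'}"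
    have ov: "w t \<in> overlap c c'" if "t \<in> ?X" for t
    proof -
      have "w t \<in> chart_img c" using that img by (auto simp: image_subset_iff)
      then have "w t = chart_map c (?\<gamma> t)" "?\<gamma> t \<in> chart_dom c" using c by auto
      then show ?thesis using that unfolding overlap_def by blast
    qed
    \<comment> \<open>Smoothness of the transition map gives continuity of its derivative for a
      fixed direction; the moving direction \<open>w' t\<close> is therefore expanded in coordinate
      directions.\<close>
    have "continuous_on ?X (\<lambda>t. \<Sum>i\<in>UNIV. w' t $ i *\<^sub>R dird (axis i 1) ?T (w t))"
    proof (intro continuous_intros)
      show "continuous_on ?X w'" using w' by (rule continuous_on_subset) auto
      show "continuous_on ?X (\<lambda>t. dird (axis i 1) ?T (w t))" for i
        by (rule continuous_on_compose2[OF smooth_on_continuous[OF smooth_on_dird[OF transition_smooth[OF c c']]]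
              continuous_on_subset[OF cw]]) (use ov in auto)
    qed
    moreover have "(\<Sum>i\<in>UNIV. w' t $ i *\<^sub>R dird (axis i 1) ?T (w t)) = dird (w' t) ?T (w t)" if "t \<in> ?X" for t
      using dird_expand[OF transition_smooth[OF c c'] open_overlap[OF c c'] ov[OF that], of "w' t"] by (rule sym)
    ultimately have 1: "continuous_on ?X (\<lambda>t. dird (w' t) ?T (w t))" by (rule continuous_on_eq)
    have 2: "((chart_map c' \<circ> ?\<gamma>) has_vector_derivative dird (w' t) ?T (w t)) (at t within {0..1})" if t: "t \<in> ?X" for t
    proof -
      have d: "(?T has_derivative (\<lambda>v. dird v ?T (w t))) (at (w t))" by (rule transition_has_derivative[OF c c' ov[OF t]])
      have "(w has_derivative (\<lambda>h. h *\<^sub>R w' t)) (at t)" using w t by (simp add: has_vector_derivative_def)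
      from has_derivative_compose[OF this d] have "((\<lambda>s. ?T (w s)) has_derivative (\<lambda>h. dird (h *\<^sub>R w' t) ?T (w t))) (at t)" .
      moreover have "dird (h *\<^sub>R w' t) ?T (w t) = h *\<^sub>R dird (w' t) ?T (w t)" for h
        using linear_cmul[OF has_derivative_linear[OF d]] .
      moreover have "(\<lambda>s. ?T (w s)) = chart_map c' \<circ> ?\<gamma>" by (simp add: transition_def fun_eq_iff)
      ultimately have "((chart_map c' \<circ> ?\<gamma>) has_vector_derivative dird (w' t) ?T (w t)) (at t)"
        by (simp add: has_vector_derivative_def)
      then show ?thesis by (rule has_vector_derivative_at_within)
    qed
    show "\<exists>D. continuous_on ?X D \<and> (\<forall>t\<in>{0..1}. ?\<gamma> t \<in> chart_dom c' \<longrightarrow>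
        ((chart_map c' \<circ> ?\<gamma>) has_vector_derivative D t) (at t within {0..1}))"
      using 1 2 by (intro exI[of _ "\<lambda>t. dird (w' t) ?T (w t)"]) blast
  qed
  then show "?\<gamma> \<in> curves (chart_inv c (w 0)) (chart_inv c (w 1))"
    using \<gamma> unfolding piecewise_C1_curve_def by (auto intro!: exI[of _ "{0, 1}"])
  have sp: "sqrt (g c (w t) (w' t) (w' t)) = speed \<A> g ?\<gamma> t" if t: "t \<in> {0..1} - {0, 1}" for t
  proof -
    have t': "t \<in> {0<..<1}" using t by auto
    have wt: "w t \<in> chart_img c" using img t by auto
    have "open ({0<..<1} \<inter> w -` chart_img c)"
      by (rule continuous_open_preimage[OF continuous_on_subset[OF cw] _ chart_facts(2)[OF c]]) auto
    then have "((chart_map c \<circ> ?\<gamma>) has_vector_derivative w' t) (at t)"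
      by (rule has_vector_derivative_transform_within_open[rotated]) (use t' wt c w in auto)
    from speed_chart[OF c \<gamma> t' _ this] show ?thesis using wt c unfolding o_def by simp
  qed
  \<comment> \<open>\<open>speed\<close> uses the two-sided derivative, which at the end points sees
    values of the curve outside the unit interval; two points do not affect the length.\<close>
  have "negligible {0, 1 :: real}" by (rule negligible_finite) simp
  from integral_spike[OF this sp] show "len ?\<gamma> = integral {0..1} (\<lambda>t. sqrt (g c (w t) (w' t) (w' t)))" .
qed

section \<open>Reversal and concatenation of curves\<close>

lemma C1_curve_on_affine:
  assumes C1: "C1_curve_on \<A> a b \<gamma>"
    and h: "\<And>t. t \<in> {u..v} \<Longrightarrow> \<delta> t = \<gamma> (s * t + r) \<and> s * t + r \<in> {a..b}"
  shows "C1_curve_on \<A> u v \<delta>"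
  unfolding C1_curve_on_def
proof
  fix c assume c: "c \<in> \<A>"
  let ?h = "\<lambda>t. s * t + r"
  obtain D where D: "continuous_on {t \<in> {a..b}. \<gamma> t \<in> chart_dom c} D"
    "\<And>t. t\<in>{a..b} \<Longrightarrow> \<gamma> t \<in> chart_dom c \<Longrightarrow> ((chart_map c \<circ> \<gamma>) has_vector_derivative D t) (at t within {a..b})"
    using C1 c unfolding C1_curve_on_def by blast
  have "continuous_on {t \<in> {u..v}. \<delta> t \<in> chart_dom c} (\<lambda>t. s *\<^sub>R D (?h t))"
    by (intro continuous_intros continuous_on_compose2[OF D(1)]) (use h in auto)
  moreover have "((chart_map c \<circ> \<delta>) has_vector_derivative s *\<^sub>R D (?h t)) (at t within {u..v})"
    if t: "t \<in> {u..v}" "\<delta> t \<in> chart_dom c" for t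
  proof -
    have "?h ` {u..v} \<subseteq> {a..b}" using h by auto
    then have "((chart_map c \<circ> \<gamma>) has_vector_derivative D (?h t)) (at (?h t) within ?h ` {u..v})"
      using D(2)[of "?h t"] h[OF t(1)] t(2) has_vector_derivative_within_subset by fastforce
    moreover have "(?h has_vector_derivative s) (at t within {u..v})"
      by (auto intro!: derivative_eq_intros)
    ultimately have "((chart_map c \<circ> \<gamma>) \<circ> ?h has_vector_derivative s *\<^sub>R D (?h t)) (at t within {u..v})"
      using vector_diff_chain_within by blast
    then show ?thesis
      by (rule has_vector_derivative_transform[OF t(1), rotated]) (use h in auto)
  qed
  ultimately show "\<exists>D. continuous_on {t \<in> {u..v}. \<delta> t \<in> chart_dom c} D \<and> (\<forall>t\<in>{u..v}. \<delta> t \<in> chart_dom c \<longrightarrow>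
     ((chart_map c \<circ> \<delta>) has_vector_derivative D t) (at t within {u..v}))"
    by (intro exI[of _ "\<lambda>t. s *\<^sub>R D (?h t)"]) blast
qed

definition regular_off :: "(real \<Rightarrow> 'a) \<Rightarrow> real set \<Rightarrow> bool" where
  "regular_off \<gamma> S \<longleftrightarrow> (\<forall>c\<in>\<A>. \<forall>t\<in>{0<..<1} - S. \<gamma> t \<in> chart_dom c \<longrightarrow>
    (\<exists>D. ((chart_map c \<circ> \<gamma>) has_vector_derivative D) (at t) \<and> speed \<A> g \<gamma> t = sqrt (g c (chart_map c (\<gamma> t)) D D)))"

text \<open>\<open>I\<close> is an open set on which the new curve is the reparametrized one; for a
  concatenation it is an open half-line that ends at 1/2.\<close>

lemma speed_affine:
  assumes S: "regular_off \<gamma> S" and \<gamma>: "\<gamma> ` {0..1} \<subseteq> M"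
    and \<delta>: "continuous_on {0..1} \<delta>" "\<delta> ` {0..1} \<subseteq> M" and I: "open I" "t \<in> I" "t \<in> {0<..<1}"
      "\<And>t. t \<in> I \<Longrightarrow> \<delta> t = \<gamma> (s * t + r)" and st: "s * t + r \<in> {0<..<1} - S"
  shows "speed \<A> g \<delta> t = \<bar>s\<bar> * speed \<A> g \<gamma> (s * t + r)"
proof -
  have "\<gamma> (s * t + r) \<in> M" using \<gamma> st by (auto simp: image_subset_iff)
  then obtain c where c: "c \<in> \<A>" "\<gamma> (s * t + r) \<in> chart_dom c" using cover by blast
  obtain D where D: "((chart_map c \<circ> \<gamma>) has_vector_derivative D) (at (s * t + r))"
    "speed \<A> g \<gamma> (s * t + r) = sqrt (g c (chart_map c (\<gamma> (s * t + r))) D D)"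
    using S[unfolded regular_off_def, rule_format, OF c(1) st c(2)] by blast
  have "((\<lambda>t. s * t + r) has_vector_derivative s) (at t)" by (auto intro!: derivative_eq_intros)
  from vector_diff_chain_at[OF this D(1)]
  have "((chart_map c \<circ> \<gamma>) \<circ> (\<lambda>t. s * t + r) has_vector_derivative s *\<^sub>R D) (at t)" .
  then have "(chart_map c \<circ> \<delta> has_vector_derivative s *\<^sub>R D) (at t)"
    by (rule has_vector_derivative_transform_within_open[OF _ I(1,2)]) (use I in auto)
  from speed_chart[OF c(1) \<delta> I(3) _ this]
  have "speed \<A> g \<delta> t = sqrt (g c (chart_map c (\<gamma> (s * t + r))) (s *\<^sub>R D) (s *\<^sub>R D))"
    using I c by auto
  also have "\<dots> = sqrt ((s * s) * g c (chart_map c (\<gamma> (s * t + r))) D D)"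
    using local_metric.g_arith(5,6)[OF local_metric_chart[OF c(1)], of "chart_map c (\<gamma> (s * t + r))"] c(2)
    by (simp add: mult.assoc)
  also have "\<dots> = \<bar>s\<bar> * sqrt (g c (chart_map c (\<gamma> (s * t + r))) D D)"
    by (simp add: real_sqrt_mult)
  finally show ?thesis using D(2) by simp
qed

lemma regular_off_exists: "piecewise_C1_curve M \<A> \<gamma> \<Longrightarrow> \<exists>S. finite S \<and> regular_off \<gamma> S"
  using piecewise_C1_derivative unfolding regular_off_def by blast

definition breakpoints :: "(real \<Rightarrow> 'a) \<Rightarrow> real set \<Rightarrow> bool" where
  "breakpoints \<gamma> S \<longleftrightarrow> finite S \<and> {0, 1} \<subseteq> S \<and> S \<subseteq> {0..1} \<and>
    (\<forall>a\<in>S. \<forall>b\<in>S. a < b \<and> {a<..<b} \<inter> S = {} \<longrightarrow> C1_curve_on \<A> a b \<gamma>)"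

lemma breakpoints_exist: "piecewise_C1_curve M \<A> \<gamma> \<Longrightarrow> \<exists>S. breakpoints \<gamma> S"
  unfolding piecewise_C1_curve_def breakpoints_def by (elim conjE)

lemma piecewise_C1I:
  "breakpoints \<gamma> S \<Longrightarrow> continuous_on {0..1} \<gamma> \<Longrightarrow> \<gamma> ` {0..1} \<subseteq> M \<Longrightarrow> piecewise_C1_curve M \<A> \<gamma>"
  unfolding piecewise_C1_curve_def breakpoints_def by (intro conjI exI[of _ S]) auto

lemma breakpointsD:
  assumes "breakpoints \<gamma> S"
  shows "finite S" "{0, 1} \<subseteq> S" "S \<subseteq> {0..1}"
    "\<And>a b. a\<in>S \<Longrightarrow> b\<in>S \<Longrightarrow> a < b \<Longrightarrow> {a<..<b} \<inter> S = {} \<Longrightarrow> C1_curve_on \<A> a b \<gamma>"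
  using assms unfolding breakpoints_def by simp_all

lemma piecewise_C1_continuous:
  assumes "piecewise_C1_curve M \<A> \<gamma>"
  shows "continuous_on {0..1} \<gamma>" "\<gamma> ` {0..1} \<subseteq> M"
  using assms unfolding piecewise_C1_curve_def by simp_all

lemma speed_has_integral: "piecewise_C1_curve M \<A> \<gamma> \<Longrightarrow> (speed \<A> g \<gamma> has_integral len \<gamma>) {0..1}"
  using speed_integrable by (rule integrable_integral)

lemma reverse_curve:
  assumes "\<gamma> \<in> curves x y"
  shows "(\<lambda>t. \<gamma> (1 - t)) \<in> curves y x" "len (\<lambda>t. \<gamma> (1 - t)) = len \<gamma>"
proof -
  let ?\<delta> = "\<lambda>t. \<gamma> (1 - t)"
  have p: "piecewise_C1_curve M \<A> \<gamma>" using assms by simp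
  obtain S where "breakpoints \<gamma> S" using breakpoints_exist[OF p] by blast
  note S = breakpointsD[OF this]
  note \<gamma> = piecewise_C1_continuous[OF p]
  have \<delta>: "continuous_on {0..1} ?\<delta>" "?\<delta> ` {0..1} \<subseteq> M"
  proof -
    show "continuous_on {0..1} ?\<delta>"
      by (rule continuous_on_compose2[OF \<gamma>(1)]) (auto intro!: continuous_intros)
    show "?\<delta> ` {0..1} \<subseteq> M" using \<gamma>(2) by (auto simp: image_subset_iff)
  qed
  let ?S = "(\<lambda>t. 1 - t) ` S"
  have inS: "t \<in> ?S \<longleftrightarrow> 1 - t \<in> S" for t by (auto simp: image_iff intro!: bexI[of _ "1 - t"])
  have "C1_curve_on \<A> a b ?\<delta>" if ab: "a \<in> ?S" "b \<in> ?S" "a < b" "{a<..<b} \<inter> ?S = {}" for a b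
  proof (rule C1_curve_on_affine[of "1 - b" "1 - a" \<gamma> _ _ _ "-1" 1])
    have "{1 - b<..<1 - a} \<inter> S = {}"
    proof -
      have False if "1 - b < s" "s < 1 - a" "s \<in> S" for s
      proof -
        have "1 - s \<in> {a<..<b} \<inter> ?S" using inS[of "1 - s"] that by simp
        then show False using ab(4) by blast
      qed
      then show ?thesis by auto
    qed
    then show "C1_curve_on \<A> (1 - b) (1 - a) \<gamma>" using S(4)[of "1 - b" "1 - a"] ab inS by auto
  qed auto
  moreover have "finite ?S" "{0, 1} \<subseteq> ?S" "?S \<subseteq> {0..1}" using S inS by auto
  ultimately have "breakpoints ?\<delta> ?S" unfolding breakpoints_def by blast
  then have "piecewise_C1_curve M \<A> ?\<delta>" using \<delta> by (rule piecewise_C1I)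
  then show mem: "?\<delta> \<in> curves y x" using assms by simp
  obtain T where T: "finite T" "regular_off \<gamma> T"
    using regular_off_exists[OF p] by blast
  \<comment> \<open>The substitution t to 1 - t, carried out as a reflection followed by a
    shift.\<close>
  have "((\<lambda>t. speed \<A> g \<gamma> (- (t - 1))) has_integral len \<gamma>) {0..1}"
  proof -
    have "((\<lambda>t. speed \<A> g \<gamma> (- t)) has_integral len \<gamma>) (cbox (-1) 0)"
      using has_integral_reflect_real[of "speed \<A> g \<gamma>" "len \<gamma>" 1 0, THEN iffD2, OF speed_has_integral[OF p]]
      by (simp only: minus_zero box_real)
    from has_integral_affinity'[OF this, of 1 "-1"] show ?thesis by simp
  qed
  then have "(speed \<A> g ?\<delta> has_integral len \<gamma>) {0..1}"
  proof (rule has_integral_spike_finite[rotated 2])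
    show "finite ({0, 1} \<union> (\<lambda>t. 1 - t) ` T)" using T(1) by simp
    fix t assume t: "t \<in> {0..1} - ({0, 1} \<union> (\<lambda>t. 1 - t) ` T)"
    have "1 - t \<notin> T" using t by (auto simp: image_iff)
    then show "speed \<A> g ?\<delta> t = speed \<A> g \<gamma> (- (t - 1))"
      using speed_affine[OF T(2) \<gamma>(2) \<delta> open_UNIV, of t "-1" 1] t by auto
  qed
  then show "len ?\<delta> = len \<gamma>" by (rule integral_unique)
qed

text \<open>Each piece is run through at double speed in half the time, which leaves its length
  unchanged. The midpoint is a break point, so no interval between consecutive break points
  straddles it.\<close>

lemma join_curve:
  assumes "\<gamma>\<^sub>1 \<in> curves x y" "\<gamma>\<^sub>2 \<in> curves y z"
  shows "\<exists>\<delta>\<in>curves x z. len \<delta> = len \<gamma>\<^sub>1 + len \<gamma>\<^sub>2"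
proof -
  define \<delta> where "\<delta> t = (if t \<le> 1/2 then \<gamma>\<^sub>1 (2 * t) else \<gamma>\<^sub>2 (2 * t - 1))" for t :: real
  have p: "piecewise_C1_curve M \<A> \<gamma>\<^sub>1" "piecewise_C1_curve M \<A> \<gamma>\<^sub>2" and eq: "\<gamma>\<^sub>1 1 = \<gamma>\<^sub>2 0" using assms by auto
  obtain S1 where "breakpoints \<gamma>\<^sub>1 S1" using breakpoints_exist[OF p(1)] by blast
  note S1 = breakpointsD[OF this]
  note \<gamma>1 = piecewise_C1_continuous[OF p(1)]
  obtain S2 where "breakpoints \<gamma>\<^sub>2 S2" using breakpoints_exist[OF p(2)] by blast
  note S2 = breakpointsD[OF this]
  note \<gamma>2 = piecewise_C1_continuous[OF p(2)]
  have \<delta>1: "\<delta> t = \<gamma>\<^sub>1 (2 * t)" if "t \<le> 1/2" for t using that by (simp add: \<delta>_def)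
  have \<delta>2: "\<delta> t = \<gamma>\<^sub>2 (2 * t - 1)" if "t \<ge> 1/2" for t
  proof (cases "t = 1/2")
    case True
    show ?thesis unfolding True using eq by (simp add: \<delta>_def)
  qed (use that in \<open>simp add: \<delta>_def\<close>)
  have \<delta>: "continuous_on {0..1} \<delta>" "\<delta> ` {0..1} \<subseteq> M"
  proof -
    have "continuous_on {0..1/2} \<delta>"
      by (rule continuous_on_eq[of _ "\<lambda>t. \<gamma>\<^sub>1 (2 * t)"])
        (auto simp: \<delta>1 intro!: continuous_on_compose2[OF \<gamma>1(1)] continuous_intros)
    moreover have "continuous_on {1/2..1} \<delta>"
      by (rule continuous_on_eq[of _ "\<lambda>t. \<gamma>\<^sub>2 (2 * t - 1)"])
        (auto simp: \<delta>2 intro!: continuous_on_compose2[OF \<gamma>2(1)] continuous_intros)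
    moreover have "{0..1} = {0..1/2} \<union> {1/2..1::real}" by auto
    ultimately show "continuous_on {0..1} \<delta>" by (metis closed_real_atLeastAtMost continuous_on_closed_Un)
    show "\<delta> ` {0..1} \<subseteq> M" using \<gamma>1(2) \<gamma>2(2) by (auto simp: \<delta>_def image_subset_iff)
  qed
  let ?S = "(\<lambda>s. s / 2) ` S1 \<union> (\<lambda>s. (s + 1) / 2) ` S2"
  \<comment> \<open>A break point inherited from the other curve can lie in this half only if it is
    the midpoint, which corresponds to an end point of either curve.\<close>
  have i1: "2 * a \<in> S1" if "a \<in> ?S" "a \<le> 1/2" for a
  proof -
    from that(1) consider "2 * a \<in> S1" | s where "s \<in> S2" "a = (s + 1) / 2" by auto
    then show ?thesis
    proof cases
      case 2
      then have "s = 0" using that(2) S2(3) by fastforce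
      then have "2 * a = 1" using 2 by simp
      then show ?thesis using S1(2) by simp
    qed
  qed
  have i2: "2 * a - 1 \<in> S2" if "a \<in> ?S" "a \<ge> 1/2" for a
  proof -
    from that(1) consider s where "s \<in> S2" "a = (s + 1) / 2" | s where "s \<in> S1" "a = s / 2" by blast
    then show ?thesis
    proof cases
      case 2
      then have "s = 1" using that(2) S1(3) by fastforce
      then have "2 * a - 1 = 0" using 2 by simp
      then show ?thesis using S2(2) by simp
    next
      case 1
      then have eq: "2 * a - 1 = s" by simp
      show ?thesis unfolding eq by (rule 1(1))
    qed
  qed
  have half: "1/2 \<in> ?S" using S1(2) by force
  have "C1_curve_on \<A> a b \<delta>" if ab: "a \<in> ?S" "b \<in> ?S" "a < b" "{a<..<b} \<inter> ?S = {}" for a b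
  proof (cases "b \<le> 1/2")
    case True
    show ?thesis
    proof (rule C1_curve_on_affine[of "2 * a" "2 * b" \<gamma>\<^sub>1 _ _ _ 2 0])
      have False if "2 * a < s" "s < 2 * b" "s \<in> S1" for s
      proof -
        have "s / 2 \<in> {a<..<b} \<inter> ?S" using that by auto
        then show False using ab(4) by blast
      qed
      then have "{2 * a<..<2 * b} \<inter> S1 = {}" by auto
      then show "C1_curve_on \<A> (2 * a) (2 * b) \<gamma>\<^sub>1" using S1(4)[of "2 * a" "2 * b"] i1 ab True by auto
    qed (use True \<delta>1 in auto)
  next
    case False
    have a: "1/2 \<le> a"
    proof (rule ccontr)
      assume "\<not> 1/2 \<le> a"
      then have "1/2 \<in> {a<..<b} \<inter> ?S" using False half by simp
      then show False using ab(4) by blast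
    qed
    show ?thesis
    proof (rule C1_curve_on_affine[of "2 * a - 1" "2 * b - 1" \<gamma>\<^sub>2 _ _ _ 2 "-1"])
      have False if "2 * a - 1 < s" "s < 2 * b - 1" "s \<in> S2" for s
      proof -
        have "(s + 1) / 2 \<in> {a<..<b} \<inter> ?S" using that by auto
        then show False using ab(4) by blast
      qed
      then have "{2 * a - 1<..<2 * b - 1} \<inter> S2 = {}" by auto
      then show "C1_curve_on \<A> (2 * a - 1) (2 * b - 1) \<gamma>\<^sub>2" using S2(4)[of "2 * a - 1" "2 * b - 1"] i2 ab a by auto
    qed (use a \<delta>2 in auto)
  qed
  moreover have "finite ?S" using S1(1) S2(1) by simp
  moreover have "{0, 1} \<subseteq> ?S" using S1(2) S2(2) by force
  moreover have "?S \<subseteq> {0..1}" using S1(3) S2(3) by force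
  ultimately have "breakpoints \<delta> ?S" unfolding breakpoints_def by blast
  then have "piecewise_C1_curve M \<A> \<delta>" using \<delta> by (rule piecewise_C1I)
  moreover have "\<delta> 0 = x" "\<delta> 1 = z" using assms by (auto simp: \<delta>_def)
  ultimately have mem: "\<delta> \<in> curves x z" by simp
  obtain T1 where T1: "finite T1" "regular_off \<gamma>\<^sub>1 T1"
    using regular_off_exists[OF p(1)] by blast
  obtain T2 where T2: "finite T2" "regular_off \<gamma>\<^sub>2 T2"
    using regular_off_exists[OF p(2)] by blast
  have "((\<lambda>t. speed \<A> g \<gamma>\<^sub>1 (2 * t + 0)) has_integral len \<gamma>\<^sub>1 / 2) {0..1/2}"
    using has_integral_affinity'[of "speed \<A> g \<gamma>\<^sub>1" "len \<gamma>\<^sub>1" 0 1 2 0] speed_has_integral[OF p(1)] by simp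
  from has_integral_mult_right[OF this, of 2]
  have "((\<lambda>t. 2 * speed \<A> g \<gamma>\<^sub>1 (2 * t + 0)) has_integral len \<gamma>\<^sub>1) {0..1/2}" by simp
  then have h1: "(speed \<A> g \<delta> has_integral len \<gamma>\<^sub>1) {0..1/2}"
  proof (rule has_integral_spike_finite[rotated 2])
    show "finite ({0, 1/2} \<union> (\<lambda>t. t / 2) ` T1)" using T1(1) by simp
    fix t :: real assume t: "t \<in> {0..1/2} - ({0, 1/2} \<union> (\<lambda>t. t / 2) ` T1)"
    have "2 * t \<notin> T1"
    proof
      assume "2 * t \<in> T1"
      then have "(2 * t) / 2 \<in> (\<lambda>t. t / 2) ` T1" by blast
      then show False using t by simp
    qed
    then show "speed \<A> g \<delta> t = 2 * speed \<A> g \<gamma>\<^sub>1 (2 * t + 0)"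
      using speed_affine[OF T1(2) \<gamma>1(2) \<delta> open_lessThan, of t "1/2" 2 0] t \<delta>1 by auto
  qed
  have "((\<lambda>t. speed \<A> g \<gamma>\<^sub>2 (2 * t + -1)) has_integral len \<gamma>\<^sub>2 / 2) {1/2..1}"
    using has_integral_affinity'[of "speed \<A> g \<gamma>\<^sub>2" "len \<gamma>\<^sub>2" 0 1 2 "-1"] speed_has_integral[OF p(2)] by simp
  from has_integral_mult_right[OF this, of 2]
  have "((\<lambda>t. 2 * speed \<A> g \<gamma>\<^sub>2 (2 * t + -1)) has_integral len \<gamma>\<^sub>2) {1/2..1}" by simp
  then have h2: "(speed \<A> g \<delta> has_integral len \<gamma>\<^sub>2) {1/2..1}"
  proof (rule has_integral_spike_finite[rotated 2])
    show "finite ({1, 1/2} \<union> (\<lambda>t. (t + 1) / 2) ` T2)" using T2(1) by simp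
    fix t :: real assume t: "t \<in> {1/2..1} - ({1, 1/2} \<union> (\<lambda>t. (t + 1) / 2) ` T2)"
    have "2 * t - 1 \<notin> T2"
    proof
      assume "2 * t - 1 \<in> T2"
      then have "(2 * t - 1 + 1) / 2 \<in> (\<lambda>t. (t + 1) / 2) ` T2" by blast
      then show False using t by simp
    qed
    then show "speed \<A> g \<delta> t = 2 * speed \<A> g \<gamma>\<^sub>2 (2 * t + -1)"
      using speed_affine[OF T2(2) \<gamma>2(2) \<delta> open_greaterThan, of t "1/2" 2 "-1"] t \<delta>2 by auto
  qed
  have "(speed \<A> g \<delta> has_integral (len \<gamma>\<^sub>1 + len \<gamma>\<^sub>2)) {0..1}"
    using has_integral_combine[OF _ _ h1 h2] by simp
  then have "len \<delta> = len \<gamma>\<^sub>1 + len \<gamma>\<^sub>2" by (rule integral_unique)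
  then show ?thesis using mem by blast
qed

lemma chart_segment:
  assumes c: "c \<in> \<A>" and K: "convex K" "K \<subseteq> chart_img c" "z \<in> K" "y \<in> K"
  shows "curves (chart_inv c z) (chart_inv c y) \<noteq> {}"
proof -
  have "(\<lambda>t. z + t *\<^sub>R (y - z)) ` {0..1} \<subseteq> K"
  proof
    fix x assume "x \<in> (\<lambda>t. z + t *\<^sub>R (y - z)) ` {0..1}"
    then obtain t where "x = z + t *\<^sub>R (y - z)" "t \<in> {0..1}" by (rule imageE)
    then have t: "x = z + t *\<^sub>R (y - z)" "0 \<le> t" "t \<le> 1" by simp_all
    have "x = (1 - t) *\<^sub>R z + t *\<^sub>R y" using t by (simp add: algebra_simps)
    then show "x \<in> K" using convexD[OF K(1,3,4), of "1 - t" t] t by simp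
  qed
  then have "chart_inv c \<circ> (\<lambda>t. z + t *\<^sub>R (y - z)) \<in> curves (chart_inv c (z + 0 *\<^sub>R (y - z))) (chart_inv c (z + 1 *\<^sub>R (y - z)))"
    by (intro chart_curve(1)[OF c, of _ "\<lambda>t. y - z"]) (use K(2) in \<open>auto intro!: derivative_eq_intros\<close>)
  then have "chart_inv c \<circ> (\<lambda>t. z + t *\<^sub>R (y - z)) \<in> curves (chart_inv c z) (chart_inv c y)" by simp
  then show ?thesis by (metis empty_iff)
qed

end

section \<open>The distance on a compact connected manifold\<close>

locale closed_manifold = riemannian_manifold M \<A> g
  for M :: "'a::t2_space set" and \<A> :: "('a, 'n::finite) chart set"
    and g :: "('a, 'n) chart \<Rightarrow> real ^ 'n \<Rightarrow> real ^ 'n \<Rightarrow> real ^ 'n \<Rightarrow> real" +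
  assumes compact_M: "compact M" and connected_M: "connected M"
begin

text \<open>Being joined by an admissible curve is symmetric and transitive, and it holds locally
  along coordinate segments, so connectedness makes it global. Without it the infimum in
  \<open>riem_dist\<close> could be over an empty set and have an arbitrary value.\<close>

lemma curves_nonempty:
  assumes "x \<in> M" "y \<in> M"
  shows "curves x y \<noteq> {}"
proof (rule connected_equivalence_relation[OF connected_M assms, of "\<lambda>x y. curves x y \<noteq> {}"])
  show "curves x y \<noteq> {} \<Longrightarrow> curves y x \<noteq> {}" for x y using reverse_curve(1)[of _ x y] by blast
  show "curves x y \<noteq> {} \<Longrightarrow> curves y z \<noteq> {} \<Longrightarrow> curves x z \<noteq> {}" for x y z using join_curve[of _ x y _ z] by blast
  fix a assume "a \<in> M"
  then obtain c where c: "c \<in> \<A>" "a \<in> chart_dom c" using cover by blast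
  let ?z = "chart_map c a"
  obtain r where r: "r > 0" "ball ?z r \<subseteq> chart_img c"
    using chart_facts(2)[OF c(1)] chart_map_in[OF c(2)] by (meson open_contains_ball)
  have op: "openin (top_of_set M) (chart_inv c ` ball ?z r)"
    by (rule openin_chart_inv_image[OF c(1) open_ball r(2)])
  have "a \<in> chart_inv c ` ball ?z r" using c r by (intro image_eqI[of _ _ ?z]) auto
  moreover have "\<forall>x\<in>chart_inv c ` ball ?z r. curves a x \<noteq> {}"
    using chart_segment[OF c(1) convex_ball r(2), of ?z] r(1) c by auto
  ultimately show "\<exists>T. openin (top_of_set M) T \<and> a \<in> T \<and> (\<forall>x\<in>T. curves a x \<noteq> {})" using op by blast
qed

lemma rd_nonneg: "x \<in> M \<Longrightarrow> y \<in> M \<Longrightarrow> rd x y \<ge> 0"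
  by (rule rd_greatest[OF curves_nonempty]) (auto intro: len_nonneg)

lemma rd_sym_le: "x \<in> M \<Longrightarrow> y \<in> M \<Longrightarrow> rd x y \<le> rd y x"
proof (rule rd_greatest[OF curves_nonempty])
  fix \<gamma> assume "\<gamma> \<in> curves y x"
  from rd_le_len[OF reverse_curve(1)[OF this]] reverse_curve(2)[OF this] show "rd x y \<le> len \<gamma>" by simp
qed auto

lemma rd_commute: "x \<in> M \<Longrightarrow> y \<in> M \<Longrightarrow> rd x y = rd y x"
  by (intro antisym rd_sym_le)

lemma rd_triangle:
  assumes "x \<in> M" "y \<in> M" "z \<in> M"
  shows "rd x z \<le> rd x y + rd y z"
proof (rule field_le_epsilon)
  fix e :: real assume e: "e > 0"
  obtain \<gamma>\<^sub>1 where 1: "\<gamma>\<^sub>1 \<in> curves x y" "len \<gamma>\<^sub>1 < rd x y + e / 2"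
    using rd_less_curve[OF curves_nonempty[OF assms(1,2)], of "rd x y + e / 2"] e by auto
  obtain \<gamma>\<^sub>2 where 2: "\<gamma>\<^sub>2 \<in> curves y z" "len \<gamma>\<^sub>2 < rd y z + e / 2"
    using rd_less_curve[OF curves_nonempty[OF assms(2,3)], of "rd y z + e / 2"] e by auto
  obtain \<delta> where "\<delta> \<in> curves x z" "len \<delta> = len \<gamma>\<^sub>1 + len \<gamma>\<^sub>2" using join_curve[OF 1(1) 2(1)] by blast
  then show "rd x z \<le> rd x y + rd y z + e" using rd_le_len[of \<delta> x z] 1(2) 2(2) by linarith
qed

lemma rd_triangle_diff: "x \<in> M \<Longrightarrow> y \<in> M \<Longrightarrow> z \<in> M \<Longrightarrow> \<bar>rd x y - rd x z\<bar> \<le> rd y z"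
  using rd_triangle[of x y z] rd_triangle[of x z y] rd_commute[of y z] by linarith

end

section \<open>Distance estimates in a chart\<close>

text \<open>One constant \<open>C\<close> serves for all upper bounds on \<open>K\<close>, and
  \<open>C >= 1\<close> allows powers of it to be absorbed. Everything derived from \<open>a\<close>
  and \<open>C\<close> alone is automatically uniform in the base point \<open>z\<close>.\<close>

locale local_estimates = local_metric S g for S :: "(real ^ 'n::finite) set" and g +
  fixes K :: "(real ^ 'n) set" and a C :: real
  assumes K_sub: "K \<subseteq> S" and a_pos: "a > 0" and C_ge: "C \<ge> 1"
    and low: "z \<in> K \<Longrightarrow> a * norm w \<le> sqrt (g z w w)"
    and upp: "z \<in> K \<Longrightarrow> \<bar>g z v w\<bar> \<le> C * norm v * norm w"
    and chrb: "z \<in> K \<Longrightarrow> norm (chr z u v) \<le> C * norm u * norm v"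
    and pullb: "z \<in> K \<Longrightarrow> y \<in> K \<Longrightarrow>
      \<bar>g y w w' - g z (dPhi z (y - z) w) (dPhi z (y - z) w')\<bar> \<le> C * (norm (y - z))\<^sup>2 * norm w * norm w'"
    and densb: "z \<in> K \<Longrightarrow> y \<in> K \<Longrightarrow>
      \<bar>vol_dens y - vol_dens z * \<bar>det (matrix (dPhi z (y - z)))\<bar>\<bar> \<le> C * (norm (y - z))\<^sup>2"
    and densC: "z \<in> K \<Longrightarrow> vol_dens z \<le> C"

lemma (in local_metric) local_estimates_exist:
  assumes K: "compact K" "convex K" "K \<subseteq> S"
  shows "\<exists>a C. local_estimates S g K a C"
proof -
  obtain a where a: "a > 0" "\<And>z w. z \<in> K \<Longrightarrow> a * norm w \<le> sqrt (g z w w)" using g_lower_bound[OF K(1,3)] by blast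
  obtain C1 where C1: "C1 \<ge> 0" "\<And>z v w. z \<in> K \<Longrightarrow> \<bar>g z v w\<bar> \<le> C1 * norm v * norm w" using g_upper_bound[OF K(1,3)] by blast
  obtain C2 where C2: "C2 \<ge> 0" "\<And>z u v. z \<in> K \<Longrightarrow> norm (chr z u v) \<le> C2 * norm u * norm v" using chr_bound[OF K(1,3)] by blast
  obtain C3 where C3: "C3 \<ge> 0" "\<And>z y w w'. z \<in> K \<Longrightarrow> y \<in> K \<Longrightarrow>
      \<bar>g y w w' - g z (dPhi z (y - z) w) (dPhi z (y - z) w')\<bar> \<le> C3 * (norm (y - z))\<^sup>2 * norm w * norm w'"
    using pullback_bound[OF K] by blast
  obtain C4 where C4: "C4 \<ge> 0" "\<And>z y. z \<in> K \<Longrightarrow> y \<in> K \<Longrightarrow>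
      \<bar>vol_dens y - vol_dens z * \<bar>det (matrix (dPhi z (y - z)))\<bar>\<bar> \<le> C4 * (norm (y - z))\<^sup>2"
    using vol_dens_bound[OF K] by blast
  obtain C5 where C5: "C5 \<ge> 0" "\<And>z. z \<in> K \<Longrightarrow> vol_dens z \<le> C5" using vol_dens_bounds[OF K(1,3)] by blast
  define C where "C = 1 + C1 + C2 + C3 + C4 + C5"
  have le: "C1 \<le> C" "C2 \<le> C" "C3 \<le> C" "C4 \<le> C" "C5 \<le> C" "1 \<le> C"
    using C1(1) C2(1) C3(1) C4(1) C5(1) by (simp_all add: C_def)
  have "local_estimates S g K a C"
  proof
    fix z y w w' u v
    show "z \<in> K \<Longrightarrow> \<bar>g z v w\<bar> \<le> C * norm v * norm w"
      by (rule order_trans[OF C1(2)]) (auto intro!: mult_right_mono le)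
    show "z \<in> K \<Longrightarrow> norm (chr z u v) \<le> C * norm u * norm v"
      by (rule order_trans[OF C2(2)]) (auto intro!: mult_right_mono le)
    show "z \<in> K \<Longrightarrow> y \<in> K \<Longrightarrow>
      \<bar>g y w w' - g z (dPhi z (y - z) w) (dPhi z (y - z) w')\<bar> \<le> C * (norm (y - z))\<^sup>2 * norm w * norm w'"
      by (rule order_trans[OF C3(2)]) (auto intro!: mult_right_mono le)
    show "z \<in> K \<Longrightarrow> y \<in> K \<Longrightarrow>
      \<bar>vol_dens y - vol_dens z * \<bar>det (matrix (dPhi z (y - z)))\<bar>\<bar> \<le> C * (norm (y - z))\<^sup>2"
      by (rule order_trans[OF C4(2)]) (auto intro!: mult_right_mono le)
    show "z \<in> K \<Longrightarrow> vol_dens z \<le> C" using C5(2)[of z] le(5) by linarith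
  qed (use K a le in auto)
  then show ?thesis by blast
qed

context local_metric begin

definition gnorm :: "real ^ 'n \<Rightarrow> real ^ 'n \<Rightarrow> real" where
  "gnorm z w = sqrt (g z w w)"

lemma gnorm_nonneg: "z \<in> S \<Longrightarrow> gnorm z w \<ge> 0"
  by (simp add: gnorm_def g_nonneg)

lemma gnorm_power2: "z \<in> S \<Longrightarrow> (gnorm z w)\<^sup>2 = g z w w"
  by (simp add: gnorm_def)

lemma gnorm_triangle:
  assumes z: "z \<in> S" shows "gnorm z (u + v) \<le> gnorm z u + gnorm z v"
proof (rule power2_le_imp_le)
  have "(gnorm z (u + v))\<^sup>2 = g z u u + 2 * g z u v + g z v v"
    using sym[OF z, of v u] by (simp add: gnorm_power2[OF z] g_arith[OF z])
  also have "\<dots> \<le> g z u u + 2 * (gnorm z u * gnorm z v) + g z v v"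
    using g_cauchy_schwarz[OF z, of u v] by (simp add: gnorm_def)
  also have "\<dots> = (gnorm z u + gnorm z v)\<^sup>2" by (simp add: power2_sum gnorm_power2[OF z])
  finally show "(gnorm z (u + v))\<^sup>2 \<le> (gnorm z u + gnorm z v)\<^sup>2" .
qed (use gnorm_nonneg z in auto)

end

context local_estimates begin

lemma in_S: "z \<in> K \<Longrightarrow> z \<in> S" using K_sub by blast

lemma gnorm_ge: "z \<in> K \<Longrightarrow> a * norm w \<le> gnorm z w"
  unfolding gnorm_def by (rule low)

lemma gnorm_le: "z \<in> K \<Longrightarrow> gnorm z w \<le> C * norm w"
proof -
  assume z: "z \<in> K"
  have "(gnorm z w)\<^sup>2 \<le> C * norm w * norm w"
    unfolding gnorm_power2[OF in_S[OF z]] using upp[OF z, of w w] by linarith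
  \<comment> \<open>\<open>C >= 1\<close> makes it possible to bound the square root of
    \<open>C\<close> by \<open>C\<close>.\<close>
  also have "\<dots> \<le> (C * C) * norm w * norm w" using C_ge by (intro mult_right_mono) auto
  also have "\<dots> = (C * norm w)\<^sup>2" by (simp add: power2_eq_square)
  finally show ?thesis by (rule power2_le_imp_le) (use C_ge in simp)
qed

lemma Phi_close: "z \<in> K \<Longrightarrow> norm (Phi z y - (y - z)) \<le> C / 2 * (norm (y - z))\<^sup>2"
  using chrb[of z "y - z" "y - z"] by (simp add: Phi_def power2_eq_square mult_ac)

text \<open>As long as \<open>norm (y - z)\<close> is at most \<open>1 / C\<close>, the quadratic
  term of \<open>Phi z\<close> is at most half the linear one.\<close>

lemma Phi_lower:
  assumes "z \<in> K" "C * norm (y - z) \<le> 1"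
  shows "norm (y - z) / 2 \<le> norm (Phi z y)" "norm (Phi z y) \<le> 2 * norm (y - z)"
proof -
  have "C / 2 * (norm (y - z))\<^sup>2 \<le> norm (y - z) / 2"
    using mult_right_mono[OF assms(2), of "norm (y - z)"] by (simp add: power2_eq_square mult.assoc)
  then have 1: "norm (Phi z y - (y - z)) \<le> norm (y - z) / 2" using Phi_close[OF assms(1), of y] by linarith
  show "norm (y - z) / 2 \<le> norm (Phi z y)"
    using 1 norm_triangle_ineq2[of "y - z" "Phi z y"] by (simp add: norm_minus_commute)
  have "norm (Phi z y) \<le> 3 / 2 * norm (y - z)"
    using 1 norm_triangle_ineq2[of "Phi z y" "y - z"] by simp
  then show "norm (Phi z y) \<le> 2 * norm (y - z)" by (rule order_trans) simp
qed

text \<open>The additive error in \<open>pullb\<close> becomes a relative one, since the lower bound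
  \<open>a\<close> controls the norm of \<open>w\<close> by its length at \<open>y\<close>.\<close>

lemma dPhi_le:
  assumes z: "z \<in> K" and y: "y \<in> K"
  shows "gnorm z (dPhi z (y - z) w) \<le> (1 + C / a\<^sup>2 * (norm (y - z))\<^sup>2) * gnorm y w"
proof (rule power2_le_imp_le)
  let ?v = "y - z" and ?k = "C / a\<^sup>2 * (norm (y - z))\<^sup>2"
  have k: "?k \<ge> 0" using C_ge by simp
  have "(a * norm w)\<^sup>2 \<le> (gnorm y w)\<^sup>2" using gnorm_ge[OF y] a_pos by (intro power_mono) auto
  then have w: "(norm w)\<^sup>2 \<le> (gnorm y w)\<^sup>2 / a\<^sup>2" using a_pos by (simp add: field_simps power_mult_distrib)
  have "(gnorm z (dPhi z ?v w))\<^sup>2 \<le> g y w w + C * (norm ?v)\<^sup>2 * norm w * norm w"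
    using pullb[OF z y, of w w] by (simp add: gnorm_power2[OF in_S[OF z]])
  also have "\<dots> = (gnorm y w)\<^sup>2 + C * (norm ?v)\<^sup>2 * (norm w)\<^sup>2"
    unfolding gnorm_power2[OF in_S[OF y]] by (simp add: power2_eq_square)
  also have "\<dots> \<le> (gnorm y w)\<^sup>2 + C * (norm ?v)\<^sup>2 * ((gnorm y w)\<^sup>2 / a\<^sup>2)"
    using w C_ge by (intro add_left_mono mult_left_mono) auto
  also have "\<dots> = (1 + ?k) * (gnorm y w)\<^sup>2" by (simp add: algebra_simps)
  \<comment> \<open>Passing to the larger square keeps a square root out of the factor.\<close>
  also have "\<dots> \<le> (1 + ?k)\<^sup>2 * (gnorm y w)\<^sup>2"
  proof (rule mult_right_mono)
    have "1 + k \<le> (1 + k)\<^sup>2" if "k \<ge> 0" for k :: real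
      using that by (simp add: power2_eq_square algebra_simps)
    then show "1 + ?k \<le> (1 + ?k)\<^sup>2" using k .
  qed simp
  finally show "(gnorm z (dPhi z ?v w))\<^sup>2 \<le> ((1 + ?k) * gnorm y w)\<^sup>2" by (simp add: power_mult_distrib)
  show "0 \<le> (1 + ?k) * gnorm y w" using k gnorm_nonneg[OF in_S[OF y]] by simp
qed

text \<open>The coefficient of the cubic error in \<open>short_curve\<close>. The first summand
  comes from the deviation of the velocity from \<open>W\<close>. In the second, 1225 is 25 * 49,
  from the bounds 5 n for the displacement and 7 n for the velocity; the division by
  \<open>a\<close> comes from the lower bound a n / 2 for the length of \<open>W\<close>.\<close>

definition cdist :: real where "cdist = 32 * C ^ 3 + 1225 * C / a"

lemma cdist_pos: "cdist \<ge> 0" using C_ge a_pos by (simp add: cdist_def)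

text \<open>An explicit approximate geodesic: in the coordinates \<open>Phi z\<close> it is a straight segment
  up to third order.\<close>

lemma short_curve:
  assumes z: "z \<in> K" and K: "cball z (5 * norm (y - z)) \<subseteq> K" and small: "C * norm (y - z) \<le> 1"
  shows "\<exists>w w'. (\<forall>t. (w has_vector_derivative w' t) (at t)) \<and> continuous_on UNIV w' \<and> w 0 = z \<and> w 1 = y \<and>
    (\<forall>t\<in>{0..1}. w t \<in> cball z (5 * norm (y - z)) \<and> gnorm (w t) (w' t) \<le> gnorm z (Phi z y) + cdist * norm (y - z) ^ 3)"
proof -
  define n where "n = norm (y - z)"
  define W where "W = Phi z y"
  \<comment> \<open>The correction that makes the curve end exactly at \<open>y\<close>. By
    \<open>eq\<close> it is half the difference of the Christoffel terms of \<open>W\<close> and of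
    \<open>y - z\<close>; it is of third order because \<open>W\<close> and \<open>y - z\<close>
    differ by second order.\<close>
  define e where "e = (1/2) *\<^sub>R (chr z (W - (y - z)) W + chr z (y - z) (W - (y - z)))"
  have zS: "z \<in> S" using in_S z .
  note l1 = chr_linear(1)[OF zS] and l2 = chr_linear(2)[OF zS]
  have n0: "n \<ge> 0" by (simp add: n_def)
  have Cn: "C * n \<le> 1" using small by (simp add: n_def)
  have C0: "C \<ge> 0" using C_ge by simp
  have Wn: "n / 2 \<le> norm W" "norm W \<le> 2 * n" using Phi_lower[OF z small] by (simp_all add: W_def n_def)
  have We: "norm (W - (y - z)) \<le> C / 2 * n\<^sup>2" using Phi_close[OF z] by (simp add: W_def n_def)
  have C2n3: "C\<^sup>2 * n ^ 3 \<le> C * n\<^sup>2" "C * n\<^sup>2 \<le> n"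
  proof -
    have "C * n * (C * n\<^sup>2) \<le> 1 * (C * n\<^sup>2)" using Cn C0 by (intro mult_right_mono) auto
    then show "C\<^sup>2 * n ^ 3 \<le> C * n\<^sup>2" by (simp add: power2_eq_square power3_eq_cube mult_ac)
    have "C * n * n \<le> 1 * n" using Cn n0 by (intro mult_right_mono) auto
    then show "C * n\<^sup>2 \<le> n" by (simp add: power2_eq_square mult_ac)
  qed
  have chrb': "norm (chr z u v) \<le> C * (p * q)" if "norm u \<le> p" "norm v \<le> q" for u v p q
  proof -
    have "norm (chr z u v) \<le> C * (norm u * norm v)" using chrb[OF z, of u v] by (simp add: mult.assoc)
    also have "\<dots> \<le> C * (p * q)" using that C0 by (intro mult_left_mono mult_mono) (auto intro: order_trans[OF norm_ge_zero])
    finally show ?thesis .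
  qed
  have e_b: "norm e \<le> C\<^sup>2 * n ^ 3"
  proof -
    have "norm (chr z (W - (y - z)) W) \<le> C * (C / 2 * n\<^sup>2 * (2 * n))" by (rule chrb'[OF We Wn(2)])
    moreover have "norm (chr z (y - z) (W - (y - z))) \<le> C * (n * (C / 2 * n\<^sup>2))" by (rule chrb'[OF _ We]) (simp add: n_def)
    ultimately have "norm (chr z (W - (y - z)) W + chr z (y - z) (W - (y - z))) \<le> 3 / 2 * (C\<^sup>2 * n ^ 3)"
      using norm_triangle_ineq[of "chr z (W - (y - z)) W" "chr z (y - z) (W - (y - z))"]
      by (simp add: power2_eq_square power3_eq_cube algebra_simps)
    then have "norm e \<le> 3 / 4 * (C\<^sup>2 * n ^ 3)" by (simp add: e_def)
    moreover have "0 \<le> C\<^sup>2 * n ^ 3" using n0 by simp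
    ultimately show ?thesis by linarith
  qed
  \<comment> \<open>The second-order Taylor polynomial of the geodesic with initial velocity
    \<open>W\<close>, up to the linear correction by \<open>e\<close>.\<close>
  define w where "w t = z + t *\<^sub>R W - (t\<^sup>2 / 2) *\<^sub>R chr z W W + t *\<^sub>R e" for t
  define w' where "w' t = W - t *\<^sub>R chr z W W + e" for t
  have cWW: "norm (chr z W W) \<le> 4 * (C * n\<^sup>2)"
    using chrb'[OF Wn(2) Wn(2)] by (simp add: power2_eq_square mult_ac)
  have e_b2: "norm e \<le> C * n\<^sup>2" using e_b C2n3 by linarith
  have deriv: "(w has_vector_derivative w' t) (at t)" for t
    unfolding w_def w'_def by (auto intro!: derivative_eq_intros simp: algebra_simps)
  have cont: "continuous_on UNIV w'" unfolding w'_def by (intro continuous_intros)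
  have w0: "w 0 = z" by (simp add: w_def)
  have eq: "e = (1/2) *\<^sub>R (chr z W W - chr z (y - z) (y - z))"
    by (simp add: e_def linear_diff[OF l1] linear_diff[OF l2])
  have w1: "w 1 = y"
  proof -
    have "w 1 = z + (W - (1/2) *\<^sub>R chr z (y - z) (y - z))"
      by (simp add: w_def eq scaleR_diff_right)
    then show ?thesis by (simp add: W_def Phi_def)
  qed
  have main: "w t \<in> cball z (5 * n) \<and> gnorm (w t) (w' t) \<le> gnorm z W + cdist * n ^ 3" if t: "t \<in> {0..1}" for t
  proof -
    define q where "q = - (t\<^sup>2 / 2) *\<^sub>R chr z W W + t *\<^sub>R e"
    define q' where "q' = - t *\<^sub>R chr z W W + e"
    have p: "w t - z = t *\<^sub>R W + q" by (simp add: w_def q_def)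
    have p': "w' t = W + q'" by (simp add: w'_def q'_def)
    have t2: "t\<^sup>2 \<le> 1" using t by (simp add: power_le_one)
    have tb: "\<bar>t\<bar> * x \<le> x" "t\<^sup>2 / 2 * x \<le> x / 2" if "x \<ge> 0" for x
      using mult_right_mono[of "\<bar>t\<bar>" 1 x] mult_right_mono[of "t\<^sup>2" 1 x] t t2 that by auto
    have q: "norm q \<le> 3 * (C * n\<^sup>2)"
    proof -
      have "norm q \<le> t\<^sup>2 / 2 * norm (chr z W W) + \<bar>t\<bar> * norm e"
        unfolding q_def by (rule order_trans[OF norm_triangle_ineq]) simp
      also have "\<dots> \<le> norm (chr z W W) / 2 + norm e" using tb by (intro add_mono) auto
      finally show ?thesis using cWW e_b2 by linarith
    qed
    have q': "norm q' \<le> 5 * (C * n\<^sup>2)"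
    proof -
      have "norm q' \<le> \<bar>t\<bar> * norm (chr z W W) + norm e"
        unfolding q'_def by (rule order_trans[OF norm_triangle_ineq]) simp
      also have "\<dots> \<le> norm (chr z W W) + norm e" using tb by (intro add_mono) auto
      finally show ?thesis using cWW e_b2 by linarith
    qed
    have tW: "norm (t *\<^sub>R W) \<le> 2 * n" using tb(1)[of "norm W"] Wn(2) by simp
    \<comment> \<open>2 n comes from \<open>W\<close> and 3 n from \<open>q\<close>; in the velocity
      bound that follows, 7 n is 2 n from \<open>W\<close> plus 5 n from \<open>q'\<close>.\<close>
    have pb: "norm (w t - z) \<le> 5 * n" unfolding p using norm_triangle_ineq[of "t *\<^sub>R W" q] tW q C2n3(2) by linarith
    have p'b: "norm (w' t) \<le> 7 * n" unfolding p' using norm_triangle_ineq[of W q'] Wn(2) q' C2n3(2) by linarith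
    have wK: "w t \<in> cball z (5 * n)" using pb by (simp add: dist_norm norm_minus_commute)
    then have wtK: "w t \<in> K" using K by (auto simp: n_def)
    have wS: "w t \<in> S" using in_S wtK .
    \<comment> \<open>In the coordinates \<open>Phi z\<close> the velocity is \<open>W\<close> up to
      \<open>R\<close>, because the second-order term of \<open>w'\<close> cancels against the
      leading Christoffel correction. The factor 32 is 1 + 6 + 25, from the three summands.\<close>
    define R where "R = e + chr z q W + chr z (t *\<^sub>R W + q) q'"
    have dP: "dPhi z (w t - z) (w' t) = W + R"
      unfolding dPhi_def p p' R_def
      by (simp add: linear_add[OF l1] linear_add[OF l2] linear_cmul[OF l2] q'_def)
    have R: "norm R \<le> 32 * (C\<^sup>2 * n ^ 3)"
    proof -
      have 1: "norm (chr z q W) \<le> C * (3 * (C * n\<^sup>2) * (2 * n))" by (rule chrb'[OF q Wn(2)])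
      have 2: "norm (chr z (t *\<^sub>R W + q) q') \<le> C * (5 * n * (5 * (C * n\<^sup>2)))"
        by (rule chrb'[OF _ q']) (use pb p in simp)
      have "norm R \<le> norm e + norm (chr z q W) + norm (chr z (t *\<^sub>R W + q) q')"
        unfolding R_def by (meson norm_triangle_ineq add_mono order_refl order_trans)
      also have "\<dots> \<le> C\<^sup>2 * n ^ 3 + C * (3 * (C * n\<^sup>2) * (2 * n)) + C * (5 * n * (5 * (C * n\<^sup>2)))"
        using 1 2 e_b by linarith
      also have "\<dots> = 32 * (C\<^sup>2 * n ^ 3)" by (simp add: power2_eq_square power3_eq_cube algebra_simps)
      finally show ?thesis .
    qed
    have gR: "gnorm z (W + R) \<le> gnorm z W + 32 * C ^ 3 * n ^ 3"
    proof -
      have "gnorm z R \<le> C * (32 * (C\<^sup>2 * n ^ 3))" using gnorm_le[OF z, of R] R C0 by (meson mult_left_mono order_trans)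
      then show ?thesis using gnorm_triangle[OF zS, of W R] by (simp add: power2_eq_square power3_eq_cube mult_ac)
    qed
    have "gnorm (w t) (w' t) \<le> gnorm z W + cdist * n ^ 3"
    proof (rule power2_le_imp_le)
      let ?A = "gnorm z W + 32 * C ^ 3 * n ^ 3"
      have A0: "?A \<ge> 0" using gnorm_nonneg[OF zS] C0 n0 by simp
      have An: "a * (n / 2) \<le> ?A"
      proof -
        have "a * (n / 2) \<le> a * norm W" using Wn(1) a_pos by (intro mult_left_mono) auto
        also have "\<dots> \<le> gnorm z W" by (rule gnorm_ge[OF z])
        finally show ?thesis using C0 n0 by (smt (verit) mult_nonneg_nonneg zero_le_power)
      qed
      have "(gnorm (w t) (w' t))\<^sup>2 \<le> (gnorm z (W + R))\<^sup>2 + C * (norm (w t - z))\<^sup>2 * norm (w' t) * norm (w' t)"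
        using pullb[OF z wtK, of "w' t" "w' t"] unfolding dP gnorm_power2[OF zS] gnorm_power2[OF wS] by linarith
      also have "\<dots> \<le> ?A\<^sup>2 + C * (5 * n)\<^sup>2 * (7 * n) * (7 * n)"
        using gR pb p'b C0 n0 gnorm_nonneg[OF zS] by (intro add_mono mult_mono power_mono) auto
      \<comment> \<open>The fourth-order error of the squared length is written as twice a lower
        bound for \<open>?A\<close> times a cubic term; completing the square then gives a cubic
        error of the length itself.\<close>
      also have "C * (5 * n)\<^sup>2 * (7 * n) * (7 * n) = 2 * (a * (n / 2)) * (1225 * C / a * n ^ 3)"
        using a_pos by (simp add: power2_eq_square power3_eq_cube field_simps)
      also have "\<dots> \<le> 2 * ?A * (1225 * C / a * n ^ 3)"
        using An C0 a_pos n0 by (intro mult_right_mono mult_left_mono) auto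
      also have "?A\<^sup>2 + 2 * ?A * (1225 * C / a * n ^ 3) \<le> (?A + 1225 * C / a * n ^ 3)\<^sup>2"
        by (simp add: power2_sum)
      also have "?A + 1225 * C / a * n ^ 3 = gnorm z W + cdist * n ^ 3" by (simp add: cdist_def algebra_simps)
      finally show "(gnorm (w t) (w' t))\<^sup>2 \<le> (gnorm z W + cdist * n ^ 3)\<^sup>2" by simp
      show "0 \<le> gnorm z W + cdist * n ^ 3" using gnorm_nonneg[OF zS] cdist_pos n0 by simp
    qed
    then show ?thesis using wK by blast
  qed
  show ?thesis using deriv cont w0 w1 main unfolding n_def W_def by blast
qed

end

section \<open>Lengths of curves that start in a coordinate ball\<close>

context riemannian_manifold begin

abbreviation gn :: "('a, 'n) chart \<Rightarrow> real ^ 'n \<Rightarrow> real ^ 'n \<Rightarrow> real" where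
  "gn c \<equiv> local_metric.gnorm (g c)"

abbreviation Ph :: "('a, 'n) chart \<Rightarrow> real ^ 'n \<Rightarrow> real ^ 'n \<Rightarrow> real ^ 'n" where
  "Ph c \<equiv> local_metric.Phi (g c)"

abbreviation estimates :: "('a, 'n) chart \<Rightarrow> (real ^ 'n) set \<Rightarrow> real \<Rightarrow> real \<Rightarrow> bool" where
  "estimates c \<equiv> local_estimates (chart_img c) (g c)"

text \<open>The curve is followed until it first leaves the open coordinate ball. Up to that time it
  stays in the chart, where it can be calibrated.\<close>

lemma exit_time:
  assumes c: "c \<in> \<A>" and z: "cball z r \<subseteq> chart_img c" and r: "r > 0"
    and \<gamma>: "continuous_on {0..1} \<gamma>" "\<gamma> ` {0..1} \<subseteq> M" "\<gamma> 0 = chart_inv c z"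
  shows "\<exists>\<tau>\<in>{0..1::real}. \<gamma> ` {0..\<tau>} \<subseteq> chart_inv c ` cball z r \<and>
     (norm (chart_map c (\<gamma> \<tau>) - z) = r \<or> \<tau> = 1 \<and> norm (chart_map c (\<gamma> 1) - z) < r)"
proof -
  let ?B = "chart_inv c ` ball z r" and ?CB = "chart_inv c ` cball z r"
  have bimg: "ball z r \<subseteq> chart_img c" using z ball_subset_cball by blast
  have opB: "openin (top_of_set {0..1}) {t\<in>{0..1}. \<gamma> t \<in> ?B}"
    by (rule open_curve_preimage(1)[OF \<gamma>(1,2) openin_chart_inv_image[OF c open_ball bimg]])
  define Y where "Y = {0..1} - {t\<in>{0..1}. \<gamma> t \<in> ?B}"
  have "closedin (top_of_set {0..1}) Y"
    unfolding Y_def by (rule closedin_diff[OF _ opB]) simp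
  then have clY: "closed Y" using closedin_closed_trans closed_atLeastAtMost by blast
  show ?thesis
  proof (cases "Y = {}")
    case True
    then have all: "\<gamma> t \<in> ?B" if "t \<in> {0..1}" for t using that by (auto simp: Y_def)
    then have "\<gamma> 1 \<in> ?B" by simp
    then obtain y where "\<gamma> 1 = chart_inv c y" "y \<in> ball z r" by blast
    then have "norm (chart_map c (\<gamma> 1) - z) < r" using bimg c by (auto simp: dist_norm norm_minus_commute subset_iff)
    moreover have "\<gamma> ` {0..1} \<subseteq> ?CB" using all ball_subset_cball by blast
    ultimately show ?thesis by (intro bexI[of _ 1]) auto
  next
    case False
    define \<tau> where "\<tau> = Inf Y"
    have bdd: "bdd_below Y" by (auto simp: Y_def intro!: bdd_belowI[of _ 0])
    have \<tau>Y: "\<tau> \<in> Y" unfolding \<tau>_def by (rule closed_contains_Inf[OF False bdd clY])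
    then have \<tau>: "0 \<le> \<tau>" "\<tau> \<le> 1" "\<gamma> \<tau> \<notin> ?B" by (auto simp: Y_def)
    have "\<gamma> 0 \<in> ?B" using \<gamma>(3) r by auto
    then have \<tau>0: "\<tau> > 0" using \<tau> by (cases "\<tau> = 0") auto
    have before: "\<gamma> t \<in> ?B" if "0 \<le> t" "t < \<tau>" for t
    proof (rule ccontr)
      assume "\<gamma> t \<notin> ?B"
      then have "t \<in> Y" using that \<tau> by (auto simp: Y_def)
      then have "\<tau> \<le> t" unfolding \<tau>_def using bdd by (rule cInf_lower)
      then show False using that by simp
    qed
    have "compact ?CB"
      by (rule compact_continuous_image[OF continuous_on_subset[OF chart_inv_continuous[OF c] z] compact_cball])
    \<comment> \<open>A compact set in a Hausdorff space is closed, so the point reached at time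
      \<tau> still belongs to the closed coordinate ball.\<close>
    then have "closed ?CB" by (rule compact_imp_closed)
    then have clZ: "closed ({0..1} \<inter> \<gamma> -` ?CB)"
      using continuous_closed_preimage[OF \<gamma>(1)] by blast
    have "{0..<\<tau>} \<subseteq> {0..1} \<inter> \<gamma> -` ?CB" using before \<tau> ball_subset_cball by fastforce
    then have "closure {0..<\<tau>} \<subseteq> {0..1} \<inter> \<gamma> -` ?CB" using clZ closure_minimal by blast
    then have sub: "{0..\<tau>} \<subseteq> {0..1} \<inter> \<gamma> -` ?CB" using \<tau>0 by simp
    then have "\<gamma> ` {0..\<tau>} \<subseteq> ?CB" by blast
    moreover have "norm (chart_map c (\<gamma> \<tau>) - z) = r"
    proof -
      have "\<gamma> \<tau> \<in> ?CB" using sub \<tau> by auto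
      then obtain y where y: "\<gamma> \<tau> = chart_inv c y" "y \<in> cball z r" by blast
      then have "y \<notin> ball z r" using \<tau>(3) by blast
      then have "norm (y - z) = r" using y(2) by (simp add: dist_norm norm_minus_commute)
      moreover have "chart_map c (\<gamma> \<tau>) = y" using y z c by auto
      ultimately show ?thesis by simp
    qed
    ultimately show ?thesis using \<tau> by (intro bexI[of _ \<tau>]) auto
  qed
qed

text \<open>The linear functions of \<open>Phi z\<close> of unit length are almost 1-Lipschitz, so they calibrate
  the length of curves.\<close>

lemma calibration:
  assumes c: "c \<in> \<A>" and est: "estimates c K a C" and z: "z \<in> K" "cball z r \<subseteq> K" and r: "r > 0"
    and \<gamma>: "piecewise_C1_curve M \<A> \<gamma>" "\<gamma> 0 = chart_inv c z"
    and \<tau>: "\<tau> \<in> {0..1}" "\<gamma> ` {0..\<tau>} \<subseteq> chart_inv c ` cball z r"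
  shows "gn c z (Ph c z (chart_map c (\<gamma> \<tau>))) \<le> (1 + C / a\<^sup>2 * r\<^sup>2) * len \<gamma>"
proof -
  interpret local_estimates "chart_img c" "g c" K a C by (rule est)
  note \<gamma>c = piecewise_C1_continuous[OF \<gamma>(1)]
  have zS: "z \<in> chart_img c" using in_S z by blast
  define u where "u = chart_map c \<circ> \<gamma>"
  define \<kappa> where "\<kappa> = 1 + C / a\<^sup>2 * r\<^sup>2"
  have \<kappa>: "\<kappa> \<ge> 1" using C_ge by (simp add: \<kappa>_def)
  have ub: "\<gamma> t \<in> chart_dom c \<and> u t \<in> cball z r" if "t \<in> {0..\<tau>}" for t
  proof -
    obtain y where "\<gamma> t = chart_inv c y" "y \<in> cball z r" using \<tau>(2) \<open>t \<in> {0..\<tau>}\<close> by blast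
    then show ?thesis using z(2) K_sub c by (auto simp: u_def subset_iff)
  qed
  \<comment> \<open>The calibrating function pairs \<open>Phi z\<close> with the final value
    \<open>e\<close> itself. Along the curve it grows from 0 to the squared length of
    \<open>e\<close>, at a rate of at most \<kappa> times the speed times the length of
    \<open>e\<close>; one factor is divided out at the end.\<close>
  define e where "e = Ph c z (u \<tau>)"
  define F where "F x = g c z (Ph c z x) e" for x
  obtain S where S: "finite S" "regular_off \<gamma> S" using regular_off_exists[OF \<gamma>(1)] by blast
  define D where "D t = vector_derivative u (at t)" for t
  have D: "(u has_vector_derivative D t) (at t)" "speed \<A> g \<gamma> t = gn c (u t) (D t)" if t: "t \<in> {0<..<\<tau>} - S" for t
  proof -
    have "\<gamma> t \<in> chart_dom c" using ub t by auto
    moreover have "t \<in> {0<..<1} - S" using t \<tau> by auto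
    ultimately obtain D' where D': "(u has_vector_derivative D') (at t)" "speed \<A> g \<gamma> t = sqrt (g c (chart_map c (\<gamma> t)) D' D')"
      using S(2) c unfolding regular_off_def u_def by blast
    moreover have "D t = D'" unfolding D_def by (rule vector_derivative_at[OF D'(1)])
    ultimately show "(u has_vector_derivative D t) (at t)" "speed \<A> g \<gamma> t = gn c (u t) (D t)"
      by (simp_all add: gnorm_def u_def)
  qed
  \<comment> \<open>The value 0 at the ends and at exceptional times makes the derivative total and
    keeps the pointwise bound valid everywhere.\<close>
  define f' where "f' t = (if t \<in> {0<..<\<tau>} - S then g c z (dPhi z (u t - z) (D t)) e else 0)" for t
  have lin: "linear (\<lambda>x. g c z x e)" using g_lin(2)[OF zS] .
  have bl: "bounded_linear (\<lambda>x. g c z x e)" using lin linear_conv_bounded_linear by blast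
  have Fd: "(F has_derivative (\<lambda>w. g c z (dPhi z (x - z) w) e)) (at x within X)" for x X
    unfolding F_def by (rule bounded_linear.has_derivative[OF bl Phi_has_derivative[OF zS]])
  have hi: "(f' has_integral (F (u \<tau>) - F (u 0))) {0..\<tau>}"
  proof (rule fundamental_theorem_of_calculus_interior_strong[of S, where f = "\<lambda>t. F (u t)", OF S(1)])
    show "0 \<le> \<tau>" using \<tau> by simp
    have "continuous_on {0..\<tau>} u" unfolding u_def
      by (rule continuous_on_compose[OF continuous_on_subset[OF \<gamma>c(1)] continuous_on_subset[OF chart_map_continuous[OF c]]])
        (use \<tau> ub in auto)
    moreover have "continuous_on (u ` {0..\<tau>}) F" by (rule has_derivative_continuous_on[OF Fd])
    ultimately show "continuous_on {0..\<tau>} (\<lambda>t. F (u t))" using continuous_on_compose[of "{0..\<tau>}" u F] by (simp add: o_def)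
    fix t assume t: "t \<in> {0<..<\<tau>} - S"
    have "(u has_derivative (\<lambda>h. h *\<^sub>R D t)) (at t)" using D(1)[OF t] by (simp add: has_vector_derivative_def)
    from has_derivative_compose[OF this Fd]
    have "((\<lambda>t. F (u t)) has_derivative (\<lambda>h. g c z (dPhi z (u t - z) (h *\<^sub>R D t)) e)) (at t)" .
    then show "((\<lambda>t. F (u t)) has_vector_derivative f' t) (at t)"
      using t by (simp add: has_vector_derivative_def f'_def linear_cmul[OF dPhi_linear[OF zS]] g_arith[OF zS])
  qed
  have Ph0: "Ph c z z = 0" using linear_0[OF chr_linear(1)[OF zS]] by (simp add: Phi_def)
  have "u 0 = z" using \<gamma>(2) zS c by (simp add: u_def)
  then have F0: "F (u 0) = 0" by (simp add: F_def Ph0 g_arith[OF zS])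
  have F1: "F (u \<tau>) = (gnorm z e)\<^sup>2" by (simp add: F_def e_def gnorm_power2[OF zS])
  have sp: "speed \<A> g \<gamma> integrable_on {0..1}" by (rule speed_integrable[OF \<gamma>(1)])
  have sp\<tau>: "speed \<A> g \<gamma> integrable_on {0..\<tau>}" using sp \<tau> by (auto intro: integrable_subinterval_real)
  have nonneg: "speed \<A> g \<gamma> t \<ge> 0" if "t \<in> {0..1}" for t using speed_nonneg[of \<gamma> t] \<gamma>c(2) that by (auto simp: image_subset_iff)
  have bound: "f' t \<le> \<kappa> * gnorm z e * speed \<A> g \<gamma> t" if t: "t \<in> {0..\<tau>}" for t
  proof (cases "t \<in> {0<..<\<tau>} - S")
    case True
    have uK: "u t \<in> K" using ub t z(2) by auto
    have "norm (u t - z) \<le> r" using ub t by (auto simp: dist_norm norm_minus_commute)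
    then have "1 + C / a\<^sup>2 * (norm (u t - z))\<^sup>2 \<le> \<kappa>" unfolding \<kappa>_def using C_ge by (intro add_left_mono mult_left_mono power_mono) auto
    then have "gnorm z (dPhi z (u t - z) (D t)) \<le> \<kappa> * gnorm (u t) (D t)"
      using dPhi_le[OF z(1) uK, of "D t"] mult_right_mono[OF _ gnorm_nonneg[OF in_S[OF uK], of "D t"]] by (meson order_trans)
    then have "gnorm z (dPhi z (u t - z) (D t)) * gnorm z e \<le> \<kappa> * speed \<A> g \<gamma> t * gnorm z e"
      unfolding D(2)[OF True] using gnorm_nonneg[OF zS] by (intro mult_right_mono)
    then show ?thesis using g_cauchy_schwarz[OF zS, of "dPhi z (u t - z) (D t)" e] True
      by (simp add: f'_def gnorm_def mult_ac)
  next
    case False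
    then have "f' t = 0" unfolding f'_def by (rule if_not_P)
    then show ?thesis using nonneg[of t] t \<tau> \<kappa> gnorm_nonneg[OF zS] by simp
  qed
  have "(gnorm z e)\<^sup>2 \<le> \<kappa> * gnorm z e * integral {0..\<tau>} (speed \<A> g \<gamma>)"
    by (rule has_integral_le[OF hi[unfolded F0 F1 diff_0_right] has_integral_mult_right[OF integrable_integral[OF sp\<tau>]] bound])
  also have "\<dots> \<le> \<kappa> * gnorm z e * len \<gamma>"
  proof (rule mult_left_mono)
    show "integral {0..\<tau>} (speed \<A> g \<gamma>) \<le> len \<gamma>"
      by (rule integral_subset_le[OF _ sp\<tau> sp]) (use \<tau> nonneg in auto)
    show "0 \<le> \<kappa> * gnorm z e" using \<kappa> gnorm_nonneg[OF zS] by simp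
  qed
  finally have *: "gnorm z e * gnorm z e \<le> gnorm z e * (\<kappa> * len \<gamma>)" by (simp add: power2_eq_square mult_ac)
  have "gnorm z e \<le> \<kappa> * len \<gamma>"
  proof (cases "gnorm z e = 0")
    case True then show ?thesis using \<kappa> len_nonneg[OF \<gamma>(1)] by simp
  next
    case False
    then have "gnorm z e > 0" using gnorm_nonneg[OF zS, of e] by linarith
    then show ?thesis using * by (simp only: mult_le_cancel_left_pos)
  qed
  then show ?thesis by (simp add: e_def u_def \<kappa>_def)
qed

lemma length_lower_bound:
  assumes c: "c \<in> \<A>" and est: "estimates c K a C" and z: "z \<in> K" "cball z r \<subseteq> K" and r: "r > 0"
    and \<gamma>: "\<gamma> \<in> curves (chart_inv c z) q"
  shows "\<exists>y\<in>cball z r. gn c z (Ph c z y) \<le> (1 + C / a\<^sup>2 * r\<^sup>2) * len \<gamma> \<and>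
    (norm (y - z) = r \<or> q \<in> chart_dom c \<and> chart_map c q = y \<and> norm (y - z) < r)"
proof -
  have p: "piecewise_C1_curve M \<A> \<gamma>" "\<gamma> 0 = chart_inv c z" "\<gamma> 1 = q" using \<gamma> by auto
  have K: "cball z r \<subseteq> chart_img c" using local_estimates.in_S[OF est] z(2) by blast
  obtain \<tau> where \<tau>: "\<tau> \<in> {0..1}" "\<gamma> ` {0..\<tau>} \<subseteq> chart_inv c ` cball z r"
    "norm (chart_map c (\<gamma> \<tau>) - z) = r \<or> \<tau> = 1 \<and> norm (chart_map c (\<gamma> 1) - z) < r"
    using exit_time[OF c K r piecewise_C1_continuous[OF p(1)] p(2)] by blast
  let ?y = "chart_map c (\<gamma> \<tau>)"
  have "gn c z (Ph c z ?y) \<le> (1 + C / a\<^sup>2 * r\<^sup>2) * len \<gamma>" by (rule calibration[OF c est z r p(1,2) \<tau>(1,2)])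
  moreover have "?y \<in> cball z r" using \<tau>(3) by (auto simp: dist_norm norm_minus_commute)
  moreover have "\<tau> = 1 \<Longrightarrow> q \<in> chart_dom c"
  proof -
    assume "\<tau> = 1"
    then have "q \<in> chart_inv c ` cball z r" using \<tau>(2) p(3) by auto
    then show "q \<in> chart_dom c" using K c by auto
  qed
  ultimately show ?thesis using \<tau>(3) p(3) by auto
qed

end

context closed_manifold begin

text \<open>Where a curve meets the sphere of radius \<open>r\<close>, the length of
  \<open>Phi z\<close> is at least a r / 2, and the calibration factor is at most 2. So a curve that
  reaches the sphere has length at least a r / 4, and shorter ones end inside the ball.\<close>

lemma distance_lower:
  assumes c: "c \<in> \<A>" and est: "estimates c K a C" and z: "z \<in> K" "cball z r \<subseteq> K" and r: "r > 0"
    and small: "C * r \<le> 1" "C * r\<^sup>2 \<le> a\<^sup>2" and q: "q \<in> M" and d: "rd (chart_inv c z) q < a / 4 * r"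
  shows "q \<in> chart_dom c" "norm (chart_map c q - z) < r"
    "gn c z (Ph c z (chart_map c q)) \<le> (1 + C / a\<^sup>2 * r\<^sup>2) * rd (chart_inv c z) q"
proof -
  interpret local_estimates "chart_img c" "g c" K a C by (rule est)
  have zM: "chart_inv c z \<in> M" using chart_inv_M[OF c in_S[OF z(1)]] .
  let ?\<kappa> = "1 + C / a\<^sup>2 * r\<^sup>2"
  have \<kappa>: "1 \<le> ?\<kappa>" "?\<kappa> \<le> 2" using small(2) C_ge a_pos by (auto simp: field_simps)
  have main: "q \<in> chart_dom c \<and> norm (chart_map c q - z) < r \<and> gn c z (Ph c z (chart_map c q)) \<le> ?\<kappa> * len \<gamma>"
    if \<gamma>: "\<gamma> \<in> curves (chart_inv c z) q" "len \<gamma> < a / 4 * r" for \<gamma>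
  proof -
    obtain y where y: "y \<in> cball z r" "gn c z (Ph c z y) \<le> ?\<kappa> * len \<gamma>"
      "norm (y - z) = r \<or> q \<in> chart_dom c \<and> chart_map c q = y \<and> norm (y - z) < r"
      using length_lower_bound[OF c est z r \<gamma>(1)] by blast
    have "norm (y - z) \<noteq> r"
    proof
      assume n: "norm (y - z) = r"
      have "a * (r / 2) \<le> a * norm (Ph c z y)"
        using Phi_lower(1)[OF z(1), of y] small(1) n a_pos by (intro mult_left_mono) auto
      also have "\<dots> \<le> ?\<kappa> * len \<gamma>" using gnorm_ge[OF z(1)] y(2) order_trans by blast
      also have "\<dots> \<le> 2 * len \<gamma>" using \<kappa>(2) len_nonneg[of \<gamma>] \<gamma>(1) by (intro mult_right_mono) auto
      finally show False using \<gamma>(2) by simp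
    qed
    then show ?thesis using y by auto
  qed
  note ne = curves_nonempty[OF zM q]
  obtain \<gamma> where "\<gamma> \<in> curves (chart_inv c z) q" "len \<gamma> < a / 4 * r" using rd_less_curve[OF ne d] by blast
  from main[OF this] show "q \<in> chart_dom c" "norm (chart_map c q - z) < r" by auto
  show "gn c z (Ph c z (chart_map c q)) \<le> ?\<kappa> * rd (chart_inv c z) q"
  proof (rule ccontr)
    assume n: "\<not> ?thesis"
    \<comment> \<open>A curve below both thresholds would stay in the ball and yet violate the
      calibration inequality.\<close>
    define m where "m = min (a / 4 * r) (gn c z (Ph c z (chart_map c q)) / ?\<kappa>)"
    have "rd (chart_inv c z) q < m" using n d \<kappa> by (auto simp: m_def field_simps)
    then obtain \<gamma> where "\<gamma> \<in> curves (chart_inv c z) q" "len \<gamma> < m" using rd_less_curve[OF ne] by blast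
    moreover from this main[of \<gamma>] have "gn c z (Ph c z (chart_map c q)) \<le> ?\<kappa> * len \<gamma>" by (auto simp: m_def)
    ultimately show False using \<kappa> by (auto simp: m_def field_simps)
  qed
qed

lemma distance_upper:
  assumes c: "c \<in> \<A>" and est: "estimates c K a C" and z: "z \<in> K" "cball z (5 * norm (y - z)) \<subseteq> K"
    and small: "C * norm (y - z) \<le> 1"
  shows "rd (chart_inv c z) (chart_inv c y) \<le> gn c z (Ph c z y) + local_estimates.cdist a C * norm (y - z) ^ 3"
proof -
  interpret local_estimates "chart_img c" "g c" K a C by (rule est)
  let ?m = "gn c z (Ph c z y) + cdist * norm (y - z) ^ 3"
  obtain w w' where w: "\<And>t. (w has_vector_derivative w' t) (at t)" "continuous_on UNIV w'" "w 0 = z" "w 1 = y"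
    "\<And>t. t \<in> {0..1} \<Longrightarrow> w t \<in> cball z (5 * norm (y - z))" "\<And>t. t \<in> {0..1} \<Longrightarrow> gnorm (w t) (w' t) \<le> ?m"
    using short_curve[OF z small] by blast
  have img: "w ` {0..1} \<subseteq> chart_img c" using w(5) z(2) in_S by blast
  have cw': "continuous_on {0..1} w'" using w(2) continuous_on_subset by blast
  have cw: "continuous_on {0..1} w" using w(1) by (meson continuous_at_imp_continuous_on has_vector_derivative_continuous)
  note cc = chart_curve[OF c w(1) cw' img]
  have "rd (chart_inv c z) (chart_inv c y) \<le> len (chart_inv c \<circ> w)" using rd_le_len[OF cc(1)] w(3,4) by simp
  also have "\<dots> = integral {0..1} (\<lambda>t. gnorm (w t) (w' t))" using cc(2) by (simp add: gnorm_def)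
  also have "\<dots> \<le> integral {0..1} (\<lambda>t::real. ?m)"
  proof (rule integral_le)
    show "(\<lambda>t. gnorm (w t) (w' t)) integrable_on {0..1}"
      unfolding gnorm_def by (intro integrable_continuous_real continuous_on_real_sqrt g_continuous cw cw' img)
  qed (use w(6) in auto)
  finally show ?thesis by simp
qed

text \<open>The lower bound is applied with a radius proportional to \<open>norm (y - z)\<close>, so
  that its relative error is of second order and the absolute one of third order. The last
  conclusion puts small metric balls inside small coordinate balls.\<close>

lemma distance_expansion:
  assumes c: "c \<in> \<A>" and est: "estimates c (cball x0 R) a C" and R: "R > 0"
  shows "\<exists>s>0. \<exists>C'\<ge>0. s \<le> R / 2 \<and> C * s \<le> 1 \<and>
    (\<forall>z\<in>cball x0 (R / 2). \<forall>y. norm (y - z) \<le> s \<longrightarrow>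
      \<bar>rd (chart_inv c z) (chart_inv c y) - gn c z (Ph c z y)\<bar> \<le> C' * norm (y - z) ^ 3) \<and>
    (\<forall>z\<in>cball x0 (R / 2). \<forall>q\<in>M. \<forall>r. 0 < r \<and> r \<le> s \<and> rd (chart_inv c z) q < a / 4 * r \<longrightarrow>
      q \<in> chart_dom c \<and> norm (chart_map c q - z) < r)"
proof -
  let ?K = "cball x0 R"
  interpret local_estimates "chart_img c" "g c" ?K a C by (rule est)
  \<comment> \<open>\<open>c2 * n\<close> bounds the distance of points at coordinate distance
    \<open>n\<close>. \<open>L\<close> makes the radius \<open>L * n\<close> contain the curve of
    \<open>short_curve\<close> and satisfy the distance hypothesis of \<open>distance_lower\<close>;
    \<open>s0\<close> collects the smallness conditions on that radius, and \<open>s\<close> passes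
    from the radius back to \<open>n\<close>.\<close>
  define c2 where "c2 = 2 * C + cdist"
  define L where "L = max 5 (4 * (c2 + 1) / a)"
  define s0 where "s0 = min (R / 2) (min (1 / C) (a / C))"
  define s where "s = min 1 (s0 / L)"
  define C' where "C' = cdist + C / a\<^sup>2 * L\<^sup>2 * c2"
  have C0: "C > 0" using C_ge by simp
  have c2: "c2 > 0" using C0 cdist_pos by (simp add: c2_def)
  have L: "L \<ge> 5" "4 * (c2 + 1) / a \<le> L" by (simp_all add: L_def)
  have s0: "s0 > 0" using R C0 a_pos by (simp add: s0_def)
  have s: "s > 0" using s0 L by (simp add: s_def)
  have "s0 / L \<le> s0" using s0 L by (simp add: divide_le_eq)
  then have ss0: "s \<le> s0" by (simp add: s_def)
  have sR: "s \<le> R / 2" using ss0 by (simp add: s0_def)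
  have "C' \<ge> 0" using cdist_pos c2 C0 by (simp add: C'_def)
  have small: "cball z r \<subseteq> ?K" "C * r \<le> 1" "C * r\<^sup>2 \<le> a\<^sup>2"
    if "z \<in> cball x0 (R / 2)" "0 < r" "r \<le> s0" for z r
  proof -
    have r: "r \<le> R / 2" "r \<le> 1 / C" "r \<le> a / C" using that(3) by (auto simp: s0_def)
    show "cball z r \<subseteq> ?K"
    proof
      fix y assume "y \<in> cball z r"
      then show "y \<in> ?K" using dist_triangle[of x0 y z] that(1) r(1) by simp
    qed
    show "C * r \<le> 1" using r(2) C0 by (simp add: field_simps)
    have "(C * r)\<^sup>2 \<le> a\<^sup>2" using r(3) C0 that(2) by (intro power_mono) (auto simp: field_simps)
    moreover have "C * r\<^sup>2 \<le> (C * r)\<^sup>2"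
      unfolding power_mult_distrib power2_eq_square[of C] using C_ge by (intro mult_right_mono) auto
    ultimately show "C * r\<^sup>2 \<le> a\<^sup>2" by linarith
  qed
  have zK: "z \<in> ?K" if "z \<in> cball x0 (R / 2)" for z using that R by simp
  have exp: "\<bar>rd (chart_inv c z) (chart_inv c y) - gn c z (Ph c z y)\<bar> \<le> C' * norm (y - z) ^ 3"
    if z: "z \<in> cball x0 (R / 2)" and y: "norm (y - z) \<le> s" for z y
  \<comment> \<open>For y = z the radius \<open>L * n\<close> would be 0 and the lower bound could
    not be applied.\<close>
  proof (cases "y = z")
    case True
    have "Ph c z z = 0" using linear_0[OF chr_linear(1)[OF in_S[OF zK[OF z]]]] by (simp add: Phi_def)
    then have "gn c z (Ph c z z) = 0" by (simp add: gnorm_def g_arith[OF in_S[OF zK[OF z]]])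
    moreover have "rd (chart_inv c z) (chart_inv c z) = 0"
    proof -
      have M: "chart_inv c z \<in> M" using chart_inv_M[OF c in_S[OF zK[OF z]]] .
      have "rd (chart_inv c z) (chart_inv c z) \<le> gn c z (Ph c z z) + cdist * norm (z - z) ^ 3"
        by (rule distance_upper[OF c est zK[OF z]]) (use zK[OF z] in auto)
      then show ?thesis using rd_nonneg[OF M M] \<open>gn c z (Ph c z z) = 0\<close> by simp
    qed
    ultimately show ?thesis using True by simp
  next
    case False
    define n where "n = norm (y - z)"
    have n: "n > 0" "n \<le> s" "n \<le> 1" using False y by (auto simp: n_def s_def)
    have nL: "L * n \<le> s0"
    proof -
      have "n \<le> s0 / L" using y by (simp add: n_def s_def)
      then show ?thesis using L by (simp add: field_simps)
    qed
    have n5: "5 * n \<le> s0"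
    proof -
      have "5 * n \<le> L * n" using L n by (intro mult_right_mono) auto
      then show ?thesis using nL by simp
    qed
    have Cn: "C * n \<le> 1" using small(2)[OF z n(1)] n(2) ss0 by linarith
    have up: "rd (chart_inv c z) (chart_inv c y) \<le> gn c z (Ph c z y) + cdist * n ^ 3"
      unfolding n_def by (rule distance_upper[OF c est zK[OF z]]) (use small(1)[OF z, of "5 * n"] n n5 Cn in \<open>auto simp: n_def\<close>)
    have n3: "n ^ 3 \<le> n" using n power_decreasing[of 1 3 n] by simp
    have d2: "rd (chart_inv c z) (chart_inv c y) \<le> c2 * n"
    proof -
      have "gn c z (Ph c z y) \<le> C * norm (Ph c z y)" by (rule gnorm_le[OF zK[OF z]])
      also have "\<dots> \<le> C * (2 * n)" using Phi_lower(2)[OF zK[OF z], of y] Cn C0 by (intro mult_left_mono) (auto simp: n_def)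
      finally have "gn c z (Ph c z y) \<le> 2 * C * n" by simp
      moreover have "cdist * n ^ 3 \<le> cdist * n" using n3 cdist_pos by (rule mult_left_mono)
      ultimately show ?thesis using up by (simp add: c2_def algebra_simps)
    qed
    define r where "r = L * n"
    have r: "0 < r" "r \<le> s0" using L n nL by (auto simp: r_def)
    have "c2 * n < (c2 + 1) * n" using n by simp
    also have "\<dots> = a / 4 * (4 * (c2 + 1) / a * n)" using a_pos by simp
    also have "\<dots> \<le> a / 4 * r" unfolding r_def using L(2) n a_pos by (intro mult_left_mono mult_right_mono) auto
    finally have d3: "rd (chart_inv c z) (chart_inv c y) < a / 4 * r" using d2 by linarith
    have yK: "y \<in> ?K"     proof (rule subsetD[OF small(1)[OF z s0 order_refl]])
      show "y \<in> cball z s0" using y ss0 by (simp add: dist_norm norm_minus_commute)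
    qed
    have M: "chart_inv c y \<in> M" using chart_inv_M[OF c in_S[OF yK]] .
    have Mz: "chart_inv c z \<in> M" using chart_inv_M[OF c in_S[OF zK[OF z]]] .
    have "gn c z (Ph c z y) \<le> (1 + C / a\<^sup>2 * r\<^sup>2) * rd (chart_inv c z) (chart_inv c y)"
      using distance_lower(3)[OF c est zK[OF z] small(1)[OF z r] r(1) small(2,3)[OF z r] M d3] in_S[OF yK] c by simp
    also have "\<dots> = rd (chart_inv c z) (chart_inv c y) + C / a\<^sup>2 * r\<^sup>2 * rd (chart_inv c z) (chart_inv c y)" by (simp add: algebra_simps)
    also have "C / a\<^sup>2 * r\<^sup>2 * rd (chart_inv c z) (chart_inv c y) \<le> C / a\<^sup>2 * r\<^sup>2 * (c2 * n)"
      using d2 C0 by (intro mult_left_mono) auto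
    also have "C / a\<^sup>2 * r\<^sup>2 * (c2 * n) = (C' - cdist) * n ^ 3"
      by (simp add: C'_def r_def power2_eq_square power3_eq_cube)
    finally have "gn c z (Ph c z y) \<le> rd (chart_inv c z) (chart_inv c y) + (C' - cdist) * n ^ 3" by simp
    moreover have "0 \<le> cdist * n ^ 3" "0 \<le> (C' - cdist) * n ^ 3" using cdist_pos n c2 C0 by (simp_all add: C'_def)
    ultimately show ?thesis using up by (simp add: n_def algebra_simps abs_le_iff)
  qed
  have loc: "q \<in> chart_dom c \<and> norm (chart_map c q - z) < r"
    if "z \<in> cball x0 (R / 2)" "q \<in> M" "0 < r" "r \<le> s" "rd (chart_inv c z) q < a / 4 * r" for z q r
  proof -
    have "r \<le> s0" using that ss0 by simp
    note sm = small[OF that(1,3) this]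
    from distance_lower(1,2)[OF c est zK[OF that(1)] sm(1) that(3) sm(2,3) that(2,5)] show ?thesis by simp
  qed
  have "C * s \<le> 1" using small(2)[of x0 s] s ss0 R by simp
  then show ?thesis using s \<open>C' \<ge> 0\<close> sR exp loc by blast
qed

end

text \<open>Finitely many neighbourhoods suffice, and the largest of their constants works for all
  of them. This is the passage from estimates in one chart to estimates on \<open>M\<close>.\<close>

lemma compact_uniform_bound:
  fixes P :: "'a::topological_space \<Rightarrow> real \<Rightarrow> bool"
  assumes "compact M"
    and loc: "\<And>q. q \<in> M \<Longrightarrow> \<exists>U L. openin (top_of_set M) U \<and> q \<in> U \<and> (\<forall>x\<in>U. P x L)"
    and mono: "\<And>x L L'. P x L \<Longrightarrow> L \<le> L' \<Longrightarrow> P x L'"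
  shows "\<exists>L>0. \<forall>x\<in>M. P x L"
proof -
  have "\<forall>q\<in>M. \<exists>UL. openin (top_of_set M) (fst UL) \<and> q \<in> fst UL \<and> (\<forall>x\<in>fst UL. P x (snd UL))"
    using loc by auto
  then obtain UL where UL: "\<And>q. q \<in> M \<Longrightarrow> openin (top_of_set M) (fst (UL q)) \<and> q \<in> fst (UL q) \<and> (\<forall>x\<in>fst (UL q). P x (snd (UL q)))"
    by metis
  let ?C = "(\<lambda>q. fst (UL q)) ` M"
  have "(\<forall>c\<in>?C. openin (top_of_set M) c) \<and> M \<subseteq> \<Union>?C" using UL by blast
  then obtain D where D: "D \<subseteq> ?C" "finite D" "M \<subseteq> \<Union>D"
    using assms(1) unfolding compact_eq_openin_cover by meson
  then obtain F where F: "F \<subseteq> M" "finite F" "D = (\<lambda>q. fst (UL q)) ` F"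
    using finite_subset_image by metis
  define L where "L = Max (insert 1 ((\<lambda>q. snd (UL q)) ` F))"
  have L: "1 \<le> L" "\<And>q. q \<in> F \<Longrightarrow> snd (UL q) \<le> L" using F(2) by (auto simp: L_def)
  have "P x L" if "x \<in> M" for x
  proof -
    have "x \<in> \<Union>D" using D(3) that by blast
    then obtain q where q: "q \<in> F" "x \<in> fst (UL q)" using F(3) by blast
    then have "P x (snd (UL q))" using UL F(1) by blast
    then show ?thesis using L(2)[OF q(1)] mono by blast
  qed
  then show ?thesis using L(1) by (intro exI[of _ L]) auto
qed

context riemannian_manifold begin

lemma chart_ball_exists:
  assumes c: "c \<in> \<A>" "q \<in> chart_dom c"
  shows "\<exists>R a C. R > 0 \<and> cball (chart_map c q) R \<subseteq> chart_img c \<and> estimates c (cball (chart_map c q) R) a C"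
proof -
  obtain R where R: "R > 0" "cball (chart_map c q) R \<subseteq> chart_img c"
    using chart_facts(2)[OF c(1)] chart_map_in[OF c(2)] by (meson open_contains_cball)
  from local_metric.local_estimates_exist[OF local_metric_chart[OF c(1)] compact_cball convex_cball R(2)]
  show ?thesis using R by blast
qed

lemma chart_neighbourhood:
  assumes c: "c \<in> \<A>" "q \<in> chart_dom c" and R: "R > 0" "ball (chart_map c q) R \<subseteq> chart_img c"
  shows "openin (top_of_set M) (chart_inv c ` ball (chart_map c q) R)" "q \<in> chart_inv c ` ball (chart_map c q) R"
proof -
  show "openin (top_of_set M) (chart_inv c ` ball (chart_map c q) R)"
    by (rule openin_chart_inv_image[OF c(1) open_ball R(2)])
  show "q \<in> chart_inv c ` ball (chart_map c q) R"
    using c R by (intro image_eqI[of _ _ "chart_map c q"]) auto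
qed

end

context closed_manifold begin

text \<open>By the expansion of the distance, small coordinate balls are small for
  \<open>rd\<close>. Hence \<open>rd\<close>-Lipschitz functions are continuous for the topology of
  \<open>M\<close>, and so they are measurable.\<close>

lemma rd_small:
  assumes q: "q \<in> M" and e: "e > 0"
  shows "\<exists>U. openin (top_of_set M) U \<and> q \<in> U \<and> (\<forall>x\<in>U. rd q x < e)"
proof -
  obtain c where c: "c \<in> \<A>" "q \<in> chart_dom c" using cover q by blast
  let ?z = "chart_map c q"
  obtain R a C where R: "R > 0" "cball ?z R \<subseteq> chart_img c" and est: "estimates c (cball ?z R) a C"
    using chart_ball_exists[OF c] by blast
  interpret local_estimates "chart_img c" "g c" "cball ?z R" a C by (rule est)
  obtain s C' where s: "s > 0" "C' \<ge> 0" "s \<le> R / 2" "C * s \<le> 1"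
    "\<And>y. norm (y - ?z) \<le> s \<Longrightarrow> \<bar>rd (chart_inv c ?z) (chart_inv c y) - gn c ?z (Ph c ?z y)\<bar> \<le> C' * norm (y - ?z) ^ 3"
    using distance_expansion[OF c(1) est R(1)] R(1) by (metis centre_in_cball half_gt_zero less_imp_le)
  have zK: "?z \<in> cball ?z R" using R by simp
  define d where "d = min s (min 1 (e / (2 * C + C' + 1)))"
  have d: "d > 0" "d \<le> s" "d \<le> 1" "d \<le> e / (2 * C + C' + 1)" using s e C_ge by (auto simp: d_def)
  have "rd q x < e" if x: "x \<in> chart_inv c ` ball ?z d" for x
  proof -
    obtain y where "x = chart_inv c y" "y \<in> ball ?z d" using x by blast
    then have y: "x = chart_inv c y" "norm (y - ?z) < d" by (simp_all add: dist_norm norm_minus_commute)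
    define n where "n = norm (y - ?z)"
    have n: "0 \<le> n" "n < d" "n \<le> 1" using y d by (auto simp: n_def)
    have Cn: "C * n \<le> 1" using s(4) n d(2) C_ge by (smt (verit) mult_left_mono)
    have "gn c ?z (Ph c ?z y) \<le> C * norm (Ph c ?z y)" by (rule gnorm_le[OF zK])
    also have "\<dots> \<le> C * (2 * n)" using Phi_lower(2)[OF zK, of y] Cn C_ge by (intro mult_left_mono) (auto simp: n_def)
    finally have 1: "gn c ?z (Ph c ?z y) \<le> 2 * C * n" by simp
    have "n ^ 3 \<le> n" using n power_decreasing[of 1 3 n] by simp
    then have 2: "C' * n ^ 3 \<le> C' * n" using s(2) by (rule mult_left_mono)
    have "rd (chart_inv c ?z) (chart_inv c y) \<le> (2 * C + C') * n"
      using s(5)[of y] 1 2 n d by (simp add: n_def algebra_simps)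
    also have "\<dots> \<le> (2 * C + C' + 1) * n" using n by (intro mult_right_mono) auto
    also have "\<dots> < (2 * C + C' + 1) * d" using n s(2) C_ge by (intro mult_strict_left_mono) auto
    also have "\<dots> \<le> e" using d(4) s(2) C_ge by (simp add: field_simps)
    finally show ?thesis using y c by simp
  qed
  moreover have "ball ?z d \<subseteq> chart_img c" using R(2) d s R(1) by (auto simp: subset_iff)
  ultimately show ?thesis using chart_neighbourhood[OF c d(1)] by blast
qed

lemma Lipschitz_continuous:
  assumes L: "\<And>x y. x \<in> M \<Longrightarrow> y \<in> M \<Longrightarrow> \<bar>h x - h y\<bar> \<le> L * rd x y"
  shows "continuous_on M h"
  unfolding continuous_on_topological
proof (intro ballI allI impI)
  fix q B assume q: "q \<in> M" and B: "open B" "h q \<in> B"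
  obtain e where e: "e > 0" "ball (h q) e \<subseteq> B" using B open_contains_ball by blast
  obtain U where U: "openin (top_of_set M) U" "q \<in> U" "\<And>x. x \<in> U \<Longrightarrow> rd q x < e / (\<bar>L\<bar> + 1)"
    using rd_small[OF q, of "e / (\<bar>L\<bar> + 1)"] e by auto
  obtain A where A: "open A" "U = M \<inter> A" using U(1) by (auto simp: openin_open)
  have "h y \<in> B" if "y \<in> M" "y \<in> A" for y
  proof -
    have "\<bar>h q - h y\<bar> \<le> L * rd q y" using L q that by blast
    also have "\<dots> \<le> (\<bar>L\<bar> + 1) * rd q y" using rd_nonneg[OF q that(1)] by (intro mult_right_mono) auto
    also have "\<dots> < e" using U(3)[of y] that A by (simp add: pos_less_divide_eq mult.commute)
    finally show ?thesis using e by (auto simp: dist_real_def subset_iff)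
  qed
  then show "\<exists>A. open A \<and> q \<in> A \<and> (\<forall>y\<in>M. y \<in> A \<longrightarrow> h y \<in> B)" using A U by blast
qed

lemma rd_continuous: "p \<in> M \<Longrightarrow> continuous_on M (rd p)"
  by (rule Lipschitz_continuous[of _ 1]) (use rd_triangle_diff in auto)

lemma rd_bounded: "\<exists>B>0. \<forall>x\<in>M. \<forall>y\<in>M. rd x y \<le> B"
proof (cases "M = {}")
  case False
  then obtain p where p: "p \<in> M" by blast
  have "compact (rd p ` M)" by (rule compact_continuous_image[OF rd_continuous[OF p] compact_M])
  then have "bounded (rd p ` M)" by (rule compact_imp_bounded)
  then obtain B where "\<forall>x\<in>rd p ` M. norm x \<le> B" unfolding bounded_iff by blast
  then have B: "\<bar>rd p x\<bar> \<le> B" if "x \<in> M" for x using that by simp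
  have "rd x y \<le> 2 * \<bar>B\<bar> + 1" if "x \<in> M" "y \<in> M" for x y
    using rd_triangle[of x p y] rd_commute[of x p] B[of x] B[of y] that p by linarith
  then show ?thesis by (intro exI[of _ "2 * \<bar>B\<bar> + 1"]) auto
qed (auto intro: exI[of _ 1])

lemma smooth_function_bounded:
  assumes f: "smooth_function \<A> f"
  shows "\<exists>B>0. \<forall>x\<in>M. \<bar>f x\<bar> \<le> B"
proof (rule compact_uniform_bound[OF compact_M])
  fix q assume "q \<in> M"
  then obtain c where c: "c \<in> \<A>" "q \<in> chart_dom c" using cover by blast
  let ?z = "chart_map c q"
  obtain R where R: "R > 0" "cball ?z R \<subseteq> chart_img c"
    using chart_ball_exists[OF c] by blast
  have "smooth_on (f \<circ> chart_inv c) (chart_img c)" using f c by (simp add: smooth_function_def)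
  from dird_funpow_bound[OF chart_facts(2)[OF c(1)] compact_cball R(2) this, of 0]
  obtain L where "\<forall>x\<in>cball ?z R. \<bar>f (chart_inv c x)\<bar> \<le> L" by auto
  then have "\<forall>x\<in>chart_inv c ` ball ?z R. \<bar>f x\<bar> \<le> L" by auto
  moreover have "ball ?z R \<subseteq> chart_img c" using R(2) ball_subset_cball by blast
  ultimately show "\<exists>U L. openin (top_of_set M) U \<and> q \<in> U \<and> (\<forall>x\<in>U. \<bar>f x\<bar> \<le> L)"
    using chart_neighbourhood[OF c R(1)] by blast
qed auto

text \<open>Two ranges of the distance: nearby points lie in one coordinate ball, where
  \<open>f\<close> is Lipschitz in the coordinates and the coordinates are controlled by
  \<open>rd\<close>; for distant points boundedness of \<open>f\<close> is enough.\<close>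

lemma smooth_function_Lipschitz:
  assumes f: "smooth_function \<A> f"
  shows "\<exists>L>0. \<forall>x\<in>M. \<forall>y\<in>M. \<bar>f x - f y\<bar> \<le> L * rd x y"
proof -
  obtain B where B: "B > 0" "\<And>x. x \<in> M \<Longrightarrow> \<bar>f x\<bar> \<le> B" using smooth_function_bounded[OF f] by blast
  \<comment> \<open>Membership in \<open>M\<close> is part of the predicate because monotonicity in
    \<open>L\<close> rests on nonnegative distances.\<close>
  have "\<exists>L>0. \<forall>x\<in>M. x \<in> M \<and> (\<forall>y\<in>M. \<bar>f x - f y\<bar> \<le> L * rd x y)"
  proof (rule compact_uniform_bound[OF compact_M])
    fix q assume "q \<in> M"
    then obtain c where c: "c \<in> \<A>" "q \<in> chart_dom c" using cover by blast
    let ?z = "chart_map c q"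
    obtain R a C where R: "R > 0" "cball ?z R \<subseteq> chart_img c" and est: "estimates c (cball ?z R) a C"
      using chart_ball_exists[OF c] by blast
    interpret local_estimates "chart_img c" "g c" "cball ?z R" a C by (rule est)
    obtain s where s: "s > 0" "s \<le> R / 2"
      "\<And>x q r. x \<in> cball ?z (R / 2) \<Longrightarrow> q \<in> M \<Longrightarrow> 0 < r \<Longrightarrow> r \<le> s \<Longrightarrow> rd (chart_inv c x) q < a / 4 * r \<Longrightarrow>
        q \<in> chart_dom c \<and> norm (chart_map c q - x) < r"
      using distance_expansion[OF c(1) est R(1)] by blast
    have sm: "smooth_on (f \<circ> chart_inv c) (chart_img c)" using f c by (simp add: smooth_function_def)
    obtain Lf where Lf: "Lf \<ge> 0" "\<And>x y. x \<in> cball ?z R \<Longrightarrow> y \<in> cball ?z R \<Longrightarrow> \<bar>f (chart_inv c y) - f (chart_inv c x)\<bar> \<le> Lf * norm (y - x)"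
      using lipschitz_bound[OF chart_facts(2)[OF c(1)] compact_cball convex_cball R(2) sm] by auto
    \<comment> \<open>The first summand serves points at distance below a s / 4, the second one all
      others.\<close>
    define L where "L = Lf * (4 / a) + 8 * B / (a * s)"
    have L: "Lf * (4 / a) \<le> L" "8 * B / (a * s) \<le> L" "L \<ge> 0" using Lf(1) B(1) a_pos s(1) by (simp_all add: L_def)
    have "\<bar>f x - f y\<bar> \<le> L * rd x y" if x: "x \<in> chart_inv c ` ball ?z (R / 2)" and y: "y \<in> M" for x y
    proof -
      obtain x' where x': "x = chart_inv c x'" "x' \<in> ball ?z (R / 2)" using x by blast
      then have x'K: "x' \<in> cball ?z (R / 2)" "x' \<in> cball ?z R" using R(1) by auto
      then have xM: "x \<in> M" using x' chart_inv_M[OF c(1)] R(2) by blast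
      have d0: "rd x y \<ge> 0" by (rule rd_nonneg[OF xM y])
      show ?thesis
      proof (cases "rd x y < a / 4 * s")
        case True
        have near: "y \<in> chart_dom c \<and> norm (chart_map c y - x') < r" if "4 / a * rd x y < r" "r \<le> s" for r
        proof (rule s(3)[OF x'K(1) y _ that(2)])
          have "0 \<le> 4 / a * rd x y" using d0 a_pos by simp
          then show "0 < r" using that(1) by linarith
          show "rd (chart_inv c x') y < a / 4 * r" using that(1) a_pos x' by (simp add: field_simps)
        qed
        have lt: "4 / a * rd x y < s" using True a_pos by (simp add: field_simps)
        have yd: "y \<in> chart_dom c" "norm (chart_map c y - x') < s" using near[OF lt] by auto
        have le: "norm (chart_map c y - x') \<le> 4 / a * rd x y"
        \<comment> \<open>Otherwise localization with the coordinate distance itself as radius would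
          make that distance smaller than itself.\<close>
        proof (rule ccontr)
          assume "\<not> ?thesis"
          then have "4 / a * rd x y < norm (chart_map c y - x')" by simp
          from near[OF this] yd show False by simp
        qed
        have "chart_map c y \<in> cball ?z R"
          using dist_triangle[of ?z "chart_map c y" x'] x'K(1) yd(2) s(2) by (simp add: dist_norm norm_minus_commute)
        then have "\<bar>f y - f x\<bar> \<le> Lf * norm (chart_map c y - x')" using Lf(2)[OF x'K(2)] yd(1) c(1) x' by fastforce
        also have "\<dots> \<le> Lf * (4 / a * rd x y)" using le Lf(1) by (rule mult_left_mono)
        also have "\<dots> = (Lf * (4 / a)) * rd x y" by simp
        also have "\<dots> \<le> L * rd x y" by (rule mult_right_mono[OF L(1) d0])
        finally show ?thesis by simp
      next
        case False
        have "\<bar>f x - f y\<bar> \<le> 2 * B" using B(2)[OF xM] B(2)[OF y] by linarith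
        also have "\<dots> = 8 * B / (a * s) * (a / 4 * s)" using a_pos s(1) by simp
        also have "\<dots> \<le> L * rd x y" using False L a_pos s(1) by (intro mult_mono) auto
        finally show ?thesis .
      qed
    qed
    moreover have bs: "ball ?z (R / 2) \<subseteq> chart_img c" using R by (auto simp: subset_iff)
    moreover have R2: "R / 2 > 0" using R by simp
    moreover have "chart_inv c ` ball ?z (R / 2) \<subseteq> M" using chart_inv_M[OF c(1)] bs by blast
    ultimately show "\<exists>U L. openin (top_of_set M) U \<and> q \<in> U \<and> (\<forall>x\<in>U. x \<in> M \<and> (\<forall>y\<in>M. \<bar>f x - f y\<bar> \<le> L * rd x y))"
      using chart_neighbourhood[OF c R2 bs] by (intro exI[of _ "chart_inv c ` ball ?z (R / 2)"] exI[of _ L]) blast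
  next
    fix x L L' assume L: "x \<in> M \<and> (\<forall>y\<in>M. \<bar>f x - f y\<bar> \<le> L * rd x y)" "L \<le> L'"
    have "\<bar>f x - f y\<bar> \<le> L' * rd x y" if y: "y \<in> M" for y
      using L y mult_right_mono[OF L(2) rd_nonneg[of x y]] by force
    then show "x \<in> M \<and> (\<forall>y\<in>M. \<bar>f x - f y\<bar> \<le> L' * rd x y)" using L by blast
  qed
  then show ?thesis by blast
qed

end

section \<open>The Riemannian volume\<close>

context riemannian_manifold begin

abbreviation MB :: "'a measure" where
  "MB \<equiv> restrict_space borel M"

definition dens :: "('a, 'n) chart \<Rightarrow> real ^ 'n \<Rightarrow> real" where
  "dens c x = sqrt (det (gram g c x))"

lemma dens_vol_dens: "c \<in> \<A> \<Longrightarrow> dens c = local_metric.vol_dens (g c)"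
  by (simp add: dens_def[abs_def] local_metric.vol_dens_def[OF local_metric_chart] gram_form_matrix fun_eq_iff)

lemma dens_pos: "c \<in> \<A> \<Longrightarrow> x \<in> chart_img c \<Longrightarrow> dens c x > 0"
  using local_metric.vol_dens_pos[OF local_metric_chart] by (simp add: dens_vol_dens)

lemma dens_measurable:
  assumes c: "c \<in> \<A>"
  shows "(\<lambda>x. indicator (chart_img c) x * dens c x) \<in> borel_measurable borel"
proof -
  have "continuous_on (chart_img c) (dens c)"
    using local_metric.vol_dens_continuous[OF local_metric_chart[OF c]] by (simp add: dens_vol_dens[OF c])
  then have "(\<lambda>x. indicator (chart_img c) x *\<^sub>R dens c x) \<in> borel_measurable borel"
    using chart_facts(2)[OF c] by (intro borel_measurable_continuous_on_indicator) auto
  then show ?thesis by simp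
qed

lemma openin_sets_MB: "openin (top_of_set M) U \<Longrightarrow> U \<in> sets MB"
proof -
  assume "openin (top_of_set M) U"
  then obtain T where "open T" "U = M \<inter> T" by (metis openin_open)
  then show ?thesis by (auto simp: sets_restrict_space)
qed

lemma chart_dom_sets: "c \<in> \<A> \<Longrightarrow> chart_dom c \<in> sets MB"
  by (rule openin_sets_MB[OF chart_facts(1)])

lemma sets_MB_subset: "B \<in> sets MB \<Longrightarrow> B \<subseteq> M"
  using sets.sets_into_space[of B MB] by (simp add: space_restrict_space)

lemma chart_inv_measurable:
  assumes c: "c \<in> \<A>"
  shows "chart_inv c \<in> measurable (restrict_space borel (chart_img c)) MB"
proof (rule measurable_restrict_space2)
  show "chart_inv c \<in> space (restrict_space borel (chart_img c)) \<rightarrow> M"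
    using chart_inv_M[OF c] by (auto simp: space_restrict_space)
  show "chart_inv c \<in> measurable (restrict_space borel (chart_img c)) borel"
    by (rule borel_measurable_continuous_on_restrict[OF chart_inv_continuous[OF c]])
qed

lemma chart_image_sets:
  assumes c: "c \<in> \<A>" and B: "B \<in> sets MB"
  shows "{x \<in> chart_img c. chart_inv c x \<in> B} \<in> sets borel"
proof -
  have "chart_inv c -` B \<inter> space (restrict_space borel (chart_img c)) \<in> sets (restrict_space borel (chart_img c))"
    using measurable_sets[OF chart_inv_measurable[OF c] B] .
  moreover have "chart_inv c -` B \<inter> space (restrict_space borel (chart_img c)) = {x \<in> chart_img c. chart_inv c x \<in> B}"
    by (auto simp: space_restrict_space)
  ultimately show ?thesis using chart_facts(2)[OF c] by (simp add: sets_restrict_space_iff)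
qed

lemma chart_image_eq:
  assumes c: "c \<in> \<A>" and B: "B \<subseteq> chart_dom c"
  shows "{x \<in> chart_img c. chart_inv c x \<in> B} = chart_map c ` B"
  using assms by (auto simp: chart_img_def)

text \<open>The volume seen by one chart, as a measure on the Borel sets of all of \<open>M\<close>
  that gives no mass to the complement of the chart domain.\<close>

definition chart_measure :: "('a, 'n) chart \<Rightarrow> 'a measure" where
  "chart_measure c = distr (restrict_space (density lborel (\<lambda>x. ennreal (indicator (chart_img c) x * dens c x))) (chart_img c)) MB (chart_inv c)"

lemma sets_chart_measure [simp]: "sets (chart_measure c) = sets MB"
  by (simp add: chart_measure_def)

lemma chart_measure_emeasure:
  assumes c: "c \<in> \<A>" and B: "B \<in> sets MB"
  shows "emeasure (chart_measure c) B = (\<integral>\<^sup>+x\<in>{x \<in> chart_img c. chart_inv c x \<in> B}. ennreal (dens c x) \<partial>lborel)"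
proof -
  let ?d = "density lborel (\<lambda>x. ennreal (indicator (chart_img c) x * dens c x))"
  let ?X = "{x \<in> chart_img c. chart_inv c x \<in> B}"
  have m: "chart_inv c \<in> measurable (restrict_space ?d (chart_img c)) MB"
    using chart_inv_measurable[OF c] by (simp cong: measurable_cong_sets add: sets_restrict_space measurable_def space_restrict_space)
  have sp: "chart_inv c -` B \<inter> space (restrict_space ?d (chart_img c)) = ?X"
    by (auto simp: space_restrict_space)
  have "emeasure (chart_measure c) B = emeasure (restrict_space ?d (chart_img c)) ?X"
    unfolding chart_measure_def using B by (subst emeasure_distr[OF m]) (simp_all add: sp)
  also have "\<dots> = emeasure ?d ?X"
    using chart_facts(2)[OF c] by (intro emeasure_restrict_space) auto
  also have "\<dots> = (\<integral>\<^sup>+x. ennreal (indicator (chart_img c) x * dens c x) * indicator ?X x \<partial>lborel)"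
    using dens_measurable[OF c] chart_image_sets[OF c B] by (intro emeasure_density) auto
  also have "\<dots> = (\<integral>\<^sup>+x\<in>?X. ennreal (dens c x) \<partial>lborel)"
    by (intro nn_integral_cong) (auto simp: indicator_def)
  finally show ?thesis .
qed

text \<open>The metric in \<open>c\<close> is the pullback of the one in \<open>c'\<close> by the
  derivative of the transition map, so the Gram determinants differ by the squared Jacobian.\<close>

lemma dens_change:
  assumes c: "c \<in> \<A>" "c' \<in> \<A>" and x: "x \<in> overlap c c'"
  shows "dens c x = \<bar>det (matrix (\<lambda>v. dird v (transition c c') x))\<bar> * dens c' (transition c c' x)"
proof -
  let ?L = "\<lambda>v. dird v (transition c c') x" and ?y = "transition c c' x"
  interpret local_metric "chart_img c'" "g c'" using local_metric_chart[OF c(2)] .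
  have y: "?y \<in> chart_img c'" using x c by (auto simp: overlap_def transition_def)
  have lin: "linear ?L" using has_derivative_linear[OF transition_has_derivative[OF c x]] .
  have "form_matrix (g c x) = form_matrix (\<lambda>u v. g c' ?y (?L u) (?L v))"
    unfolding form_matrix_def using g_change[OF c x] by presburger
  then have "det (form_matrix (g c x)) = det (form_matrix (g c' ?y)) * (det (matrix ?L))\<^sup>2"
    using det_pullback[OF y lin] by simp
  then show ?thesis unfolding dens_def gram_form_matrix by (simp add: real_sqrt_mult mult.commute)
qed

text \<open>Change of variables by the transition map, whose Jacobian is exactly the quotient of the
  two densities.\<close>

lemma chart_measure_overlap:
  assumes c: "c \<in> \<A>" "c' \<in> \<A>" and B: "B \<in> sets MB" "B \<subseteq> chart_dom c" "B \<subseteq> chart_dom c'"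
  shows "emeasure (chart_measure c) B = emeasure (chart_measure c') B"
proof -
  let ?T = "transition c c'" and ?W = "overlap c c'"
  let ?J = "\<lambda>x. det (matrix (\<lambda>v. dird v ?T x))"
  let ?X = "{x \<in> chart_img c. chart_inv c x \<in> B}" and ?X' = "{x \<in> chart_img c'. chart_inv c' x \<in> B}"
  \<comment> \<open>The cut-off to the chart image makes the density Borel on the whole
    space.\<close>
  define h where "h y = ennreal (indicator (chart_img c') y * dens c' y) * indicator ?X' y" for y
  have [measurable]: "?X' \<in> sets borel" by (rule chart_image_sets[OF c(2) B(1)])
  have hm: "h \<in> borel_measurable borel" unfolding h_def using dens_measurable[OF c(2)] by measurable
  have W: "?W \<subseteq> chart_img c" by (auto simp: overlap_def)
  have inj: "inj_on ?T ?W"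
    by (rule inj_onI) (use c in \<open>auto simp: overlap_def transition_def dest: inj_onD\<close>, metis chart_inv_map)
  have cont: "continuous_on ?W ?J"
  proof (rule continuous_on_det)
    fix i j
    have "continuous_on ?W (\<lambda>x. dird (axis j 1) ?T x)"
      by (rule smooth_on_continuous[OF smooth_on_dird[OF transition_smooth[OF c]]])
    then show "continuous_on ?W (\<lambda>x. matrix (\<lambda>v. dird v ?T x) $ i $ j)"
      by (simp add: matrix_def continuous_on_component)
  qed
  have TW: "?X' \<subseteq> ?T ` ?W"
  proof
    fix y assume y: "y \<in> ?X'"
    then have q: "chart_inv c' y \<in> chart_dom c" "chart_inv c' y \<in> chart_dom c'" "y = chart_map c' (chart_inv c' y)"
      using B c by auto
    then have "y = ?T (chart_map c (chart_inv c' y))" using c by (simp add: transition_def)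
    then show "y \<in> ?T ` ?W" using q unfolding overlap_def by blast
  qed
  have XT: "x \<in> ?X \<longleftrightarrow> ?T x \<in> ?X'" if x: "x \<in> ?W" for x
  proof -
    obtain q where q: "x = chart_map c q" "q \<in> chart_dom c" "q \<in> chart_dom c'" using x by (auto simp: overlap_def)
    then have "?T x = chart_map c' q" using c by (simp add: transition_def)
    then show ?thesis using q c by simp
  qed
  have XW: "?X \<subseteq> ?W"
  proof
    fix x assume "x \<in> ?X"
    then have "x = chart_map c (chart_inv c x)" "chart_inv c x \<in> chart_dom c \<inter> chart_dom c'" using B c by auto
    then show "x \<in> ?W" unfolding overlap_def by blast
  qed
  have "emeasure (chart_measure c') B = (\<integral>\<^sup>+y\<in>?X'. ennreal (dens c' y) \<partial>lborel)"
    by (rule chart_measure_emeasure[OF c(2) B(1)])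
  also have "\<dots> = (\<integral>\<^sup>+y\<in>?T ` ?W. h y \<partial>lborel)"
    by (intro nn_integral_cong) (use TW in \<open>auto simp: h_def indicator_def\<close>)
  also have "\<dots> = (\<integral>\<^sup>+x\<in>?W. ennreal \<bar>?J x\<bar> * h (?T x) \<partial>lborel)"
    by (rule nn_integral_change_of_variables[OF open_overlap[OF c] transition_has_derivative[OF c] inj cont hm])
  also have "\<dots> = (\<integral>\<^sup>+x\<in>?X. ennreal (dens c x) \<partial>lborel)"
  proof (rule nn_integral_cong)
    fix x
    show "ennreal \<bar>?J x\<bar> * h (?T x) * indicator ?W x = ennreal (dens c x) * indicator ?X x"
    proof (cases "x \<in> ?X")
      case True
      then have xW: "x \<in> ?W" using XW by blast
      then have T: "?T x \<in> ?X'" using XT True by blast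
      then have "h (?T x) = ennreal (dens c' (?T x))" by (simp add: h_def)
      then show ?thesis using True xW dens_change[OF c xW] by (simp add: ennreal_mult')
    next
      case False
      then have "?T x \<notin> ?X'" if "x \<in> ?W" using XT that by blast
      then have "h (?T x) = 0" if "x \<in> ?W" using that by (simp add: h_def)
      then show ?thesis using False by (cases "x \<in> ?W") auto
    qed
  qed
  also have "\<dots> = emeasure (chart_measure c) B" by (rule chart_measure_emeasure[OF c(1) B(1), symmetric])
  finally show ?thesis by simp
qed

definition is_riem_volume :: "'a measure \<Rightarrow> bool" where
  "is_riem_volume V \<longleftrightarrow> sets V = sets MB \<and>
     (\<forall>c\<in>\<A>. \<forall>B\<in>sets V. B \<subseteq> chart_dom c \<longrightarrow> emeasure V B = emeasure (chart_measure c) B)"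

lemma riem_volume_def': "riem_volume M \<A> g = (THE V. is_riem_volume V)"
proof -
  have "(sets V = sets MB \<and> (\<forall>c\<in>\<A>. \<forall>B\<in>sets V. B \<subseteq> chart_dom c \<longrightarrow>
        emeasure V B = (\<integral>\<^sup>+x\<in>chart_map c ` B. ennreal (sqrt (det (gram g c x))) \<partial>lborel))) \<longleftrightarrow> is_riem_volume V" for V
  proof -
    have "emeasure (chart_measure c) B = (\<integral>\<^sup>+x\<in>chart_map c ` B. ennreal (sqrt (det (gram g c x))) \<partial>lborel)"
      if "c \<in> \<A>" "B \<in> sets MB" "B \<subseteq> chart_dom c" for c B
      using chart_measure_emeasure[OF that(1,2)] chart_image_eq[OF that(1,3)] by (simp add: dens_def)
    then show ?thesis unfolding is_riem_volume_def by (intro conj_cong refl ball_cong imp_cong) auto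
  qed
  then show ?thesis unfolding riem_volume_def by presburger
qed

end

section \<open>Existence and uniqueness of the Riemannian volume\<close>

context closed_manifold begin

lemma chart_enumeration:
  "\<exists>m c. (\<forall>i<m::nat. c i \<in> \<A>) \<and> (\<Union>i<m. chart_dom (c i)) = M"
proof -
  have "(\<forall>U\<in>chart_dom ` \<A>. openin (top_of_set M) U) \<and> M \<subseteq> \<Union>(chart_dom ` \<A>)"
    using chart_facts(1) cover by blast
  then obtain D where D: "D \<subseteq> chart_dom ` \<A>" "finite D" "M \<subseteq> \<Union>D"
    using compact_M unfolding compact_eq_openin_cover by meson
  then obtain F where F: "F \<subseteq> \<A>" "finite F" "D = chart_dom ` F"
    using finite_subset_image by metis
  obtain c where c: "bij_betw c {0..<card F} F" using ex_bij_betw_nat_finite[OF F(2)] by blast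
  have cF: "c ` {..<card F} = F" using c by (simp add: bij_betw_def lessThan_atLeast0)
  then have cA: "c i \<in> \<A>" if "i < card F" for i using that F(1) by blast
  moreover have "(\<Union>i<card F. chart_dom (c i)) = M"
  proof
    have "(\<Union>i<card F. chart_dom (c i)) = (\<Union>x\<in>c ` {..<card F}. chart_dom x)" by blast
    also have "\<dots> = \<Union>D" by (simp only: cF F(3))
    finally show "M \<subseteq> (\<Union>i<card F. chart_dom (c i))" using D(3) by (simp only:)
    show "(\<Union>i<card F. chart_dom (c i)) \<subseteq> M" using cA chart_facts(4) by blast
  qed
  ultimately show ?thesis using cA by blast
qed

text \<open>Removing earlier domains from a finite cover by charts gives a finite Borel partition. A
  volume is determined on each piece by its chart, hence unique; the sum over the pieces is a volume
  because chart measures agree on overlaps.\<close>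

lemma riem_volume_exists_unique: "\<exists>!V. is_riem_volume V"
proof -
  obtain m c where c: "\<And>i. i < m \<Longrightarrow> c i \<in> \<A>" and M: "(\<Union>i<m::nat. chart_dom (c i)) = M"
    using chart_enumeration by blast
  define D where "D i = chart_dom (c i) - (\<Union>j<i. chart_dom (c j))" for i
  have D_sets: "D i \<in> sets MB" if "i < m" for i
    unfolding D_def using that chart_dom_sets[OF c] by (intro sets.Diff sets.finite_UN) auto
  have D_dom: "D i \<subseteq> chart_dom (c i)" for i by (auto simp: D_def)
  have D_disj: "disjoint_family_on D {..<m}"
    unfolding disjoint_family_on_def
  proof (intro ballI impI)
    fix i j :: nat assume "i \<noteq> j"
    moreover have "D i \<inter> D j = {}" if "i < j" for i j using that unfolding D_def by blast
    ultimately show "D i \<inter> D j = {}" by (metis Int_commute linorder_neqE_nat)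
  qed
  have D_cover: "(\<Union>i<m. D i) = M"
  proof
    show "(\<Union>i<m. D i) \<subseteq> M" using D_dom M by blast
    show "M \<subseteq> (\<Union>i<m. D i)"
    proof
      fix q assume "q \<in> M"
      then obtain i where i: "i < m" "q \<in> chart_dom (c i)" using M by blast
      define k where "k = (LEAST i. q \<in> chart_dom (c i))"
      have "q \<in> chart_dom (c k)" unfolding k_def using i(2) by (rule LeastI)
      moreover have "q \<notin> chart_dom (c j)" if "j < k" for j using that not_less_Least unfolding k_def by blast
      moreover have "k \<le> i" unfolding k_def using i(2) by (rule Least_le)
      ultimately show "q \<in> (\<Union>i<m. D i)" using i(1) by (auto simp: D_def intro!: bexI[of _ k])
    qed
  qed
  have split: "emeasure N B = (\<Sum>i<m. emeasure N (B \<inter> D i))" if N: "sets N = sets MB" "B \<in> sets MB" for N B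
  proof -
    have "B = (\<Union>i<m. B \<inter> D i)" using D_cover sets_MB_subset[OF N(2)] by blast
    moreover have "(\<Sum>i<m. emeasure N (B \<inter> D i)) = emeasure N (\<Union>i<m. B \<inter> D i)"
    proof (rule sum_emeasure)
      show "(\<lambda>i. B \<inter> D i) ` {..<m} \<subseteq> sets N" using N D_sets by auto
      show "disjoint_family_on (\<lambda>i. B \<inter> D i) {..<m}" using D_disj unfolding disjoint_family_on_def by blast
    qed simp
    ultimately show ?thesis by simp
  qed
  define \<mu> where "\<mu> B = (\<Sum>i<m. emeasure (chart_measure (c i)) (B \<inter> D i))" for B
  define V where "V = measure_of M (sets MB) \<mu>"
  have alg: "sigma_algebra M (sets MB)" using sets.sigma_algebra_axioms[of MB] by (simp add: space_restrict_space)
  have setsV: "sets V = sets MB" unfolding V_def using alg by (simp add: sigma_algebra.sets_measure_of_eq)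
  have emV: "emeasure V B = \<mu> B" if B: "B \<in> sets MB" for B
    unfolding V_def
  proof (rule emeasure_measure_of_sigma[OF alg _ _ B])
    show "positive (sets MB) \<mu>" by (simp add: positive_def \<mu>_def)
    show "countably_additive (sets MB) \<mu>"
    proof (rule countably_additiveI)
      fix A :: "nat \<Rightarrow> 'a set" assume A: "range A \<subseteq> sets MB" "disjoint_family A" "(\<Union>i. A i) \<in> sets MB"
      have "(\<Sum>n. \<mu> (A n)) = (\<Sum>i<m. \<Sum>n. emeasure (chart_measure (c i)) (A n \<inter> D i))"
        unfolding \<mu>_def by (rule suminf_sum) auto
      also have "\<dots> = (\<Sum>i<m. emeasure (chart_measure (c i)) (\<Union>n. A n \<inter> D i))"
        by (intro sum.cong refl suminf_emeasure) (use A D_sets in \<open>auto simp: disjoint_family_on_def\<close>)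
      also have "\<dots> = \<mu> (\<Union>n. A n)" unfolding \<mu>_def by simp
      finally show "(\<Sum>n. \<mu> (A n)) = \<mu> (\<Union>n. A n)" .
    qed
  qed
  have isV: "is_riem_volume V" unfolding is_riem_volume_def
  proof (intro conjI ballI impI)
    fix c' B assume c': "c' \<in> \<A>" and B: "B \<in> sets V" "B \<subseteq> chart_dom c'"
    have B': "B \<in> sets MB" using B setsV by simp
    have "emeasure V B = (\<Sum>i<m. emeasure (chart_measure (c i)) (B \<inter> D i))" using emV[OF B'] by (simp add: \<mu>_def)
    also have "\<dots> = (\<Sum>i<m. emeasure (chart_measure c') (B \<inter> D i))"
      by (intro sum.cong refl chart_measure_overlap c c') (use B B' D_sets D_dom in auto)
    also have "\<dots> = emeasure (chart_measure c') B" using split[OF _ B', of "chart_measure c'"] by simp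
    finally show "emeasure V B = emeasure (chart_measure c') B" .
  qed (rule setsV)
  moreover have "V' = V" if V': "is_riem_volume V'" for V'
  proof (rule measure_eqI)
    show sets: "sets V' = sets V" using V' setsV by (simp add: is_riem_volume_def)
    fix B assume "B \<in> sets V'"
    then have B: "B \<in> sets MB" using sets setsV by simp
    have "emeasure V' B = (\<Sum>i<m. emeasure V' (B \<inter> D i))" using split[OF _ B] sets setsV by simp
    also have "\<dots> = (\<Sum>i<m. emeasure (chart_measure (c i)) (B \<inter> D i))"
    proof (rule sum.cong[OF refl])
      fix i assume "i \<in> {..<m}"
      then have i: "i < m" by simp
      have "B \<inter> D i \<in> sets V'" using B D_sets[OF i] sets setsV by simp
      moreover have "B \<inter> D i \<subseteq> chart_dom (c i)" using D_dom by blast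
      ultimately show "emeasure V' (B \<inter> D i) = emeasure (chart_measure (c i)) (B \<inter> D i)"
        using V' c[OF i] unfolding is_riem_volume_def by blast
    qed
    also have "\<dots> = emeasure V B" using emV[OF B] by (simp add: \<mu>_def)
    finally show "emeasure V' B = emeasure V B" .
  qed
  ultimately show ?thesis by blast
qed

abbreviation Vol :: "'a measure" where "Vol \<equiv> riem_volume M \<A> g"

lemma riem_volume: "is_riem_volume Vol"
  unfolding riem_volume_def' by (rule theI'[OF riem_volume_exists_unique])

lemma sets_Vol [simp]: "sets Vol = sets MB"
  using riem_volume by (simp add: is_riem_volume_def)

lemma space_Vol [simp]: "space Vol = M"
  using sets_eq_imp_space_eq[OF sets_Vol] by (simp add: space_restrict_space)

lemma emeasure_Vol_chart:
  "c \<in> \<A> \<Longrightarrow> B \<in> sets MB \<Longrightarrow> B \<subseteq> chart_dom c \<Longrightarrow> emeasure Vol B = emeasure (chart_measure c) B"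
  using riem_volume by (simp add: is_riem_volume_def)

lemma chart_map_measurable:
  assumes c: "c \<in> \<A>"
  shows "chart_map c \<in> measurable (restrict_space Vol (chart_dom c)) borel"
proof -
  have "chart_map c \<in> measurable (restrict_space borel (chart_dom c)) borel"
    by (rule borel_measurable_continuous_on_restrict[OF chart_map_continuous[OF c]])
  moreover have "sets (restrict_space Vol (chart_dom c)) = sets (restrict_space borel (chart_dom c))"
  proof -
    have "sets (restrict_space Vol (chart_dom c)) = sets (restrict_space MB (chart_dom c))"
      by (rule sets_restrict_space_cong[OF sets_Vol])
    also have "\<dots> = sets (restrict_space borel (M \<inter> chart_dom c))" by (rule sets_restrict_restrict_space)
    also have "M \<inter> chart_dom c = chart_dom c" using chart_facts(4)[OF c] by blast
    finally show ?thesis .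
  qed
  ultimately show ?thesis using measurable_cong_sets[of "restrict_space Vol (chart_dom c)" "restrict_space borel (chart_dom c)" borel borel] by blast
qed

lemma chart_dom_Int_sets: "c \<in> \<A> \<Longrightarrow> chart_dom c \<inter> space Vol \<in> sets Vol"
  using chart_dom_sets[of c] chart_facts(4)[of c] by (simp add: Int_absorb2)

lemma distr_Vol_chart:
  assumes c: "c \<in> \<A>"
  shows "distr (restrict_space Vol (chart_dom c)) borel (chart_map c) =
    density lborel (\<lambda>x. ennreal (indicator (chart_img c) x * dens c x))" (is "?P = ?Q")
proof (rule measure_eqI)
  fix A assume "A \<in> sets ?P"
  then have A: "A \<in> sets borel" by simp
  have U: "chart_dom c \<in> sets MB" by (rule chart_dom_sets[OF c])
  note m = chart_map_measurable[OF c]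
  let ?B = "chart_map c -` A \<inter> space (restrict_space Vol (chart_dom c))"
  have Beq: "?B = {q \<in> chart_dom c. chart_map c q \<in> A}" using chart_facts(4)[OF c] by (auto simp: space_restrict_space)
  have "?B \<in> sets (restrict_space Vol (chart_dom c))" by (rule measurable_sets[OF m A])
  then have Bs: "?B \<in> sets MB" using sets_restrict_space_iff[OF chart_dom_Int_sets[OF c]] sets_Vol by blast
  have eq: "{x \<in> chart_img c. chart_inv c x \<in> ?B} = A \<inter> chart_img c" unfolding Beq using c by auto
  have "emeasure ?P A = emeasure (restrict_space Vol (chart_dom c)) ?B" by (rule emeasure_distr[OF m A])
  also have "\<dots> = emeasure Vol ?B" by (rule emeasure_restrict_space[OF chart_dom_Int_sets[OF c]]) (use Beq in blast)
  also have "\<dots> = emeasure (chart_measure c) ?B" by (rule emeasure_Vol_chart[OF c Bs]) (simp add: Beq)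
  also have "\<dots> = (\<integral>\<^sup>+x\<in>A \<inter> chart_img c. ennreal (dens c x) \<partial>lborel)" using chart_measure_emeasure[OF c Bs] eq by simp
  also have "\<dots> = (\<integral>\<^sup>+x. ennreal (indicator (chart_img c) x * dens c x) * indicator A x \<partial>lborel)"
    by (intro nn_integral_cong) (auto simp: indicator_def)
  also have "\<dots> = emeasure ?Q A" using dens_measurable[OF c] A by (intro emeasure_density[symmetric]) auto
  finally show "emeasure ?P A = emeasure ?Q A" .
qed simp

text \<open>The integrand vanishes off the image of \<open>B\<close>, so the integral can be moved
  into the chart. The indicator of \<open>B\<close> removes the arbitrary values of
  \<open>chart_inv c\<close> outside the chart image.\<close>

lemma integral_Vol_chart:
  assumes c: "c \<in> \<A>" and B: "B \<in> sets borel" "B \<subseteq> chart_img c"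
    and F: "continuous_on M F" "\<And>q. q \<in> M \<Longrightarrow> F q \<noteq> 0 \<Longrightarrow> q \<in> chart_inv c ` B"
  shows "(\<integral>q. F q \<partial>Vol) = (\<integral>x. indicator B x * (F (chart_inv c x) * dens c x) \<partial>lborel)"
proof -
  define h where "h x = indicator B x * F (chart_inv c x)" for x
  have hm: "h \<in> borel_measurable borel"
  proof -
    have "continuous_on (chart_img c) (\<lambda>x. F (chart_inv c x))"
      by (rule continuous_on_compose2[OF F(1) chart_inv_continuous[OF c]]) (use chart_inv_M[OF c] in auto)
    then have "(\<lambda>x. indicator (chart_img c) x *\<^sub>R F (chart_inv c x)) \<in> borel_measurable borel"
      using chart_facts(2)[OF c] by (intro borel_measurable_continuous_on_indicator) auto
    then have "(\<lambda>x. indicator B x * (indicator (chart_img c) x *\<^sub>R F (chart_inv c x))) \<in> borel_measurable borel"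
      using B by measurable
    also have "(\<lambda>x. indicator B x * (indicator (chart_img c) x *\<^sub>R F (chart_inv c x))) = h"
      using B(2) by (auto simp: h_def fun_eq_iff indicator_def)
    finally show ?thesis .
  qed
  have U: "chart_dom c \<in> sets MB" by (rule chart_dom_sets[OF c])
  note m = chart_map_measurable[OF c]
  have Fh: "F q = h (chart_map c q)" if q: "q \<in> chart_dom c" for q
  proof (cases "chart_map c q \<in> B")
    case False
    have "q \<notin> chart_inv c ` B"
    proof
      assume "q \<in> chart_inv c ` B"
      then obtain x where "x \<in> B" "q = chart_inv c x" by blast
      then show False using False B(2) c by auto
    qed
    then have "F q = 0" using F(2) q chart_facts(4)[OF c] by blast
    then show ?thesis using False by (simp add: h_def)
  qed (use q c in \<open>simp add: h_def\<close>)
  have "(\<integral>q. F q \<partial>Vol) = (\<integral>q. indicator (chart_dom c) q *\<^sub>R F q \<partial>Vol)"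
  proof (rule Bochner_Integration.integral_cong[OF refl])
    fix q assume "q \<in> space Vol"
    then show "F q = indicator (chart_dom c) q *\<^sub>R F q"
      using F(2)[of q] B(2) c by (cases "F q = 0") (auto simp: indicator_def)
  qed
  also have "\<dots> = (\<integral>q. F q \<partial>restrict_space Vol (chart_dom c))"
    by (rule integral_restrict_space[OF chart_dom_Int_sets[OF c], symmetric])
  also have "\<dots> = (\<integral>q. h (chart_map c q) \<partial>restrict_space Vol (chart_dom c))"
    by (rule Bochner_Integration.integral_cong[OF refl]) (use Fh in \<open>auto simp: space_restrict_space\<close>)
  also have "\<dots> = (\<integral>x. h x \<partial>distr (restrict_space Vol (chart_dom c)) borel (chart_map c))"
    by (rule integral_distr[OF m hm, symmetric])
  also have "\<dots> = (\<integral>x. (indicator (chart_img c) x * dens c x) *\<^sub>R h x \<partial>lborel)"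
    unfolding distr_Vol_chart[OF c] using hm dens_measurable[OF c] dens_pos[OF c]
    by (intro integral_density) (auto simp: indicator_def less_imp_le)
  also have "\<dots> = (\<integral>x. indicator B x * (F (chart_inv c x) * dens c x) \<partial>lborel)"
    by (rule Bochner_Integration.integral_cong[OF refl]) (use B(2) in \<open>auto simp: h_def indicator_def\<close>)
  finally show ?thesis .
qed

lemma emeasure_Vol_ball:
  assumes c: "c \<in> \<A>" and K: "cball z r \<subseteq> chart_img c" and U: "U \<subseteq> cball z r" "U \<in> sets borel"
  shows "emeasure Vol (chart_inv c ` U) = (\<integral>\<^sup>+x\<in>U. ennreal (dens c x) \<partial>lborel)" "chart_inv c ` U \<in> sets MB"
proof -
  have UI: "U \<subseteq> chart_img c" using U K by blast
  have eq: "chart_inv c ` U = {q \<in> chart_dom c. chart_map c q \<in> U}" using UI c by (force simp: image_iff subset_iff)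
  have m: "chart_map c \<in> measurable (restrict_space borel (chart_dom c)) borel"
    by (rule borel_measurable_continuous_on_restrict[OF chart_map_continuous[OF c]])
  have "chart_map c -` U \<inter> space (restrict_space borel (chart_dom c)) \<in> sets (restrict_space borel (chart_dom c))"
    by (rule measurable_sets[OF m U(2)])
  moreover have "chart_map c -` U \<inter> space (restrict_space borel (chart_dom c)) = chart_inv c ` U"
    by (auto simp: eq space_restrict_space)
  ultimately have "chart_inv c ` U \<in> sets (restrict_space borel (chart_dom c))" by simp
  then obtain X where X: "X \<in> sets borel" "chart_inv c ` U = chart_dom c \<inter> X" by (auto simp: sets_restrict_space)
  have "chart_dom c \<inter> X = chart_dom c \<inter> (M \<inter> X)" using chart_facts(4)[OF c] by blast
  moreover have "M \<inter> X \<in> sets MB" using X(1) by (auto simp: sets_restrict_space)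
  ultimately show s: "chart_inv c ` U \<in> sets MB" using X(2) chart_dom_sets[OF c] by auto
  have sub: "chart_inv c ` U \<subseteq> chart_dom c" by (auto simp: eq)
  have "{x \<in> chart_img c. chart_inv c x \<in> chart_inv c ` U} = U" unfolding eq using UI c by auto
  then show "emeasure Vol (chart_inv c ` U) = (\<integral>\<^sup>+x\<in>U. ennreal (dens c x) \<partial>lborel)"
    using emeasure_Vol_chart[OF c s sub] chart_measure_emeasure[OF c s] by simp
qed

end

section \<open>Integrals of radial kernels\<close>

text \<open>The proof shows an equality of measures; integrals against equal measures agree for
  every Borel function, integrable or not.\<close>

theorem integral_change_of_variables:
  fixes f :: "real ^ 'n::finite \<Rightarrow> real ^ 'n" and h :: "real ^ 'n \<Rightarrow> real"
  assumes U: "open U" and der: "\<And>x. x \<in> U \<Longrightarrow> (f has_derivative f' x) (at x)" and inj: "inj_on f U"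
    and cont: "continuous_on U (\<lambda>x. det (matrix (f' x)))"
    and h [measurable]: "h \<in> borel_measurable borel"
  shows "(\<integral>y. indicator (f ` U) y * h y \<partial>lborel) = (\<integral>x. indicator U x * (\<bar>det (matrix (f' x))\<bar> * h (f x)) \<partial>lborel)"
proof -
  let ?J = "\<lambda>x. indicator U x * \<bar>det (matrix (f' x))\<bar>"
  let ?f = "\<lambda>x. indicator U x *\<^sub>R f x"
  have cf: "continuous_on U f"
    using der has_derivative_at_withinI has_derivative_continuous_on by blast
  have [measurable]: "U \<in> sets borel" using U by simp
  have fm [measurable]: "?f \<in> borel_measurable borel"
    using cf U by (intro borel_measurable_continuous_on_indicator) auto
  have "(\<lambda>x. indicator U x *\<^sub>R \<bar>det (matrix (f' x))\<bar>) \<in> borel_measurable borel"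
    using cont U by (intro borel_measurable_continuous_on_indicator continuous_intros) auto
  then have Jm [measurable]: "?J \<in> borel_measurable borel" by simp
  have fU [measurable]: "f ` U \<in> sets borel"
    using invariance_of_domain[OF cf U inj] by simp
  define Q where "Q = distr (density lborel (\<lambda>x. ennreal (?J x))) borel ?f"
  define R where "R = density lborel (\<lambda>y. ennreal (indicator (f ` U) y))"
  have "R = Q"
  proof (rule measure_eqI)
    fix A assume "A \<in> sets R"
    then have A [measurable]: "A \<in> sets borel" by (simp add: R_def)
    have "emeasure R A = (\<integral>\<^sup>+y\<in>f ` U. indicator A y \<partial>lborel)"
      unfolding R_def by (subst emeasure_density) (auto intro!: nn_integral_cong simp: indicator_def)
    also have "\<dots> = (\<integral>\<^sup>+x\<in>U. ennreal \<bar>det (matrix (f' x))\<bar> * indicator A (f x) \<partial>lborel)"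
      by (rule nn_integral_change_of_variables[OF U der inj cont]) auto
    also have "\<dots> = (\<integral>\<^sup>+x. ennreal (?J x) * indicator (?f -` A) x \<partial>lborel)"
      by (intro nn_integral_cong) (auto simp: indicator_def)
    also have "\<dots> = emeasure Q A"
      unfolding Q_def using A measurable_sets_borel[OF fm A]
      by (subst emeasure_distr, simp, simp, subst emeasure_density) auto
    finally show "emeasure R A = emeasure Q A" .
  qed (simp add: Q_def R_def)
  have "(\<integral>y. indicator (f ` U) y * h y \<partial>lborel) = (\<integral>y. h y \<partial>R)"
    unfolding R_def by (subst integral_density) auto
  also have "\<dots> = (\<integral>y. h y \<partial>Q)" by (simp add: \<open>R = Q\<close>)
  also have "\<dots> = (\<integral>x. ?J x *\<^sub>R h (?f x) \<partial>lborel)"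
    unfolding Q_def by (subst integral_distr, simp, simp, subst integral_density) auto
  also have "\<dots> = (\<integral>x. indicator U x * (\<bar>det (matrix (f' x))\<bar> * h (f x)) \<partial>lborel)"
    by (intro Bochner_Integration.integral_cong refl) (auto simp: indicator_def)
  finally show ?thesis .
qed

lemma integral_matrix_substitution:
  fixes A :: "real ^ 'n::finite ^ 'n" and h :: "real ^ 'n \<Rightarrow> real"
  assumes A: "det A \<noteq> 0" and h: "h \<in> borel_measurable borel"
  shows "(\<integral>y. h y \<partial>lborel) = \<bar>det A\<bar> * (\<integral>x. h (A *v x) \<partial>lborel)"
proof -
  have inv: "invertible A" using A invertible_det_nz by blast
  have inj: "inj_on ((*v) A) UNIV" using inv by (simp add: inj_matrix_vector_mult)
  have "surj ((*v) A)" using inv by (metis invertible_def surjI matrix_vector_mul_assoc matrix_vector_mul_lid)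
  moreover have "(\<integral>y. indicator (((*v) A) ` UNIV) y * h y \<partial>lborel) =
      (\<integral>x. indicator UNIV x * (\<bar>det (matrix ((*v) A))\<bar> * h (A *v x)) \<partial>lborel)"
  proof (rule integral_change_of_variables[OF open_UNIV _ inj _ h])
    show "((*v) A has_derivative (*v) A) (at x)" for x
      by (rule bounded_linear_imp_has_derivative[OF matrix_vector_mul_bounded_linear])
  qed simp
  ultimately show ?thesis by simp
qed

lemma integral_orthogonal_matrix:
  fixes A :: "real ^ 'n::finite ^ 'n" and h :: "real ^ 'n \<Rightarrow> real"
  assumes A: "orthogonal_matrix A" and h: "h \<in> borel_measurable borel"
  shows "(\<integral>y. h y \<partial>lborel) = (\<integral>x. h (A *v x) \<partial>lborel)"
  using integral_matrix_substitution[OF _ h, of A] det_orthogonal_matrix[OF A] by auto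

lemma norm_orthogonal_matrix:
  fixes A :: "real ^ 'n::finite ^ 'n"
  shows "orthogonal_matrix A \<Longrightarrow> norm (A *v x) = norm x"
  using orthogonal_transformation_matrix[of "(*v) A"] orthogonal_transformation_norm[of "(*v) A" x]
  by (simp add: matrix_vector_mul_linear)

lemma involution_orthogonal:
  fixes A :: "real ^ 'n::finite ^ 'n"
  assumes "transpose A = A" "\<And>x. A *v (A *v x) = x"
  shows "orthogonal_matrix A"
proof -
  have "A ** A = mat 1" using assms(2) by (simp add: matrix_eq matrix_vector_mul_assoc)
  then show ?thesis using assms(1) by (simp add: orthogonal_matrix_def)
qed

text \<open>Sign changes and swaps of coordinates are orthogonal, and invariance under these two
  families determines the second moments of a radial weight up to one number.\<close>

definition reflect_coord :: "'n \<Rightarrow> real ^ 'n::finite ^ 'n" where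
  "reflect_coord i = (\<chi> a b. if a = b then (if a = i then - 1 else 1) else 0)"

definition swap_coord :: "'n \<Rightarrow> 'n \<Rightarrow> real ^ 'n::finite ^ 'n" where
  "swap_coord i j = (\<chi> a b. if b = Transposition.transpose i j a then 1 else 0)"

lemma reflect_coord_apply: "(reflect_coord i *v s) $ a = (if a = i then - s $ a else s $ a)"
proof -
  have "(\<Sum>b\<in>UNIV. (if a = b then (if a = i then - 1 else 1) else 0) * s $ b) = (\<Sum>b\<in>UNIV. if a = b then (if a = i then - s $ b else s $ b) else 0)"
    by (rule sum.cong) auto
  then show ?thesis by (simp add: reflect_coord_def matrix_vector_mult_def)
qed

lemma swap_coord_apply: "(swap_coord i j *v s) $ a = s $ (Transposition.transpose i j a)"
proof -
  have "(\<Sum>b\<in>UNIV. (if b = Transposition.transpose i j a then 1 else 0) * s $ b) = (\<Sum>b\<in>UNIV. if b = Transposition.transpose i j a then s $ b else 0)"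
    by (rule sum.cong) auto
  then show ?thesis by (simp add: swap_coord_def matrix_vector_mult_def)
qed

lemma orthogonal_reflect_coord: "orthogonal_matrix (reflect_coord i)"
proof (rule involution_orthogonal)
  show "Finite_Cartesian_Product.transpose (reflect_coord i) = reflect_coord i"
    by (auto simp: vec_eq_iff reflect_coord_def Finite_Cartesian_Product.transpose_def)
qed (auto simp: vec_eq_iff reflect_coord_apply)

lemma orthogonal_swap_coord: "orthogonal_matrix (swap_coord i j)"
proof (rule involution_orthogonal)
  show "Finite_Cartesian_Product.transpose (swap_coord i j) = swap_coord i j"
    by (auto simp: vec_eq_iff swap_coord_def Finite_Cartesian_Product.transpose_def)
qed (auto simp: vec_eq_iff swap_coord_apply)

locale radial_kernel =
  fixes k :: "real \<Rightarrow> real" and R :: real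
  assumes k_cont: "continuous_on {0..} k" and k_supp: "r > R \<Longrightarrow> k r = 0" and R_pos: "R > 0"
begin

lemma k_norm_measurable [measurable]: "(\<lambda>s :: 'a::euclidean_space. k (norm s)) \<in> borel_measurable borel"
proof (rule borel_measurable_continuous_onI)
  show "continuous_on UNIV (\<lambda>s :: 'a. k (norm s))"
    by (rule continuous_on_compose2[OF k_cont continuous_on_norm_id]) auto
qed

lemma k_bound: "\<exists>B>0. \<forall>r\<ge>0. \<bar>k r\<bar> \<le> B"
proof -
  have "compact (k ` {0..R})" by (rule compact_continuous_image[OF continuous_on_subset[OF k_cont]]) auto
  then have "bounded (k ` {0..R})" by (rule compact_imp_bounded)
  then obtain B where B: "\<forall>x\<in>k ` {0..R}. norm x \<le> B" unfolding bounded_iff by blast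
  have "\<bar>k r\<bar> \<le> \<bar>B\<bar> + 1" if "r \<ge> 0" for r
  proof (cases "r \<le> R")
    case True
    then have "norm (k r) \<le> B" using B that by auto
    then show ?thesis by simp
  qed (use k_supp in auto)
  then show ?thesis by (intro exI[of _ "\<bar>B\<bar> + 1"]) auto
qed

lemma integrable_radial:
  fixes p :: "real ^ 'n::finite \<Rightarrow> real"
  assumes p: "continuous_on UNIV p"
  shows "integrable lborel (\<lambda>s. k (norm s) * p s)"
proof -
  obtain B where B: "B > 0" "\<And>r. r \<ge> 0 \<Longrightarrow> \<bar>k r\<bar> \<le> B" using k_bound by blast
  have "compact (p ` cball 0 R)" by (rule compact_continuous_image[OF continuous_on_subset[OF p]]) auto
  then have "bounded (p ` cball 0 R)" by (rule compact_imp_bounded)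
  then obtain P where P: "\<forall>x\<in>p ` cball 0 R. norm x \<le> P" unfolding bounded_iff by blast
  have pm [measurable]: "p \<in> borel_measurable borel" using p by (rule borel_measurable_continuous_onI)
  show ?thesis
  proof (rule integrableI_bounded_set[where A = "cball 0 R" and B = "B * P"])
    show "emeasure lborel (cball (0 :: real ^ 'n) R) < \<infinity>"
      using emeasure_bounded_finite[OF bounded_cball] by blast
    have "norm (k (norm s) * p s) \<le> B * P" if "s \<in> cball 0 R" for s
    proof -
      have "\<bar>p s\<bar> \<le> P" using P that by auto
      then show ?thesis using B(2)[of "norm s"] B(1) by (simp add: abs_mult mult_mono)
    qed
    then show "AE s in lborel. s \<in> cball 0 R \<longrightarrow> norm (k (norm s) * p s) \<le> B * P" by blast
    show "AE s in lborel. s \<notin> cball 0 R \<longrightarrow> k (norm s) * p s = 0" using k_supp by auto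
  qed auto
qed

text \<open>The reflection in coordinate \<open>i\<close> preserves the weight and flips the sign of
  the integrand.\<close>

lemma moment_off_diagonal:
  fixes i j :: "'n::finite"
  assumes "i \<noteq> j"
  shows "(\<integral>s. k (norm (s :: real ^ 'n)) * (s $ i * s $ j) \<partial>lborel) = 0"
proof -
  have "(\<integral>s. k (norm (s :: real ^ 'n)) * (s $ i * s $ j) \<partial>lborel) = (\<integral>s. - (k (norm (s :: real ^ 'n)) * (s $ i * s $ j)) \<partial>lborel)"
    by (subst integral_orthogonal_matrix[OF orthogonal_reflect_coord[of i]])
      (use assms in \<open>simp_all add: norm_orthogonal_matrix[OF orthogonal_reflect_coord] reflect_coord_apply\<close>)
  then show ?thesis by simp
qed

lemma moment_diagonal:
  fixes i j :: "'n::finite"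
  shows "(\<integral>s. k (norm (s :: real ^ 'n)) * (s $ i * s $ i) \<partial>lborel) = (\<integral>s. k (norm (s :: real ^ 'n)) * (s $ j * s $ j) \<partial>lborel)"
  by (subst integral_orthogonal_matrix[OF orthogonal_swap_coord[of i j]])
    (simp_all add: norm_orthogonal_matrix[OF orthogonal_swap_coord] swap_coord_apply)

lemma moment_linear:
  fixes l :: "real ^ 'n::finite \<Rightarrow> real"
  assumes l: "linear l"
  shows "(\<integral>s. k (norm s) * l s \<partial>lborel) = 0"
proof -
  have lm [measurable]: "l \<in> borel_measurable borel"
    using l by (intro borel_measurable_continuous_onI linear_continuous_on) (simp add: linear_conv_bounded_linear)
  let ?A = "(- 1) *\<^sub>R mat 1 :: real ^ 'n ^ 'n"
  have A: "?A *v s = - s" for s by (simp only: scaleR_matrix_vector_assoc[symmetric]) simp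
  have orth: "orthogonal_matrix ?A"
  proof (rule involution_orthogonal)
    show "Finite_Cartesian_Product.transpose ?A = ?A"
      by (auto simp: vec_eq_iff Finite_Cartesian_Product.transpose_def mat_def)
    show "?A *v (?A *v x) = x" for x unfolding A by simp
  qed
  have "(\<integral>s. k (norm s) * l s \<partial>lborel) = (\<integral>s. - (k (norm s) * l s) \<partial>lborel)"
    by (subst integral_orthogonal_matrix[OF orth], simp, simp only: A norm_minus_cancel linear_neg[OF l] mult_minus_right)
  then show ?thesis by simp
qed

text \<open>Polar coordinates for a radial integrand: on the ball of radius \<open>R\<close> the
  norm is distributed with the derivative of the ball volume as density. The two distributions are
  compared on upper half-lines.\<close>

lemma radial_integral:
  "(\<integral>s. k (norm (s :: real ^ 'n::finite)) * (norm s)\<^sup>2 \<partial>lborel) =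
    CARD('n) * unit_ball_vol CARD('n) * integral {0..} (\<lambda>r. k r * r ^ (CARD('n) + 1))"
proof -
  let ?n = "CARD('n)" and ?w = "unit_ball_vol (real CARD('n))"
  have w: "?w \<ge> 0" by simp
  have n: "?n \<ge> 1" by (simp add: Suc_leI)
  \<comment> \<open>The restriction to the ball that contains the support makes the measure finite,
    as the comparison on half-lines requires.\<close>
  define P where "P = distr (density lborel (\<lambda>s :: real ^ 'n. ennreal (indicator (cball 0 R) s))) borel norm"
  define d where "d r = indicator {0..R} r * (?n * ?w * r ^ (?n - 1))" for r
  define N where "N = density lborel (\<lambda>r. ennreal (d r))"
  have dm [measurable]: "d \<in> borel_measurable borel" unfolding d_def by measurable
  have vol: "emeasure lborel (cball (0 :: real ^ 'n) r) = ennreal (?w * r ^ ?n)" if "r \<ge> 0" for r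
    using emeasure_cball[OF that, of "0 :: real ^ 'n"] by simp
  have nm: "(norm :: real ^ 'n \<Rightarrow> real) \<in> borel_measurable borel" by simp
  have [measurable]: "cball (0 :: real ^ 'n) R \<in> sets borel" by simp
  have eP: "emeasure P {x<..} = emeasure lborel (cball (0 :: real ^ 'n) R \<inter> {s. x < norm s})" for x
  proof -
    have "emeasure P {x<..} = emeasure (density lborel (\<lambda>s :: real ^ 'n. ennreal (indicator (cball 0 R) s))) (norm -` {x<..})"
      unfolding P_def by (subst emeasure_distr) auto
    also have "\<dots> = (\<integral>\<^sup>+s. ennreal (indicator (cball 0 R) s) * indicator (norm -` {x<..}) (s :: real ^ 'n) \<partial>lborel)"
      using measurable_sets_borel[OF nm, of "{x<..}"] by (subst emeasure_density) auto
    also have "\<dots> = (\<integral>\<^sup>+s. indicator (cball 0 R \<inter> {s. x < norm s}) (s :: real ^ 'n) \<partial>lborel)"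
      by (intro nn_integral_cong) (auto simp: indicator_def)
    also have "\<dots> = emeasure lborel (cball (0 :: real ^ 'n) R \<inter> {s. x < norm s})" by (rule nn_integral_indicator) measurable
    finally show ?thesis .
  qed
  have eN: "emeasure N {x<..} = (\<integral>\<^sup>+r. ennreal (?n * ?w * r ^ (?n - 1)) * indicator {max x 0..R} r \<partial>lborel)" for x
  proof -
    have "emeasure N {x<..} = (\<integral>\<^sup>+r. ennreal (d r) * indicator {x<..} r \<partial>lborel)"
      unfolding N_def by (subst emeasure_density) auto
    also have "\<dots> = (\<integral>\<^sup>+r. ennreal (?n * ?w * r ^ (?n - 1)) * indicator {max x 0..R} r \<partial>lborel)"
    \<comment> \<open>The two integrands can differ at the single point \<open>x\<close>
      only.\<close>
    proof (rule nn_integral_cong_AE)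
      show "AE r in lborel. ennreal (d r) * indicator {x<..} r = ennreal (?n * ?w * r ^ (?n - 1)) * indicator {max x 0..R} r"
        using AE_lborel_singleton[of x]
        by eventually_elim (auto simp: d_def indicator_def)
    qed
    finally show ?thesis .
  qed
  have ftc: "(\<integral>\<^sup>+r. ennreal (?n * ?w * r ^ (?n - 1)) * indicator {a..R} r \<partial>lborel) = ennreal (?w * R ^ ?n - ?w * a ^ ?n)"
    if "0 \<le> a" "a \<le> R" for a
  proof -
    have 1: "((\<lambda>r. ?w * r ^ ?n) has_real_derivative ?n * ?w * r ^ (?n - 1)) (at r)" for r
      by (auto intro!: derivative_eq_intros)
    have 2: "0 \<le> ?n * ?w * r ^ (?n - 1)" if "a \<le> r" for r using that \<open>0 \<le> a\<close> w by simp
    show ?thesis by (rule nn_integral_FTC_Icc[where F = "\<lambda>r. ?w * r ^ ?n"]) (use 1 2 that in \<open>auto intro: has_field_derivative_at_within\<close>)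
  qed
  have "P = N"
  proof (rule measure_eqI_lessThan)
    show "sets P = sets borel" "sets N = sets borel" by (simp_all add: P_def N_def)
    fix x
    have "emeasure P {x<..} \<le> emeasure lborel (cball (0 :: real ^ 'n) R)" unfolding eP by (intro emeasure_mono) auto
    also have "\<dots> < \<infinity>" using R_pos by (simp add: vol)
    finally show "emeasure P {x<..} < \<infinity>" .
    consider "x < 0" | "0 \<le> x" "x < R" | "R \<le> x" by linarith
    then show "emeasure P {x<..} = emeasure N {x<..}"
    proof cases
      case 1
      then have "cball (0 :: real ^ 'n) R \<inter> {s. x < norm s} = cball 0 R"
        using order_less_le_trans[OF 1 norm_ge_zero] by auto
      then have "emeasure P {x<..} = ennreal (?w * R ^ ?n)" using R_pos by (simp add: eP vol)
      also have "\<dots> = emeasure N {x<..}" unfolding eN using 1 ftc[of 0] R_pos n by (simp add: max_def)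
      finally show ?thesis .
    next
      case 2
      have "cball (0 :: real ^ 'n) R \<inter> {s. x < norm s} = cball 0 R - cball 0 x" by auto
      then have "emeasure P {x<..} = emeasure lborel (cball (0 :: real ^ 'n) R) - emeasure lborel (cball (0 :: real ^ 'n) x)"
      proof -
        have "emeasure lborel (cball (0 :: real ^ 'n) R - cball 0 x) =
            emeasure lborel (cball (0 :: real ^ 'n) R) - emeasure lborel (cball (0 :: real ^ 'n) x)"
        proof (rule emeasure_Diff)
          show "emeasure lborel (cball (0 :: real ^ 'n) x) \<noteq> \<infinity>" using 2 by (simp add: vol)
          show "cball (0 :: real ^ 'n) x \<subseteq> cball 0 R" using 2 by (intro subset_cball) simp
        qed simp_all
        then show ?thesis unfolding eP \<open>cball (0 :: real ^ 'n) R \<inter> {s. x < norm s} = cball 0 R - cball 0 x\<close> .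
      qed
      also have "\<dots> = ennreal (?w * R ^ ?n - ?w * x ^ ?n)" using 2 R_pos by (simp add: vol ennreal_minus)
      also have "\<dots> = emeasure N {x<..}" unfolding eN using 2 ftc[of x] by (simp add: max_def)
      finally show ?thesis .
    next
      case 3
      then have "cball (0 :: real ^ 'n) R \<inter> {s. x < norm s} = {}" by auto
      then have "emeasure P {x<..} = 0" by (simp add: eP)
      moreover have "emeasure N {x<..} = 0"
      proof (cases "x = R")
        case True
        then show ?thesis unfolding eN using ftc[of R] R_pos by (simp add: max_def)
      next
        case False
        then have "{max x 0..R} = {}" using 3 by auto
        then show ?thesis unfolding eN by simp
      qed
      ultimately show ?thesis by simp
    qed
  qed
  define h where "h r = indicator {0..R} r * (k r * r\<^sup>2)" for r
  have hm [measurable]: "h \<in> borel_measurable borel"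
  proof -
    have "(\<lambda>r. indicator {0..R} r *\<^sub>R (k r * r\<^sup>2)) \<in> borel_measurable borel"
      by (rule borel_measurable_continuous_on_indicator)
        (auto intro!: continuous_intros continuous_on_subset[OF k_cont])
    then show ?thesis by (simp add: h_def[abs_def])
  qed
  have "(\<integral>s. k (norm (s :: real ^ 'n)) * (norm s)\<^sup>2 \<partial>lborel) = (\<integral>s. indicator (cball 0 R) s *\<^sub>R h (norm (s :: real ^ 'n)) \<partial>lborel)"
    by (rule Bochner_Integration.integral_cong[OF refl]) (auto simp: h_def indicator_def k_supp)
  also have "\<dots> = (\<integral>r. h r \<partial>P)"
    unfolding P_def by (subst integral_distr, simp, simp, subst integral_density) auto
  also have "\<dots> = (\<integral>r. d r *\<^sub>R h r \<partial>lborel)"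
    unfolding \<open>P = N\<close> N_def by (rule integral_density) (auto simp: d_def indicator_def)
  also have "\<dots> = (\<integral>r. (?n * ?w) * (indicator {0..R} r *\<^sub>R (k r * r ^ (?n + 1))) \<partial>lborel)"
  proof (rule Bochner_Integration.integral_cong[OF refl])
    fix r :: real
    have "r ^ (?n - 1) * r\<^sup>2 = r ^ (?n + 1)" using n by (simp add: power_add[symmetric])
    then show "d r *\<^sub>R h r = (?n * ?w) * (indicator {0..R} r *\<^sub>R (k r * r ^ (?n + 1)))"
      by (auto simp: d_def h_def indicator_def mult_ac)
  qed
  also have "\<dots> = (?n * ?w) * (\<integral>r. indicator {0..R} r *\<^sub>R (k r * r ^ (?n + 1)) \<partial>lborel)"
    by (rule integral_mult_right_zero)
  also have "(\<integral>r. indicator {0..R} r *\<^sub>R (k r * r ^ (?n + 1)) \<partial>lborel) = integral {0..R} (\<lambda>r. k r * r ^ (?n + 1))"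
  proof -
    have "set_integrable lborel {0..R} (\<lambda>r. k r * r ^ (?n + 1))"
      by (rule borel_integrable_atLeastAtMost') (auto intro!: continuous_intros continuous_on_subset[OF k_cont])
    from set_borel_integral_eq_integral(2)[OF this] show ?thesis by (simp add: set_lebesgue_integral_def)
  qed
  also have "\<dots> = integral {0..} (\<lambda>r. k r * r ^ (?n + 1))"
  proof -
    have "integral {0..R} (\<lambda>r. k r * r ^ (?n + 1)) = integral UNIV (\<lambda>r. if r \<in> {0..R} then k r * r ^ (?n + 1) else 0)"
      by (rule integral_restrict_UNIV[symmetric])
    also have "(\<lambda>r. if r \<in> {0..R} then k r * r ^ (?n + 1) else 0) = (\<lambda>r. if r \<in> {0..} then k r * r ^ (?n + 1) else 0)"
      using k_supp by (auto simp: fun_eq_iff)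
    also have "integral UNIV \<dots> = integral {0..} (\<lambda>r. k r * r ^ (?n + 1))" by (simp only: integral_restrict_UNIV)
    finally show ?thesis .
  qed
  finally show ?thesis by simp
qed

text \<open>The second moment of the kernel in any one coordinate, see \<open>moment_eq\<close>; the
  type argument carries the dimension.\<close>

definition moment :: "'n::finite itself \<Rightarrow> real" where
  "moment _ = unit_ball_vol CARD('n) * integral {0..} (\<lambda>r. k r * r ^ (CARD('n) + 1))"

text \<open>All coordinates have the same second moment, and their sum is the radial integral with
  the weight of the squared norm.\<close>

lemma moment_eq:
  fixes i :: "'n::finite"
  shows "(\<integral>s. k (norm (s :: real ^ 'n)) * (s $ i * s $ i) \<partial>lborel) = moment TYPE('n)"
proof -
  let ?m = "\<lambda>j. (\<integral>s. k (norm (s :: real ^ 'n)) * (s $ j * s $ j) \<partial>lborel)"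
  have "real CARD('n) * ?m i = (\<Sum>j\<in>(UNIV :: 'n set). ?m j)"
  proof -
    have "(\<Sum>j\<in>(UNIV :: 'n set). ?m j) = (\<Sum>j\<in>(UNIV :: 'n set). ?m i)"
      by (rule sum.cong[OF refl moment_diagonal])
    then show ?thesis by simp
  qed
  also have "\<dots> = (\<integral>s. (\<Sum>j\<in>UNIV. k (norm (s :: real ^ 'n)) * (s $ j * s $ j)) \<partial>lborel)"
    by (rule Bochner_Integration.integral_sum[symmetric]) (intro integrable_radial continuous_intros)
  also have "\<dots> = (\<integral>s. k (norm (s :: real ^ 'n)) * (norm s)\<^sup>2 \<partial>lborel)"
    by (intro Bochner_Integration.integral_cong refl)
      (simp add: sum_distrib_left[symmetric] power2_norm_eq_inner inner_vec_def)
  also have "\<dots> = real CARD('n) * moment TYPE('n)" by (simp add: radial_integral moment_def)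
  finally show ?thesis by simp
qed

text \<open>Odd and mixed terms integrate to 0 and the diagonal ones share one moment, so the trace
  of \<open>B\<close> is what survives.\<close>

lemma radial_quadratic:
  fixes l :: "real ^ 'n::finite \<Rightarrow> real" and B :: "real ^ 'n \<Rightarrow> real ^ 'n \<Rightarrow> real"
  assumes l: "linear l" and B: "bilinear B"
  shows "(\<integral>s. k (norm s) * (l s + B s s) \<partial>lborel) = moment TYPE('n) * (\<Sum>i\<in>UNIV. B (axis i 1) (axis i 1))"
proof -
  let ?b = "\<lambda>i j. B (axis i 1) (axis j 1)"
  have cl: "continuous_on UNIV l" using l by (simp add: linear_continuous_on linear_conv_bounded_linear)
  have "k (norm s) * (l s + B s s) = k (norm s) * l s + (\<Sum>i\<in>UNIV. \<Sum>j\<in>UNIV. ?b i j * (k (norm s) * (s $ i * s $ j)))" for s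
    by (subst bilinear_expand[OF B, of s s]) (simp add: distrib_left sum_distrib_left mult_ac)
  then have "(\<integral>s. k (norm s) * (l s + B s s) \<partial>lborel) =
      (\<integral>s. k (norm s) * l s + (\<Sum>i\<in>UNIV. \<Sum>j\<in>UNIV. ?b i j * (k (norm s) * (s $ i * s $ j))) \<partial>lborel)" by presburger
  also have "\<dots> = (\<integral>s. k (norm s) * l s \<partial>lborel) + (\<integral>s. (\<Sum>i\<in>UNIV. \<Sum>j\<in>UNIV. ?b i j * (k (norm (s :: real ^ 'n)) * (s $ i * s $ j))) \<partial>lborel)"
    by (intro Bochner_Integration.integral_add integrable_radial cl Bochner_Integration.integrable_sum integrable_mult_right)
      (auto intro!: continuous_intros)
  also have "(\<integral>s. (\<Sum>i\<in>UNIV. \<Sum>j\<in>UNIV. ?b i j * (k (norm (s :: real ^ 'n)) * (s $ i * s $ j))) \<partial>lborel) =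
     (\<Sum>i\<in>UNIV. \<Sum>j\<in>UNIV. ?b i j * (\<integral>s. k (norm (s :: real ^ 'n)) * (s $ i * s $ j) \<partial>lborel))"
    by (subst Bochner_Integration.integral_sum, (intro Bochner_Integration.integrable_sum integrable_mult_right integrable_radial continuous_intros),
        intro sum.cong refl, subst Bochner_Integration.integral_sum, (intro integrable_mult_right integrable_radial continuous_intros),
        intro sum.cong refl integral_mult_right_zero)
  also have "\<dots> = (\<Sum>i\<in>UNIV. \<Sum>j\<in>UNIV. if i = j then ?b i j * moment TYPE('n) else 0)"
    by (intro sum.cong refl) (auto simp: moment_off_diagonal moment_eq)
  also have "\<dots> = moment TYPE('n) * (\<Sum>i\<in>UNIV. ?b i i)" by (simp add: sum_distrib_left mult.commute)
  finally show ?thesis using moment_linear[OF l] by simp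
qed

text \<open>The substitution u = \<epsilon> T s with a frame \<open>T\<close> turns the length for
  \<open>b\<close> into \<epsilon> times the Euclidean norm. Its Jacobian contributes \<epsilon>^n,
  the determinant of \<open>T\<close> cancels the density, and the quadratic term contributes
  another \<epsilon>^2.\<close>

lemma quadratic_kernel_integral:
  fixes l :: "real ^ 'n::finite \<Rightarrow> real" and B b :: "real ^ 'n \<Rightarrow> real ^ 'n \<Rightarrow> real"
  assumes l: "linear l" and B: "bilinear B" and b: "bilinear b" and T: "is_frame b T" and \<epsilon>: "\<epsilon> > 0"
  shows "sqrt (det (form_matrix b)) * (\<integral>u. k (sqrt (b u u) / \<epsilon>) * (l u + B u u) \<partial>lborel) =
    \<epsilon> ^ (CARD('n) + 2) * moment TYPE('n) * (\<Sum>i\<in>UNIV. B (T *v axis i 1) (T *v axis i 1))"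
proof -
  let ?n = "CARD('n)"
  let ?h = "\<lambda>u. k (sqrt (b u u) / \<epsilon>) * (l u + B u u)"
  have dT: "sqrt (det (form_matrix b)) * \<bar>det T\<bar> = 1" by (rule frame_det(2)[OF b T])
  then have T0: "det T \<noteq> 0" by auto
  have dA: "det (\<epsilon> *\<^sub>R T) = \<epsilon> ^ ?n * det T"
    by (simp add: det_def prod.distrib sum_distrib_left mult_ac)
  have bnorm: "sqrt (b (\<epsilon> *\<^sub>R T *v s) (\<epsilon> *\<^sub>R T *v s)) / \<epsilon> = norm s" for s
  proof -
    have "b (\<epsilon> *\<^sub>R T *v s) (\<epsilon> *\<^sub>R T *v s) = \<epsilon>\<^sup>2 * b (T *v s) (T *v s)"
      using b by (simp add: scaleR_matrix_vector_assoc[symmetric] bilinear_lmul bilinear_rmul power2_eq_square)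
    also have "\<dots> = \<epsilon>\<^sup>2 * (norm s)\<^sup>2" using T by (simp add: is_frame_def power2_norm_eq_inner)
    finally show ?thesis using \<epsilon> by (simp add: real_sqrt_mult)
  qed
  have hm: "?h \<in> borel_measurable borel"
  proof -
    have "bounded_bilinear b" "bounded_bilinear B" using b B by (simp_all add: bilinear_conv_bounded_bilinear)
    then have cb: "continuous_on UNIV (\<lambda>u. b u u)" "continuous_on UNIV (\<lambda>u. B u u)"
      by (auto intro: bounded_bilinear.continuous_on[OF _ continuous_on_id continuous_on_id])
    have nn: "b u u \<ge> 0" for u
    proof -
      have "invertible T" using T0 invertible_det_nz by blast
      then obtain s where "u = T *v s" by (metis invertible_def matrix_vector_mul_assoc matrix_vector_mul_lid)
      then show ?thesis using T by (simp add: is_frame_def)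
    qed
    have ck: "continuous_on UNIV (\<lambda>u. k (sqrt (b u u) / \<epsilon>))"
      by (rule continuous_on_compose2[OF k_cont]) (use \<epsilon> nn cb in \<open>auto intro!: continuous_intros\<close>)
    have cl: "continuous_on UNIV l" using l by (simp add: linear_continuous_on linear_conv_bounded_linear)
    show ?thesis by (rule borel_measurable_continuous_onI) (intro continuous_intros ck cl cb)
  qed
  have "(\<integral>u. ?h u \<partial>lborel) = \<bar>det (\<epsilon> *\<^sub>R T)\<bar> * (\<integral>s. ?h (\<epsilon> *\<^sub>R T *v s) \<partial>lborel)"
    by (rule integral_matrix_substitution[OF _ hm]) (use dA T0 \<epsilon> in simp)
  also have "(\<integral>s. ?h (\<epsilon> *\<^sub>R T *v s) \<partial>lborel) = (\<integral>s. k (norm s) * (\<epsilon> * l (T *v s) + \<epsilon>\<^sup>2 * B (T *v s) (T *v s)) \<partial>lborel)"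
    by (rule Bochner_Integration.integral_cong[OF refl], subst bnorm)
      (simp add: scaleR_matrix_vector_assoc[symmetric] linear_cmul[OF l] bilinear_lmul[OF B] bilinear_rmul[OF B] power2_eq_square)
  also have "\<dots> = moment TYPE('n) * (\<Sum>i\<in>UNIV. \<epsilon>\<^sup>2 * B (T *v axis i 1) (T *v axis i 1))"
  proof -
    have lin: "linear (\<lambda>s. \<epsilon> * l (T *v s))"
      using l by (intro linearI) (simp_all add: matrix_vector_right_distrib linear_add linear_cmul matrix_vector_mult_scaleR algebra_simps)
    have bil: "bilinear (\<lambda>s t. \<epsilon>\<^sup>2 * B (T *v s) (T *v t))"
      unfolding bilinear_def
      by (intro conjI allI linearI) (simp_all add: matrix_vector_right_distrib matrix_vector_mult_scaleR
          bilinear_ladd[OF B] bilinear_radd[OF B] bilinear_lmul[OF B] bilinear_rmul[OF B] algebra_simps)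
    show ?thesis by (rule radial_quadratic[OF lin bil])
  qed
  finally have "sqrt (det (form_matrix b)) * (\<integral>u. ?h u \<partial>lborel) =
     (sqrt (det (form_matrix b)) * \<bar>det T\<bar>) * (\<epsilon> ^ ?n * (moment TYPE('n) * (\<epsilon>\<^sup>2 * (\<Sum>i\<in>UNIV. B (T *v axis i 1) (T *v axis i 1)))))"
    using \<epsilon> by (simp add: dA abs_mult sum_distrib_left mult_ac)
  then show ?thesis unfolding dT by (simp add: power_add power2_eq_square mult_ac)
qed

end

section \<open>Asymptotics of kernel integrals\<close>

context local_estimates begin

lemma Phi_diff:
  assumes z: "z \<in> K"
  shows "Phi z x - Phi z y = (x - y) + (1/2) *\<^sub>R (chr z (x - y) (x - z) + chr z (y - z) (x - y))"
proof -
  note l1 = chr_linear(1)[OF in_S[OF z]] and l2 = chr_linear(2)[OF in_S[OF z]]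
  have "chr z (x - z) (x - z) - chr z (y - z) (y - z) = chr z (x - y) (x - z) + chr z (y - z) (x - y)"
    by (simp add: linear_diff[OF l1] linear_diff[OF l2])
  then show ?thesis unfolding Phi_def by (simp add: algebra_simps flip: scaleR_diff_right scaleR_add_right)
qed

text \<open>Up to a translation \<open>Phi z\<close> is the identity plus a map with Lipschitz
  constant at most \<open>C * r\<close>, hence at most 1/2.\<close>

lemma inj_on_Phi:
  assumes z: "z \<in> K" and r: "C * r \<le> 1 / 2"
  shows "inj_on (Phi z) (ball z r)"
proof (rule inj_onI, rule ccontr)
  fix x y assume xy: "x \<in> ball z r" "y \<in> ball z r" and eq: "Phi z x = Phi z y" and ne: "x \<noteq> y"
  have n: "norm (x - z) \<le> r" "norm (y - z) \<le> r" using xy by (auto simp: dist_norm norm_minus_commute)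
  have C0: "C \<ge> 0" using C_ge by simp
  have "x - y = - (1/2) *\<^sub>R (chr z (x - y) (x - z) + chr z (y - z) (x - y))"
    using Phi_diff[OF z, of x y] eq by (simp add: eq_neg_iff_add_eq_0)
  then have "norm (x - y) = 1/2 * norm (chr z (x - y) (x - z) + chr z (y - z) (x - y))"
    by (metis abs_of_pos half_gt_zero_iff norm_minus_cancel norm_scaleR scaleR_minus_left zero_less_one)
  also have "\<dots> \<le> 1/2 * (C * norm (x - y) * r + C * r * norm (x - y))"
  proof (intro mult_left_mono order_trans[OF norm_triangle_ineq] add_mono)
    show "norm (chr z (x - y) (x - z)) \<le> C * norm (x - y) * r"
      by (rule order_trans[OF chrb[OF z]]) (use n C0 in \<open>auto intro!: mult_left_mono\<close>)
    show "norm (chr z (y - z) (x - y)) \<le> C * r * norm (x - y)"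
      by (rule order_trans[OF chrb[OF z]]) (use n C0 in \<open>auto intro!: mult_right_mono mult_left_mono\<close>)
  qed simp
  also have "\<dots> = C * r * norm (x - y)" by simp
  also have "\<dots> \<le> 1/2 * norm (x - y)" using r by (intro mult_right_mono) auto
  finally show False using ne by simp
qed

text \<open>A preimage is \<open>z\<close> plus a fixed point of the map that takes v to u - chr(v,
  v) / 2. Brouwer's theorem applies on the ball of radius r / 2, where the quadratic term has norm
  at most r / 16.\<close>

lemma Phi_surj:
  assumes z: "z \<in> K" and r: "C * r \<le> 1 / 2" "r > 0" and u: "norm u \<le> r / 8"
  shows "u \<in> Phi z ` ball z r"
proof -
  let ?T = "\<lambda>v. u - (1/2) *\<^sub>R chr z v v"
  have "continuous_on (cball 0 (r / 2)) (\<lambda>v. chr z v v)"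
    by (rule bounded_bilinear.continuous_on[OF chr_bilinear[OF in_S[OF z]] continuous_on_id continuous_on_id])
  then have cont: "continuous_on (cball 0 (r / 2)) ?T" by (intro continuous_intros)
  have "?T v \<in> cball 0 (r / 2)" if v: "v \<in> cball 0 (r / 2)" for v
  proof -
    have nv: "norm v \<le> r / 2" using v by simp
    have "norm (chr z v v) \<le> C * norm v * norm v" by (rule chrb[OF z])
    also have "\<dots> \<le> C * (r / 2) * (r / 2)" using nv C_ge r(2) by (intro mult_mono) auto
    also have "\<dots> = (C * r) * (r / 4)" by simp
    also have "\<dots> \<le> 1/2 * (r / 4)" using r by (intro mult_right_mono) auto
    finally have "norm ((1/2) *\<^sub>R chr z v v) \<le> r / 16" by simp
    then have "norm (?T v) \<le> r / 8 + r / 16" using u norm_triangle_ineq4[of u "(1/2) *\<^sub>R chr z v v"] by linarith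
    then show ?thesis using r(2) by simp
  qed
  then have maps: "?T \<in> cball 0 (r / 2) \<rightarrow> cball 0 (r / 2)" by blast
  have ne: "cball (0 :: real ^ 'n) (r / 2) \<noteq> {}" using r(2) by simp
  obtain v where v: "v \<in> cball 0 (r / 2)" "?T v = v"
    by (rule brouwer[OF compact_cball convex_cball ne cont maps])
  have "Phi z (z + v) = v + (1/2) *\<^sub>R chr z v v" by (simp add: Phi_def)
  also have "\<dots> = u" using v(2) by (metis diff_add_cancel)
  finally have "u = Phi z (z + v)" by simp
  moreover have "z + v \<in> ball z r" using v(1) r(2) by (simp add: dist_norm)
  ultimately show ?thesis by blast
qed

text \<open>A bilinear form with the Riemannian Hessian on its diagonal, as the moment formulas ask
  for bilinear forms.\<close>

definition hform :: "(real ^ 'n \<Rightarrow> real) \<Rightarrow> real ^ 'n \<Rightarrow> real ^ 'n \<Rightarrow> real ^ 'n \<Rightarrow> real" where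
  "hform F z u w = (\<Sum>i\<in>UNIV. \<Sum>j\<in>UNIV. u $ i * w $ j * partial_deriv i (partial_deriv j F) z) - dird (chr z u w) F z"

lemma hform_bilinear:
  assumes z: "z \<in> S" and F: "smooth_on F S"
  shows "bilinear (hform F z)"
proof -
  have lin: "linear (\<lambda>v. dird v F z)" by (rule has_derivative_linear[OF smooth_on_has_derivative[OF F open_S z]])
  note l1 = chr_linear(1)[OF z] and l2 = chr_linear(2)[OF z]
  show ?thesis unfolding bilinear_def hform_def
    by (intro conjI allI linearI)
      (simp_all add: linear_add[OF l1] linear_add[OF l2] linear_cmul[OF l1] linear_cmul[OF l2] linear_add[OF lin] linear_cmul[OF lin]
        distrib_right distrib_left sum.distrib sum_distrib_left right_diff_distrib mult_ac)
qed

lemma hform_hess: "z \<in> S \<Longrightarrow> smooth_on F S \<Longrightarrow> hform F z w w = hess F z w"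
  unfolding hform_def hess_def using dird2_expand[OF _ open_S] by simp

text \<open>The derivative of \<open>F\<close> along the quadratic term of \<open>Phi z\<close>
  compensates the Christoffel term of the Hessian, so in \<open>Phi z\<close> the Taylor polynomial
  has the covariant Hessian as its quadratic part. Replacing \<open>y - z\<close> by
  \<open>Phi z y\<close> in that part costs a third-order term.\<close>

lemma taylor_normal_form:
  assumes K: "compact K" "convex K" and F: "smooth_on F S"
  shows "\<exists>D\<ge>0. \<forall>z\<in>K. \<forall>y\<in>K. C * norm (y - z) \<le> 1 \<longrightarrow>
    \<bar>F y - F z - (dird (Phi z y) F z + hform F z (Phi z y) (Phi z y) / 2)\<bar> \<le> D * norm (y - z) ^ 3"
proof -
  obtain D3 where D3: "D3 \<ge> 0" "\<And>z y. z \<in> K \<Longrightarrow> y \<in> K \<Longrightarrow>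
     \<bar>F y - F z - dird (y - z) F z - dird (y - z) (dird (y - z) F) z / 2\<bar> \<le> D3 * norm (y - z) ^ 3"
    using taylor3_bound[OF open_S K K_sub F] by blast
  obtain D1 where D1: "D1 \<ge> 0" "\<And>z v. z \<in> K \<Longrightarrow> \<bar>dird v F z\<bar> \<le> D1 * norm v"
    using dird_funpow_bound[OF open_S K(1) K_sub F, of 1] by auto
  have pd: "smooth_on (partial_deriv j F) S" for j using smooth_on_dird[OF F] by (simp add: partial_deriv_dird[abs_def])
  have "\<forall>i j. \<exists>D\<ge>0. \<forall>z\<in>K. \<bar>partial_deriv i (partial_deriv j F) z\<bar> \<le> D * 1"
  proof (intro allI)
    fix i j :: 'n
    have "smooth_on (partial_deriv i (partial_deriv j F)) S" using smooth_on_dird[OF pd[of j]] by (simp add: partial_deriv_dird[of i, abs_def])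
    from dird_funpow_bound[OF open_S K(1) K_sub this, of 0]
    show "\<exists>D\<ge>0. \<forall>z\<in>K. \<bar>partial_deriv i (partial_deriv j F) z\<bar> \<le> D * 1" by auto
  qed
  then obtain P where P: "\<And>i j. P i j \<ge> 0" "\<And>i j z. z \<in> K \<Longrightarrow> \<bar>partial_deriv i (partial_deriv j F) z\<bar> \<le> P i j * 1" by metis
  define D2 where "D2 = (\<Sum>i\<in>UNIV. \<Sum>j\<in>UNIV. P i j) + D1 * C"
  have C0: "C \<ge> 0" using C_ge by simp
  have D2: "D2 \<ge> 0" using P(1) D1(1) C0 by (simp add: D2_def sum_nonneg)
  have hb: "\<bar>hform F z u w\<bar> \<le> D2 * norm u * norm w" if z: "z \<in> K" for z u w
  proof -
    have "\<bar>dird (chr z u w) F z\<bar> \<le> D1 * (C * norm u * norm w)"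
      by (rule order_trans[OF D1(2)[OF z]]) (use chrb[OF z] D1(1) in \<open>auto intro!: mult_left_mono\<close>)
    moreover have "\<bar>\<Sum>i\<in>UNIV. \<Sum>j\<in>UNIV. u $ i * w $ j * partial_deriv i (partial_deriv j F) z\<bar> \<le> (\<Sum>i\<in>UNIV. \<Sum>j\<in>UNIV. P i j) * 1 * norm u * norm w"
      by (rule sum2_bound[OF P(2)[OF z]])
    ultimately show ?thesis unfolding hform_def D2_def by (simp add: algebra_simps abs_le_iff)
  qed
  define D where "D = D3 + D2 * C"
  have "\<bar>F y - F z - (dird (Phi z y) F z + hform F z (Phi z y) (Phi z y) / 2)\<bar> \<le> D * norm (y - z) ^ 3"
    if zy: "z \<in> K" "y \<in> K" and small: "C * norm (y - z) \<le> 1" for z y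
  proof -
    have zS: "z \<in> S" using in_S zy by blast
    define v where "v = y - z"
    define W where "W = Phi z y"
    have lin: "linear (\<lambda>v. dird v F z)" by (rule has_derivative_linear[OF smooth_on_has_derivative[OF F open_S zS]])
    have H: "bilinear (hform F z)" by (rule hform_bilinear[OF zS F])
    have nW: "norm W \<le> 2 * norm v" using Phi_lower(2)[OF zy(1) small] by (simp add: W_def v_def)
    have nWv: "norm (W - v) \<le> C / 2 * (norm v)\<^sup>2" using Phi_close[OF zy(1)] by (simp add: W_def v_def)
    have "dird W F z = dird v F z + dird (chr z v v) F z / 2"
      unfolding W_def Phi_def v_def[symmetric] by (simp add: linear_add[OF lin] linear_cmul[OF lin])
    moreover have "hform F z v v = dird v (dird v F) z - dird (chr z v v) F z"
      using hform_hess[OF zS F] by (simp add: hess_def)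
    moreover have HW: "hform F z W W = hform F z v v + (hform F z (W - v) W + hform F z v (W - v))"
      by (simp add: bilinear_lsub[OF H] bilinear_rsub[OF H])
    \<comment> \<open>The terms with \<open>chr z v v\<close> from the first derivative and from the
      Hessian cancel.\<close>
    ultimately have eq: "F y - F z - (dird W F z + hform F z W W / 2) =
       (F y - F z - dird v F z - dird v (dird v F) z / 2) - (hform F z (W - v) W + hform F z v (W - v)) / 2"
      by (simp add: field_simps)
    have "\<bar>hform F z (W - v) W\<bar> \<le> D2 * (C / 2 * (norm v)\<^sup>2) * (2 * norm v)"
      by (rule order_trans[OF hb[OF zy(1)] mult_mono[OF mult_left_mono[OF nWv D2] nW]]) (use D2 C0 in auto)
    moreover have "\<bar>hform F z v (W - v)\<bar> \<le> D2 * norm v * (C / 2 * (norm v)\<^sup>2)"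
      by (rule order_trans[OF hb[OF zy(1)] mult_left_mono[OF nWv]]) (use D2 in simp)
    ultimately have "\<bar>hform F z (W - v) W + hform F z v (W - v)\<bar> \<le> 2 * (D2 * C * norm v ^ 3)"
    proof -
      assume a1: "\<bar>hform F z (W - v) W\<bar> \<le> D2 * (C / 2 * (norm v)\<^sup>2) * (2 * norm v)"
        and a2: "\<bar>hform F z v (W - v)\<bar> \<le> D2 * norm v * (C / 2 * (norm v)\<^sup>2)"
      have e: "D2 * (C / 2 * (norm v)\<^sup>2) * (2 * norm v) = D2 * C * norm v ^ 3" "D2 * norm v * (C / 2 * (norm v)\<^sup>2) = D2 * C * norm v ^ 3 / 2"
        by (simp_all add: power2_eq_square power3_eq_cube)
      have "\<bar>hform F z (W - v) W\<bar> + \<bar>hform F z v (W - v)\<bar> \<le> D2 * C * norm v ^ 3 + D2 * C * norm v ^ 3 / 2"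
        by (rule add_mono[OF a1[unfolded e(1)] a2[unfolded e(2)]])
      also have "\<dots> \<le> 2 * (D2 * C * norm v ^ 3)" using D2 C0 by simp
      finally show ?thesis by (rule order_trans[OF abs_triangle_ineq])
    qed
    moreover have "\<bar>F y - F z - dird v F z - dird v (dird v F) z / 2\<bar> \<le> D3 * norm v ^ 3"
      using D3(2)[OF zy] by (simp add: v_def)
    moreover have "\<bar>p - q / 2\<bar> \<le> \<bar>p\<bar> + \<bar>q\<bar> / 2" for p q :: real by linarith
    ultimately have "\<bar>F y - F z - (dird W F z + hform F z W W / 2)\<bar> \<le> D3 * norm v ^ 3 + 2 * (D2 * C * norm v ^ 3) / 2"
      unfolding eq by (meson add_mono divide_right_mono order_trans zero_le_numeral)
    then show ?thesis by (simp add: D_def W_def v_def algebra_simps)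
  qed
  moreover have "D \<ge> 0" using D3(1) D2 C0 by (simp add: D_def)
  ultimately show ?thesis by blast
qed

end

lemma integral_indicator_diff_bound:
  fixes G1 G2 :: "real ^ 'n::finite \<Rightarrow> real"
  assumes m: "(\<lambda>y. indicator (ball z r) y * G1 y) \<in> borel_measurable borel" "(\<lambda>y. indicator (ball z r) y * G2 y) \<in> borel_measurable borel"
    and B: "\<And>y. y \<in> ball z r \<Longrightarrow> \<bar>G1 y\<bar> \<le> B" and e: "\<And>y. y \<in> ball z r \<Longrightarrow> \<bar>G1 y - G2 y\<bar> \<le> e" and r: "r \<ge> 0"
  shows "\<bar>(\<integral>y. indicator (ball z r) y * G1 y \<partial>lborel) - (\<integral>y. indicator (ball z r) y * G2 y \<partial>lborel)\<bar> \<le> e * (unit_ball_vol CARD('n) * r ^ CARD('n))"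
proof -
  have fin: "emeasure lborel (ball z r) < \<infinity>" using emeasure_bounded_finite[OF bounded_ball] by blast
  have i1: "integrable lborel (\<lambda>y. indicator (ball z r) y * G1 y)"
    by (rule integrableI_bounded_set[where A = "ball z r" and B = B]) (use m(1) fin B in auto)
  have "\<bar>G2 y\<bar> \<le> B + e" if "y \<in> ball z r" for y using B[OF that] e[OF that] by linarith
  then have i2: "integrable lborel (\<lambda>y. indicator (ball z r) y * G2 y)"
    by (intro integrableI_bounded_set[where A = "ball z r" and B = "B + e"]) (use m(2) fin in auto)
  have i3: "integrable lborel (\<lambda>y. indicator (ball z r) y * e)"
    using fin by (intro integrable_mult_left integrable_real_indicator) auto
  have "\<bar>(\<integral>y. indicator (ball z r) y * G1 y \<partial>lborel) - (\<integral>y. indicator (ball z r) y * G2 y \<partial>lborel)\<bar> =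
    \<bar>\<integral>y. indicator (ball z r) y * G1 y - indicator (ball z r) y * G2 y \<partial>lborel\<bar>"
    by (simp only: Bochner_Integration.integral_diff[OF i1 i2])
  also have "\<dots> \<le> (\<integral>y. indicator (ball z r) y * e \<partial>lborel)"
  proof (rule integral_abs_bound[THEN order_trans], rule integral_mono)
    show "\<bar>indicator (ball z r) y * G1 y - indicator (ball z r) y * G2 y\<bar> \<le> indicator (ball z r) y * e" for y
      using e[of y] by (auto simp: indicator_def)
  qed (use i1 i2 i3 in auto)
  also have "\<dots> = e * measure lborel (ball z r)" using fin by (simp add: mult.commute)
  also have "measure lborel (ball z r) = unit_ball_vol CARD('n) * r ^ CARD('n)"
    using content_ball[OF r, of z] by simp
  finally show ?thesis .
qed

context riemannian_manifold begin

text \<open>The Laplace-Beltrami formula with the chart left free;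
  \<open>lapc_chart_independent\<close> shows that its value does not depend on that chart.\<close>

definition lapc :: "('a, 'n) chart \<Rightarrow> ('a \<Rightarrow> real) \<Rightarrow> real ^ 'n \<Rightarrow> real" where
  "lapc c f z = 1 / dens c z * (\<Sum>i\<in>UNIV. partial_deriv i (\<lambda>y. \<Sum>j\<in>UNIV.
     dens c y * matrix_inv (gram g c y) $ i $ j * partial_deriv j (f \<circ> chart_inv c) y) z)"

lemma laplace_beltrami_lapc: "laplace_beltrami \<A> g f q = lapc (chart_at \<A> q) f (chart_map (chart_at \<A> q) q)"
  unfolding laplace_beltrami_def lapc_def Let_def dens_def by (rule refl)

end

context closed_manifold begin

text \<open>\<open>G1\<close> is the exact integrand in the chart. \<open>G2\<close> is the pullback
  by \<open>Phi z\<close> of a model on the tangent space, with frozen density, with the length of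
  the vector as distance and with the second Taylor polynomial of \<open>f\<close>; the model has a
  closed-form integral. The pointwise difference is of order \<epsilon>^3 on a ball whose volume is
  of order \<epsilon>^n.\<close>

lemma local_kernel_asymptotics:
  assumes c: "c \<in> \<A>" and est: "estimates c (cball x0 R) a C" and R: "R > 0"
    and k: "radial_kernel k Rk" and Lk: "L-lipschitz_on {0..} k" and f: "smooth_function \<A> f"
  shows "\<exists>E\<ge>0. \<exists>\<epsilon>0>0. \<forall>z\<in>cball x0 (R / 2). \<forall>\<epsilon>. 0 < \<epsilon> \<and> \<epsilon> \<le> \<epsilon>0 \<longrightarrow>
    \<bar>(\<integral>q. k (rd (chart_inv c z) q / \<epsilon>) * (f q - f (chart_inv c z)) \<partial>Vol)
      - \<epsilon> ^ (CARD('n) + 2) * (radial_kernel.moment k TYPE('n) / 2 * lapc c f z)\<bar> \<le> E * \<epsilon> ^ (CARD('n) + 3)"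
proof -
  interpret rk: radial_kernel k Rk by (rule k)
  let ?K = "cball x0 R" and ?n = "CARD('n)" and ?S = "chart_img c"
  interpret local_estimates ?S "g c" ?K a C by (rule est)
  define F where "F = f \<circ> chart_inv c"
  have F: "smooth_on F ?S" using f c by (simp add: F_def smooth_function_def)
  obtain s C' where s: "s > 0" "C' \<ge> 0" "s \<le> R / 2" "C * s \<le> 1"
    and dist: "\<And>z y. z \<in> cball x0 (R / 2) \<Longrightarrow> norm (y - z) \<le> s \<Longrightarrow>
      \<bar>rd (chart_inv c z) (chart_inv c y) - gn c z (Ph c z y)\<bar> \<le> C' * norm (y - z) ^ 3"
    and near: "\<And>z q r. z \<in> cball x0 (R / 2) \<Longrightarrow> q \<in> M \<Longrightarrow> 0 < r \<Longrightarrow> r \<le> s \<Longrightarrow> rd (chart_inv c z) q < a / 4 * r \<Longrightarrow>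
      q \<in> chart_dom c \<and> norm (chart_map c q - z) < r"
    using distance_expansion[OF c est R] by blast
  obtain D4 where D4: "D4 \<ge> 0" "\<And>z y. z \<in> ?K \<Longrightarrow> y \<in> ?K \<Longrightarrow> C * norm (y - z) \<le> 1 \<Longrightarrow>
    \<bar>F y - F z - (dird (Phi z y) F z + hform F z (Phi z y) (Phi z y) / 2)\<bar> \<le> D4 * norm (y - z) ^ 3"
    using taylor_normal_form[OF compact_cball convex_cball F] by blast
  obtain Lf where Lf: "Lf \<ge> 0" "\<And>z y. z \<in> ?K \<Longrightarrow> y \<in> ?K \<Longrightarrow> \<bar>F y - F z\<bar> \<le> Lf * norm (y - z)"
    using lipschitz_bound[OF open_S compact_cball convex_cball K_sub F] by blast
  obtain Bk where Bk: "Bk > 0" "\<And>r. r \<ge> 0 \<Longrightarrow> \<bar>k r\<bar> \<le> Bk" using rk.k_bound by blast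
  have L0: "L \<ge> 0" using Lk by (rule lipschitz_on_nonneg)
  have kL: "\<bar>k x - k y\<bar> \<le> L * \<bar>x - y\<bar>" if "x \<ge> 0" "y \<ge> 0" for x y
    using lipschitz_onD[OF Lk, of x y] that by (simp add: dist_real_def)
  \<comment> \<open>The coordinate radius A \<epsilon> contains the support of the kernel at scale
    \<epsilon>: the 8 satisfies the localization bound a r / 4 with room to spare and, for the
    model, the bound r / 8 of \<open>Phi_surj\<close> exactly.\<close>
  define A where "A = 8 * Rk / a"
  have A: "A > 0" using rk.R_pos a_pos by (simp add: A_def)
  have C0: "C > 0" using C_ge by simp
  \<comment> \<open>Keeps r = A \<epsilon> within the range \<open>s\<close> of the distance
    expansion, and C r within 1/2 for \<open>inj_on_Phi\<close> and \<open>Phi_surj\<close>.\<close>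
  define \<epsilon>0 where "\<epsilon>0 = min 1 (min (s / A) (1 / (2 * C * A)))"
  have \<epsilon>0: "\<epsilon>0 > 0" using s A C0 by (simp add: \<epsilon>0_def)
  define f2b where "f2b = Lf * A + D4 * A ^ 3"
  \<comment> \<open>The three summands are the errors from the kernel, from \<open>f\<close> and
    from the density, in the order of the telescoping sum for \<open>G1 y - G2 y\<close>.\<close>
  define E1 where "E1 = L * C' * A ^ 3 * (Lf * A) * C + Bk * (D4 * A ^ 3) * C + Bk * f2b * (C * A\<^sup>2)"
  define E where "E = E1 * (unit_ball_vol ?n * A ^ ?n)"
  have f2b: "f2b \<ge> 0" using Lf(1) D4(1) A by (simp add: f2b_def)
  have E1: "E1 \<ge> 0" using L0 s(2) A Lf(1) C0 Bk(1) D4(1) f2b by (simp add: E1_def)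
  have E: "E \<ge> 0" using E1 A by (simp add: E_def)
  have main: "\<bar>(\<integral>q. k (rd (chart_inv c z) q / \<epsilon>) * (f q - f (chart_inv c z)) \<partial>Vol)
      - \<epsilon> ^ (?n + 2) * (rk.moment TYPE('n) / 2 * lapc c f z)\<bar> \<le> E * \<epsilon> ^ (?n + 3)"
    if z: "z \<in> cball x0 (R / 2)" and \<epsilon>: "0 < \<epsilon>" "\<epsilon> \<le> \<epsilon>0" for z \<epsilon>
  proof -
    let ?p = "chart_inv c z"
    define r where "r = A * \<epsilon>"
    have \<epsilon>1: "\<epsilon> \<le> 1" "\<epsilon> \<le> s / A" "\<epsilon> \<le> 1 / (2 * C * A)" using \<epsilon>(2) by (simp_all add: \<epsilon>0_def)
    have r: "r > 0" "r \<le> s" "C * r \<le> 1 / 2" using \<epsilon>1 \<epsilon>(1) A C0 by (simp_all add: r_def field_simps)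
    have zK: "z \<in> ?K" using z R by simp
    have zS: "z \<in> ?S" by (rule in_S[OF zK])
    have pM: "?p \<in> M" by (rule chart_inv_M[OF c zS])
    let ?U = "ball z r"
    have yK: "y \<in> ?K" if "y \<in> ?U" for y
    proof -
      have "dist z y < r" using that by simp
      moreover have "dist x0 z \<le> R / 2" using z by simp
      ultimately have "dist x0 y \<le> R" using dist_triangle[of x0 y z] r(2) s(3) by linarith
      then show ?thesis by simp
    qed
    have US: "?U \<subseteq> ?S" using yK in_S by blast
    have ny: "norm (y - z) < r" if "y \<in> ?U" for y using that by (simp add: dist_norm norm_minus_commute)
    define G1 where "G1 y = k (rd ?p (chart_inv c y) / \<epsilon>) * (F y - F z) * dens c y" for y
    define l where "l w = dird w F z" for w
    define H where "H u w = hform F z u w / 2" for u w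
    have lin: "linear l" unfolding l_def by (rule has_derivative_linear[OF smooth_on_has_derivative[OF F open_S zS]])
    have bil: "bilinear H"
    proof -
      note b = hform_bilinear[OF zS F]
      show ?thesis unfolding bilinear_def H_def
        by (intro conjI allI linearI)
          (simp_all add: bilinear_ladd[OF b] bilinear_radd[OF b] bilinear_lmul[OF b] bilinear_rmul[OF b] add_divide_distrib)
    qed
    \<comment> \<open>The model integrand on the tangent space at \<open>z\<close>.\<close>
    define h where "h u = vol_dens z * (k (gnorm z u / \<epsilon>) * (l u + H u u))" for u
    define J where "J y = \<bar>det (matrix (dPhi z (y - z)))\<bar>" for y
    define G2 where "G2 y = J y * h (Phi z y)" for y
    have dens: "dens c y = vol_dens y" for y using dens_vol_dens[OF c] by simp
    have int1: "(\<integral>q. k (rd ?p q / \<epsilon>) * (f q - f ?p) \<partial>Vol) = (\<integral>y. indicator ?U y * G1 y \<partial>lborel)"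
    proof -
      have "(\<integral>q. k (rd ?p q / \<epsilon>) * (f q - f ?p) \<partial>Vol) =
        (\<integral>y. indicator ?U y * ((k (rd ?p (chart_inv c y) / \<epsilon>) * (f (chart_inv c y) - f ?p)) * dens c y) \<partial>lborel)"
      proof (rule integral_Vol_chart[OF c _ US])
        show "?U \<in> sets borel" by simp
        obtain Lf' where "\<forall>x\<in>M. \<forall>y\<in>M. \<bar>f x - f y\<bar> \<le> Lf' * rd x y" using smooth_function_Lipschitz[OF f] by blast
        then have cf: "continuous_on M f" by (intro Lipschitz_continuous[of f Lf']) blast
        have ck: "continuous_on M (\<lambda>q. k (rd ?p q / \<epsilon>))"
          by (rule continuous_on_compose2[OF rk.k_cont])
            (use \<epsilon> rd_nonneg[OF pM] in \<open>auto intro!: continuous_intros rd_continuous[OF pM]\<close>)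
        show "continuous_on M (\<lambda>q. k (rd ?p q / \<epsilon>) * (f q - f ?p))"
          by (intro continuous_intros ck cf)
        fix q assume q: "q \<in> M" "k (rd ?p q / \<epsilon>) * (f q - f ?p) \<noteq> 0"
        then have "k (rd ?p q / \<epsilon>) \<noteq> 0" by auto
        then have "rd ?p q / \<epsilon> \<le> Rk" using rk.k_supp by (meson not_le)
        then have "rd ?p q \<le> Rk * \<epsilon>" using \<epsilon> by (simp add: field_simps)
        also have "\<dots> < a / 4 * r" using rk.R_pos \<epsilon> a_pos by (simp add: r_def A_def)
        finally have "q \<in> chart_dom c \<and> norm (chart_map c q - z) < r" by (rule near[OF z q(1) r(1,2)])
        then show "q \<in> chart_inv c ` ?U" using c
          by (intro image_eqI[of _ _ "chart_map c q"]) (auto simp: dist_norm norm_minus_commute)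
      qed
      then show ?thesis by (simp add: G1_def F_def)
    qed
    have Jc: "continuous_on UNIV (\<lambda>y. det (matrix (dPhi z (y - z))))"
    proof (rule continuous_on_det)
      fix i j
      have "continuous_on UNIV (\<lambda>y. chr z (y - z) (axis j 1))"
        by (rule bounded_bilinear.continuous_on[OF chr_bilinear[OF zS]]) (intro continuous_intros)+
      then show "continuous_on UNIV (\<lambda>y. matrix (dPhi z (y - z)) $ i $ j)"
        unfolding matrix_def dPhi_def by (simp add: continuous_intros)
    qed
    have cg: "continuous_on UNIV (gnorm z)"
      unfolding gnorm_def[abs_def] by (intro continuous_on_real_sqrt g_continuous continuous_intros) (use zS in auto)
    have hc: "continuous_on UNIV h"
    proof -
      have "continuous_on UNIV (\<lambda>u. k (gnorm z u / \<epsilon>))"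
        by (rule continuous_on_compose2[OF rk.k_cont]) (use \<epsilon> cg gnorm_nonneg[OF zS] in \<open>auto intro!: continuous_intros\<close>)
      moreover have "continuous_on UNIV l" using lin by (simp add: linear_continuous_on linear_conv_bounded_linear)
      moreover have "continuous_on UNIV (\<lambda>u. H u u)"
        using bil by (auto simp: bilinear_conv_bounded_bilinear intro: bounded_bilinear.continuous_on[OF _ continuous_on_id continuous_on_id])
      ultimately show ?thesis unfolding h_def by (intro continuous_intros)
    qed
    have Pc: "continuous_on UNIV (Phi z)" by (rule has_derivative_continuous_on[OF Phi_has_derivative[OF zS]])
    have G2c: "continuous_on UNIV G2" unfolding G2_def J_def
      by (intro continuous_intros Jc continuous_on_compose2[OF hc Pc]) auto
    have hm: "h \<in> borel_measurable borel" by (rule borel_measurable_continuous_onI[OF hc])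
    have int2: "(\<integral>y. indicator ?U y * G2 y \<partial>lborel) = \<epsilon> ^ (?n + 2) * (rk.moment TYPE('n) / 2 * lapc c f z)"
    proof -
      have "(\<integral>y. indicator ?U y * G2 y \<partial>lborel) = (\<integral>u. indicator (Phi z ` ?U) u * h u \<partial>lborel)"
        unfolding G2_def J_def
        by (rule integral_change_of_variables[OF open_ball Phi_has_derivative[OF zS] inj_on_Phi[OF zK r(3)] continuous_on_subset[OF Jc subset_UNIV] hm, symmetric])
      \<comment> \<open>By \<open>Phi_surj\<close> the support of the model lies in the image of the
        ball, so the integral extends to the whole space.\<close>
      also have "\<dots> = (\<integral>u. h u \<partial>lborel)"
      proof (rule Bochner_Integration.integral_cong[OF refl])
        fix u
        show "indicator (Phi z ` ?U) u * h u = h u"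
        proof (cases "h u = 0")
          case False
          then have "k (gnorm z u / \<epsilon>) \<noteq> 0" by (auto simp: h_def)
          then have "gnorm z u / \<epsilon> \<le> Rk" using rk.k_supp by (meson not_le)
          then have "gnorm z u \<le> Rk * \<epsilon>" using \<epsilon> by (simp add: field_simps)
          then have "a * norm u \<le> Rk * \<epsilon>" using gnorm_ge[OF zK, of u] by linarith
          then have "norm u \<le> r / 8" using a_pos by (simp add: r_def A_def field_simps)
          then have "u \<in> Phi z ` ?U" by (rule Phi_surj[OF zK r(3,1)])
          then show ?thesis by simp
        qed simp
      qed
      also have "\<dots> = vol_dens z * (\<integral>u. k (gnorm z u / \<epsilon>) * (l u + H u u) \<partial>lborel)"
        unfolding h_def by (rule integral_mult_right_zero)
      also have "\<dots> = \<epsilon> ^ (?n + 2) * (rk.moment TYPE('n) / 2 * lapc c f z)"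
      proof -
        obtain T where T: "is_frame (g c z) T" using frame_ex[OF zS] by blast
        have "vol_dens z * (\<integral>u. k (gnorm z u / \<epsilon>) * (l u + H u u) \<partial>lborel) =
          \<epsilon> ^ (?n + 2) * rk.moment TYPE('n) * (\<Sum>i\<in>UNIV. H (T *v axis i 1) (T *v axis i 1))"
          unfolding vol_dens_def gnorm_def by (rule rk.quadratic_kernel_integral[OF lin bil bilin[OF zS] T \<epsilon>(1)])
        also have "(\<Sum>i\<in>UNIV. H (T *v axis i 1) (T *v axis i 1)) = (\<Sum>i\<in>UNIV. hess F z (T *v axis i 1)) / 2"
          by (simp add: H_def hform_hess[OF zS F] sum_divide_distrib)
        also have "(\<Sum>i\<in>UNIV. hess F z (T *v axis i 1)) = lapc c f z"
          unfolding lapc_def dens gram_form_matrix F_def[symmetric] by (rule divergence_form[OF zS F T, symmetric])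
        finally show ?thesis by simp
      qed
      finally show ?thesis .
    qed
    have G1m: "(\<lambda>y. indicator ?U y * G1 y) \<in> borel_measurable borel"
    proof -
      have c1: "continuous_on ?S (\<lambda>y. rd ?p (chart_inv c y))"
        by (rule continuous_on_compose2[OF rd_continuous[OF pM] chart_inv_continuous[OF c]]) (use chart_inv_M[OF c] in auto)
      have "continuous_on ?S (\<lambda>y. k (rd ?p (chart_inv c y) / \<epsilon>))"
        by (rule continuous_on_compose2[OF rk.k_cont])
          (use \<epsilon> c1 rd_nonneg[OF pM chart_inv_M[OF c]] in \<open>auto intro!: continuous_intros\<close>)
      then have "continuous_on ?S G1" unfolding G1_def dens
        by (intro continuous_intros smooth_on_continuous[OF F] vol_dens_continuous)
      then have "(\<lambda>y. indicator ?U y *\<^sub>R G1 y) \<in> borel_measurable borel"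
        using US by (intro borel_measurable_continuous_on_indicator) (auto intro: continuous_on_subset)
      then show ?thesis by simp
    qed
    have G2m: "(\<lambda>y. indicator ?U y * G2 y) \<in> borel_measurable borel"
      by (intro borel_measurable_times borel_measurable_indicator borel_measurable_continuous_onI[OF G2c]) simp
    have f1: "\<bar>F y - F z\<bar> \<le> Lf * A * \<epsilon>" if y: "y \<in> ?U" for y
    proof -
      have "\<bar>F y - F z\<bar> \<le> Lf * norm (y - z)" by (rule Lf(2)[OF zK yK[OF y]])
      also have "\<dots> \<le> Lf * r" using ny[OF y] Lf(1) by (intro mult_left_mono) auto
      finally show ?thesis by (simp add: r_def mult_ac)
    qed
    have \<rho>1: "0 \<le> dens c y \<and> dens c y \<le> C" if y: "y \<in> ?U" for y
      using densC[OF yK[OF y]] vol_dens_pos[OF in_S[OF yK[OF y]]] dens by simp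
    have G1b: "\<bar>G1 y\<bar> \<le> Bk * (Lf * A * \<epsilon>) * C" if y: "y \<in> ?U" for y
    proof -
      have "\<bar>k (rd ?p (chart_inv c y) / \<epsilon>)\<bar> \<le> Bk"
        using rd_nonneg[OF pM chart_inv_M[OF c in_S[OF yK[OF y]]]] \<epsilon> by (intro Bk(2)) simp
      then show ?thesis unfolding G1_def abs_mult using f1[OF y] \<rho>1[OF y] Bk(1) by (intro mult_mono) auto
    qed
    have diff: "\<bar>G1 y - G2 y\<bar> \<le> E1 * \<epsilon> ^ 3" if y: "y \<in> ?U" for y
    proof -
      define n where "n = norm (y - z)"
      have n: "0 \<le> n" "n \<le> r" using ny[OF y] by (auto simp: n_def)
      have n3: "n ^ 3 \<le> A ^ 3 * \<epsilon> ^ 3" "n\<^sup>2 \<le> A\<^sup>2 * \<epsilon>\<^sup>2"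
        using power_mono[OF n(2,1), of 3] power_mono[OF n(2,1), of 2] by (simp_all add: r_def power_mult_distrib)
      have rd0: "rd ?p (chart_inv c y) \<ge> 0" by (rule rd_nonneg[OF pM chart_inv_M[OF c in_S[OF yK[OF y]]]])
      have gn0: "gnorm z (Phi z y) \<ge> 0" by (rule gnorm_nonneg[OF zS])
      define k1 where "k1 = k (rd ?p (chart_inv c y) / \<epsilon>)"
      define k2 where "k2 = k (gnorm z (Phi z y) / \<epsilon>)"
      define f1' where "f1' = F y - F z"
      define f2' where "f2' = l (Phi z y) + H (Phi z y) (Phi z y)"
      define \<rho>1' where "\<rho>1' = dens c y"
      define \<rho>2' where "\<rho>2' = vol_dens z * J y"
      \<comment> \<open>The kernel sees the distance divided by \<epsilon>, which turns its
        third-order error into a second-order one.\<close>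
      have k12: "\<bar>k1 - k2\<bar> \<le> L * C' * A ^ 3 * \<epsilon>\<^sup>2"
      proof -
        have "\<bar>k1 - k2\<bar> \<le> L * \<bar>rd ?p (chart_inv c y) / \<epsilon> - gnorm z (Phi z y) / \<epsilon>\<bar>"
          unfolding k1_def k2_def using rd0 gn0 \<epsilon> by (intro kL) auto
        also have "\<bar>rd ?p (chart_inv c y) / \<epsilon> - gnorm z (Phi z y) / \<epsilon>\<bar> = \<bar>rd ?p (chart_inv c y) - gnorm z (Phi z y)\<bar> / \<epsilon>"
          using \<epsilon> by (simp add: diff_divide_distrib[symmetric])
        also have "L * \<dots> \<le> L * (C' * (A ^ 3 * \<epsilon> ^ 3) / \<epsilon>)"
        proof (intro mult_left_mono divide_right_mono)
          have "\<bar>rd ?p (chart_inv c y) - gnorm z (Phi z y)\<bar> \<le> C' * n ^ 3"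
            unfolding n_def by (rule dist[OF z]) (use n r(2) in \<open>simp add: n_def\<close>)
          also have "\<dots> \<le> C' * (A ^ 3 * \<epsilon> ^ 3)" using n3(1) s(2) by (rule mult_left_mono)
          finally show "\<bar>rd ?p (chart_inv c y) - gnorm z (Phi z y)\<bar> \<le> C' * (A ^ 3 * \<epsilon> ^ 3)" .
        qed (use \<epsilon> L0 in auto)
        also have "\<dots> = L * C' * A ^ 3 * \<epsilon>\<^sup>2" using \<epsilon> by (simp add: power2_eq_square power3_eq_cube)
        finally show ?thesis .
      qed
      have k2b: "\<bar>k2\<bar> \<le> Bk" unfolding k2_def using gn0 \<epsilon> by (intro Bk(2)) simp
      have f12: "\<bar>f1' - f2'\<bar> \<le> D4 * A ^ 3 * \<epsilon> ^ 3"
      proof -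
        have "C * norm (y - z) \<le> C * r" using n C0 by (intro mult_left_mono) (auto simp: n_def)
        then have "C * norm (y - z) \<le> 1" using r(3) by linarith
        from D4(2)[OF zK yK[OF y] this] have "\<bar>f1' - f2'\<bar> \<le> D4 * n ^ 3" by (simp add: f1'_def f2'_def l_def H_def n_def)
        also have "\<dots> \<le> D4 * (A ^ 3 * \<epsilon> ^ 3)" using n3(1) D4(1) by (rule mult_left_mono)
        finally show ?thesis by simp
      qed
      have f1b: "\<bar>f1'\<bar> \<le> Lf * A * \<epsilon>" using f1[OF y] by (simp add: f1'_def)
      have f2b': "\<bar>f2'\<bar> \<le> f2b * \<epsilon>"
      proof -
        have "\<epsilon> ^ 3 \<le> \<epsilon>" using \<epsilon>(1) \<epsilon>1(1) power_decreasing[of 1 3 \<epsilon>] by simp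
        then have "D4 * A ^ 3 * \<epsilon> ^ 3 \<le> D4 * A ^ 3 * \<epsilon>" using D4(1) A by (intro mult_left_mono) auto
        then show ?thesis using f1b f12 by (simp add: f2b_def algebra_simps)
      qed
      have \<rho>12: "\<bar>\<rho>1' - \<rho>2'\<bar> \<le> C * A\<^sup>2 * \<epsilon>\<^sup>2"
      proof -
        have "\<bar>\<rho>1' - \<rho>2'\<bar> \<le> C * n\<^sup>2" using densb[OF zK yK[OF y]] by (simp add: \<rho>1'_def \<rho>2'_def J_def dens n_def)
        also have "\<dots> \<le> C * (A\<^sup>2 * \<epsilon>\<^sup>2)" using n3(2) C0 by (intro mult_left_mono) auto
        finally show ?thesis by simp
      qed
      have \<rho>b: "\<bar>\<rho>1'\<bar> \<le> C" using \<rho>1[OF y] by (simp add: \<rho>1'_def)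
      \<comment> \<open>Telescoping over kernel, function and density; the orders in \<epsilon> are
        2 + 1 + 0, 0 + 3 + 0 and 0 + 1 + 2.\<close>
      have "G1 y - G2 y = (k1 - k2) * f1' * \<rho>1' + k2 * (f1' - f2') * \<rho>1' + k2 * f2' * (\<rho>1' - \<rho>2')"
      proof -
        have "G1 y = k1 * f1' * \<rho>1'" by (simp add: G1_def k1_def f1'_def \<rho>1'_def)
        moreover have "G2 y = k2 * f2' * \<rho>2'" by (simp add: G2_def h_def k2_def f2'_def \<rho>2'_def)
        ultimately show ?thesis by (simp add: algebra_simps)
      qed
      also have "\<bar>\<dots>\<bar> \<le> \<bar>(k1 - k2) * f1' * \<rho>1'\<bar> + \<bar>k2 * (f1' - f2') * \<rho>1'\<bar> + \<bar>k2 * f2' * (\<rho>1' - \<rho>2')\<bar>"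
        by linarith
      also have "\<dots> \<le> (L * C' * A ^ 3 * \<epsilon>\<^sup>2) * (Lf * A * \<epsilon>) * C + Bk * (D4 * A ^ 3 * \<epsilon> ^ 3) * C + Bk * (f2b * \<epsilon>) * (C * A\<^sup>2 * \<epsilon>\<^sup>2)"
      proof -
        have p3: "\<bar>x * y * w\<bar> \<le> X * Y * Z" if "\<bar>x\<bar> \<le> X" "\<bar>y\<bar> \<le> Y" "\<bar>w\<bar> \<le> Z" for x y w X Y Z :: real
          unfolding abs_mult using that by (intro mult_mono) auto
        show ?thesis by (intro add_mono p3 k12 f1b \<rho>b k2b f12 f2b' \<rho>12)
      qed
      also have "\<dots> = E1 * \<epsilon> ^ 3" by (simp add: E1_def power2_eq_square power3_eq_cube algebra_simps)
      finally show ?thesis .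
    qed
    have "\<bar>(\<integral>y. indicator ?U y * G1 y \<partial>lborel) - (\<integral>y. indicator ?U y * G2 y \<partial>lborel)\<bar> \<le> E1 * \<epsilon> ^ 3 * (unit_ball_vol ?n * r ^ ?n)"
      by (rule integral_indicator_diff_bound[OF G1m G2m G1b diff]) (use r in auto)
    also have "\<dots> = E * \<epsilon> ^ (?n + 3)" by (simp add: E_def r_def power_mult_distrib power_add mult_ac)
    finally show ?thesis unfolding int1 int2 .
  qed
  then show ?thesis using E \<epsilon>0 by blast
qed

end

section \<open>The limit constant and the tent kernel\<close>

context radial_kernel begin

lemma moment_pos:
  assumes nn: "\<And>r. r \<ge> 0 \<Longrightarrow> k r \<ge> 0" and r0: "r0 > 0" "k r0 \<noteq> 0"
  shows "integral {0..} (\<lambda>r. k r * r ^ m) > 0"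
proof -
  let ?f = "\<lambda>r. k r * r ^ m"
  have r0R: "r0 \<le> R" using r0 k_supp by (meson not_le)
  have cont: "continuous_on {0..R} ?f"
    by (intro continuous_intros continuous_on_subset[OF k_cont]) auto
  have "integral {0..R} ?f \<noteq> 0"
  proof
    assume "integral {0..R} ?f = 0"
    then have "\<forall>r\<in>{0..R}. ?f r = 0" using integral_eq_0_iff[OF cont R_pos] nn by simp
    then have "?f r0 = 0" using r0 r0R by auto
    then show False using r0 by simp
  qed
  moreover have "integral {0..R} ?f \<ge> 0"
    by (rule integral_nonneg[OF integrable_continuous_real[OF cont]]) (use nn in auto)
  moreover have "integral {0..R} ?f = integral {0..} ?f"
  proof -
    have "integral {0..R} ?f = integral UNIV (\<lambda>r. if r \<in> {0..R} then ?f r else 0)" by (rule integral_restrict_UNIV[symmetric])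
    also have "(\<lambda>r. if r \<in> {0..R} then ?f r else 0) = (\<lambda>r. if r \<in> {0..} then ?f r else 0)"
      using k_supp by (auto simp: fun_eq_iff)
    also have "integral UNIV \<dots> = integral {0..} ?f" by (simp only: integral_restrict_UNIV)
    finally show ?thesis .
  qed
  ultimately show ?thesis by linarith
qed

end

text \<open>The functional equation of the Gamma function identifies half the unit ball volume,
  which enters through the moment, with the corresponding factor of
  \<open>limit_constant\<close>.\<close>

lemma unit_ball_vol_Gamma:
  assumes "n > 0"
  shows "unit_ball_vol n / 2 = pi powr (n / 2) / (n * Gamma (n / 2))"
proof -
  have "Gamma (n / 2 + 1) = n / 2 * Gamma (n / 2)"
    using assms by (subst Gamma_plus1) (auto dest: nonpos_Ints_nonpos)
  then show ?thesis by (simp add: unit_ball_vol_def)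
qed

text \<open>A concrete kernel: it serves to compare the Laplacian in two charts and to detect the
  atoms of the empirical measure.\<close>

definition hat :: "real \<Rightarrow> real" where "hat r = max 0 (1 - r)"

lemma hat_kernel: "radial_kernel hat 1"
  by unfold_locales (auto simp: hat_def intro!: continuous_intros)

lemma hat_lipschitz: "1-lipschitz_on {0..} hat"
  by (rule lipschitz_onI) (auto simp: hat_def dist_real_def)

lemma radial_kernel_exists:
  assumes L: "L-lipschitz_on {0..} k" and supp: "compact (closure {r. r \<ge> 0 \<and> k r \<noteq> 0})"
  shows "\<exists>R. radial_kernel k R"
proof -
  have "bounded {r. r \<ge> 0 \<and> k r \<noteq> 0}" using compact_imp_bounded[OF supp] bounded_subset closure_subset by blast
  then obtain B where B: "\<forall>r\<in>{r. r \<ge> 0 \<and> k r \<noteq> 0}. norm r \<le> B" unfolding bounded_iff by blast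
  have "radial_kernel k (max 1 B)"
  proof
    show "continuous_on {0..} k" by (rule lipschitz_on_continuous_on[OF L])
    fix r assume r: "max 1 B < r"
    show "k r = 0"
    proof (rule ccontr)
      assume "k r \<noteq> 0"
      then have "norm r \<le> B" using B r by auto
      then show False using r by auto
    qed
  qed simp
  then show ?thesis by blast
qed

text \<open>By continuity \<open>k\<close> cannot be nonzero at 0 alone. Positivity of the moment is
  tested at a positive radius, because its power weight vanishes at 0.\<close>

lemma lipschitz_nonzero_pos:
  fixes k :: "real \<Rightarrow> real"
  assumes L: "L-lipschitz_on {0..} k" and r: "r \<ge> 0" "k r \<noteq> 0"
  shows "\<exists>r>0. k r \<noteq> 0"
proof (cases "r = 0")
  case True
  have L0: "L \<ge> 0" using L by (rule lipschitz_on_nonneg)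
  show ?thesis
  proof (rule ccontr)
    assume "\<not> ?thesis"
    then have z: "k s = 0" if "s > 0" for s using that by blast
    have "\<bar>k 0\<bar> \<le> L * s" if "s > 0" for s
      using lipschitz_onD[OF L, of 0 s] that z[OF that] by (simp add: dist_real_def)
    \<comment> \<open>At this \<open>s\<close> the Lipschitz bound is at most half the absolute
      value of \<open>k 0\<close>.\<close>
    from this[of "\<bar>k 0\<bar> / (2 * (L + 1))"] have "\<bar>k 0\<bar> \<le> L * (\<bar>k 0\<bar> / (2 * (L + 1)))"
      using r True L0 by simp
    also have "\<dots> \<le> \<bar>k 0\<bar> / 2" using L0 by (simp add: field_simps)
    finally show False using r True by simp
  qed
qed (use r in \<open>auto intro!: exI[of _ r]\<close>)

section \<open>Grids and the Kantorovich distance\<close>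

context closed_manifold begin

lemma rd_self: "p \<in> M \<Longrightarrow> rd p p = 0"
proof -
  assume p: "p \<in> M"
  have "rd p p < e" if "e > 0" for e using rd_small[OF p that] by blast
  then show ?thesis using rd_nonneg[OF p p] by (meson less_irrefl not_less order_le_less)
qed

text \<open>Compactness reduces the claim to coordinate balls, on which the density is
  bounded.\<close>

lemma emeasure_Vol_finite: "emeasure Vol M < \<infinity>"
proof -
  let ?C = "{U. openin (top_of_set M) U \<and> emeasure Vol U < \<infinity>}"
  have "\<exists>U\<in>?C. q \<in> U" if q: "q \<in> M" for q
  proof -
    obtain c where c: "c \<in> \<A>" "q \<in> chart_dom c" using cover q by blast
    let ?z = "chart_map c q"
    obtain R a C where R: "R > 0" "cball ?z R \<subseteq> chart_img c" and est: "estimates c (cball ?z R) a C"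
      using chart_ball_exists[OF c] by blast
    interpret local_estimates "chart_img c" "g c" "cball ?z R" a C by (rule est)
    have "emeasure Vol (chart_inv c ` ball ?z R) = (\<integral>\<^sup>+x\<in>ball ?z R. ennreal (dens c x) \<partial>lborel)"
      by (rule emeasure_Vol_ball(1)[OF c(1) R(2)]) auto
    also have "\<dots> \<le> (\<integral>\<^sup>+x. ennreal C * indicator (ball ?z R) x \<partial>lborel)"
      by (intro nn_integral_mono) (auto simp: indicator_def dens_vol_dens[OF c(1)] intro!: ennreal_leI densC)
    also have "\<dots> = ennreal C * emeasure lborel (ball ?z R)" by (intro nn_integral_cmult_indicator) auto
    also have "\<dots> < \<infinity>"
      using emeasure_bounded_finite[OF bounded_ball, of ?z R] by (simp add: ennreal_mult_less_top)
    finally have "emeasure Vol (chart_inv c ` ball ?z R) < \<infinity>" .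
    moreover have "ball ?z R \<subseteq> chart_img c" using R(2) ball_subset_cball by blast
    ultimately show ?thesis using chart_neighbourhood[OF c R(1)] by blast
  qed
  then have "(\<forall>U\<in>?C. openin (top_of_set M) U) \<and> M \<subseteq> \<Union>?C" by blast
  then obtain D where D: "D \<subseteq> ?C" "finite D" "M \<subseteq> \<Union>D" using compact_M unfolding compact_eq_openin_cover by meson
  have sets: "U \<in> sets Vol" if "U \<in> D" for U using that D(1) openin_sets_MB by auto
  have "emeasure Vol M \<le> emeasure Vol (\<Union>U\<in>D. U)" using D sets by (intro emeasure_mono) auto
  also have "\<dots> \<le> (\<Sum>U\<in>D. emeasure Vol U)" using D(2) sets by (intro emeasure_subadditive_finite) auto
  also have "\<dots> < \<infinity>"
  proof -
    have "emeasure Vol U \<noteq> top" if "U \<in> D" for U using that D(1) by fastforce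
    then show ?thesis using D(2) by (simp add: less_top)
  qed
  finally show ?thesis .
qed

lemma measure_Vol_pos:
  assumes "M \<noteq> {}"
  shows "measure Vol M > 0"
proof -
  obtain q where q: "q \<in> M" using assms by blast
  obtain c where c: "c \<in> \<A>" "q \<in> chart_dom c" using cover q by blast
  let ?z = "chart_map c q"
  obtain R where R: "R > 0" "cball ?z R \<subseteq> chart_img c" using chart_ball_exists[OF c] by blast
  obtain m where m: "m > 0" "\<And>x. x \<in> cball ?z R \<Longrightarrow> m \<le> dens c x"
    using local_metric.vol_dens_bounds[OF local_metric_chart[OF c(1)] compact_cball R(2)] by (auto simp: dens_vol_dens[OF c(1)])
  have "0 < ennreal m * emeasure lborel (ball ?z R)"
    using m(1) R(1) by (simp add: ennreal_zero_less_mult_iff emeasure_ball)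
  also have "\<dots> = (\<integral>\<^sup>+x. ennreal m * indicator (ball ?z R) x \<partial>lborel)" by (intro nn_integral_cmult_indicator[symmetric]) auto
  also have "\<dots> \<le> (\<integral>\<^sup>+x\<in>ball ?z R. ennreal (dens c x) \<partial>lborel)"
    by (intro nn_integral_mono) (auto simp: indicator_def intro!: ennreal_leI m)
  also have "\<dots> = emeasure Vol (chart_inv c ` ball ?z R)"
    by (rule emeasure_Vol_ball(1)[OF c(1) R(2), symmetric]) auto
  also have "\<dots> \<le> emeasure Vol M" using emeasure_Vol_ball(2)[OF c(1) R(2), of "ball ?z R"] R(2) chart_inv_M[OF c(1)]
    by (intro emeasure_mono) (auto simp: subset_iff openin_sets_MB)
  finally show ?thesis using emeasure_Vol_finite by (simp add: measure_def enn2real_positive_iff)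
qed

abbreviation V0 :: real where "V0 \<equiv> measure Vol M"

definition mean :: "('a \<Rightarrow> real) \<Rightarrow> real" where
  "mean h = (\<integral>q. h q \<partial>Vol) / V0"

lemma integral_uniform_Vol:
  assumes M: "M \<noteq> {}" and h: "h \<in> borel_measurable MB"
  shows "(\<integral>q. h q \<partial>uniform_measure Vol M) = mean h"
proof -
  have V: "V0 > 0" by (rule measure_Vol_pos[OF M])
  have e: "emeasure Vol M = ennreal V0" using emeasure_Vol_finite by (simp add: emeasure_eq_ennreal_measure less_top)
  have eq: "uniform_measure Vol M = density Vol (\<lambda>q. ennreal (indicator M q / V0))"
    unfolding uniform_measure_def e
  proof (rule arg_cong[where f = "density Vol"], rule ext)
    fix q
    show "indicator M q / ennreal V0 = ennreal (indicator M q / V0)"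
      using V by (cases "q \<in> M") (simp_all add: divide_ennreal flip: ennreal_1)
  qed
  have "(\<integral>q. h q \<partial>uniform_measure Vol M) = (\<integral>q. (indicator M q / V0) *\<^sub>R h q \<partial>Vol)"
    unfolding eq
  proof (rule integral_density)
    have "(indicator M :: 'a \<Rightarrow> real) \<in> borel_measurable MB" by (rule borel_measurable_indicator[OF openin_sets_MB]) simp
    then show "(\<lambda>q. indicator M q / V0) \<in> borel_measurable Vol"
      by (simp add: measurable_cong_sets[OF sets_Vol refl])
  qed (use h V in \<open>auto simp: measurable_cong_sets[OF sets_Vol refl]\<close>)
  also have "\<dots> = (\<integral>q. h q / V0 \<partial>Vol)"
    by (rule Bochner_Integration.integral_cong[OF refl]) auto
  finally show ?thesis by (simp add: mean_def)
qed

lemma Lipschitz_measurable: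
  assumes "\<And>x y. x \<in> M \<Longrightarrow> y \<in> M \<Longrightarrow> \<bar>h x - h y\<bar> \<le> L * rd x y"
  shows "h \<in> borel_measurable MB"
  by (rule borel_measurable_continuous_on_restrict[OF Lipschitz_continuous[OF assms]])

lemma integral_empirical:
  assumes p: "\<And>i. i \<ge> 1 \<Longrightarrow> p i \<in> M" and N: "N \<ge> 1" and h: "h \<in> borel_measurable MB"
  shows "(\<integral>q. h q \<partial>empirical_measure M p N) = (\<Sum>i=1..N. h (p i)) / N"
proof -
  have "p \<in> measurable (uniform_count_measure {1..N}) MB"
    unfolding measurable_cong_sets[OF sets_uniform_count_measure_count_space refl]
    using p by (auto simp: measurable_count_space_eq1 space_restrict_space)
  then have "(\<integral>q. h q \<partial>empirical_measure M p N) = (\<integral>i. h (p i) \<partial>uniform_count_measure {1..N})"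
    unfolding empirical_measure_def using h by (intro integral_distr)
  then show ?thesis by (simp add: integral_uniform_count_measure)
qed

end

section \<open>Empirical averages against the volume mean\<close>

locale grid_sequence = closed_manifold M \<A> g
  for M :: "'a::t2_space set" and \<A> :: "('a, 'n::finite) chart set"
    and g :: "('a, 'n) chart \<Rightarrow> real ^ 'n \<Rightarrow> real ^ 'n \<Rightarrow> real ^ 'n \<Rightarrow> real" +
  fixes p :: "nat \<Rightarrow> 'a"
  assumes p_in: "i \<ge> 1 \<Longrightarrow> p i \<in> M"
    and W1_lim: "W1_to_volume M \<A> g p \<longlonglongrightarrow> 0"
begin

abbreviation W :: "nat \<Rightarrow> real" where "W \<equiv> W1_to_volume M \<A> g p"

definition avg :: "nat \<Rightarrow> ('a \<Rightarrow> real) \<Rightarrow> real" where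
  "avg N h = (\<Sum>i=1..N. h (p i)) / N"

lemma M_nonempty: "M \<noteq> {}" using p_in[of 1] by auto

lemma V0_pos: "V0 > 0" by (rule measure_Vol_pos[OF M_nonempty])

definition Lip :: "real \<Rightarrow> ('a \<Rightarrow> real) \<Rightarrow> bool" where
  "Lip L h \<longleftrightarrow> (\<forall>x\<in>M. \<forall>y\<in>M. \<bar>h x - h y\<bar> \<le> L * rd x y)"

lemma W_eq:
  assumes N: "N \<ge> 1"
  shows "W N = (SUP h\<in>{h. Lip 1 h}. avg N h - mean h)"
proof -
  have "{h. \<forall>x\<in>M. \<forall>y\<in>M. \<bar>h x - h y\<bar> \<le> rd x y} = {h. Lip 1 h}" by (simp add: Lip_def)
  moreover have "(\<integral>x. h x \<partial>empirical_measure M p N) - (\<integral>x. h x \<partial>uniform_measure Vol M) = avg N h - mean h"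
    if "h \<in> {h. Lip 1 h}" for h
  proof -
    have m: "h \<in> borel_measurable MB" by (rule Lipschitz_measurable[of _ 1]) (use that in \<open>auto simp: Lip_def\<close>)
    show ?thesis using integral_empirical[OF p_in N m] integral_uniform_Vol[OF M_nonempty m] by (simp add: avg_def)
  qed
  ultimately show ?thesis unfolding W1_to_volume_def kantorovich_def by (metis (no_types, lifting) SUP_cong)
qed

text \<open>A 1-Lipschitz function varies by at most the diameter, so both averages are within
  \<open>B\<close> of its value at the first grid point. This bound makes the supremum in
  \<open>kantorovich\<close> a genuine least upper bound.\<close>

lemma avg_mean_bounded: "\<exists>B. \<forall>N\<ge>1. \<forall>h. Lip 1 h \<longrightarrow> avg N h - mean h \<le> B"
proof -
  obtain B where B: "B > 0" "\<And>x y. x \<in> M \<Longrightarrow> y \<in> M \<Longrightarrow> rd x y \<le> B" using rd_bounded by blast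
  have "avg N h - mean h \<le> 2 * B" if N: "N \<ge> 1" and h: "Lip 1 h" for N h
  proof -
    have p1: "p 1 \<in> M" using p_in by simp
    have hb: "\<bar>h x - h (p 1)\<bar> \<le> B" if "x \<in> M" for x
    proof -
      have "\<bar>h x - h (p 1)\<bar> \<le> rd x (p 1)" using h that p1 by (simp add: Lip_def)
      also have "\<dots> \<le> B" using that p1 by (rule B(2))
      finally show ?thesis .
    qed
    have "(\<Sum>i=1..N. h (p i)) \<le> (\<Sum>i=1..N. h (p 1) + B)"
      by (rule sum_mono) (use hb p_in in \<open>force simp: abs_le_iff\<close>)
    then have 1: "avg N h \<le> h (p 1) + B" using N by (simp add: avg_def field_simps)
    have m: "h \<in> borel_measurable MB" by (rule Lipschitz_measurable[of _ 1]) (use h in \<open>auto simp: Lip_def\<close>)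
    then have m': "h \<in> borel_measurable Vol" by (simp add: measurable_cong_sets[OF sets_Vol refl])
    interpret finite_measure Vol by (rule finite_measureI) (use emeasure_Vol_finite in auto)
    have int: "integrable Vol h"
    proof (rule integrable_const_bound[OF _ m', of "\<bar>h (p 1)\<bar> + B"])
      show "AE x in Vol. norm (h x) \<le> \<bar>h (p 1)\<bar> + B"
      proof (rule AE_I2)
        fix x assume "x \<in> space Vol"
        then have "\<bar>h x - h (p 1)\<bar> \<le> B" using hb by simp
        then show "norm (h x) \<le> \<bar>h (p 1)\<bar> + B" by simp
      qed
    qed
    have "(h (p 1) - B) * V0 = (\<integral>x. h (p 1) - B \<partial>Vol)" by simp
    also have "\<dots> \<le> (\<integral>x. h x \<partial>Vol)"
    proof (rule integral_mono[OF _ int])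
      fix x assume "x \<in> space Vol"
      then have "\<bar>h x - h (p 1)\<bar> \<le> B" using hb by simp
      then show "h (p 1) - B \<le> h x" by simp
    qed simp
    finally have "h (p 1) - B \<le> mean h" using V0_pos by (simp add: mean_def field_simps)
    then show ?thesis using 1 by simp
  qed
  then show ?thesis by blast
qed

lemma avg_mean_le_W:
  assumes N: "N \<ge> 1" and h: "Lip 1 h"
  shows "avg N h - mean h \<le> W N"
proof -
  obtain B where B: "\<And>N h. N \<ge> 1 \<Longrightarrow> Lip 1 h \<Longrightarrow> avg N h - mean h \<le> B" using avg_mean_bounded by blast
  show ?thesis unfolding W_eq[OF N]
    by (rule cSUP_upper) (use h N B in \<open>auto intro!: bdd_aboveI[of _ B]\<close>)
qed

lemma W_nonneg: "N \<ge> 1 \<Longrightarrow> W N \<ge> 0"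
  using avg_mean_le_W[of N "\<lambda>_. 0"] rd_nonneg by (simp add: Lip_def avg_def mean_def)

text \<open>Scaling to Lipschitz constant 1, applied to \<open>h\<close> and to its
  negative.\<close>

lemma avg_mean_Lip:
  assumes N: "N \<ge> 1" and L: "L > 0" and h: "Lip L h"
  shows "\<bar>avg N h - mean h\<bar> \<le> L * W N"
proof -
  have "avg N (\<lambda>x. h x / L) - mean (\<lambda>x. h x / L) \<le> W N"
    by (rule avg_mean_le_W[OF N]) (use h L in \<open>auto simp: Lip_def diff_divide_distrib[symmetric] field_simps\<close>)
  then have "(avg N h - mean h) / L \<le> W N"
    by (simp add: avg_def mean_def sum_divide_distrib[symmetric] diff_divide_distrib mult.commute)
  then have 1: "avg N h - mean h \<le> L * W N"
    using L by (simp add: pos_divide_le_eq mult.commute)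
  have "avg N (\<lambda>x. - h x / L) - mean (\<lambda>x. - h x / L) \<le> W N"
  proof (rule avg_mean_le_W[OF N])
    have "\<bar>- h x / L - - h y / L\<bar> = \<bar>h x - h y\<bar> / L" for x y
      using L by (simp add: diff_divide_distrib[symmetric] abs_minus_commute)
    then show "Lip 1 (\<lambda>x. - h x / L)" using h L by (simp add: Lip_def field_simps)
  qed
  then have "(mean h - avg N h) / L \<le> W N"
    by (simp add: avg_def mean_def sum_divide_distrib[symmetric] sum_negf diff_divide_distrib mult.commute)
  then have 2: "mean h - avg N h \<le> L * W N"
    using L by (simp add: pos_divide_le_eq mult.commute)
  show ?thesis using 1 2 by linarith
qed

end

section \<open>Asymptotics on the manifold and independence of the chart\<close>

context closed_manifold begin

text \<open>Both charts compute the limit of the same integrals.\<close>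

lemma lapc_chart_independent:
  assumes f: "smooth_function \<A> f" and c: "c \<in> \<A>" "q \<in> chart_dom c" and c': "c' \<in> \<A>" "q \<in> chart_dom c'"
  shows "lapc c f (chart_map c q) = lapc c' f (chart_map c' q)"
proof -
  interpret rk: radial_kernel hat 1 by (rule hat_kernel)
  let ?n = "CARD('n)" and ?m = "radial_kernel.moment hat TYPE('n)"
  let ?I = "\<lambda>\<epsilon>. \<integral>x. hat (rd q x / \<epsilon>) * (f x - f q) \<partial>Vol"
  have loc: "\<exists>E\<ge>0. \<exists>\<epsilon>0>0. \<forall>\<epsilon>. 0 < \<epsilon> \<and> \<epsilon> \<le> \<epsilon>0 \<longrightarrow>
    \<bar>?I \<epsilon> - \<epsilon> ^ (?n + 2) * (?m / 2 * lapc c f (chart_map c q))\<bar> \<le> E * \<epsilon> ^ (?n + 3)"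
    if c: "c \<in> \<A>" "q \<in> chart_dom c" for c
  proof -
    obtain R a C where R: "R > 0" and est: "estimates c (cball (chart_map c q) R) a C"
      using chart_ball_exists[OF c] by blast
    have "chart_map c q \<in> cball (chart_map c q) (R / 2)" using R by simp
    then show ?thesis
      using chart_inv_map[OF c] local_kernel_asymptotics[OF c(1) est R hat_kernel hat_lipschitz f]
      by (elim exE conjE) (drule bspec, assumption, auto)
  qed
  let ?l = "lapc c f (chart_map c q)" and ?l' = "lapc c' f (chart_map c' q)"
  obtain E \<epsilon>0 where E: "E \<ge> 0" "\<epsilon>0 > 0" "\<And>\<epsilon>. 0 < \<epsilon> \<Longrightarrow> \<epsilon> \<le> \<epsilon>0 \<Longrightarrow> \<bar>?I \<epsilon> - \<epsilon> ^ (?n + 2) * (?m / 2 * ?l)\<bar> \<le> E * \<epsilon> ^ (?n + 3)"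
    using loc[OF c] by blast
  obtain E' \<epsilon>0' where E': "E' \<ge> 0" "\<epsilon>0' > 0" "\<And>\<epsilon>. 0 < \<epsilon> \<Longrightarrow> \<epsilon> \<le> \<epsilon>0' \<Longrightarrow> \<bar>?I \<epsilon> - \<epsilon> ^ (?n + 2) * (?m / 2 * ?l')\<bar> \<le> E' * \<epsilon> ^ (?n + 3)"
    using loc[OF c'] by blast
  have m: "?m > 0"
    unfolding rk.moment_def using rk.moment_pos[of "1/2" "?n + 1"] by (simp add: hat_def)
  \<comment> \<open>A positive multiple of the distance between the two Laplacians. Both expansions
    describe the same integrals, so dividing by \<epsilon>^(n+2) bounds it by a multiple of
    \<epsilon>.\<close>
  define d where "d = ?m / 2 * \<bar>?l - ?l'\<bar>"
  have bound: "d \<le> (E + E') * \<epsilon>" if \<epsilon>: "0 < \<epsilon>" "\<epsilon> \<le> min \<epsilon>0 \<epsilon>0'" for \<epsilon>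
  proof -
    have "\<bar>\<epsilon> ^ (?n + 2) * (?m / 2 * ?l) - \<epsilon> ^ (?n + 2) * (?m / 2 * ?l')\<bar> \<le> E * \<epsilon> ^ (?n + 3) + E' * \<epsilon> ^ (?n + 3)"
      using E(3)[of \<epsilon>] E'(3)[of \<epsilon>] \<epsilon> by linarith
    moreover have "\<epsilon> ^ (?n + 2) * (?m / 2 * ?l) - \<epsilon> ^ (?n + 2) * (?m / 2 * ?l') = \<epsilon> ^ (?n + 2) * (?m / 2 * (?l - ?l'))"
      by (simp add: algebra_simps)
    moreover have "\<bar>\<epsilon> ^ (?n + 2) * (?m / 2 * (?l - ?l'))\<bar> = \<epsilon> ^ (?n + 2) * d"
      using \<epsilon> m by (simp add: d_def abs_mult)
    moreover have "E * \<epsilon> ^ (?n + 3) + E' * \<epsilon> ^ (?n + 3) = \<epsilon> ^ (?n + 2) * ((E + E') * \<epsilon>)"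
      by (simp add: algebra_simps power_add power3_eq_cube power2_eq_square)
    ultimately have "\<epsilon> ^ (?n + 2) * d \<le> \<epsilon> ^ (?n + 2) * ((E + E') * \<epsilon>)" by simp
    then show ?thesis using \<epsilon> by (simp only: mult_le_cancel_left_pos zero_less_power)
  qed
  have "d \<le> 0"
  proof (rule ccontr)
    assume "\<not> d \<le> 0"
    then have d: "d > 0" by simp
    define \<epsilon> where "\<epsilon> = min (min \<epsilon>0 \<epsilon>0') (d / (2 * (E + E' + 1)))"
    have "\<epsilon> > 0" using E E' d by (simp add: \<epsilon>_def)
    moreover have "d \<le> (E + E') * \<epsilon>" by (rule bound[OF \<open>\<epsilon> > 0\<close>]) (simp only: \<epsilon>_def min.cobounded1)
    moreover have "(E + E') * \<epsilon> \<le> (E + E' + 1) * (d / (2 * (E + E' + 1)))"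
      using E E' \<open>\<epsilon> > 0\<close> by (intro mult_mono) (auto simp: \<epsilon>_def)
    moreover have "\<dots> = d / 2" using E E' by (simp add: field_simps)
    ultimately show False using d by simp
  qed
  then have "\<bar>?l - ?l'\<bar> \<le> 0" unfolding d_def using m by (simp add: mult_le_0_iff)
  then show ?thesis by simp
qed

text \<open>One number \<open>E\<close> encodes both the error constant and the admissible range of
  \<epsilon>. The statement then becomes weaker as \<open>E\<close> grows, which is what
  \<open>compact_uniform_bound\<close> asks for.\<close>

theorem kernel_asymptotics:
  assumes k: "radial_kernel k Rk" and Lk: "L-lipschitz_on {0..} k" and f: "smooth_function \<A> f"
  shows "\<exists>E>0. \<forall>x\<in>M. \<forall>\<epsilon>. 0 < \<epsilon> \<and> \<epsilon> < 1 / E \<longrightarrow>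
    \<bar>(\<integral>q. k (rd x q / \<epsilon>) * (f q - f x) \<partial>Vol)
      - \<epsilon> ^ (CARD('n) + 2) * (radial_kernel.moment k TYPE('n) / 2 * laplace_beltrami \<A> g f x)\<bar> \<le> E * \<epsilon> ^ (CARD('n) + 3)"
proof -
  let ?P = "\<lambda>x E. E > 0 \<and> (\<forall>\<epsilon>. 0 < \<epsilon> \<and> \<epsilon> < 1 / E \<longrightarrow>
    \<bar>(\<integral>q. k (rd x q / \<epsilon>) * (f q - f x) \<partial>Vol)
      - \<epsilon> ^ (CARD('n) + 2) * (radial_kernel.moment k TYPE('n) / 2 * laplace_beltrami \<A> g f x)\<bar> \<le> E * \<epsilon> ^ (CARD('n) + 3))"
  have "\<exists>E>0. \<forall>x\<in>M. ?P x E"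
  proof (rule compact_uniform_bound[OF compact_M])
    fix q assume "q \<in> M"
    then obtain c where c: "c \<in> \<A>" "q \<in> chart_dom c" using cover by blast
    let ?z = "chart_map c q"
    obtain R a C where R: "R > 0" "cball ?z R \<subseteq> chart_img c" and est: "estimates c (cball ?z R) a C"
      using chart_ball_exists[OF c] by blast
    obtain E \<epsilon>0 where E: "E \<ge> 0" "\<epsilon>0 > 0" "\<And>z \<epsilon>. z \<in> cball ?z (R / 2) \<Longrightarrow> 0 < \<epsilon> \<Longrightarrow> \<epsilon> \<le> \<epsilon>0 \<Longrightarrow>
      \<bar>(\<integral>q. k (rd (chart_inv c z) q / \<epsilon>) * (f q - f (chart_inv c z)) \<partial>Vol)
      - \<epsilon> ^ (CARD('n) + 2) * (radial_kernel.moment k TYPE('n) / 2 * lapc c f z)\<bar> \<le> E * \<epsilon> ^ (CARD('n) + 3)"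
      using local_kernel_asymptotics[OF c(1) est R(1) k Lk f] by blast
    define E' where "E' = max (E + 1) (1 / \<epsilon>0)"
    have E': "E' > 0" "E \<le> E'" "1 / E' \<le> \<epsilon>0" using E by (auto simp: E'_def field_simps max_def)
    have bs: "ball ?z (R / 2) \<subseteq> chart_img c" using R by (auto simp: subset_iff)
    have R2: "R / 2 > 0" using R by simp
    have "?P x E'" if x: "x \<in> chart_inv c ` ball ?z (R / 2)" for x
    proof (intro conjI allI impI E'(1))
      fix \<epsilon> assume \<epsilon>: "0 < \<epsilon> \<and> \<epsilon> < 1 / E'"
      obtain z where z: "x = chart_inv c z" "z \<in> ball ?z (R / 2)" using x by blast
      have zi: "z \<in> chart_img c" using z bs by blast
      have xd: "x \<in> chart_dom c" "chart_map c x = z" using z zi c by auto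
      have xM: "x \<in> M" using xd chart_facts(4)[OF c(1)] by blast
      \<comment> \<open>\<open>laplace_beltrami\<close> picks its own chart at each point, whereas
        the estimate lives in the fixed chart \<open>c\<close>.\<close>
      have lap: "laplace_beltrami \<A> g f x = lapc c f z"
        unfolding laplace_beltrami_lapc using lapc_chart_independent[OF f _ _ c(1) xd(1)] chart_at[OF xM] xd(2) by simp
      have "\<bar>(\<integral>q. k (rd x q / \<epsilon>) * (f q - f x) \<partial>Vol)
        - \<epsilon> ^ (CARD('n) + 2) * (radial_kernel.moment k TYPE('n) / 2 * laplace_beltrami \<A> g f x)\<bar> \<le> E * \<epsilon> ^ (CARD('n) + 3)"
        unfolding lap unfolding z(1) by (rule E(3)) (use z \<epsilon> E' in auto)
      also have "\<dots> \<le> E' * \<epsilon> ^ (CARD('n) + 3)" using E'(2) \<epsilon> by (intro mult_right_mono) auto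
      finally show "\<bar>(\<integral>q. k (rd x q / \<epsilon>) * (f q - f x) \<partial>Vol)
        - \<epsilon> ^ (CARD('n) + 2) * (radial_kernel.moment k TYPE('n) / 2 * laplace_beltrami \<A> g f x)\<bar> \<le> E' * \<epsilon> ^ (CARD('n) + 3)" .
    qed
    then show "\<exists>U L. openin (top_of_set M) U \<and> q \<in> U \<and> (\<forall>x\<in>U. ?P x L)"
      using chart_neighbourhood[OF c R2 bs] by (intro exI[of _ "chart_inv c ` ball ?z (R / 2)"] exI[of _ E']) blast
  next
    fix x :: 'a and E E' :: real assume P: "?P x E" and "E \<le> E'"
    show "?P x E'"
    proof (intro conjI allI impI)
      show "E' > 0" using P \<open>E \<le> E'\<close> by linarith
      fix \<epsilon> :: real assume \<epsilon>: "0 < \<epsilon> \<and> \<epsilon> < 1 / E'"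
      have "1 / E' \<le> 1 / E" using P \<open>E \<le> E'\<close> by (intro divide_left_mono) auto
      then have "\<bar>(\<integral>q. k (rd x q / \<epsilon>) * (f q - f x) \<partial>Vol)
        - \<epsilon> ^ (CARD('n) + 2) * (radial_kernel.moment k TYPE('n) / 2 * laplace_beltrami \<A> g f x)\<bar> \<le> E * \<epsilon> ^ (CARD('n) + 3)"
        using P \<epsilon> by auto
      also have "\<dots> \<le> E' * \<epsilon> ^ (CARD('n) + 3)" using \<open>E \<le> E'\<close> \<epsilon> by (intro mult_right_mono) auto
      finally show "\<bar>(\<integral>q. k (rd x q / \<epsilon>) * (f q - f x) \<partial>Vol)
        - \<epsilon> ^ (CARD('n) + 2) * (radial_kernel.moment k TYPE('n) / 2 * laplace_beltrami \<A> g f x)\<bar> \<le> E' * \<epsilon> ^ (CARD('n) + 3)" .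
    qed
  qed
  then show ?thesis by blast
qed

lemma limit_constant_moment:
  assumes k: "radial_kernel k Rk"
  shows "limit_constant M \<A> g k = radial_kernel.moment k TYPE('n) / 2 / measure Vol M"
  unfolding limit_constant_def radial_kernel.moment_def[OF k]
  using unit_ball_vol_Gamma[of "real CARD('n)"] by (simp add: field_simps)

text \<open>Balls of radius \<epsilon> have volume of order \<epsilon>^n. This expresses the absence
  of atoms in a form that can be tested with Lipschitz functions.\<close>

lemma hat_integral_bound:
  assumes q: "q \<in> M"
  shows "\<exists>E\<ge>0. \<exists>\<epsilon>0>0. \<forall>\<epsilon>. 0 < \<epsilon> \<and> \<epsilon> \<le> \<epsilon>0 \<longrightarrow> (\<integral>x. hat (rd q x / \<epsilon>) \<partial>Vol) \<le> E * \<epsilon> ^ CARD('n)"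
proof -
  obtain c where c: "c \<in> \<A>" "q \<in> chart_dom c" using cover q by blast
  let ?z = "chart_map c q" and ?S = "chart_img c"
  obtain R a C where R: "R > 0" "cball ?z R \<subseteq> ?S" and est: "estimates c (cball ?z R) a C"
    using chart_ball_exists[OF c] by blast
  interpret local_estimates ?S "g c" "cball ?z R" a C by (rule est)
  obtain s where s: "s > 0" "s \<le> R / 2"
    and near0: "\<And>z x r. z \<in> cball ?z (R / 2) \<Longrightarrow> x \<in> M \<Longrightarrow> 0 < r \<Longrightarrow> r \<le> s \<Longrightarrow> rd (chart_inv c z) x < a / 4 * r \<Longrightarrow>
      x \<in> chart_dom c \<and> norm (chart_map c x - z) < r"
    using distance_expansion[OF c(1) est R(1)] by blast
  have near: "x \<in> chart_dom c \<and> norm (chart_map c x - ?z) < r" if "x \<in> M" "0 < r" "r \<le> s" "rd q x < a / 4 * r" for x r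
    using near0[of ?z x r] that R(1) c by simp
  define A where "A = 8 / a"
  have A: "A > 0" using a_pos by (simp add: A_def)
  have "(\<integral>x. hat (rd q x / \<epsilon>) \<partial>Vol) \<le> C * (unit_ball_vol CARD('n) * A ^ CARD('n)) * \<epsilon> ^ CARD('n)"
    if \<epsilon>: "0 < \<epsilon>" "\<epsilon> \<le> s / A" for \<epsilon>
  proof -
    define r where "r = A * \<epsilon>"
    have r: "r > 0" "r \<le> s" using \<epsilon> A by (simp_all add: r_def field_simps)
    let ?U = "ball ?z r"
    have UK: "?U \<subseteq> cball ?z R" using r s R by (auto simp: subset_iff)
    then have US: "?U \<subseteq> ?S" using R(2) by blast
    define G where "G y = hat (rd q (chart_inv c y) / \<epsilon>) * dens c y" for y
    have ch: "continuous_on UNIV hat" unfolding hat_def[abs_def] by (intro continuous_intros)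
    have cont: "continuous_on M (\<lambda>x. hat (rd q x / \<epsilon>))"
      by (rule continuous_on_compose2[OF ch]) (use \<epsilon> in \<open>auto intro!: continuous_intros rd_continuous[OF q]\<close>)
    have int: "(\<integral>x. hat (rd q x / \<epsilon>) \<partial>Vol) = (\<integral>y. indicator ?U y * G y \<partial>lborel)"
      unfolding G_def
    proof (rule integral_Vol_chart[OF c(1) _ US cont])
      fix x assume x: "x \<in> M" "hat (rd q x / \<epsilon>) \<noteq> 0"
      then have "rd q x / \<epsilon> < 1" unfolding hat_def by linarith
      then have "rd q x < \<epsilon>" using \<epsilon> by (simp add: field_simps)
      also have "\<dots> < a / 4 * r" using \<epsilon> a_pos by (simp add: r_def A_def)
      finally have "x \<in> chart_dom c \<and> norm (chart_map c x - ?z) < r" by (rule near[OF x(1) r])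
      then show "x \<in> chart_inv c ` ?U" using c(1)
        by (intro image_eqI[of _ _ "chart_map c x"]) (auto simp: dist_norm norm_minus_commute)
    qed simp
    have Gm: "(\<lambda>y. indicator ?U y * G y) \<in> borel_measurable borel"
    proof -
      have "continuous_on ?S (\<lambda>y. hat (rd q (chart_inv c y) / \<epsilon>))"
        by (rule continuous_on_compose2[OF cont chart_inv_continuous[OF c(1)]]) (use chart_inv_M[OF c(1)] in auto)
      then have "continuous_on ?S G" unfolding G_def dens_vol_dens[OF c(1)]
        by (intro continuous_intros vol_dens_continuous)
      then have "(\<lambda>y. indicator ?U y *\<^sub>R G y) \<in> borel_measurable borel"
        using US by (intro borel_measurable_continuous_on_indicator) (auto intro: continuous_on_subset)
      then show ?thesis by simp
    qed
    have Gb: "\<bar>G y\<bar> \<le> C" if y: "y \<in> ?U" for y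
    proof -
      have yK: "y \<in> cball ?z R" using UK y by blast
      have "rd q (chart_inv c y) \<ge> 0" by (rule rd_nonneg[OF q chart_inv_M[OF c(1) in_S[OF yK]]])
      then have "\<bar>hat (rd q (chart_inv c y) / \<epsilon>)\<bar> \<le> 1" using \<epsilon> by (simp add: hat_def)
      moreover have "\<bar>dens c y\<bar> \<le> C"
        using densC[OF yK] vol_dens_pos[OF in_S[OF yK]] by (simp add: dens_vol_dens[OF c(1)])
      ultimately have "\<bar>hat (rd q (chart_inv c y) / \<epsilon>)\<bar> * \<bar>dens c y\<bar> \<le> 1 * C" by (intro mult_mono) auto
      then show ?thesis by (simp add: G_def abs_mult)
    qed
    have "\<bar>(\<integral>y. indicator ?U y * G y \<partial>lborel) - (\<integral>y. indicator ?U y * 0 \<partial>lborel)\<bar> \<le> C * (unit_ball_vol CARD('n) * r ^ CARD('n))"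
      by (rule integral_indicator_diff_bound[OF Gm]) (use Gb r in auto)
    then show ?thesis unfolding int by (simp add: r_def power_mult_distrib mult_ac)
  qed
  moreover have "C * (unit_ball_vol CARD('n) * A ^ CARD('n)) \<ge> 0" using C_ge A by simp
  moreover have "s / A > 0" using s A by simp
  ultimately show ?thesis by blast
qed

end

section \<open>Positivity and decay of the bandwidth, and the passage to grids\<close>

context grid_sequence begin

text \<open>An empirical measure has atoms while the Riemannian volume has none.\<close>

lemma W_pos:
  assumes N: "N \<ge> 1"
  shows "W N > 0"
proof (rule ccontr)
  assume "\<not> W N > 0"
  then have W0: "W N = 0" using W_nonneg[OF N] by simp
  have p1: "p 1 \<in> M" using p_in by simp
  obtain E \<epsilon>0 where E: "E \<ge> 0" "\<epsilon>0 > 0" "\<And>\<epsilon>. 0 < \<epsilon> \<Longrightarrow> \<epsilon> \<le> \<epsilon>0 \<Longrightarrow> (\<integral>x. hat (rd (p 1) x / \<epsilon>) \<partial>Vol) \<le> E * \<epsilon> ^ CARD('n)"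
    using hat_integral_bound[OF p1] by blast
  have bound: "1 / N \<le> E / V0 * \<epsilon>" if \<epsilon>: "0 < \<epsilon>" "\<epsilon> \<le> \<epsilon>0" "\<epsilon> \<le> 1" for \<epsilon>
  proof -
    \<comment> \<open>The tent of width \<epsilon> at the first grid point is Lipschitz, so a
      vanishing W1 would force equal averages. The empirical one is at least 1 / N, while the volume
      mean tends to 0 with \<epsilon>.\<close>
    let ?h = "\<lambda>x. hat (rd (p 1) x / \<epsilon>)"
    have "Lip (1 / \<epsilon>) ?h" unfolding Lip_def
    proof (intro ballI)
      fix x y assume xy: "x \<in> M" "y \<in> M"
      have "\<bar>?h x - ?h y\<bar> \<le> \<bar>rd (p 1) x / \<epsilon> - rd (p 1) y / \<epsilon>\<bar>" by (auto simp: hat_def)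
      also have "\<dots> = \<bar>rd (p 1) x - rd (p 1) y\<bar> / \<epsilon>" using \<epsilon>(1) by (simp add: diff_divide_distrib[symmetric])
      also have "\<dots> \<le> rd x y / \<epsilon>" using rd_triangle_diff[OF p1 xy] \<epsilon>(1) by (intro divide_right_mono) auto
      finally show "\<bar>?h x - ?h y\<bar> \<le> 1 / \<epsilon> * rd x y" by simp
    qed
    then have eq: "avg N ?h = mean ?h" using avg_mean_Lip[OF N, of "1 / \<epsilon>" ?h] \<epsilon>(1) W0 by simp
    have "1 = ?h (p 1)" using rd_self[OF p1] by (simp add: hat_def)
    also have "\<dots> \<le> (\<Sum>i=1..N. ?h (p i))" by (rule member_le_sum) (use N in \<open>auto simp: hat_def\<close>)
    finally have "1 / N \<le> avg N ?h" unfolding avg_def by (rule divide_right_mono) simp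
    also have "\<dots> \<le> E * \<epsilon> ^ CARD('n) / V0" unfolding eq mean_def using E(3)[OF \<epsilon>(1,2)] V0_pos by (intro divide_right_mono) auto
    also have "\<dots> \<le> E * \<epsilon> / V0"
    proof (intro divide_right_mono mult_left_mono)
      have "\<epsilon> ^ CARD('n) \<le> \<epsilon> ^ 1" using \<epsilon> by (intro power_decreasing) (auto simp: Suc_leI)
      then show "\<epsilon> ^ CARD('n) \<le> \<epsilon>" by simp
    qed (use E V0_pos in auto)
    finally show ?thesis by simp
  qed
  define e where "e = E / V0"
  have e: "e \<ge> 0" using E V0_pos by (simp add: e_def)
  \<comment> \<open>Small enough to push the bound down to 1 / (2 N).\<close>
  define \<epsilon> where "\<epsilon> = min (min \<epsilon>0 1) (1 / (2 * real N * (e + 1)))"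
  have \<epsilon>: "0 < \<epsilon>" using E N e by (simp add: \<epsilon>_def)
  then have "1 / N \<le> e * \<epsilon>" unfolding e_def by (intro bound) (auto simp: \<epsilon>_def)
  also have "\<dots> \<le> (e + 1) * (1 / (2 * real N * (e + 1)))" using e \<epsilon> by (intro mult_mono) (auto simp: \<epsilon>_def)
  also have "\<dots> = 1 / (2 * real N)" using e by simp
  finally show False using N by (simp add: field_simps)
qed

definition Wsup :: "nat \<Rightarrow> real" where "Wsup N = (SUP m\<in>{N..}. W m)"

lemma W_bdd: "bdd_above (W ` {N..})"
proof -
  have "Bseq W" using W1_lim convergentI convergent_imp_Bseq by blast
  then show ?thesis using Bseq_eq_bounded bounded_imp_bdd_above bounded_subset by (metis image_mono subset_UNIV)
qed

lemma W_le_Wsup: "W N \<le> Wsup N"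
  unfolding Wsup_def by (rule cSUP_upper[OF _ W_bdd]) simp

lemma Wsup_pos: "N \<ge> 1 \<Longrightarrow> Wsup N > 0"
  using W_pos W_le_Wsup by (meson less_le_trans)

lemma Wsup_lim: "Wsup \<longlonglongrightarrow> 0"
proof (rule LIMSEQ_I)
  fix e :: real assume e: "0 < e"
  obtain N0 where N0: "\<And>m. m \<ge> N0 \<Longrightarrow> \<bar>W m\<bar> < e / 2" using LIMSEQ_D[OF W1_lim, of "e / 2"] e by auto
  have "norm (Wsup N - 0) < e" if N: "N \<ge> max 1 N0" for N
  proof -
    have "Wsup N \<le> e / 2" unfolding Wsup_def
    proof (rule cSUP_least)
      fix m assume "m \<in> {N..}"
      then show "W m \<le> e / 2" using N0[of m] N by auto
    qed simp
    then show ?thesis using Wsup_pos[of N] N e by simp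
  qed
  then show "\<exists>no. \<forall>n\<ge>no. norm (Wsup n - 0) < e" by blast
qed

abbreviation bw :: "nat \<Rightarrow> real" where "bw \<equiv> bandwidth M \<A> g p"

lemma bw_eq: "bw N = Wsup N powr (1 / (4 + real CARD('n)))"
  by (simp add: bandwidth_def Wsup_def)

lemma bw_pos: "N \<ge> 1 \<Longrightarrow> bw N > 0"
  using Wsup_pos[of N] by (simp add: bw_eq)

text \<open>With this exponent the transport error is a power of the bandwidth that beats the
  normalization by two orders.\<close>

lemma bw_power:
  assumes N: "N \<ge> 1"
  shows "bw N ^ (CARD('n) + 4) = Wsup N"
proof -
  have "bw N ^ (CARD('n) + 4) = bw N powr real (CARD('n) + 4)" using bw_pos[OF N] by (simp only: powr_realpow)
  also have "\<dots> = Wsup N powr ((real CARD('n) + 4) / (4 + real CARD('n)))" unfolding bw_eq powr_powr by simp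
  also have "(real CARD('n) + 4) / (4 + real CARD('n)) = 1" by simp
  also have "Wsup N powr 1 = Wsup N" using Wsup_pos[OF N] by simp
  finally show ?thesis .
qed

lemma bw_lim: "bw \<longlonglongrightarrow> 0"
proof -
  have "(\<lambda>N. Wsup N powr (1 / (4 + real CARD('n)))) \<longlonglongrightarrow> 0"
  proof (rule tendsto_zero_powrI[OF Wsup_lim tendsto_const])
    show "\<forall>\<^sub>F N in sequentially. 0 \<le> Wsup N" using Wsup_pos by (intro eventually_sequentiallyI[of 1]) (auto simp: less_imp_le)
  qed simp
  then show ?thesis by (simp add: bw_eq[abs_def])
qed

lemma kernel_function_Lip:
  assumes k: "radial_kernel k Rk" and Lk: "L-lipschitz_on {0..} k"
    and Bk: "\<And>r. r \<ge> 0 \<Longrightarrow> \<bar>k r\<bar> \<le> Bk" and f: "Lip Lf f" and Lf: "Lf \<ge> 0" and x: "x \<in> M" and \<epsilon>: "\<epsilon> > 0"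
  shows "Lip (L * Rk * Lf + Bk * Lf) (\<lambda>q. k (rd x q / \<epsilon>) * (f q - f x))"
  unfolding Lip_def
proof (intro ballI)
  interpret radial_kernel k Rk by (rule k)
  have L0: "L \<ge> 0" using Lk by (rule lipschitz_on_nonneg)
  let ?h = "\<lambda>q. k (rd x q / \<epsilon>) * (f q - f x)"
  have Bk0: "Bk \<ge> 0" using Bk[of 0] by simp
  \<comment> \<open>By symmetry \<open>q\<close> may be taken as the nearer point. Either both
    values vanish, or \<open>f q - f x\<close> is at most Lf Rk \<epsilon>; the product is split so
    that this difference multiplies the increment of the kernel, whose factor 1 / \<epsilon> it
    cancels.\<close>
  have main: "\<bar>?h q - ?h q'\<bar> \<le> (L * Rk * Lf + Bk * Lf) * rd q q'"
    if q: "q \<in> M" "q' \<in> M" and le: "rd x q \<le> rd x q'" for q q'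
  proof (cases "rd x q / \<epsilon> \<le> Rk")
    case False
    then have "rd x q' / \<epsilon> > Rk" using le \<epsilon> by (smt (verit) divide_right_mono)
    then have "?h q = 0" "?h q' = 0" using False k_supp[of "rd x q / \<epsilon>"] k_supp[of "rd x q' / \<epsilon>"] by auto
    moreover have "0 \<le> (L * Rk * Lf + Bk * Lf) * rd q q'" using L0 R_pos Lf Bk0 rd_nonneg[OF q] by simp
    ultimately show ?thesis by (simp only: diff_self abs_zero)
  next
    case True
    have r0: "rd x q \<ge> 0" "rd x q' \<ge> 0" using rd_nonneg[OF x] q by auto
    have "\<bar>k (rd x q / \<epsilon>) - k (rd x q' / \<epsilon>)\<bar> \<le> L * \<bar>rd x q / \<epsilon> - rd x q' / \<epsilon>\<bar>"
      using lipschitz_onD[OF Lk, of "rd x q / \<epsilon>" "rd x q' / \<epsilon>"] r0 \<epsilon> by (simp add: dist_real_def)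
    also have "\<bar>rd x q / \<epsilon> - rd x q' / \<epsilon>\<bar> = \<bar>rd x q - rd x q'\<bar> / \<epsilon>" using \<epsilon> by (simp add: diff_divide_distrib[symmetric])
    also have "L * \<dots> \<le> L * (rd q q' / \<epsilon>)" using rd_triangle_diff[OF x q] L0 \<epsilon> by (intro mult_left_mono divide_right_mono) auto
    finally have 1: "\<bar>k (rd x q / \<epsilon>) - k (rd x q' / \<epsilon>)\<bar> \<le> L * (rd q q' / \<epsilon>)" .
    have "\<bar>f q - f x\<bar> \<le> Lf * rd x q" using f x q rd_commute[OF x q(1)] by (simp add: Lip_def)
    also have "\<dots> \<le> Lf * (Rk * \<epsilon>)" using True \<epsilon> Lf by (intro mult_left_mono) (auto simp: field_simps)
    finally have 2: "\<bar>f q - f x\<bar> \<le> Lf * (Rk * \<epsilon>)" .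
    have 3: "\<bar>k (rd x q' / \<epsilon>)\<bar> \<le> Bk" using r0 \<epsilon> by (intro Bk) simp
    have 4: "\<bar>f q - f q'\<bar> \<le> Lf * rd q q'" using f q by (simp add: Lip_def)
    have d0: "rd q q' \<ge> 0" by (rule rd_nonneg[OF q])
    have "?h q - ?h q' = (k (rd x q / \<epsilon>) - k (rd x q' / \<epsilon>)) * (f q - f x) + k (rd x q' / \<epsilon>) * (f q - f q')"
      by (simp add: algebra_simps)
    also have "\<bar>\<dots>\<bar> \<le> \<bar>k (rd x q / \<epsilon>) - k (rd x q' / \<epsilon>)\<bar> * \<bar>f q - f x\<bar> + \<bar>k (rd x q' / \<epsilon>)\<bar> * \<bar>f q - f q'\<bar>"
      by (simp only: abs_mult[symmetric] abs_triangle_ineq)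
    also have "\<dots> \<le> (L * (rd q q' / \<epsilon>)) * (Lf * (Rk * \<epsilon>)) + Bk * (Lf * rd q q')"
      by (intro add_mono mult_mono 1 2 3 4) (use L0 d0 \<epsilon> Bk0 in auto)
    also have "\<dots> = (L * Rk * Lf + Bk * Lf) * rd q q'" using \<epsilon> by (simp add: field_simps)
    finally show ?thesis .
  qed
  fix q q' assume q: "q \<in> M" "q' \<in> M"
  show "\<bar>?h q - ?h q'\<bar> \<le> (L * Rk * Lf + Bk * Lf) * rd q q'"
  proof (cases "rd x q \<le> rd x q'")
    case True then show ?thesis by (rule main[OF q])
  next
    case False
    then have "\<bar>?h q' - ?h q\<bar> \<le> (L * Rk * Lf + Bk * Lf) * rd q' q" by (intro main[OF q(2,1)]) simp
    then show ?thesis using rd_commute[OF q] by (simp add: abs_minus_commute)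
  qed
qed

lemma grid_laplacian_bound:
  assumes k: "radial_kernel k Rk" and Lk: "L-lipschitz_on {0..} k" and f: "smooth_function \<A> f"
  shows "\<exists>b. b \<longlonglongrightarrow> 0 \<and> (\<forall>\<^sub>F N in sequentially. \<forall>i\<in>{1..N}. \<bar>rescaling M \<A> g p N
      * (\<Sum>j=1..N. weight M \<A> g p k N i j * (f (p j) - f (p i)))
      - limit_constant M \<A> g k * laplace_beltrami \<A> g f (p i)\<bar> \<le> b N)"
proof -
  interpret radial_kernel k Rk by (rule k)
  let ?n = "CARD('n)"
  obtain E where E: "E > 0" "\<And>x \<epsilon>. x \<in> M \<Longrightarrow> 0 < \<epsilon> \<Longrightarrow> \<epsilon> < 1 / E \<Longrightarrow>
    \<bar>(\<integral>q. k (rd x q / \<epsilon>) * (f q - f x) \<partial>Vol) - \<epsilon> ^ (?n + 2) * (moment TYPE('n) / 2 * laplace_beltrami \<A> g f x)\<bar> \<le> E * \<epsilon> ^ (?n + 3)"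
    using kernel_asymptotics[OF k Lk f] by blast
  obtain Bk where Bk: "Bk > 0" "\<And>r. r \<ge> 0 \<Longrightarrow> \<bar>k r\<bar> \<le> Bk" using k_bound by blast
  obtain Lf where Lf: "Lf > 0" "Lip Lf f" using smooth_function_Lipschitz[OF f] unfolding Lip_def by blast
  have L0: "L \<ge> 0" using Lk by (rule lipschitz_on_nonneg)
  define K0 where "K0 = L * Rk * Lf + Bk * Lf"
  have K0: "K0 > 0" using L0 R_pos Lf Bk by (simp add: K0_def add_nonneg_pos)
  \<comment> \<open>The first summand is the sampling error after normalization, the second the
    error in the asymptotics of the integral.\<close>
  define b where "b N = K0 * bw N ^ 2 + E / V0 * bw N" for N
  have "b \<longlonglongrightarrow> K0 * 0 ^ 2 + E / V0 * 0" unfolding b_def by (intro tendsto_intros bw_lim)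
  then have b: "b \<longlonglongrightarrow> 0" by simp
  have "\<forall>\<^sub>F N in sequentially. bw N < 1 / E" using order_tendstoD(2)[OF bw_lim, of "1 / E"] E(1) by simp
  moreover have "\<forall>\<^sub>F N in sequentially. N \<ge> 1" by (rule eventually_ge_at_top)
  ultimately have "\<forall>\<^sub>F N in sequentially. \<forall>i\<in>{1..N}. \<bar>rescaling M \<A> g p N
      * (\<Sum>j=1..N. weight M \<A> g p k N i j * (f (p j) - f (p i)))
      - limit_constant M \<A> g k * laplace_beltrami \<A> g f (p i)\<bar> \<le> b N"
  proof eventually_elim
    case (elim N)
    show ?case
    proof
      fix i assume "i \<in> {1..N}"
      then have x: "p i \<in> M" using p_in by simp
      let ?x = "p i"
      define \<epsilon> where "\<epsilon> = bw N"
      have \<epsilon>: "0 < \<epsilon>" "\<epsilon> < 1 / E" using elim bw_pos by (auto simp: \<epsilon>_def)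
      define h where "h q = k (rd ?x q / \<epsilon>) * (f q - f ?x)" for q
      define lap where "lap = laplace_beltrami \<A> g f ?x"
      define X where "X = moment TYPE('n) / 2 * lap"
      have "Lip K0 h" unfolding h_def K0_def
        by (rule kernel_function_Lip[OF k Lk Bk(2) Lf(2) _ x \<epsilon>(1)]) (use Lf in auto)
      then have "\<bar>avg N h - mean h\<bar> \<le> K0 * W N" by (rule avg_mean_Lip[OF elim(2) K0])
      also have "\<dots> \<le> K0 * Wsup N" using W_le_Wsup K0 by (intro mult_left_mono) auto
      also have "Wsup N = \<epsilon> ^ (?n + 2) * \<epsilon>\<^sup>2" using bw_power[OF elim(2)]
        by (simp only: \<epsilon>_def power_add[symmetric] add.assoc) simp
      finally have 1: "\<bar>avg N h - mean h\<bar> \<le> \<epsilon> ^ (?n + 2) * (K0 * \<epsilon>\<^sup>2)" by (simp add: mult_ac)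
      have "\<bar>(\<integral>q. h q \<partial>Vol) - \<epsilon> ^ (?n + 2) * X\<bar> \<le> E * \<epsilon> ^ (?n + 3)"
        unfolding h_def X_def lap_def by (rule E(2)[OF x \<epsilon>])
      then have "\<bar>(\<integral>q. h q \<partial>Vol) - \<epsilon> ^ (?n + 2) * X\<bar> / V0 \<le> E * \<epsilon> ^ (?n + 3) / V0"
        using V0_pos by (intro divide_right_mono) auto
      moreover have "\<bar>(\<integral>q. h q \<partial>Vol) - \<epsilon> ^ (?n + 2) * X\<bar> / V0 = \<bar>mean h - \<epsilon> ^ (?n + 2) * (X / V0)\<bar>"
        using V0_pos unfolding mean_def by (simp add: diff_divide_distrib[symmetric])
      moreover have "E * \<epsilon> ^ (?n + 3) / V0 = \<epsilon> ^ (?n + 2) * (E / V0 * \<epsilon>)"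
        by (simp add: power_add power2_eq_square power3_eq_cube)
      ultimately have 2: "\<bar>mean h - \<epsilon> ^ (?n + 2) * (X / V0)\<bar> \<le> \<epsilon> ^ (?n + 2) * (E / V0 * \<epsilon>)" by simp
      have e0: "\<epsilon> ^ (?n + 2) > 0" using \<epsilon> by simp
      have "\<bar>avg N h - \<epsilon> ^ (?n + 2) * (X / V0)\<bar> \<le> \<epsilon> ^ (?n + 2) * (K0 * \<epsilon>\<^sup>2) + \<epsilon> ^ (?n + 2) * (E / V0 * \<epsilon>)"
        using 1 2 by linarith
      also have "\<dots> = \<epsilon> ^ (?n + 2) * b N" by (simp add: b_def \<epsilon>_def algebra_simps)
      finally have "\<bar>avg N h - \<epsilon> ^ (?n + 2) * (X / V0)\<bar> / \<epsilon> ^ (?n + 2) \<le> b N"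
        using e0 by (simp add: pos_divide_le_eq mult.commute)
      moreover have "\<bar>avg N h - \<epsilon> ^ (?n + 2) * (X / V0)\<bar> / \<epsilon> ^ (?n + 2) = \<bar>avg N h / \<epsilon> ^ (?n + 2) - X / V0\<bar>"
      proof -
        have "avg N h / \<epsilon> ^ (?n + 2) - X / V0 = (avg N h - \<epsilon> ^ (?n + 2) * (X / V0)) / \<epsilon> ^ (?n + 2)"
          using nonzero_mult_div_cancel_left[OF less_imp_neq[OF e0, symmetric], of "X / V0"] by (simp only: diff_divide_distrib)
        then show ?thesis using e0 by (simp add: abs_divide)
      qed
      moreover have "avg N h / \<epsilon> ^ (?n + 2) = rescaling M \<A> g p N * (\<Sum>j=1..N. weight M \<A> g p k N i j * (f (p j) - f ?x))"
      proof -
        have "\<epsilon> powr (- 2 - real ?n) = inverse (\<epsilon> ^ (?n + 2))"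
        proof -
          have "\<epsilon> powr (- 2 - real ?n) = \<epsilon> powr (- real (?n + 2))" by (rule arg_cong[where f = "\<lambda>t. \<epsilon> powr t"]) simp
          also have "\<dots> = inverse (\<epsilon> powr real (?n + 2))" by (rule powr_minus)
          finally show ?thesis using \<epsilon> by (simp only: powr_realpow)
        qed
        then show ?thesis unfolding rescaling_def weight_def avg_def h_def \<epsilon>_def[symmetric]
          by (simp add: divide_inverse mult_ac)
      qed
      moreover have "X / V0 = limit_constant M \<A> g k * lap"
        by (simp add: X_def limit_constant_moment[OF k])
      ultimately show "\<bar>rescaling M \<A> g p N * (\<Sum>j=1..N. weight M \<A> g p k N i j * (f (p j) - f ?x))
        - limit_constant M \<A> g k * laplace_beltrami \<A> g f ?x\<bar> \<le> b N"
        by (simp add: lap_def)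
    qed
  qed
  then show ?thesis using b by blast
qed

lemma limit_constant_pos:
  assumes k: "radial_kernel k Rk" and nn: "\<And>r. r \<ge> 0 \<Longrightarrow> k r \<ge> 0" and r: "r > 0" "k r \<noteq> 0"
  shows "limit_constant M \<A> g k > 0"
  using radial_kernel.moment_pos[OF k nn r, of "CARD('n) + 1"] V0_pos
  unfolding limit_constant_moment[OF k] radial_kernel.moment_def[OF k] by simp

end

theorem mainTheorem2:
  fixes M :: "'a::t2_space set"
    and \<A> :: "('a, 'n::finite) chart set"
    and g :: "('a, 'n) chart \<Rightarrow> real ^ 'n \<Rightarrow> real ^ 'n \<Rightarrow> real ^ 'n \<Rightarrow> real"
    and p :: "nat \<Rightarrow> 'a"
    and k :: "real \<Rightarrow> real"
  assumes "riemannian_manifold M \<A> g" and "compact M" and "connected M"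
    and "\<forall>i\<ge>1. p i \<in> M"
    and "(\<lambda>N. kantorovich M (riem_dist M \<A> g) (empirical_measure M p N)
                 (uniform_measure (riem_volume M \<A> g) M)) \<longlonglongrightarrow> 0"
    and "\<forall>r\<ge>0. k r \<ge> 0"
    and "\<exists>L. L-lipschitz_on {0..} k"
    and "compact (closure {r. r \<ge> 0 \<and> k r \<noteq> 0})"
  shows "((\<exists>r\<ge>0. k r \<noteq> 0) \<longrightarrow> limit_constant M \<A> g k > 0) \<and>
    (\<forall>f. smooth_function \<A> f \<longrightarrow>
      (\<lambda>N. SUP i\<in>{1..N}. \<bar>rescaling M \<A> g p N
              * (\<Sum>j=1..N. weight M \<A> g p k N i j * (f (p j) - f (p i)))
            - limit_constant M \<A> g k * laplace_beltrami \<A> g f (p i)\<bar>) \<longlonglongrightarrow> 0) \<and>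
    (\<forall>f. smooth_function \<A> f \<longrightarrow>
      (\<lambda>N. 1 / real N * (\<Sum>i=1..N. \<bar>rescaling M \<A> g p N
              * (\<Sum>j=1..N. weight M \<A> g p k N i j * (f (p j) - f (p i)))
            - limit_constant M \<A> g k * laplace_beltrami \<A> g f (p i)\<bar>)) \<longlonglongrightarrow> 0)"
proof -
  interpret riemannian_manifold M \<A> g by (rule assms(1))
  interpret grid_sequence M \<A> g p
    by unfold_locales (use assms(2-5) in \<open>auto simp: W1_to_volume_def[abs_def]\<close>)
  obtain L where L: "L-lipschitz_on {0..} k" using assms(7) by blast
  obtain Rk where k: "radial_kernel k Rk" using radial_kernel_exists[OF L assms(8)] by blast
  have pos: "limit_constant M \<A> g k > 0" if r: "r \<ge> 0" "k r \<noteq> 0" for r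
    using lipschitz_nonzero_pos[OF L r] limit_constant_pos[OF k] assms(6) by blast
  \<comment> \<open>One bound \<open>b N\<close> that holds for all grid points controls the
    supremum and the mean alike.\<close>
  have lim: "(\<lambda>N. SUP i\<in>{1..N}. e N i) \<longlonglongrightarrow> 0 \<and> (\<lambda>N. 1 / real N * (\<Sum>i=1..N. e N i)) \<longlonglongrightarrow> 0"
    if b: "b \<longlonglongrightarrow> 0" "\<forall>\<^sub>F N in sequentially. \<forall>i\<in>{1..N}. e N i \<le> b N" and e0: "\<And>N i. e N i \<ge> 0"
    for e :: "nat \<Rightarrow> nat \<Rightarrow> real" and b
  proof
    have ev: "\<forall>\<^sub>F N in sequentially. N \<ge> 1 \<and> (\<forall>i\<in>{1..N}. e N i \<le> b N)"
      using b(2) eventually_ge_at_top[of 1] by eventually_elim simp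
    show "(\<lambda>N. SUP i\<in>{1..N}. e N i) \<longlonglongrightarrow> 0"
    proof (rule tendsto_sandwich[OF _ _ tendsto_const b(1)])
      show "\<forall>\<^sub>F N in sequentially. 0 \<le> (SUP i\<in>{1..N}. e N i)"
        using ev
      proof eventually_elim
        case (elim N)
        \<comment> \<open>N >= 1 makes the index set nonempty; for N = 0 the supremum is
          unspecified, which is harmless because only eventual bounds enter.\<close>
        have "e N 1 \<le> (SUP i\<in>{1..N}. e N i)" by (rule cSUP_upper) (use elim in auto)
        then show ?case using e0[of N 1] by linarith
      qed
      show "\<forall>\<^sub>F N in sequentially. (SUP i\<in>{1..N}. e N i) \<le> b N"
        using ev by eventually_elim (rule cSUP_least, auto)
    qed
    show "(\<lambda>N. 1 / real N * (\<Sum>i=1..N. e N i)) \<longlonglongrightarrow> 0"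
    proof (rule tendsto_sandwich[OF _ _ tendsto_const b(1)])
      show "\<forall>\<^sub>F N in sequentially. 0 \<le> 1 / real N * (\<Sum>i=1..N. e N i)"
        using e0 by (simp add: sum_nonneg)
      show "\<forall>\<^sub>F N in sequentially. 1 / real N * (\<Sum>i=1..N. e N i) \<le> b N"
        using ev
      proof eventually_elim
        case (elim N)
        then have "(\<Sum>i=1..N. e N i) \<le> (\<Sum>i=1..N. b N)" by (intro sum_mono) auto
        then show ?case using elim by (simp add: field_simps)
      qed
    qed
  qed
  have main: "(\<lambda>N. SUP i\<in>{1..N}. \<bar>rescaling M \<A> g p N
              * (\<Sum>j=1..N. weight M \<A> g p k N i j * (f (p j) - f (p i)))
            - limit_constant M \<A> g k * laplace_beltrami \<A> g f (p i)\<bar>) \<longlonglongrightarrow> 0 \<and>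
      (\<lambda>N. 1 / real N * (\<Sum>i=1..N. \<bar>rescaling M \<A> g p N
              * (\<Sum>j=1..N. weight M \<A> g p k N i j * (f (p j) - f (p i)))
            - limit_constant M \<A> g k * laplace_beltrami \<A> g f (p i)\<bar>)) \<longlonglongrightarrow> 0" if f: "smooth_function \<A> f" for f
  proof -
    obtain b where "b \<longlonglongrightarrow> 0" "\<forall>\<^sub>F N in sequentially. \<forall>i\<in>{1..N}. \<bar>rescaling M \<A> g p N
      * (\<Sum>j=1..N. weight M \<A> g p k N i j * (f (p j) - f (p i)))
      - limit_constant M \<A> g k * laplace_beltrami \<A> g f (p i)\<bar> \<le> b N"
      using grid_laplacian_bound[OF k L f] by blast
    then show ?thesis by (rule lim) simp
  qed
  show ?thesis using pos main by blast
qed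

end
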